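(* Fix $k\in \mathbb{N}_{\geq 1}\cup\{\infty\}$. Let $\Phi$ be a $C^k$ flow of a uniquely integrable vector field on a $C^k$ manifold $X$ with a globally asymptotically stable compact invariant set $A\subset X$. Then $(X,\Phi)$ is linearizable by a $C^k$ embedding if and only if all of the following hold: (1) $A$ is a $C^k$ embedded submanifold of $X$ with $C^k$ asymptotic phase; (2) the restricted flow $\Phi|_{\mathbb{R}\times A}$ on $A$ is a $1$-parameter subgroup of a $C^k$ torus action on $A$; and (3) there is $\ell\in\mathbb{N}$, a matrix $B\in\mathbb{R}^{\ell\times\ell}$ with all eigenvalues having negative real part, an open set $U\supset A$, and a $C^k$ map $G\colon U\to\mathbb{R}^\ell$ satisfying $\ker(T_AG)=TA$ and $G(\Phi^t(x))=e^{Bt}G(x)$ for all $x\in U$ and $t\in\mathbb{R}$ such that $\Phi^t(x)\in U$. Moreover, any linearizing $C^k$ embedding $X\to\mathbb{R}^n$ (for any $n$) is a proper map.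
   Context: Manifolds are, as usual, finite-dimensional, Hausdorff, second countable and without boundary. A flow on $X$ is a group action $\Phi\colon \mathbb{R}\times X\to X$, $(t,x)\mapsto \Phi^t(x)$, of $(\mathbb{R},+)$ on $X$; it is $C^k$ if $\Phi$ is a $C^k$ map. "Uniquely integrable" means that the vector field $x\mapsto\frac{d}{dt}\Phi^t(x)|_{t=0}$ generating $\Phi$ has unique maximal trajectories. A set $A\subset X$ is invariant if $\Phi^t(A)=A$ for all $t\in\mathbb{R}$. A compact invariant set $A$ is globally asymptotically stable if every neighborhood $U$ of $A$ contains a neighborhood $V$ of $A$ with $\Phi^t(V)\subset U$ for all $t\geq 0$, and $\Phi^t(x)\to A$ as $t\to\infty$ for every $x\in X$ (i.e. $\Phi^t(x)$ is eventually in every neighborhood of $A$). A map $F\colon X\to\mathbb{R}^n$ is linearizing (for $\Phi$) if there is a matrix $C\in\mathbb{R}^{n\times n}$ such that $F\circ\Phi^t=e^{Ct}\circ F$ for all $t\in\mathbb{R}$. A $C^k$ embedding ($k\ge 1$) is a $C^k$ map that is both an immersion and a homeomorphism onto its image (with the subspace topology). $(X,\Phi)$ is linearizable by a $C^k$ embedding if for some $n\in\mathbb{N}$ there is a linearizing $C^k$ embedding $F\colon X\to\mathbb{R}^n$. A map is proper if preimages of compact sets are compact. If $X$ is not connected, condition (1) is understood in the sense that the (finitely many) connected components of $A$ are compact $C^k$ embedded submanifolds of possibly different dimensions. Such an $A$ has $C^k$ asymptotic phase if there is a $C^k$ map $P\colon X\to A$ with $P|_A=\mathrm{id}_A$ and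 $P\circ\Phi^t=\Phi^t\circ P$ for all $t\in\mathbb{R}$. A $C^k$ torus action on $A$ is a $C^k$ group action $\Theta\colon H\times A\to A$, $(h,a)\mapsto\Theta^h(a)$, of a torus $H=T^m=\mathbb{R}^m/\mathbb{Z}^m$ (for some $m\in\mathbb{N}$). $\Phi|_{\mathbb{R}\times A}$ is a $1$-parameter subgroup of $\Theta$ if there is $\boldsymbol\omega\in\mathbb{R}^m$ such that $\Phi^t|_A=\Theta^{(\boldsymbol\omega t \bmod 1)}$ for all $t\in\mathbb{R}$, where "$\bmod\ 1$" is applied entrywise. With $\pi\colon TX\to X$ the tangent bundle, $T_AX:=\pi^{-1}(A)$, and $T_AG\colon T_AX\to T\mathbb{R}^\ell$ is the restriction to $T_AX$ of the tangent map of $G$; thus $\ker(T_AG)=TA$ means that for every $a\in A$ the kernel of the derivative of $G$ at $a$ equals the tangent space $T_aA$. *)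

theory Defs
  imports
    "HOL-Analysis.Analysis"
    "HOL-Library.Extended_Nat"
    "Jordan_Normal_Form.Char_Poly"
begin

section \<open>Maps of class \<open>C\<^sup>k\<close> between open subsets of Euclidean spaces\<close>

text \<open>
  \<open>\<real>\<^sup>n\<close> is \<^const>\<open>Euclidean_space\<close> \<open>n\<close>: the sequences \<open>v :: nat \<Rightarrow> real\<close> with \<open>v i = 0\<close> for \<open>i \<ge> n\<close>.
  This allows dimensions to be quantified inside a formula. Smoothness classes are indexed by
  \<open>k :: enat\<close>, where \<open>k = \<infinity>\<close> is the class \<open>C\<^sup>\<infinity>\<close>.
\<close>

definition partial_deriv :: "nat \<Rightarrow> ((nat \<Rightarrow> real) \<Rightarrow> real) \<Rightarrow> (nat \<Rightarrow> real) \<Rightarrow> real" where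
  "partial_deriv i f x = deriv (\<lambda>s. f (x(i := s))) (x i)"

primrec ck_real_finite ::
    "nat \<Rightarrow> nat \<Rightarrow> (nat \<Rightarrow> real) set \<Rightarrow> ((nat \<Rightarrow> real) \<Rightarrow> real) \<Rightarrow> bool" where
  "ck_real_finite 0 n U f \<longleftrightarrow>
     continuous_map (subtopology (Euclidean_space n) U) euclideanreal f"
| "ck_real_finite (Suc k) n U f \<longleftrightarrow>
     continuous_map (subtopology (Euclidean_space n) U) euclideanreal f \<and>
     (\<forall>i<n. (\<forall>x\<in>U. (\<lambda>s. f (x(i := s))) differentiable (at (x i))) \<and>
            ck_real_finite k n U (partial_deriv i f))"

definition ck_real ::
    "enat \<Rightarrow> nat \<Rightarrow> (nat \<Rightarrow> real) set \<Rightarrow> ((nat \<Rightarrow> real) \<Rightarrow> real) \<Rightarrow> bool" where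
  "ck_real k n U f \<longleftrightarrow> (\<forall>j. enat j \<le> k \<longrightarrow> ck_real_finite j n U f)"

text \<open>The domain \<open>U\<close> is always an open subset of \<open>\<real>\<^sup>n\<close> in the uses below.\<close>

definition ck_vec ::
    "enat \<Rightarrow> nat \<Rightarrow> (nat \<Rightarrow> real) set \<Rightarrow> nat \<Rightarrow> ((nat \<Rightarrow> real) \<Rightarrow> (nat \<Rightarrow> real)) \<Rightarrow> bool" where
  "ck_vec k n U m g \<longleftrightarrow> (\<forall>i<m. ck_real k n U (\<lambda>x. g x i))"

definition jacobian_app ::
    "nat \<Rightarrow> nat \<Rightarrow> ((nat \<Rightarrow> real) \<Rightarrow> (nat \<Rightarrow> real)) \<Rightarrow> (nat \<Rightarrow> real) \<Rightarrow> (nat \<Rightarrow> real) \<Rightarrow> (nat \<Rightarrow> real)" where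
  "jacobian_app n m g x v =
     (\<lambda>i. if i < m then \<Sum>j<n. partial_deriv j (\<lambda>y. g y i) x * v j else 0)"


section \<open>Manifolds\<close>

record 'a chart =
  chart_dom :: "'a set"
  chart_dim :: nat
  chart_map :: "'a \<Rightarrow> nat \<Rightarrow> real"

definition chart_inv :: "'a chart \<Rightarrow> (nat \<Rightarrow> real) \<Rightarrow> 'a" where
  "chart_inv c = inv_into (chart_dom c) (chart_map c)"

definition is_chart :: "'a topology \<Rightarrow> 'a chart \<Rightarrow> bool" where
  "is_chart X c \<longleftrightarrow>
     openin X (chart_dom c) \<and>
     openin (Euclidean_space (chart_dim c)) (chart_map c ` chart_dom c) \<and>
     homeomorphic_map (subtopology X (chart_dom c))
       (subtopology (Euclidean_space (chart_dim c)) (chart_map c ` chart_dom c)) (chart_map c)"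

text \<open>The transition map from \<open>c\<close> to \<open>c'\<close> is \<open>C\<^sup>k\<close>; compatibility is this in both directions.\<close>

definition ck_transition :: "enat \<Rightarrow> 'a chart \<Rightarrow> 'a chart \<Rightarrow> bool" where
  "ck_transition k c c' \<longleftrightarrow>
     ck_vec k (chart_dim c) (chart_map c ` (chart_dom c \<inter> chart_dom c')) (chart_dim c')
       (chart_map c' \<circ> chart_inv c)"

record 'a mfd =
  space_of :: "'a topology"
  atlas_of :: "'a chart set"

abbreviation points :: "'a mfd \<Rightarrow> 'a set" where
  "points M \<equiv> topspace (space_of M)"

definition charts_at :: "'a mfd \<Rightarrow> 'a \<Rightarrow> 'a chart set" where
  "charts_at M x = {c \<in> atlas_of M. x \<in> chart_dom c}"

text \<open>
  Each chart carries its own dimension, so different connected components may have different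
  dimensions. The atlas is not required to be maximal.
\<close>

definition ck_manifold :: "enat \<Rightarrow> 'a mfd \<Rightarrow> bool" where
  "ck_manifold k M \<longleftrightarrow>
     Hausdorff_space (space_of M) \<and> second_countable (space_of M) \<and>
     (\<forall>c\<in>atlas_of M. is_chart (space_of M) c) \<and>
     (\<Union>c\<in>atlas_of M. chart_dom c) = points M \<and>
     (\<forall>c\<in>atlas_of M. \<forall>c'\<in>atlas_of M. ck_transition k c c')"

definition ck_map :: "enat \<Rightarrow> 'a mfd \<Rightarrow> 'b mfd \<Rightarrow> ('a \<Rightarrow> 'b) \<Rightarrow> bool" where
  "ck_map k M N f \<longleftrightarrow>
     continuous_map (space_of M) (space_of N) f \<and>
     (\<forall>c\<in>atlas_of M. \<forall>e\<in>atlas_of N.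
        ck_vec k (chart_dim c) (chart_map c ` (chart_dom c \<inter> f -` chart_dom e)) (chart_dim e)
          (chart_map e \<circ> f \<circ> chart_inv c))"

definition euclidean_mfd :: "nat \<Rightarrow> (nat \<Rightarrow> real) mfd" where
  "euclidean_mfd n =
     \<lparr>space_of = Euclidean_space n,
      atlas_of = {\<lparr>chart_dom = topspace (Euclidean_space n), chart_dim = n, chart_map = (\<lambda>v. v)\<rparr>}\<rparr>"

definition real_mfd :: "real mfd" where
  "real_mfd =
     \<lparr>space_of = euclideanreal,
      atlas_of = {\<lparr>chart_dom = UNIV, chart_dim = 1, chart_map = (\<lambda>t i. if i = 0 then t else 0)\<rparr>}\<rparr>"

definition prod_chart :: "'a chart \<Rightarrow> 'b chart \<Rightarrow> ('a \<times> 'b) chart" where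
  "prod_chart c e =
     \<lparr>chart_dom = chart_dom c \<times> chart_dom e,
      chart_dim = chart_dim c + chart_dim e,
      chart_map = (\<lambda>(x, y) i. if i < chart_dim c then chart_map c x i
                                else chart_map e y (i - chart_dim c))\<rparr>"

definition prod_mfd :: "'a mfd \<Rightarrow> 'b mfd \<Rightarrow> ('a \<times> 'b) mfd" where
  "prod_mfd M N =
     \<lparr>space_of = prod_topology (space_of M) (space_of N),
      atlas_of = {prod_chart c e | c e. c \<in> atlas_of M \<and> e \<in> atlas_of N}\<rparr>"

definition open_mfd :: "'a mfd \<Rightarrow> 'a set \<Rightarrow> 'a mfd" where
  "open_mfd M U =
     \<lparr>space_of = subtopology (space_of M) U,
      atlas_of = {c\<lparr>chart_dom := chart_dom c \<inter> U\<rparr> | c. c \<in> atlas_of M}\<rparr>"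


section \<open>Embedded submanifolds\<close>

text \<open>Charts belonging to the maximal \<open>C\<^sup>k\<close> atlas.\<close>

definition admissible_chart :: "enat \<Rightarrow> 'a mfd \<Rightarrow> 'a chart \<Rightarrow> bool" where
  "admissible_chart k M c \<longleftrightarrow>
     is_chart (space_of M) c \<and>
     (\<forall>c'\<in>atlas_of M. ck_transition k c c' \<and> ck_transition k c' c)"

text \<open>
  Because of the zero padding, \<open>\<real>\<^sup>p\<close> is literally the slice of \<open>\<real>\<^sup>d\<close> (\<open>p \<le> d\<close>) on which the last
  \<open>d - p\<close> coordinates vanish.
\<close>

definition slice_chart :: "enat \<Rightarrow> 'a mfd \<Rightarrow> nat \<Rightarrow> 'a set \<Rightarrow> 'a chart \<Rightarrow> bool" where
  "slice_chart k M p S c \<longleftrightarrow>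
     admissible_chart k M c \<and> p \<le> chart_dim c \<and>
     chart_map c ` (chart_dom c \<inter> S) = chart_map c ` chart_dom c \<inter> topspace (Euclidean_space p)"

definition embedded_submanifold :: "enat \<Rightarrow> 'a mfd \<Rightarrow> nat \<Rightarrow> 'a set \<Rightarrow> bool" where
  "embedded_submanifold k M p S \<longleftrightarrow>
     S \<subseteq> points M \<and> (\<forall>a\<in>S. \<exists>c. slice_chart k M p S c \<and> a \<in> chart_dom c)"

text \<open>The induced \<open>C\<^sup>k\<close> structure; the dimension \<open>p\<close> may depend on the component of \<open>S\<close>.\<close>

definition sub_mfd :: "enat \<Rightarrow> 'a mfd \<Rightarrow> 'a set \<Rightarrow> 'a mfd" where
  "sub_mfd k M S =
     \<lparr>space_of = subtopology (space_of M) S,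
      atlas_of = {\<lparr>chart_dom = chart_dom c \<inter> S, chart_dim = p, chart_map = chart_map c\<rparr> | c p.
                    slice_chart k M p S c}\<rparr>"


section \<open>Tangent vectors\<close>

text \<open>
  A tangent vector at \<open>x\<close> is a family of coordinate vectors, one for each chart of the atlas at
  \<open>x\<close>, transforming by the Jacobians of the transition maps. At charts not around \<open>x\<close> the family
  is set to \<open>0\<close>, so that equality of tangent vectors is equality of functions.
\<close>

type_synonym 'a tangent = "'a chart \<Rightarrow> nat \<Rightarrow> real"

definition tangent_space :: "'a mfd \<Rightarrow> 'a \<Rightarrow> 'a tangent set" where
  "tangent_space M x =
     {v. (\<forall>c. c \<notin> charts_at M x \<longrightarrow> v c = (\<lambda>_. 0)) \<and>
         (\<forall>c\<in>charts_at M x. v c \<in> topspace (Euclidean_space (chart_dim c))) \<and>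
         (\<forall>c\<in>charts_at M x. \<forall>c'\<in>charts_at M x.
            v c' = jacobian_app (chart_dim c) (chart_dim c') (chart_map c' \<circ> chart_inv c)
                     (chart_map c x) (v c))}"

definition zero_tangent :: "'a tangent" where
  "zero_tangent = (\<lambda>_ _. 0)"

text \<open>
  The value of the tangent map does not depend on the chart chosen at \<open>x\<close>, and it depends only
  on the germ of \<open>f\<close> at \<open>x\<close>.
\<close>

definition tangent_map :: "'a mfd \<Rightarrow> 'b mfd \<Rightarrow> ('a \<Rightarrow> 'b) \<Rightarrow> 'a \<Rightarrow> 'a tangent \<Rightarrow> 'b tangent" where
  "tangent_map M N f x v =
     (\<lambda>e. if e \<in> charts_at N (f x)
          then let c = (SOME c. c \<in> charts_at M x)
               in jacobian_app (chart_dim c) (chart_dim e) (chart_map e \<circ> f \<circ> chart_inv c)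
                    (chart_map c x) (v c)
          else (\<lambda>_. 0))"

definition ck_embedding :: "enat \<Rightarrow> 'a mfd \<Rightarrow> 'b mfd \<Rightarrow> ('a \<Rightarrow> 'b) \<Rightarrow> bool" where
  "ck_embedding k M N f \<longleftrightarrow>
     ck_map k M N f \<and>
     (\<forall>x\<in>points M. inj_on (tangent_map M N f x) (tangent_space M x)) \<and>
     embedding_map (space_of M) (space_of N) f"


section \<open>Flows\<close>

definition ck_flow :: "enat \<Rightarrow> 'a mfd \<Rightarrow> (real \<Rightarrow> 'a \<Rightarrow> 'a) \<Rightarrow> bool" where
  "ck_flow k M \<Phi> \<longleftrightarrow>
     ck_map k (prod_mfd real_mfd M) M (\<lambda>(t, x). \<Phi> t x) \<and>
     (\<forall>x\<in>points M. \<Phi> 0 x = x) \<and>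
     (\<forall>s t. \<forall>x\<in>points M. \<Phi> (s + t) x = \<Phi> s (\<Phi> t x))"

definition generator :: "'a mfd \<Rightarrow> (real \<Rightarrow> 'a \<Rightarrow> 'a) \<Rightarrow> 'a \<Rightarrow> 'a tangent" where
  "generator M \<Phi> x =
     (\<lambda>c i. if c \<in> charts_at M x \<and> i < chart_dim c
            then deriv (\<lambda>t. chart_map c (\<Phi> t x) i) 0 else 0)"

definition trajectory ::
    "'a mfd \<Rightarrow> ('a \<Rightarrow> 'a tangent) \<Rightarrow> real set \<Rightarrow> (real \<Rightarrow> 'a) \<Rightarrow> bool" where
  "trajectory M V I \<gamma> \<longleftrightarrow>
     open I \<and> is_interval I \<and> I \<noteq> {} \<and>
     continuous_map (subtopology euclideanreal I) (space_of M) \<gamma> \<and>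
     (\<forall>t\<in>I. \<forall>c\<in>charts_at M (\<gamma> t). \<forall>i<chart_dim c.
        ((\<lambda>s. chart_map c (\<gamma> s) i) has_real_derivative V (\<gamma> t) c i) (at t))"

definition maximal_trajectory ::
    "'a mfd \<Rightarrow> ('a \<Rightarrow> 'a tangent) \<Rightarrow> real set \<Rightarrow> (real \<Rightarrow> 'a) \<Rightarrow> bool" where
  "maximal_trajectory M V I \<gamma> \<longleftrightarrow>
     trajectory M V I \<gamma> \<and>
     (\<forall>J \<eta>. trajectory M V J \<eta> \<and> I \<subseteq> J \<and> (\<forall>t\<in>I. \<eta> t = \<gamma> t) \<longrightarrow> J = I)"

text \<open>Trajectories are identified when they agree on their common interval of definition.\<close>

definition uniquely_integrable :: "'a mfd \<Rightarrow> ('a \<Rightarrow> 'a tangent) \<Rightarrow> bool" where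
  "uniquely_integrable M V \<longleftrightarrow>
     (\<forall>x\<in>points M.
        (\<exists>I \<gamma>. maximal_trajectory M V I \<gamma> \<and> 0 \<in> I \<and> \<gamma> 0 = x) \<and>
        (\<forall>I \<gamma> J \<eta>. maximal_trajectory M V I \<gamma> \<and> 0 \<in> I \<and> \<gamma> 0 = x \<and>
                    maximal_trajectory M V J \<eta> \<and> 0 \<in> J \<and> \<eta> 0 = x \<longrightarrow>
                    I = J \<and> (\<forall>t\<in>I. \<gamma> t = \<eta> t)))"

definition invariant_set :: "(real \<Rightarrow> 'a \<Rightarrow> 'a) \<Rightarrow> 'a set \<Rightarrow> bool" where
  "invariant_set \<Phi> A \<longleftrightarrow> (\<forall>t. \<Phi> t ` A = A)"

definition neighborhood :: "'a topology \<Rightarrow> 'a set \<Rightarrow> 'a set \<Rightarrow> bool" where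
  "neighborhood X A U \<longleftrightarrow> U \<subseteq> topspace X \<and> (\<exists>W. openin X W \<and> A \<subseteq> W \<and> W \<subseteq> U)"

definition globally_asymptotically_stable ::
    "'a topology \<Rightarrow> (real \<Rightarrow> 'a \<Rightarrow> 'a) \<Rightarrow> 'a set \<Rightarrow> bool" where
  "globally_asymptotically_stable X \<Phi> A \<longleftrightarrow>
     (\<forall>U. neighborhood X A U \<longrightarrow>
        (\<exists>V. neighborhood X A V \<and> V \<subseteq> U \<and> (\<forall>t\<ge>0. \<Phi> t ` V \<subseteq> U))) \<and>
     (\<forall>x\<in>topspace X. \<forall>U. neighborhood X A U \<longrightarrow> (\<forall>\<^sub>F t in at_top. \<Phi> t x \<in> U))"

definition ck_asymptotic_phase ::
    "enat \<Rightarrow> 'a mfd \<Rightarrow> (real \<Rightarrow> 'a \<Rightarrow> 'a) \<Rightarrow> 'a set \<Rightarrow> ('a \<Rightarrow> 'a) \<Rightarrow> bool" where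
  "ck_asymptotic_phase k M \<Phi> A P \<longleftrightarrow>
     ck_map k M (sub_mfd k M A) P \<and>
     (\<forall>a\<in>A. P a = a) \<and>
     (\<forall>t. \<forall>x\<in>points M. P (\<Phi> t x) = \<Phi> t (P x))"


section \<open>Linearizing maps\<close>

definition mat_exp :: "real mat \<Rightarrow> real mat" where
  "mat_exp C = Matrix.mat (dim_row C) (dim_row C)
     (\<lambda>(i, j). \<Sum>m. (C ^\<^sub>m m) $$ (i, j) / fact m)"

definition mat_app :: "real mat \<Rightarrow> (nat \<Rightarrow> real) \<Rightarrow> (nat \<Rightarrow> real)" where
  "mat_app C v = (\<lambda>i. if i < dim_row C then \<Sum>j<dim_col C. C $$ (i, j) * v j else 0)"

definition linearizing ::
    "'a mfd \<Rightarrow> (real \<Rightarrow> 'a \<Rightarrow> 'a) \<Rightarrow> nat \<Rightarrow> ('a \<Rightarrow> nat \<Rightarrow> real) \<Rightarrow> bool" where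
  "linearizing M \<Phi> n F \<longleftrightarrow>
     (\<exists>C\<in>carrier_mat n n. \<forall>t. \<forall>x\<in>points M. F (\<Phi> t x) = mat_app (mat_exp (t \<cdot>\<^sub>m C)) (F x))"

definition linearizing_embedding ::
    "enat \<Rightarrow> 'a mfd \<Rightarrow> (real \<Rightarrow> 'a \<Rightarrow> 'a) \<Rightarrow> nat \<Rightarrow> ('a \<Rightarrow> nat \<Rightarrow> real) \<Rightarrow> bool" where
  "linearizing_embedding k M \<Phi> n F \<longleftrightarrow>
     ck_embedding k M (euclidean_mfd n) F \<and> linearizing M \<Phi> n F"

definition linearizable_by_embedding :: "enat \<Rightarrow> 'a mfd \<Rightarrow> (real \<Rightarrow> 'a \<Rightarrow> 'a) \<Rightarrow> bool" where
  "linearizable_by_embedding k M \<Phi> \<longleftrightarrow> (\<exists>n F. linearizing_embedding k M \<Phi> n F)"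

text \<open>This is weaker, as a definition, than \<^const>\<open>proper_map\<close>, which also asks for closedness.\<close>

definition proper :: "'a topology \<Rightarrow> 'b topology \<Rightarrow> ('a \<Rightarrow> 'b) \<Rightarrow> bool" where
  "proper X Y f \<longleftrightarrow> (\<forall>K. compactin Y K \<longrightarrow> compactin X {x \<in> topspace X. f x \<in> K})"


section \<open>Tori\<close>

text \<open>
  \<open>T\<^sup>m = \<real>\<^sup>m / \<int>\<^sup>m\<close>, with each coset represented by its element in \<open>[0,1)\<^sup>m\<close>. The topology is the
  quotient topology along \<open>mod1\<close> and the charts are the local inverses of \<open>mod1\<close>.
\<close>

definition mod1 :: "(nat \<Rightarrow> real) \<Rightarrow> (nat \<Rightarrow> real)" where
  "mod1 v = (\<lambda>i. frac (v i))"

definition torus_topology :: "nat \<Rightarrow> (nat \<Rightarrow> real) topology" where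
  "torus_topology m =
     topology (\<lambda>U. U \<subseteq> mod1 ` topspace (Euclidean_space m) \<and>
                   openin (Euclidean_space m) {v \<in> topspace (Euclidean_space m). mod1 v \<in> U})"

lemma openin_torus_topology:
  "openin (torus_topology m) U \<longleftrightarrow>
     U \<subseteq> mod1 ` topspace (Euclidean_space m) \<and>
     openin (Euclidean_space m) {v \<in> topspace (Euclidean_space m). mod1 v \<in> U}"
proof -
  let ?E = "Euclidean_space m"
  let ?P = "\<lambda>U. {v \<in> topspace ?E. mod1 v \<in> U}"
  have int: "?P (S \<inter> T) = ?P S \<inter> ?P T" for S T by auto
  have un: "?P (\<Union>\<K>) = \<Union>(?P ` \<K>)" for \<K> by auto
  have "istopology (\<lambda>U. U \<subseteq> mod1 ` topspace ?E \<and> openin ?E (?P U))"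
    unfolding istopology_def
    by (intro conjI allI impI) (auto simp only: int un intro!: openin_Int openin_Union)
  then show ?thesis
    unfolding torus_topology_def by (simp add: topology_inverse')
qed

lemma topspace_torus_topology: "topspace (torus_topology m) = mod1 ` topspace (Euclidean_space m)"
proof
  show "topspace (torus_topology m) \<subseteq> mod1 ` topspace (Euclidean_space m)"
    using openin_torus_topology[of m "topspace (torus_topology m)"] by simp
  have "{v \<in> topspace (Euclidean_space m). mod1 v \<in> mod1 ` topspace (Euclidean_space m)} =
        topspace (Euclidean_space m)" by auto
  then show "mod1 ` topspace (Euclidean_space m) \<subseteq> topspace (torus_topology m)"
    by (intro openin_subset) (simp add: openin_torus_topology)
qed

lemma quotient_map_mod1: "quotient_map (Euclidean_space m) (torus_topology m) mod1"
  unfolding quotient_map_def topspace_torus_topology by (auto simp: openin_torus_topology)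

definition torus_mfd :: "nat \<Rightarrow> (nat \<Rightarrow> real) mfd" where
  "torus_mfd m =
     \<lparr>space_of = torus_topology m,
      atlas_of = {\<lparr>chart_dom = mod1 ` W, chart_dim = m, chart_map = inv_into W mod1\<rparr> | W.
                    openin (Euclidean_space m) W \<and> inj_on mod1 W}\<rparr>"

definition ck_torus_action ::
    "enat \<Rightarrow> nat \<Rightarrow> 'a mfd \<Rightarrow> ((nat \<Rightarrow> real) \<Rightarrow> 'a \<Rightarrow> 'a) \<Rightarrow> bool" where
  "ck_torus_action k m N \<Theta> \<longleftrightarrow>
     ck_map k (prod_mfd (torus_mfd m) N) N (\<lambda>(h, a). \<Theta> h a) \<and>
     (\<forall>a\<in>points N. \<Theta> (\<lambda>_. 0) a = a) \<and>
     (\<forall>g\<in>points (torus_mfd m). \<forall>h\<in>points (torus_mfd m). \<forall>a\<in>points N.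
        \<Theta> (mod1 (\<lambda>i. g i + h i)) a = \<Theta> g (\<Theta> h a))"

definition one_parameter_subgroup ::
    "nat \<Rightarrow> ((nat \<Rightarrow> real) \<Rightarrow> 'a \<Rightarrow> 'a) \<Rightarrow> (real \<Rightarrow> 'a \<Rightarrow> 'a) \<Rightarrow> 'a set \<Rightarrow> bool" where
  "one_parameter_subgroup m \<Theta> \<Phi> A \<longleftrightarrow>
     (\<exists>\<omega>\<in>topspace (Euclidean_space m). \<forall>t. \<forall>a\<in>A. \<Phi> t a = \<Theta> (mod1 (\<lambda>i. \<omega> i * t)) a)"


section \<open>The three conditions\<close>

definition submanifold_with_phase ::
    "enat \<Rightarrow> 'a mfd \<Rightarrow> (real \<Rightarrow> 'a \<Rightarrow> 'a) \<Rightarrow> 'a set \<Rightarrow> bool" where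
  "submanifold_with_phase k M \<Phi> A \<longleftrightarrow>
     finite (connected_components_of (subtopology (space_of M) A)) \<and>
     (\<forall>K\<in>connected_components_of (subtopology (space_of M) A).
        compactin (space_of M) K \<and> (\<exists>p. embedded_submanifold k M p K)) \<and>
     (\<exists>P. ck_asymptotic_phase k M \<Phi> A P)"

definition torus_subgroup_flow ::
    "enat \<Rightarrow> 'a mfd \<Rightarrow> (real \<Rightarrow> 'a \<Rightarrow> 'a) \<Rightarrow> 'a set \<Rightarrow> bool" where
  "torus_subgroup_flow k M \<Phi> A \<longleftrightarrow>
     (\<exists>m \<Theta>. ck_torus_action k m (sub_mfd k M A) \<Theta> \<and> one_parameter_subgroup m \<Theta> \<Phi> A)"

text \<open>
  The tangent space of \<open>A\<close> at \<open>a\<close>, as a subspace of that of \<open>M\<close>, is the image of the tangent map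
  of the inclusion.
\<close>

definition transverse_linearization ::
    "enat \<Rightarrow> 'a mfd \<Rightarrow> (real \<Rightarrow> 'a \<Rightarrow> 'a) \<Rightarrow> 'a set \<Rightarrow> bool" where
  "transverse_linearization k M \<Phi> A \<longleftrightarrow>
     (\<exists>l. \<exists>B\<in>carrier_mat l l. \<exists>U G.
        (\<forall>z. eigenvalue (map_mat complex_of_real B) z \<longrightarrow> Re z < 0) \<and>
        openin (space_of M) U \<and> A \<subseteq> U \<and>
        ck_map k (open_mfd M U) (euclidean_mfd l) G \<and>
        (\<forall>a\<in>A. {v \<in> tangent_space M a. tangent_map M (euclidean_mfd l) G a v = zero_tangent} =
               tangent_map (sub_mfd k M A) M (\<lambda>x. x) a ` tangent_space (sub_mfd k M A) a) \<and>
        (\<forall>x\<in>U. \<forall>t. \<Phi> t x \<in> U \<longrightarrow> G (\<Phi> t x) = mat_app (mat_exp (t \<cdot>\<^sub>m B)) (G x)))"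

end

theory Submission
 imports Defs "HOL-Homology.Invariance_of_Domain" "Jordan_Normal_Form.Jordan_Normal_Form_Existence"
begin

text \<open>
  Why the theorem holds. If an embedding \<open>F\<close> linearizes the flow, the Jordan form of its matrix gives
  complex coordinates \<open>u\<^sub>a\<close> on \<open>F(X)\<close> that evolve as exponential polynomials (\<open>spectral_coordinates\<close>).
  Forward orbits are bounded, so unstable coordinates vanish and neutral ones merely rotate
  (\<open>unstable_and_center\<close>). Almost periods of the rotations push every orbit to its neutral part, which
  therefore lies in the compact set \<open>F(A)\<close>: forgetting the stable coordinates is a smooth retraction of
  \<open>X\<close> onto \<open>A\<close>, its image is a submanifold (\<open>retract_slice\<close>), and it is the asymptotic phase
  (\<open>condition_1\<close>). Kronecker's theorem extends the rotations by the flow to rotations by a torus that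
  preserve \<open>F(A)\<close> (\<open>condition_2\<close>), and the stable coordinates form the transverse linearization
  (\<open>condition_3\<close>).

  Conversely, the transverse linearization extends to \<open>X\<close> by the flow (\<open>globalize_transverse\<close>).
  Averaging over the circles of the torus one after the other turns functions on \<open>A\<close> into joint
  eigenfunctions, enough of them to separate points and tangent vectors (\<open>eigenfunction_exists\<close>). Composed
  with the phase they satisfy linear equations along orbits. By compactness finitely many of these
  functions embed a neighbourhood of \<open>A\<close>, and the flow transports this to all of \<open>X\<close>
  (\<open>embedding_of_observables\<close>). In both directions properness comes from the decaying function: its
  sublevel sets are compact (\<open>sublevel_compact\<close>), and a proper injective map is an embedding.
\<close>

abbreviation "Euc \<equiv> Euclidean_space"
abbreviation "cdom \<equiv> chart_dom"
abbreviation "cdim \<equiv> chart_dim"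
abbreviation "cmap \<equiv> chart_map"
abbreviation "cinv \<equiv> chart_inv"
abbreviation "pder \<equiv> partial_deriv"
abbreviation "ckf \<equiv> ck_real_finite"

section \<open>Open subsets of Euclidean spaces\<close>

abbreviation "E n\<equiv>topspace (Euc n)"

lemma E_iff:"x:E n\<longleftrightarrow>(ALL i>=n. x i=0)" by (simp add: topspace_Euclidean_space)

lemma E_eqI:"x:E n==>y:E n==>(!!i. i<n==>x i=y i)==>x=y"
 by (metis E_iff ext linorder_not_less)

definition box_at :: "nat=>(nat=>real)=>real=>(nat=>real) set" where
 "box_at n x r={y:E n. ALL i<n. \<bar>y i-x i\<bar><r}"

lemma openin_E_eu:"openin (Euc n) S \<longleftrightarrow> openin (top_of_set (E n)) S"
 by (simp add: Euclidean_space_def euclidean_product_topology)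

lemma subtopology_E:"U<=E n==>subtopology (Euc n) U=top_of_set U"
 by (simp add: Euclidean_space_def euclidean_product_topology subtopology_subtopology inf.absorb2)

lemma continuous_coord [continuous_intros]:"continuous_on S (%x::nat=>real. x i)"
 by (rule continuous_on_subset[OF continuous_on_product_coordinates]) simp

lemma openin_box_at:"openin (Euc n) (box_at n x r)"
proof -
 have "open {y::nat=>real. \<bar>y i-x i\<bar><r}" for i
 by (rule open_Collect_less) (rule continuous_intros | simp)+
 hence "open (\<Inter>i\<in>{..<n}. {y::nat=>real. \<bar>y i-x i\<bar><r})" by (intro open_INT) auto
 hence "openin (top_of_set (E n)) (E n\<inter>(\<Inter>i\<in>{..<n}. {y. \<bar>y i-x i\<bar><r}))"
 by (rule openin_open_Int)
 moreover have "E n\<inter>(\<Inter>i\<in>{..<n}. {y. \<bar>y i-x i\<bar><r})=box_at n x r"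
 unfolding box_at_def by auto
 ultimately show ?thesis by (simp add: openin_E_eu)
qed

text \<open>Coordinate boxes are a basis of the topology, so openness can be used one coordinate at a time.\<close>

lemma openin_E_iff:
 "openin (Euc n) U\<longleftrightarrow>U<=E n&(ALL x:U. EX r>0. box_at n x r<=U)"
proof (intro iffI conjI ballI)
 assume o:"openin (Euc n) U"
 thus "U<=E n" using openin_subset by blast
 fix x assume xU:"x:U"
 obtain T where T:"openin (powertop_real UNIV) T" "U=T\<inter>E n"
 using o unfolding Euclidean_space_def openin_subtopology by auto
 obtain V where V:"finite {i. V i~=UNIV}" "!!i. open (V i)" "x:Pi\<^sub>E UNIV V" "Pi\<^sub>E UNIV V<=T"
 proof -
 have "x:T" using xU T(2) by auto
 then obtain V where "finite {i:UNIV. V i~=topspace euclideanreal}"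
 "ALL i:UNIV. openin euclideanreal (V i)" "x:Pi\<^sub>E UNIV V" "Pi\<^sub>E UNIV V<=T"
 using T(1)[unfolded openin_product_topology_alt] by meson
 thus ?thesis using that[of V] by auto
 qed
 have "EX r>0. ALL y. \<bar>y-x i\<bar><r-->y:V i" for i
 proof -
 have "x i:V i" using V(3) by auto
 then obtain r where "r > 0" "ball (x i) r<=V i" using V(2) open_contains_ball by blast
 thus ?thesis by (intro exI[of _ r]) (auto simp: ball_def dist_real_def abs_minus_commute subset_iff)
 qed
 then obtain r where r:"!!i. r i > 0" "!!i y. \<bar>y-x i\<bar><r i==>y:V i" by metis
 define s where "s=Min (insert 1 (r`{i. V i~=UNIV}))"
 have s:"s > 0" "!!i. V i~=UNIV==>s<=r i" unfolding s_def using V(1) r(1) by (auto)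
 have "box_at n x s<=U"
 proof
 fix y assume y:"y:box_at n x s"
 have "y i:V i" for i
 proof (cases "V i=UNIV")
 case False
 have "\<bar>y i-x i\<bar><s"
 proof (cases "i<n")
 case True thus ?thesis using y by (auto simp: box_at_def)
 next
 case False
 hence "x i=0" "y i=0" using y xU T(2) by (auto simp: box_at_def E_iff)
 thus ?thesis using s by simp
 qed
 thus ?thesis using r(2) s(2)[OF False] by (meson less_le_trans)
 qed auto
 thus "y:U" using V(4) T(2) y by (auto simp: box_at_def)
 qed
 thus "EX r>0. box_at n x r<=U" using s(1) by blast
next
 assume a:"U<=E n&(ALL x:U. EX r>0. box_at n x r<=U)"
 have "EX T. openin (Euc n) T&x:T&T<=U" if "x:U" for x
 proof -
 from a that obtain r where "r > 0" "box_at n x r<=U" by blast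
 moreover have "x:box_at n x r" using that a \<open>r > 0\<close> by (auto simp: box_at_def)
 ultimately show ?thesis using openin_box_at by blast
 qed
 thus "openin (Euc n) U" by (subst openin_subopen) blast
qed

lemma cont_iff:
 assumes "openin (Euc n) U"
 shows "continuous_map (subtopology (Euc n) U) euclideanreal f\<longleftrightarrow>continuous_on U f"
 using subtopology_E[OF openin_subset[OF assms]] by simp

lemma openin_E_cont_preimage:
 assumes "openin (Euc n) U" "continuous_on U f" "open T"
 shows "openin (Euc n) {x:U. f x:T}"
proof -
 have "openin (top_of_set U) (U\<inter>f -` T)" using assms by (intro continuous_openin_preimage_gen)
 moreover have "U\<inter>f -` T={x:U. f x:T}" by auto
 ultimately show ?thesis using assms(1) unfolding openin_E_eu by (metis openin_trans)
qed

lemma cont_box: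
 assumes "openin (Euc n) U" "continuous_on U (f::_=>real)" "x:U" "e > 0"
 obtains r where "r > 0" "box_at n x r<=U" "!!y. y:box_at n x r==>\<bar>f y-f x\<bar><e"
proof -
 have "openin (Euc n) {y:U. f y:ball (f x) e}" by (rule openin_E_cont_preimage[OF assms(1,2)]) auto
 then obtain r where "r > 0" "box_at n x r<={y:U. f y:ball (f x) e}"
 using assms(3,4) unfolding openin_E_iff by fastforce
 thus ?thesis using that[of r] by (auto simp: dist_real_def abs_minus_commute)
qed

lemma upd_in_open:
 assumes "openin (Euc n) U" "x:U" "i<n"
 shows "\<forall>\<^sub>F s in nhds (x i). x(i := s)\<in>U"
proof -
 obtain r where r:"r > 0" "box_at n x r<=U" using assms unfolding openin_E_iff by blast
 have "x:E n" using assms openin_subset by blast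
 hence "x(i := s):U" if "dist s (x i)<r" for s
 using that r assms(3) by (auto simp: box_at_def dist_real_def E_iff subset_iff)
 thus ?thesis using r(1) unfolding eventually_nhds_metric by blast
qed

lemma box_segment:
 assumes "y:box_at n x r" "z:box_at n x r" "0<=t" "t<=1"
 shows "(%i. y i+t*(z i-y i)):box_at n x r"
proof -
 have "\<bar>y i+t*(z i-y i)-x i\<bar><r" if "i<n" for i
 proof -
 have "y i+t*(z i-y i)-x i=(1-t)*(y i-x i)+t*(z i-x i)" by (simp add: algebra_simps)
 hence "\<bar>y i+t*(z i-y i)-x i\<bar><=(1-t)*\<bar>y i-x i\<bar>+t*\<bar>z i-x i\<bar>"
 using assms(3,4) by (metis abs_mult abs_of_nonneg abs_triangle_ineq diff_ge_0_iff_ge)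
 also have "...<r" using assms that by (intro convex_bound_lt) (auto simp: box_at_def)
 finally show ?thesis .
 qed
 thus ?thesis using assms by (auto simp: box_at_def E_iff)
qed

section \<open>Functions of class \<open>C\<^sup>k\<close>\<close>

text \<open>A relational form of \<open>partial_deriv\<close>, so that existence and value can be proved together.\<close>

definition has_pd :: "nat=>((nat=>real)=>real)=>(nat=>real)=>real=>bool" where
 "has_pd i f x d\<longleftrightarrow>((%s. f (x(i := s))) has_real_derivative d) (at (x i))"

lemma has_pd_imp:"has_pd i f x d==>pder i f x=d"
 unfolding has_pd_def partial_deriv_def by (rule DERIV_imp_deriv)

lemma has_pd_cong:
 assumes "openin (Euc n) U" "x:U" "i<n" "!!y. y:U==>f y=g y"
 shows "has_pd i f x d\<longleftrightarrow>has_pd i g x d"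
proof -
 have "\<forall>\<^sub>F s in nhds (x i). f (x(i := s))=g (x(i := s))"
 using upd_in_open[OF assms(1-3)] by eventually_elim (rule assms(4))
 thus ?thesis unfolding has_pd_def by (intro DERIV_cong_ev) auto
qed

lemma differentiable_iff_pd:
 "(%s. f (x(i := s))) differentiable (at (x i))\<longleftrightarrow>has_pd i f x (pder i f x)"
 unfolding has_pd_def partial_deriv_def by (metis DERIV_deriv_iff_real_differentiable)

lemma pd_cong:
 assumes "openin (Euc n) U" "x:U" "i<n" "!!y. y:U==>f y=g y"
 shows "pder i f x=pder i g x"
proof -
 have "\<forall>\<^sub>F s in nhds (x i). f (x(i := s))=g (x(i := s))"
 using upd_in_open[OF assms(1-3)] by eventually_elim (rule assms(4))
 thus ?thesis unfolding partial_deriv_def by (intro deriv_cong_ev) auto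
qed

lemma ck_fin_0:"openin (Euc n) U==>ckf 0 n U f\<longleftrightarrow>continuous_on U f"
 by (simp add: cont_iff)

lemma ck_fin_cong:
 assumes "openin (Euc n) U"
 shows "(!!y. y:U==>f y=g y)==>ckf j n U f\<longleftrightarrow>ckf j n U g"
proof (induction j arbitrary: f g)
 case 0 thus ?case unfolding ck_fin_0[OF assms] by (rule continuous_on_cong[OF refl])
next
 case (Suc j)
 have 1:"pder i f x=pder i g x" if "x:U" "i<n" for x i by (rule pd_cong[OF assms that Suc.prems])
 have 2:"has_pd i f x d\<longleftrightarrow>has_pd i g x d" if "x:U" "i<n" for x i d
 by (rule has_pd_cong[OF assms that Suc.prems])
 have "continuous_on U f\<longleftrightarrow>continuous_on U g"
 by (rule continuous_on_cong[OF refl]) (use Suc.prems in auto)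
 moreover have "ckf j n U (pder i f)\<longleftrightarrow>ckf j n U (pder i g)"
 if "i<n" for i using Suc.IH 1 that by blast
 ultimately show ?case using 1 2 by (auto simp: cont_iff[OF assms] differentiable_iff_pd)
qed

lemma ck_fin_Suc:
 assumes "openin (Euc n) U"
 shows "ckf (Suc j) n U f\<longleftrightarrow>continuous_on U f &
 (ALL i<n. (ALL x:U. has_pd i f x (pder i f x))&ckf j n U (pder i f))"
 by (simp add: cont_iff[OF assms] differentiable_iff_pd)

declare ck_real_finite.simps(2) [simp del]

text \<open>Any family of functions that are the partial derivatives may be used in place of the
  canonical one.\<close>

lemma ck_fin_SucI:
 assumes "openin (Euc n) U" "continuous_on U f"
 "!!i x. i<n==>x:U==>has_pd i f x (D i x)"
 "!!i. i<n==>ckf j n U (D i)"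
 shows "ckf (Suc j) n U f"
proof -
 have "pder i f x=D i x" if "i<n" "x:U" for i x using assms(3)[OF that] by (rule has_pd_imp)
 thus ?thesis unfolding ck_fin_Suc[OF assms(1)]
 using assms(2,3,4) ck_fin_cong[OF assms(1), of "pder i f" "D i" j for i] by auto
qed

lemma ck_fin_cont:"openin (Euc n) U==>ckf j n U f==>continuous_on U f"
 by (cases j) (auto simp: cont_iff ck_fin_Suc)

lemma ck_fin_SucD:
 assumes "openin (Euc n) U"
 shows "ckf (Suc j) n U f==>ckf j n U f"
proof (induction j arbitrary: f)
 case (Suc j) thus ?case using ck_fin_Suc[OF assms] by metis
qed (auto simp: ck_fin_Suc[OF assms] cont_iff[OF assms])

lemma ck_fin_subset:
 assumes "openin (Euc n) U" "openin (Euc n) V" "V<=U"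
 shows "ckf j n U f==>ckf j n V f"
proof (induction j arbitrary: f)
 case 0 thus ?case using assms continuous_on_subset by (auto simp: ck_fin_0 cont_iff)
next
 case (Suc j) thus ?case using assms continuous_on_subset unfolding ck_fin_Suc[OF assms(1)] ck_fin_Suc[OF assms(2)]
 by blast
qed

lemma cont_local:
 fixes f :: "(nat=>real)=>'b::topological_space"
 assumes "openin (Euc n) U"
 "!!x. x:U==>EX V. openin (Euc n) V&x:V&V<=U&continuous_on V f"
 shows "continuous_on U f"
proof -
 have "openin (top_of_set U) (U\<inter>f -` T)" if T:"open T" for T
 proof -
 have "openin (Euc n) (U\<inter>f -` T)"
 proof (subst openin_subopen, intro ballI)
 fix x assume x:"x:U\<inter>f -` T"
 then obtain V where V:"openin (Euc n) V" "x:V" "V<=U" "continuous_on V f" using assms(2) by blast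
 have "openin (Euc n) {y:V. f y:T}" using openin_E_cont_preimage[OF V(1,4) T] .
 thus "EX W. openin (Euc n) W&x:W&W<=U\<inter>f -` T"
 using V x by (intro exI[of _ "{y:V. f y:T}"]) auto
 qed
 thus ?thesis using openin_subset[OF assms(1)] unfolding openin_E_eu
 by (meson openin_imp_subset openin_subset_trans inf_le1)
 qed
 thus ?thesis using continuous_openin_preimage_eq by blast
qed

lemma ck_fin_local:
 assumes "openin (Euc n) U"
 "!!x. x:U==>EX V. openin (Euc n) V&x:V&V<=U&ckf j n V f"
 shows "ckf j n U f" using assms(2)
proof (induction j arbitrary: f)
 case 0
 thus ?case using cont_local[OF assms(1), of f] ck_fin_0 assms(1) by metis
next
 case (Suc j)
 have "continuous_on U f" using cont_local[OF assms(1), of f] Suc.prems ck_fin_cont by meson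
 moreover have "has_pd i f x (pder i f x)" if "i<n" "x:U" for i x
 using Suc.prems[OF that(2)] that(1) ck_fin_Suc by meson
 moreover have "ckf j n U (pder i f)" if "i<n" for i by (rule Suc.IH) (use Suc.prems that ck_fin_Suc in meson)
 ultimately show ?case using ck_fin_Suc[OF assms(1)] by blast
qed

lemma ck_fin_const:"openin (Euc n) U==>ckf j n U (%_. c)"
proof (induction j arbitrary: c)
 case (Suc j)
 show ?case by (rule ck_fin_SucI[where D = "%_ _. 0"]) (use Suc in "auto simp: has_pd_def")
qed (simp add: ck_fin_0)

lemma ck_fin_coord:
 assumes "openin (Euc n) U"
 shows "ckf j n U (%x. x l)"
proof (cases j)
 case (Suc j')
 show ?thesis unfolding Suc
 proof (rule ck_fin_SucI[OF assms, where D = "%i _. if i=l then 1 else 0"])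
 show "has_pd i (%x. x l) x (if i=l then 1 else 0)" for i and x :: "nat=>real"
 by (auto simp: has_pd_def)
 qed (use ck_fin_const[OF assms] in "auto intro: continuous_intros")
qed (use assms in "auto simp: cont_iff intro: continuous_intros")

lemma ck_fin_add:
 assumes "openin (Euc n) U"
 shows "ckf j n U f==>ckf j n U g==>ckf j n U (%x. f x+g x)"
proof (induction j arbitrary: f g)
 case 0 thus ?case using assms by (auto simp: cont_iff intro: continuous_intros)
next
 case (Suc j)
 note a = Suc.prems[unfolded ck_fin_Suc[OF assms]]
 show ?case by (rule ck_fin_SucI[OF assms, where D = "%i x. pder i f x+pder i g x"])
 (use a Suc.IH in "auto simp: has_pd_def intro!: continuous_intros DERIV_add")
qed

lemma ck_fin_mult:
 assumes "openin (Euc n) U"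
 shows "ckf j n U f==>ckf j n U g==>ckf j n U (%x. f x * g x)"
proof (induction j arbitrary: f g)
 case 0 thus ?case using assms by (auto simp: cont_iff intro: continuous_intros)
next
 case (Suc j)
 note a = Suc.prems[unfolded ck_fin_Suc[OF assms]]
 show ?case
 proof (rule ck_fin_SucI[OF assms, where D = "%i x. pder i f x * g x+pder i g x * f x"])
 show "has_pd i (%x. f x * g x) x (pder i f x * g x+pder i g x * f x)"
 if "i<n" "x:U" for i x
 proof -
 have "has_pd i f x (pder i f x)" "has_pd i g x (pder i g x)" using a that by auto
 from DERIV_mult[OF this[unfolded has_pd_def]] show ?thesis unfolding has_pd_def by simp
 qed
 show "ckf j n U (%x. pder i f x * g x+pder i g x * f x)"
 if "i<n" for i using Suc.prems ck_fin_SucD[OF assms] a that by (intro ck_fin_add[OF assms] Suc.IH) auto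
 qed (use a in "auto intro!: continuous_intros")
qed

lemma ck_fin_sum:
 assumes "openin (Euc n) U" "!!l. l:S==>ckf j n U (f l)"
 shows "ckf j n U (%x. SUM l:S. f l x)" using assms(2)
 by (induction S rule: infinite_finite_induct) (auto intro: ck_fin_const ck_fin_add assms(1))

lemma ck_fin_prod:
 assumes "openin (Euc n) U" "!!l. l:S==>ckf j n U (f l)"
 shows "ckf j n U (%x. \<Prod>l\<in>S. f l x)" using assms(2)
 by (induction S rule: infinite_finite_induct) (auto intro: ck_fin_const ck_fin_mult assms(1))

text \<open>Continuous partial derivatives give a total derivative: pass from \<open>y\<close> to \<open>z\<close> changing one
  coordinate at a time, and apply the mean value inequality to each step.\<close>

lemma total_derivative:
 assumes V:"openin (Euc m) V"
 and pd:"!!l x. l<m==>x:V==>has_pd l g x (D l x)"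
 and cont:"!!l. l<m==>continuous_on V (D l)"
 and y:"y:V" and e:"e > 0"
 obtains r where "r > 0" "box_at m y r<=V"
 "!!z. z:box_at m y r ==>
 \<bar>g z-g y-(SUM l<m. D l y*(z l-y l))\<bar><=e*(SUM l<m. \<bar>z l-y l\<bar>)"
proof -
 have yE:"y:E m" using y V openin_subset by blast
 have "EX r>0. box_at m y r<=V&(ALL z:box_at m y r. \<bar>D l z-D l y\<bar><e)" if "l<m" for l
 using cont_box[OF V cont[OF that] y e] by metis
 then obtain R where R:"!!l. l<m==>R l > 0" "!!l. l<m==>box_at m y (R l)<=V"
 "!!l z. l<m==>z:box_at m y (R l)==>\<bar>D l z-D l y\<bar><e" by metis
 obtain r0 where r0:"r0 > 0" "box_at m y r0<=V" using V y unfolding openin_E_iff by blast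
 define r where "r=Min (insert r0 (R`{..<m}))"
 have r:"r > 0" "r<=r0" "!!l. l<m==>r<=R l" using r0 R(1) by (auto simp: r_def)
 have mono:"box_at m y r<=box_at m y s" if "r<=s" for s using that by (force simp: box_at_def)
 have main:"\<bar>g z-g y-(SUM l<m. D l y*(z l-y l))\<bar><=e*(SUM l<m. \<bar>z l-y l\<bar>)"
 if z:"z:box_at m y r" for z
 proof -
 define w where "w p=(%i. if i<p then z i else y i)" for p
 have w0:"w 0=y" by (simp add: w_def)
 have wm:"w m=z" using z yE by (auto simp: w_def box_at_def E_iff fun_eq_iff)
 have step:"\<bar>g (w (Suc p))-g (w p)-D p y*(z p-y p)\<bar><=e*\<bar>z p-y p\<bar>" if p:"p<m" for p
 proof -
 define S where "S=closed_segment (y p) (z p)"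
 have inb:"(w p)(p := s):box_at m y r" if "s:S" for s
 proof -
 have "\<bar>s-y p\<bar><=\<bar>z p-y p\<bar>"
 using that unfolding S_def closed_segment_eq_real_ivl by (auto split: if_splits)
 hence "\<bar>s-y p\<bar><r" using z p by (auto simp: box_at_def)
 thus ?thesis using z yE p r(1) by (auto simp: box_at_def w_def E_iff)
 qed
 have d:"((%s. g ((w p)(p := s))-D p y * s) has_real_derivative D p ((w p)(p := s))-D p y) (at s within S)"
 if "s:S" for s
 proof -
 have "(w p)(p := s):V" using inb[OF that] mono[OF r(2)] r0(2) by blast
 from pd[OF p this] have "((%s. g ((w p)(p := s))) has_real_derivative D p ((w p)(p := s))) (at s)"
 by (simp add: has_pd_def)
 from DERIV_diff[OF this DERIV_cmult_Id[of "D p y"]] show ?thesis by (rule has_field_derivative_at_within)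
 qed
 have "norm ((g ((w p)(p := z p))-D p y * z p)-(g ((w p)(p := y p))-D p y * y p))<=e * norm (z p-y p)"
 proof (rule field_differentiable_bound[OF _ d])
 fix s assume "s:S"
 thus "norm (D p ((w p)(p := s))-D p y)<=e"
 using R(3)[OF p] inb mono[OF r(3)[OF p]] by (auto intro: less_imp_le)
 qed (auto simp: S_def)
 moreover have "(w p)(p := z p)=w (Suc p)" "(w p)(p := y p)=w p" by (auto simp: w_def fun_eq_iff)
 ultimately show ?thesis by (simp add: algebra_simps)
 qed
 have "g z-g y=(SUM p<m. g (w (Suc p))-g (w p))"
 using sum_lessThan_telescope[of "%p. g (w p)" m] w0 wm by simp
 hence "g z-g y-(SUM l<m. D l y*(z l-y l)) =
 (SUM p<m. g (w (Suc p))-g (w p)-D p y*(z p-y p))" by (simp add: sum_subtractf)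
 also have "\<bar>...\<bar><=(SUM p<m. e*\<bar>z p-y p\<bar>)"
 by (rule order_trans[OF sum_abs]) (intro sum_mono step, simp)
 finally show ?thesis by (simp add: sum_distrib_left)
 qed
 show ?thesis using that[of r] r main mono[OF r(2)] r0(2) by blast
qed

text \<open>The total derivative bounds the error of the linear approximation along the curve.\<close>

lemma chain_rule_curve:
 assumes V:"openin (Euc m) V"
 and pd:"!!l x. l<m==>x:V==>has_pd l g x (D l x)"
 and cont:"!!l. l<m==>continuous_on V (D l)"
 and c0:"c t0:V" and cE:"\<forall>\<^sub>F t in at t0. c t\<in>E m"
 and dc:"!!l. l<m==>((%t. c t l) has_real_derivative c' l) (at t0)"
 shows "((%t. g (c t)) has_real_derivative (SUM l<m. D l (c t0) * c' l)) (at t0)"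
proof -
 define y where "y=c t0"
 define L where "L t=(SUM l<m. D l y*(c t l-y l))" for t
 define N where "N t=(SUM l<m. \<bar>c t l-y l\<bar>)" for t
 have q:"((%t. (c t l-y l)/(t-t0)) \<longlongrightarrow> c' l) (at t0)" if "l<m" for l
 using dc[OF that] unfolding has_field_derivative_iff y_def .
 have "((%t. SUM l<m. D l y*((c t l-y l)/(t-t0))) \<longlongrightarrow> (SUM l<m. D l y * c' l)) (at t0)"
 by (intro tendsto_sum tendsto_mult tendsto_const q) auto
 hence lim1:"((%t. L t/(t-t0)) \<longlongrightarrow> (SUM l<m. D l y * c' l)) (at t0)"
 by (simp add: L_def sum_divide_distrib)
 have "((%t. SUM l<m. \<bar>(c t l-y l)/(t-t0)\<bar>) \<longlongrightarrow> (SUM l<m. \<bar>c' l\<bar>)) (at t0)"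
 by (intro tendsto_sum tendsto_rabs q) auto
 hence limN:"((%t. N t/\<bar>t-t0\<bar>) \<longlongrightarrow> (SUM l<m. \<bar>c' l\<bar>)) (at t0)"
 by (simp add: N_def sum_divide_distrib)
 define K where "K=(SUM l<m. \<bar>c' l\<bar>)+1"
 have K:"K > 0" unfolding K_def by (simp add: add_nonneg_pos sum_nonneg)
 have NK:"\<forall>\<^sub>F t in at t0. N t/\<bar>t-t0\<bar><K" by (rule order_tendstoD(2)[OF limN]) (simp add: K_def)
 have cc:"\<forall>\<^sub>F t in at t0. c t\<in>box_at m y r" if "r > 0" for r
 proof -
 have "\<forall>\<^sub>F t in at t0. \<forall>l\<in>{..<m}. \<bar>c t l-y l\<bar><r"
 proof (intro eventually_ball_finite ballI finite_lessThan)
 fix l assume "l:{..<m}"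
 hence "((%t. c t l) \<longlongrightarrow> c t0 l) (at t0)" using DERIV_isCont[OF dc] isCont_def by auto
 thus "\<forall>\<^sub>F t in at t0. \<bar>c t l-y l\<bar><r"
 using that unfolding tendsto_iff y_def dist_real_def by blast
 qed
 thus ?thesis using cE by eventually_elim (auto simp: box_at_def)
 qed
 have lim2:"((%t. (g (c t)-g y-L t)/(t-t0)) \<longlongrightarrow> 0) (at t0)"
 proof (rule tendstoI)
 fix e :: real assume e:"e > 0"
 have "e/(K+1) > 0" using e K by simp
 then obtain r where r:"r > 0" "box_at m y r<=V"
 "!!z. z:box_at m y r==>\<bar>g z-g y-(SUM l<m. D l y*(z l-y l))\<bar><=e/(K+1)*(SUM l<m. \<bar>z l-y l\<bar>)"
 using total_derivative[OF V pd cont c0[folded y_def], of "e/(K+1)"] by blast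
 show "\<forall>\<^sub>F t in at t0. dist ((g (c t)-g y-L t)/(t-t0)) 0<e"
 using NK cc[OF r(1)] eventually_neq_at_within[of t0]
 proof eventually_elim
 case (elim t)
 have "\<bar>g (c t)-g y-L t\<bar>/\<bar>t-t0\<bar><=e/(K+1) * N t/\<bar>t-t0\<bar>"
 using r(3)[OF elim(2)] unfolding L_def N_def by (rule divide_right_mono) auto
 also have "...=e/(K+1)*(N t/\<bar>t-t0\<bar>)" by simp
 also have "...<=e/(K+1) * K" using elim(1) e K by (intro mult_left_mono) auto
 also have "...<e" using e K by (simp add: field_simps)
 finally show ?case by (simp add: dist_real_def)
 qed
 qed
 have "((%t. L t/(t-t0)+(g (c t)-g y-L t)/(t-t0)) \<longlongrightarrow> (SUM l<m. D l y * c' l)+0) (at t0)"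
 by (rule tendsto_add[OF lim1 lim2])
 thus ?thesis unfolding has_field_derivative_iff y_def[symmetric] by (simp add: add_divide_distrib[symmetric])
qed

lemma continuous_into_E:
 assumes "!!l. l<m==>continuous_on U (%x. f x l)" "!!x. x:U==>f x:E m"
 shows "continuous_on U f"
proof (rule continuous_on_coordinatewise_then_product)
 fix l show "continuous_on U (%x. f x l)"
 proof (cases "l<m")
 case False
 hence "f x l=0" if "x:U" for x using assms(2)[OF that] by (simp add: E_iff)
 thus ?thesis by (simp cong: continuous_on_cong)
 qed (rule assms(1))
qed

lemma has_pd_comp:
 assumes U:"openin (Euc n) U" and V:"openin (Euc m) V"
 and fV:"!!x. x:U==>f x:V" and x:"x:U" and i:"i<n"
 and g:"ckf (Suc j) m V g"
 and f:"!!l. l<m==>has_pd i (%x. f x l) x (d l)"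
 shows "has_pd i (%x. g (f x)) x (SUM l<m. pder l g (f x) * d l)"
proof -
 have VE:"V<=E m" using V openin_subset by blast
 have "((%t. g (f (x(i := t)))) has_real_derivative
 (SUM l<m. pder l g (f (x(i := x i))) * d l)) (at (x i))"
 proof (rule chain_rule_curve[OF V])
 show "has_pd l g y (pder l g y)" if "l<m" "y:V" for l y using g that unfolding ck_fin_Suc[OF V] by blast
 show "continuous_on V (pder l g)" if "l<m" for l using g that ck_fin_cont[OF V] unfolding ck_fin_Suc[OF V] by blast
 show "f (x(i := x i)):V" using fV x by simp
 have "\<forall>\<^sub>F t in at (x i). x(i := t)\<in>U"
 using upd_in_open[OF U x i] by (simp add: eventually_nhds_conv_at)
 thus "\<forall>\<^sub>F t in at (x i). f (x(i := t))\<in>E m" by eventually_elim (use fV VE in blast)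
 show "((%t. f (x(i := t)) l) has_real_derivative d l) (at (x i))" if "l<m" for l
 using f[OF that] unfolding has_pd_def .
 qed
 thus ?thesis unfolding has_pd_def by simp
qed

lemma ck_fin_comp:
 assumes U:"openin (Euc n) U" and V:"openin (Euc m) V"
 and fV:"!!x. x:U==>f x:V"
 shows "ckf j m V g==>(!!l. l<m==>ckf j n U (%x. f x l))
 ==> ckf j n U (%x. g (f x))"
proof (induction j arbitrary: g)
 case 0
 have VE:"V<=E m" using V openin_subset by blast
 have "continuous_on U f" by (rule continuous_into_E[where m = m]) (use 0 fV VE in "auto simp: cont_iff[OF U]")
 moreover have "continuous_on V g" using 0 by (simp add: cont_iff[OF V])
 ultimately have "continuous_on U (%x. g (f x))" using fV continuous_on_compose2[of V g U f] by blast
 thus ?case by (simp add: cont_iff[OF U])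
next
 case (Suc j)
 have VE:"V<=E m" using V openin_subset by blast
 note g = Suc.prems(1)[unfolded ck_fin_Suc[OF V]]
 have f:"ckf j n U (%x. f x l)" if "l<m" for l using ck_fin_SucD[OF U Suc.prems(2)[OF that]] .
 have pdf:"has_pd i (%x. f x l) x (pder i (%x. f x l) x)" if "l<m" "i<n" "x:U" for l i x
 using Suc.prems(2)[OF that(1)] that(2,3) unfolding ck_fin_Suc[OF U] by blast
 have "ckf j n U (%x. g (f x))" by (rule Suc.IH[OF ck_fin_SucD[OF V Suc.prems(1)] f])
 hence c:"continuous_on U (%x. g (f x))" by (rule ck_fin_cont[OF U])
 show ?case
 proof (rule ck_fin_SucI[OF U c, where D = "%i x. SUM l<m. pder l g (f x) * pder i (%x. f x l) x"])
 show "has_pd i (%x. g (f x)) x (SUM l<m. pder l g (f x) * pder i (%x. f x l) x)"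
 if "i<n" "x:U" for i x by (rule has_pd_comp[OF U V fV that(2,1) Suc.prems(1)])
 (use pdf that in auto)
 show "ckf j n U (%x. SUM l<m. pder l g (f x) * pder i (%x. f x l) x)"
 if "i<n" for i
 proof (intro ck_fin_sum[OF U] ck_fin_mult[OF U])
 fix l assume l:"l:{..<m}"
 show "ckf j n U (%x. pder l g (f x))" by (rule Suc.IH[OF _ f]) (use g l in auto)
 show "ckf j n U (pder i (%x. f x l))" using Suc.prems(2)[of l] l that unfolding ck_fin_Suc[OF U] by auto
 qed
 qed
qed
lemma ck_fin_inverse:
 assumes "openin (Euc n) U" "!!x. x:U==>f x~=0"
 shows "ckf j n U f==>ckf j n U (%x. inverse (f x))"
proof (induction j)
 case 0 thus ?case using assms by (auto simp: cont_iff intro: continuous_intros)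
next
 case (Suc j)
 note a = Suc.prems[unfolded ck_fin_Suc[OF assms(1)]]
 have IH:"ckf j n U (%x. inverse (f x))" using Suc ck_fin_SucD[OF assms(1)] by blast
 show ?case
 proof (rule ck_fin_SucI[OF assms(1),
 where D = "%i x. (-1)*(inverse (f x) * pder i f x * inverse (f x))"])
 show "has_pd i (%x. inverse (f x)) x ((-1)*(inverse (f x) * pder i f x * inverse (f x)))"
 if "i<n" "x:U" for i x
 proof -
 have "has_pd i f x (pder i f x)" using a that by auto
 from DERIV_inverse'[OF this[unfolded has_pd_def]] assms(2)[OF that(2)]
 show ?thesis unfolding has_pd_def by simp
 qed
 show "ckf j n U (%x. (-1)*(inverse (f x) * pder i f x * inverse (f x)))"
 if "i<n" for i using IH a that by (intro ck_fin_mult[OF assms(1)] ck_fin_const[OF assms(1)]) auto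
 qed (use a assms in "auto intro!: continuous_intros")
qed

definition smooth_real :: "(real=>real)=>bool" where
 "smooth_real f\<longleftrightarrow>(EX F. F 0=f&(ALL n t. (F n has_real_derivative F (Suc n) t) (at t)))"

lemma ck_fin_smooth_real:
 assumes "openin (Euc n) U" "smooth_real h"
 and f:"ckf j n U f"
 shows "ckf j n U (%x. h (f x))"
proof -
 obtain F where F:"F 0=h" "!!n t. (F n has_real_derivative F (Suc n) t) (at t)"
 using assms(2) unfolding smooth_real_def by blast
 have cF:"continuous_on UNIV (F p)" for p using F(2) DERIV_continuous_on by (metis has_field_derivative_at_within)
 have "ckf j n U (%x. F p (f x))" for p using f
 proof (induction j arbitrary: p)
 case 0 thus ?case using assms(1) continuous_on_compose2[OF cF, of U f] by (auto simp: cont_iff)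
 next
 case (Suc j)
 note a = Suc.prems[unfolded ck_fin_Suc[OF assms(1)]]
 show ?case
 proof (rule ck_fin_SucI[OF assms(1), where D = "%i x. F (Suc p) (f x) * pder i f x"])
 show "has_pd i (%x. F p (f x)) x (F (Suc p) (f x) * pder i f x)"
 if "i<n" "x:U" for i x
 proof -
 have "has_pd i f x (pder i f x)" using a that by auto
 from DERIV_chain2[OF _ this[unfolded has_pd_def], of "F p"] F(2)
 show ?thesis unfolding has_pd_def by simp
 qed
 show "ckf j n U (%x. F (Suc p) (f x) * pder i f x)" if "i<n" for i
 using Suc ck_fin_SucD[OF assms(1)] a that by (intro ck_fin_mult[OF assms(1)]) auto
 qed (use a continuous_on_compose2[OF cF, of U f] in auto)
 qed
 thus ?thesis using F(1) by metis
qed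

lemma ck_real_cong:
 "openin (Euc n) U==>(!!y. y:U==>f y=g y)==>ck_real k n U f\<longleftrightarrow>ck_real k n U g"
 unfolding ck_real_def using ck_fin_cong by metis

lemma ck_real_eq:
 "ck_real k n U f ==> openin (Euc n) U==>(!!y. y:U==>f y=g y)==>ck_real k n U g"
 using ck_real_cong[of n U f g k] by simp

lemma ck_real_subset:
 "ck_real k n U f ==> openin (Euc n) U ==> openin (Euc n) V==>V<=U==>ck_real k n V f"
 unfolding ck_real_def using ck_fin_subset by metis

lemma ck_real_local:
 assumes "openin (Euc n) U"
 "!!x. x:U==>EX V. openin (Euc n) V&x:V&V<=U&ck_real k n V f"
 shows "ck_real k n U f" unfolding ck_real_def using ck_fin_local[OF assms(1)] assms(2) unfolding ck_real_def by metis

lemma ck_real_const:"openin (Euc n) U==>ck_real k n U (%_. c)"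
 and ck_real_coord:"openin (Euc n) U==>ck_real k n U (%x. x l)"
 and ck_real_add:"openin (Euc n) U==>ck_real k n U f==>ck_real k n U g==>ck_real k n U (%x. f x+g x)"
 and ck_real_mult:"openin (Euc n) U==>ck_real k n U f==>ck_real k n U g==>ck_real k n U (%x. f x * g x)"
 and ck_real_inverse:"openin (Euc n) U==>(!!x. x:U==>f x~=0)==>ck_real k n U f==>ck_real k n U (%x. inverse (f x))"
 and ck_real_smooth:"openin (Euc n) U==>smooth_real h==>ck_real k n U f==>ck_real k n U (%x. h (f x))"
 unfolding ck_real_def
 by (blast intro: ck_fin_const ck_fin_coord ck_fin_add ck_fin_mult ck_fin_inverse ck_fin_smooth_real)+

lemma ck_real_sum:"openin (Euc n) U==>(!!l. l:S==>ck_real k n U (f l))==>ck_real k n U (%x. SUM l:S. f l x)"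
 unfolding ck_real_def by (blast intro: ck_fin_sum)

lemma ck_real_diff:
 assumes "openin (Euc n) U" "ck_real k n U f" "ck_real k n U g"
 shows "ck_real k n U (%x. f x-g x)"
 using ck_real_add[OF assms(1,2) ck_real_mult[OF assms(1) ck_real_const[OF assms(1), of k "-1"] assms(3)]] by simp

lemma ck_real_comp:
 assumes "openin (Euc n) U" "openin (Euc m) V" "!!x. x:U==>f x:V"
 "ck_real k m V g" "!!l. l<m==>ck_real k n U (%x. f x l)"
 shows "ck_real k n U (%x. g (f x))"
 using assms(4,5) unfolding ck_real_def using ck_fin_comp[OF assms(1,2), of f] assms(3) by metis

lemma ck_real_cont:"openin (Euc n) U==>ck_real k n U f==>continuous_on U f"
 unfolding ck_real_def using ck_fin_cont[of n U 0 f] zero_le[of k] unfolding zero_enat_def by blast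

lemma ck_real_1:"k\<ge>1==>ck_real k n U f==>ckf (Suc 0) n U f"
 unfolding ck_real_def by (simp add: one_enat_def)

lemma ck_real_has_pd:
 "k\<ge>1 ==> openin (Euc n) U==>ck_real k n U f==>i<n==>x:U==>has_pd i f x (pder i f x)"
 using ck_real_1 ck_fin_Suc by metis

lemma ck_real_pd_cont:
 "k\<ge>1 ==> openin (Euc n) U==>ck_real k n U f==>i<n==>continuous_on U (pder i f)"
 using ck_real_1 ck_fin_Suc ck_fin_cont by metis

text \<open>The chain rule.\<close>

lemma partial_deriv_comp:
 assumes "openin (Euc n) U" "openin (Euc m) V" "!!x. x:U==>f x:V"
 "ck_real k m V g" "!!l. l<m==>ck_real k n U (%x. f x l)" "k\<ge>1" "x:U" "i<n"
 shows "pder i (%x. g (f x)) x=(SUM l<m. pder l g (f x) * pder i (%x. f x l) x)"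
 by (rule has_pd_imp, rule has_pd_comp[OF assms(1,2) _ assms(7,8) ck_real_1[OF assms(6,4)]])
 (auto intro: assms(3) ck_real_has_pd[OF assms(6,1,5)] assms(7,8))

section \<open>The inverse function theorem\<close>

lemma delta_sum:"i<(n::nat)==>(SUM m<n. (if i=m then 1 else 0) * f m)=(f i::'b::comm_semiring_1)"
proof -
 assume "i<n"
 have "(SUM m<n. (if i=m then 1 else 0) * f m)=(SUM m<n. if m=i then f m else 0)" by (intro sum.cong) auto
 with \<open>i < n\<close> show ?thesis by simp
qed

lemma ck_real_det:
 assumes U:"openin (Euc n) U"
 and a:"!!i j. i<d==>j<d==>ckf p n U (%x. a x i j)"
 shows "ckf p n U (%x. Determinant.det (Matrix.mat d d (%(i, j). a x i j)))"
proof -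
 have "Determinant.det (Matrix.mat d d (%(i, j). a x i j)) =
 (\<Sum>q\<in>{q. q permutes {0..<d}}. signof q*(\<Prod>i=0..<d. if i<d then a x i (q i) else 0))" for x
 unfolding Determinant.det_def by (auto intro!: sum.cong prod.cong simp: permutes_in_image)
 moreover have "ckf p n U (%x. \<Sum>q\<in>{q. q permutes {0..<d}}.
 signof q*(\<Prod>i=0..<d. if i<d then a x i (q i) else 0))"
 by (intro ck_fin_sum[OF U] ck_fin_mult[OF U] ck_fin_const[OF U] ck_fin_prod[OF U])
 (auto intro!: a simp: permutes_in_image)
 ultimately show ?thesis by simp
qed

text \<open>By Cramer's rule the entries of the inverse of a matrix are rational functions of its
  entries.\<close>

definition inv_entry :: "nat=>(nat=>nat=>real)=>nat=>nat=>real" where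
 "inv_entry d a i j=inverse (Determinant.det (Matrix.mat d d (%(i, j). a i j))) *
 adj_mat (Matrix.mat d d (%(i, j). a i j))$$(i, j)"

definition trivial_kernel :: "nat=>nat=>(nat=>nat=>real)=>bool" where
 "trivial_kernel n d J\<longleftrightarrow>(ALL v. (ALL i<n. (SUM j<d. J i j * v j)=0)-->(ALL j<d. v j=0))"

definition jac :: "((nat=>real)=>(nat=>real))=>(nat=>real)=>nat=>nat=>real" where
 "jac f x i j=pder j (%y. f y i) x"

lemma inv_entry:
 assumes "trivial_kernel d d a"
 shows "i<d==>j<d==>(SUM l<d. inv_entry d a i l * a l j)=(if i=j then 1 else 0)"
 and "Determinant.det (Matrix.mat d d (%(i, j). a i j))~=0"
proof -
 define A where "A=Matrix.mat d d (%(i, j). a i j)"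
 have A:"A:carrier_mat d d" by (simp add: A_def)
 have det:"Determinant.det A~=0"
 proof
 assume "Determinant.det A=0"
 then obtain v where v:"v:carrier_vec d" "v~=0\<^sub>v d" "A *\<^sub>v v=0\<^sub>v d"
 using det_0_iff_vec_prod_zero[OF A] by blast
 have "(SUM j<d. a i j * vec_index v j)=0" if "i<d" for i
 proof -
 have "vec_index (A *\<^sub>v v) i=(SUM j<d. a i j * vec_index v j)"
 using that v(1) by (auto simp: A_def scalar_prod_def lessThan_atLeast0 intro!: sum.cong)
 thus ?thesis using v(3) that by simp
 qed
 hence "vec_index v j=0" if "j<d" for j
 using assms[unfolded trivial_kernel_def, rule_format, of "%j. vec_index v j"] that by blast
 hence "v=0\<^sub>v d" using v(1) by (intro eq_vecI) auto
 thus False using v(2) by simp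
 qed
 thus "Determinant.det (Matrix.mat d d (%(i, j). a i j))~=0" by (simp add: A_def)
 assume ij:"i<d" "j<d"
 have "(adj_mat A * A)$$(i,j)=(SUM l<d. adj_mat A$$(i,l) * a l j)"
 using ij adj_mat(1)[OF A] A by (auto simp: scalar_prod_def A_def lessThan_atLeast0 intro!: sum.cong)
 also have "(adj_mat A * A)$$(i,j)=(if i=j then Determinant.det A else 0)" unfolding adj_mat(3)[OF A] using ij by auto
 finally have "inverse (Determinant.det A)*(SUM l<d. adj_mat A$$(i,l) * a l j)=(if i=j then 1 else 0)"
 using det by auto
 thus "(SUM l<d. inv_entry d a i l * a l j)=(if i=j then 1 else 0)"
 unfolding inv_entry_def A_def[symmetric] by (simp add: sum_distrib_left mult.assoc)
qed

lemma ck_fin_inv_entry: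
 assumes U:"openin (Euc n) U"
 and a:"!!i j. i<d==>j<d==>ckf p n U (%x. a x i j)"
 and det:"!!x. x:U==>Determinant.det (Matrix.mat d d (%(i, j). a x i j))~=0"
 and ij:"i<d" "j<d"
 shows "ckf p n U (%x. inv_entry d (a x) i j)"
proof -
 let ?A = "%x. Matrix.mat d d (%(i, j). a x i j)"
 let ?b = "%x i' j'. a x (if i'<j then i' else Suc i') (if j'<i then j' else Suc j')"
 have "adj_mat (?A x)$$(i, j)=(-1)^(j+i) * Determinant.det (Matrix.mat (d-1) (d-1) (%(i', j'). ?b x i' j'))" for x
 proof -
 have "mat_delete (?A x) j i=Matrix.mat (d-1) (d-1) (%(i', j'). ?b x i' j')"
 using ij unfolding mat_delete_def by (intro eq_matI) auto
 thus ?thesis using ij by (simp add: adj_mat_def cofactor_def)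
 qed
 hence "ckf p n U (%x. adj_mat (?A x)$$(i, j))"
 using ij by (auto intro!: ck_fin_mult[OF U] ck_fin_const[OF U] ck_real_det[OF U] a)
 thus ?thesis unfolding inv_entry_def by (intro ck_fin_mult[OF U] ck_fin_inverse[OF U] ck_real_det[OF U] a det)
qed

text \<open>Regularity of the inverse: its derivative at \<open>y\<close> is the inverse matrix of the derivative
  of \<open>f\<close> at \<open>g y\<close>, hence is as smooth as \<open>g\<close> itself, one order at a time.\<close>

lemma ck_fin_inverse_function:
 assumes V:"openin (Euc n) V" and W:"openin (Euc n) W"
 and gV:"!!y. y:W==>g y:V" and fg:"!!y i. y:W==>i<n==>f (g y) i=y i"
 and lip:"!!y y'. y:W==>y':W==>(SUM i<n. \<bar>g y i-g y' i\<bar>)<=2*(SUM i<n. \<bar>y i-y' i\<bar>)"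
 and ker:"!!x. x:V==>trivial_kernel n n (jac f x)"
 and ck:"!!i. i<n==>ckf (Suc p) n V (%x. f x i)"
 shows "i<n==>ckf (Suc p) n W (%y. g y i)"
proof -
 define a where "a=jac f"
 have a_def:"a x i j=pder j (%x. f x i) x" for x i j by (simp add: a_def jac_def)
 have ker:"trivial_kernel n n (a x)" if "x:V" for x using ker[OF that] by (simp add: \<open>a = jac f\<close>)
 define K where "K x=inv_entry n (a x)" for x
 have pd:"has_pd j (%x. f x i) x (a x i j)" if "i<n" "j<n" "x:V" for i j x
 using ck[OF that(1)] that unfolding ck_fin_Suc[OF V] a_def by blast
 have acont:"continuous_on V (%x. a x i j)" if "i<n" "j<n" for i j
 using ck[OF that(1)] that ck_fin_cont[OF V] unfolding ck_fin_Suc[OF V] a_def by blast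
 have K:"(SUM l<n. K x i l * a x l j)=(if i=j then 1 else 0)" if "x:V" "i<n" "j<n" for x i j
 unfolding K_def by (rule inv_entry(1)[OF ker[OF that(1)] that(2,3)])
 have det:"Determinant.det (Matrix.mat n n (%(i, j). a x i j))~=0" if "x:V" for x
 by (rule inv_entry(2)[OF ker[OF that]])
 have gpd:"has_pd j (%y. g y i) y (K (g y) i j)" if "y:W" and j:"j<n" and i:"i<n" for y i j
 proof -
 define z where "z=g y"
 have zV:"z:V" using gV that by (simp add: z_def)
 define w where "w s=g (y(j := s))" for s
 define R where "R l s=f (w s) l-f z l-(SUM m<n. a z l m*(w s m-z m))" for l s
 have ev:"\<forall>\<^sub>F s in at (y j). y(j := s)\<in>W"
 using upd_in_open[OF W that(1,2)] by (simp add: eventually_nhds_conv_at)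
 have wlip:"(SUM i<n. \<bar>w s i-z i\<bar>)<=2*\<bar>s-y j\<bar>" if "y(j := s):W" for s
 proof -
 have "(SUM i<n. \<bar>(y(j := s)) i-y i\<bar>)=(SUM i:{..<n}. if i=j then \<bar>s-y j\<bar> else 0)"
 by (intro sum.cong) auto
 also have "...=\<bar>s-y j\<bar>" using j by simp
 finally show ?thesis using lip[OF that \<open>y \<in> W\<close>] by (simp add: w_def z_def)
 qed
 have R0:"((%s. R l s/(s-y j)) \<longlongrightarrow> 0) (at (y j))" if l:"l<n" for l
 proof (rule tendstoI)
 fix e :: real assume e:"e > 0"
 obtain r where r:"r > 0" "box_at n z r<=V"
 "!!x. x:box_at n z r==>\<bar>f x l-f z l-(SUM m<n. a z l m*(x m-z m))\<bar><=e/4*(SUM m<n. \<bar>x m-z m\<bar>)"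
 using total_derivative[OF V pd[OF l] acont[OF l] zV, of "e/4"] e by auto
 have "\<forall>\<^sub>F s in nhds (y j). dist s (y j)<r/2"
 using r(1) by (intro eventually_nhds_metric[THEN iffD2] exI[of _ "r/2"]) auto
 hence "\<forall>\<^sub>F s in at (y j). \<bar>s-y j\<bar><r/2"
 by (simp add: eventually_nhds_conv_at dist_real_def)
 thus "\<forall>\<^sub>F s in at (y j). dist (R l s/(s-y j)) 0<e" using ev eventually_neq_at_within[of "y j"]
 proof eventually_elim
 case (elim s)
 have "\<bar>w s i-z i\<bar><r" if "i<n" for i
 proof -
 have "\<bar>w s i-z i\<bar><=(SUM i<n. \<bar>w s i-z i\<bar>)" using that by (intro member_le_sum) auto
 also have "...<=2*\<bar>s-y j\<bar>" by (rule wlip[OF elim(2)])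
 also have "...<r" using elim(1) by simp
 finally show ?thesis .
 qed
 hence "w s:box_at n z r" using gV[OF elim(2)] openin_subset[OF V] by (auto simp: box_at_def w_def)
 from r(3)[OF this] have "\<bar>R l s\<bar><=e/4*(SUM m<n. \<bar>w s m-z m\<bar>)" by (simp add: R_def)
 also have "...<=e/4*(2*\<bar>s-y j\<bar>)" using wlip[OF elim(2)] e by (intro mult_left_mono) auto
 finally have "\<bar>R l s\<bar><=e/2*\<bar>s-y j\<bar>" by simp
 moreover have "e/2*\<bar>s-y j\<bar><e*\<bar>s-y j\<bar>" using e elim(3) by simp
 ultimately show ?case using elim(3) by (simp add: dist_real_def field_simps)
 qed
 qed
 have eq:"(w s i-z i)/(s-y j)=K z i j-(SUM l<n. K z i l*(R l s/(s-y j)))"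
 if "y(j := s):W" "s~=y j" for s
 proof -
 have "w s i-z i=(SUM m<n. (if i=m then 1 else 0)*(w s m-z m))" using i by (simp add: delta_sum)
 also have "...=(SUM m<n. (SUM l<n. K z i l * a z l m)*(w s m-z m))"
 by (intro sum.cong refl) (simp add: K[OF zV i])
 also have "...=(SUM l<n. K z i l*(SUM m<n. a z l m*(w s m-z m)))"
 unfolding sum_distrib_right sum_distrib_left by (subst sum.swap) (simp add: mult.assoc)
 also have "...=(SUM l<n. K z i l*((if l=j then s-y j else 0)-R l s))"
 proof (intro sum.cong refl)
 fix l assume "l:{..<n}"
 hence "f (w s) l=(y(j := s)) l" "f z l=y l"
 using fg[OF that(1)] fg[OF \<open>y \<in> W\<close>] by (auto simp: w_def z_def)
 thus "K z i l*(SUM m<n. a z l m*(w s m-z m))=K z i l*((if l=j then s-y j else 0)-R l s)"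
 unfolding R_def by auto
 qed
 also have "...=K z i j*(s-y j)-(SUM l<n. K z i l * R l s)"
 proof -
 have "(SUM l<n. K z i l*((if l=j then s-y j else 0)-R l s)) =
 (SUM l<n. (if j=l then 1 else 0)*(K z i l*(s-y j))-K z i l * R l s)"
 by (intro sum.cong refl) (auto simp: right_diff_distrib)
 thus ?thesis using j by (simp add: sum_subtractf delta_sum)
 qed
 finally have "(w s i-z i)/(s-y j)=(K z i j*(s-y j)-(SUM l<n. K z i l * R l s))/(s-y j)" by simp
 also have "...=K z i j-(SUM l<n. K z i l * R l s)/(s-y j)" using that(2) by (simp add: diff_divide_distrib)
 finally show ?thesis by (simp add: sum_divide_distrib)
 qed
 have "((%s. K z i j-(SUM l<n. K z i l*(R l s/(s-y j)))) \<longlongrightarrow> K z i j-(SUM l<n. K z i l*0)) (at (y j))"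
 by (intro tendsto_intros R0) auto
 hence "((%s. K z i j-(SUM l<n. K z i l*(R l s/(s-y j)))) \<longlongrightarrow> K z i j) (at (y j))" by simp
 moreover have "\<forall>\<^sub>F s in at (y j). K z i j-(\<Sum>l<n. K z i l*(R l s/(s-y j)))=(w s i-z i)/(s-y j)"
 using ev eventually_neq_at_within[of "y j"] by eventually_elim (simp add: eq)
 ultimately have "((%s. (w s i-z i)/(s-y j)) \<longlongrightarrow> K z i j) (at (y j))"
 by (rule Lim_transform_eventually)
 thus ?thesis unfolding has_pd_def has_field_derivative_iff w_def z_def by simp
 qed
 have gcont:"continuous_on W (%y. g y i)" if "i<n" for i
 proof (rule cont_local[OF W])
 fix y assume y:"y:W"
 show "EX V. openin (Euc n) V&y:V&V<=W&continuous_on V (%y. g y i)"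
 proof (intro exI[of _ W] conjI W y subset_refl)
 show "continuous_on W (%y. g y i)"
 proof (rule continuous_on_eq_continuous_within[THEN iffD2], rule ballI)
 fix x assume x:"x:W"
 have "((%y. SUM i<n. \<bar>y i-x i\<bar>) \<longlongrightarrow> (SUM i<n. \<bar>x i-x i\<bar>)) (at x within W)"
 using continuous_coord[of W] x unfolding continuous_on_def by (intro tendsto_intros) auto
 hence 1:"((%y. 2*(SUM i<n. \<bar>y i-x i\<bar>)) \<longlongrightarrow> 0) (at x within W)"
 using tendsto_mult_right_zero by fastforce
 have 2:"\<forall>\<^sub>F y in at x within W. norm (g y i-g x i)<=2*(\<Sum>i<n. \<bar>y i-x i\<bar>)"
 unfolding eventually_at_filter
 proof (rule always_eventually, intro allI impI)
 fix y assume "y:W"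
 have "\<bar>g y i-g x i\<bar><=(SUM i<n. \<bar>g y i-g x i\<bar>)" using \<open>i < n\<close> by (intro member_le_sum) auto
 thus "norm (g y i-g x i)<=2*(SUM i<n. \<bar>y i-x i\<bar>)" using lip[OF \<open>y \<in> W\<close> x] by simp
 qed
 have "((%y. g y i-g x i) \<longlongrightarrow> 0) (at x within W)" by (rule Lim_null_comparison[OF 2 1])
 thus "continuous (at x within W) (%y. g y i)" unfolding continuous_within by (simp add: LIM_zero_iff)
 qed
 qed
 qed
 have *: "ckf (Suc q) n W (%y. g y i)"
 if IH:"!!l. l<n==>ckf q n W (%y. g y l)" and q:"q<=p" and i:"i<n" for q i
 proof (rule ck_fin_SucI[OF W gcont[OF i], where D = "%j y. K (g y) i j"])
 fix j assume j:"j<n"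
 have mono:"ckf q n V (%x. a x i' j')" if "i'<n" "j'<n" for i' j'
 proof -
 have "ckf p n V (%x. a x i' j')" using ck[OF that(1)] that(2) unfolding ck_fin_Suc[OF V] a_def by blast
 with q show ?thesis by (induction rule: inc_induct) (auto dest: ck_fin_SucD[OF V])
 qed
 have "ckf q n V (%x. K x i j)" unfolding K_def
 by (rule ck_fin_inv_entry[OF V _ det i j]) (use mono in auto)
 thus "ckf q n W (%y. K (g y) i j)" by (rule ck_fin_comp[OF W V, rotated]) (use gV IH in auto)
 qed (use gpd i in auto)
 have "q<=p==>i<n==>ckf (Suc q) n W (%y. g y i)" for q i
 proof (induction q arbitrary: i)
 case 0 thus ?case using *[of 0 i] gcont by (auto simp: cont_iff[OF W])
 next
 case (Suc q) thus ?case using *[of "Suc q" i] by auto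
 qed
 thus "i<n==>ckf (Suc p) n W (%y. g y i)" by blast
qed

text \<open>A map whose derivative at \<open>x0\<close> is the identity is, on a small box, a perturbation of the
  identity with Lipschitz constant \<open>1/2\<close>; this makes it injective with Lipschitz inverse, and
  invariance of domain supplies openness of the image.\<close>

lemma inverse_function:
 assumes k:"k\<ge>1" and U:"openin (Euc n) U"
 and f:"!!i. i<n==>ck_real k n U (%x. f x i)" and fE:"!!x. x:U==>f x:E n"
 and x0:"x0:U"
 and jac:"!!i j. i<n==>j<n==>pder j (%x. f x i) x0=(if i=j then 1 else 0)"
 obtains V g where "openin (Euc n) V" "x0:V" "V<=U" "inj_on f V"
 "openin (Euc n) (f`V)" "!!x. x:V==>g (f x)=x"
 "!!i. i<n==>ck_real k n (f`V) (%y. g y i)"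
 "!!x. x:V==>trivial_kernel n n (jac f x)"
proof -
 define e where "e=1/(2*(real n+1))"
 have e:"e > 0" "real n * e<=1/2" by (auto simp: e_def field_simps)
 define J where "J i j x=pder j (%x. f x i) x" for i j x
 have "EX r>0. box_at n x0 r<=U&(ALL y:box_at n x0 r. \<bar>J i j y-J i j x0\<bar><e)" if "i<n" "j<n" for i j
 using cont_box[OF U ck_real_pd_cont[OF k U f[OF that(1)] that(2)] x0 e(1)] unfolding J_def by metis
 then obtain R where R:"!!i j. i<n==>j<n==>R i j > 0"
 "!!i j y. i<n==>j<n==>y:box_at n x0 (R i j)==>\<bar>J i j y-J i j x0\<bar><e" by metis
 obtain r0 where r0:"r0 > 0" "box_at n x0 r0<=U" using U x0 unfolding openin_E_iff by blast
 define r where "r=Min (insert r0 ((%(i, j). R i j)`({..<n}\<times>{..<n})))"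
 have r:"r > 0" "r<=r0" using r0 R(1) by (auto simp: r_def)
 have rR:"r<=R i j" if "i<n" "j<n" for i j unfolding r_def by (rule Min_le) (use that in "auto simp: image_iff")
 have mono:"box_at n x0 r<=box_at n x0 s" if "r<=s" for s using that by (force simp: box_at_def)
 define V where "V=box_at n x0 r"
 have Vo:"openin (Euc n) V" by (simp add: V_def openin_box_at)
 have VU:"V<=U" using mono[OF r(2)] r0(2) V_def by blast
 have VE:"V<=E n" by (auto simp: V_def box_at_def)
 have x0V:"x0:V" using x0 openin_subset[OF U] r(1) by (auto simp: V_def box_at_def)
 have Je:"\<bar>J i j x-(if i=j then 1 else 0)\<bar><=e" if "i<n" "j<n" "x:V" for i j x
 proof -
 have "x:box_at n x0 (R i j)" using that(3) mono[OF rR[OF that(1,2)]] by (auto simp: V_def)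
 thus ?thesis using R(2)[OF that(1,2)] jac[OF that(1,2)] by (simp add: J_def less_imp_le)
 qed
 have near:"\<bar>(f y i-f x i)-(y i-x i)\<bar><=e*(SUM j<n. \<bar>y j-x j\<bar>)"
 if "x:V" "y:V" and i:"i<n" for x y i
 proof -
 define c where "c t=(%j. x j+t*(y j-x j))" for t
 have cV:"c t:V" if "t:{0..1}" for t
 using box_segment[of x n x0 r y t] that \<open>x \<in> V\<close> \<open>y \<in> V\<close> by (simp add: c_def V_def)
 have "x:E n" "y:E n" using \<open>x \<in> V\<close> \<open>y \<in> V\<close> VE by auto
 hence cE:"c t:E n" for t by (auto simp: c_def E_iff)
 have d:"((%t. f (c t) i-c t i) has_real_derivative
 (SUM j<n. J i j (c t)*(y j-x j))-(y i-x i)) (at t within {0..1})" if t:"t:{0..1}" for t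
 proof (rule has_field_derivative_at_within, rule DERIV_diff)
 show "((%t. f (c t) i) has_real_derivative (SUM j<n. J i j (c t)*(y j-x j))) (at t)"
 proof (rule chain_rule_curve[OF Vo])
 show "has_pd l (%x. f x i) x (J i l x)" if "l<n" "x:V" for l x
 unfolding J_def using that VU by (intro ck_real_has_pd[OF k U f[OF i]]) auto
 show "continuous_on V (J i l)" if "l<n" for l
 using ck_real_pd_cont[OF k U f[OF i] that] VU continuous_on_subset unfolding J_def by blast
 show "((%t. c t l) has_real_derivative y l-x l) (at t)" for l
 unfolding c_def by (auto intro!: derivative_eq_intros)
 qed (use cV[OF t] cE in auto)
 show "((%t. c t i) has_real_derivative y i-x i) (at t)"
 unfolding c_def by (auto intro!: derivative_eq_intros)
 qed
 have "norm ((f (c 1) i-c 1 i)-(f (c 0) i-c 0 i))<=(e*(SUM j<n. \<bar>y j-x j\<bar>)) * norm (1-(0::real))"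
 proof (rule field_differentiable_bound[OF _ d])
 fix t :: real assume t:"t:{0..1}"
 have "(SUM j<n. J i j (c t)*(y j-x j))-(y i-x i) =
 (SUM j<n. (J i j (c t)-(if i=j then 1 else 0))*(y j-x j))"
 using i by (simp add: left_diff_distrib sum_subtractf delta_sum)
 also have "norm ...<=(SUM j<n. e*\<bar>y j-x j\<bar>)"
 proof (rule sum_norm_le)
 fix j assume "j:{..<n}"
 hence "\<bar>J i j (c t)-(if i=j then 1 else 0)\<bar><=e" using Je[OF i] cV[OF t] by blast
 thus "norm ((J i j (c t)-(if i=j then 1 else 0))*(y j-x j))<=e*\<bar>y j-x j\<bar>"
 by (simp only: real_norm_def abs_mult) (rule mult_right_mono, auto)
 qed
 finally show "norm ((SUM j<n. J i j (c t)*(y j-x j))-(y i-x i))<=e*(SUM j<n. \<bar>y j-x j\<bar>)"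
 by (simp add: sum_distrib_left)
 qed auto
 moreover have "c 1=y" "c 0=x" by (auto simp: c_def)
 ultimately show ?thesis by (simp add: algebra_simps)
 qed
 have lip:"(SUM i<n. \<bar>y i-x i\<bar>)<=2*(SUM i<n. \<bar>f y i-f x i\<bar>)" if xy:"x:V" "y:V" for x y
 proof -
 have "(SUM i<n. \<bar>y i-x i\<bar>)<=(SUM i<n. \<bar>f y i-f x i\<bar>+e*(SUM j<n. \<bar>y j-x j\<bar>))"
 proof (rule sum_mono)
 fix i assume "i:{..<n}"
 thus "\<bar>y i-x i\<bar><=\<bar>f y i-f x i\<bar>+e*(SUM j<n. \<bar>y j-x j\<bar>)"
 using near[OF xy, of i] by fastforce
 qed
 also have "...=(SUM i<n. \<bar>f y i-f x i\<bar>)+(real n * e)*(SUM j<n. \<bar>y j-x j\<bar>)"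
 by (simp add: sum.distrib)
 also have "...<=(SUM i<n. \<bar>f y i-f x i\<bar>)+(1/2)*(SUM j<n. \<bar>y j-x j\<bar>)"
 using e(2) by (intro add_left_mono mult_right_mono) (auto intro: sum_nonneg)
 finally show ?thesis by simp
 qed
 have inj:"inj_on f V"
 proof (rule inj_onI)
 fix x y assume xy:"x:V" "y:V" "f x=f y"
 hence "(SUM i<n. \<bar>y i-x i\<bar>)<=0" using lip[OF xy(1,2)] by simp
 hence "(SUM i<n. \<bar>y i-x i\<bar>)=0" by (intro antisym) (auto intro: sum_nonneg)
 hence "y i=x i" if "i<n" for i using that by (simp add: sum_nonneg_eq_0_iff)
 thus "x=y" using xy VE by (intro E_eqI[of x n y]) auto
 qed
 have fcont:"continuous_on V f" by (rule continuous_into_E[where m = n])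
 (use ck_real_cont[OF U f] VU fE continuous_on_subset in blast)+
 have fo:"openin (Euc n) (f`V)"
 proof (rule invariance_of_domain_Euclidean_space[OF Vo _ inj])
 show "continuous_map (subtopology (Euc n) V) (Euc n) f"
 unfolding cm_Euclidean_space_iff_continuous_on using fcont fE VU VE by (auto simp: inf.absorb2)
 qed
 define g where "g=inv_into V f"
 have gf:"g (f x)=x" if "x:V" for x using inj that by (simp add: g_def)
 have ker0:"v j=0" if x:"x:V" and 0:"!!i. i<n==>(SUM j<n. pder j (%x. f x i) x * v j)=0" and "j<n"
 for x v j
 proof -
 have "(SUM i<n. \<bar>v i\<bar>)<=(SUM i<n. e*(SUM j<n. \<bar>v j\<bar>))"
 proof (rule sum_mono)
 fix i assume "i:{..<n}"
 hence i:"i<n" by simp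
 have "(SUM j<n. (J i j x-(if i=j then 1 else 0)) * v j) =-v i"
 using 0[OF i] i by (simp add: left_diff_distrib sum_subtractf delta_sum J_def)
 hence "\<bar>v i\<bar>=norm (SUM j<n. (J i j x-(if i=j then 1 else 0)) * v j)" by simp
 also have "...<=(SUM j<n. e*\<bar>v j\<bar>)"
 proof (rule sum_norm_le)
 fix j assume "j:{..<n}"
 hence "\<bar>J i j x-(if i=j then 1 else 0)\<bar><=e" using Je[OF i] x by blast
 thus "norm ((J i j x-(if i=j then 1 else 0)) * v j)<=e*\<bar>v j\<bar>"
 by (simp only: real_norm_def abs_mult) (rule mult_right_mono, auto)
 qed
 finally show "\<bar>v i\<bar><=e*(SUM j<n. \<bar>v j\<bar>)" by (simp add: sum_distrib_left)
 qed
 also have "...=(real n * e)*(SUM j<n. \<bar>v j\<bar>)" by simp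
 also have "...<=(1/2)*(SUM j<n. \<bar>v j\<bar>)" using e(2) by (intro mult_right_mono) (auto intro: sum_nonneg)
 finally have "(SUM i<n. \<bar>v i\<bar>)<=0" by simp
 hence "(SUM i<n. \<bar>v i\<bar>)=0" by (intro antisym) (auto intro: sum_nonneg)
 thus ?thesis using \<open>j < n\<close> by (simp add: sum_nonneg_eq_0_iff)
 qed
 have ker:"trivial_kernel n n (jac f x)" if "x:V" for x
 unfolding trivial_kernel_def jac_def using ker0[OF that] by blast
 have ckV:"ck_real k n V (%x. f x i)" if "i<n" for i using f[OF that] U Vo VU by (rule ck_real_subset)
 have "ck_real k n (f`V) (%y. g y i)" if i:"i<n" for i
 proof -
 have Suc:"ckf (Suc p) n (f`V) (%y. g y i)" if p:"enat (Suc p)<=k" for p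
 proof (rule ck_fin_inverse_function[OF Vo fo])
 show "ckf (Suc p) n V (%x. f x i)" if "i<n" for i using ckV[OF that] p unfolding ck_real_def by blast
 qed (use gf lip ker i in auto)
 show ?thesis unfolding ck_real_def
 proof (intro allI impI)
 fix j assume j:"enat j<=k"
 show "ckf j n (f`V) (%y. g y i)"
 proof (cases j)
 case 0
 have "enat (Suc 0)<=k" using k by (simp add: one_enat_def)
 thus ?thesis using Suc[of 0] ck_fin_SucD[OF fo] 0 by blast
 qed (use Suc j in auto)
 qed
 qed
 thus ?thesis using that[of V g] Vo x0V VU inj fo gf ker by blast
qed

section \<open>A smooth bump function\<close>

definition flat_exp :: "real=>real" where
 "flat_exp t=(if t > 0 then exp (- inverse t) else 0)"

lemma tendsto_poly_exp_0:"((%x. poly q x * exp (- x)) \<longlongrightarrow> (0::real)) at_top"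
proof (induction q)
 case (pCons a q)
 have "((%x. poly (pCons a q) x * exp (- x)) \<longlongrightarrow> 0) at_top"
 proof -
 have "poly (pCons a q) x * exp (- x)=(SUM i<=degree (pCons a q). Polynomial.coeff (pCons a q) i*(x^i/exp x))" for x :: real
 unfolding poly_altdef sum_distrib_right by (intro sum.cong refl) (simp add: exp_minus field_simps)
 moreover have "((%x::real. SUM i<=degree (pCons a q). Polynomial.coeff (pCons a q) i*(x^i/exp x)) \<longlongrightarrow>
 (SUM i<=degree (pCons a q). Polynomial.coeff (pCons a q) i*0)) at_top"
 by (intro tendsto_intros tendsto_power_div_exp_0)
 ultimately show ?thesis by simp
 qed
 thus ?case .
qed simp

text \<open>Every derivative of \<open>exp (- 1 / t)\<close> is a polynomial in \<open>1 / t\<close> times \<open>exp (- 1 / t)\<close>, and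
  the exponential beats the polynomial as \<open>t \<rightarrow> 0\<close>.\<close>

lemma smooth_real_flat_exp:"smooth_real flat_exp"
proof -
 define H where "H q t=(if t > 0 then poly q (inverse t) * exp (- inverse t) else 0)" for q :: "real poly" and t :: real
 define N where "N q=[:0, 0, 1:]*(q-pderiv q)" for q :: "real poly"
 have d:"(H q has_real_derivative H (N q) t) (at t)" for q t
 proof -
 consider "t > 0" | "t<0" | "t=0" by linarith
 thus ?thesis
 proof cases
 case 1
 have "((%t. poly q (inverse t) * exp (- inverse t)) has_real_derivative H (N q) t) (at t)"
 using 1 by (auto intro!: derivative_eq_intros poly_DERIV[THEN DERIV_chain2]
 simp: H_def N_def algebra_simps)
 moreover have "\<forall>\<^sub>F s in nhds t. H q s=poly q (inverse s) * exp (- inverse s)"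
 using eventually_nhds_in_open[of "{0<..}" t] 1 by (auto elim!: eventually_mono simp: H_def)
 ultimately show ?thesis by (subst DERIV_cong_ev[OF refl _ refl]) auto
 next
 case 2
 have "\<forall>\<^sub>F s in nhds t. H q s=0"
 using eventually_nhds_in_open[of "{..<0}" t] 2 by (auto elim!: eventually_mono simp: H_def)
 thus ?thesis using 2 by (subst DERIV_cong_ev[OF refl _ refl]) (auto simp: H_def)
 next
 case 3
 have "((%s. (H q s-H q 0)/(s-0)) \<longlongrightarrow> 0) (at 0)"
 proof (rule filterlim_split_at)
 have "((%x. poly (pCons 0 q) x * exp (- x)) \<longlongrightarrow> (0::real)) at_top" by (rule tendsto_poly_exp_0)
 hence "((%s. poly (pCons 0 q) (inverse s) * exp (- inverse s)) \<longlongrightarrow> (0::real)) (at_right 0)"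
 by (rule filterlim_compose[OF _ filterlim_inverse_at_top_right])
 moreover have "\<forall>\<^sub>F s in at_right 0. poly (pCons 0 q) (inverse s) * exp (- inverse s)=(H q s-H q 0)/(s-0)"
 unfolding eventually_at_filter by (rule always_eventually) (auto simp: H_def field_simps)
 ultimately show "((%s. (H q s-H q 0)/(s-0)) \<longlongrightarrow> 0) (at_right 0)" by (rule Lim_transform_eventually)
 have "\<forall>\<^sub>F s in at_left 0. 0=(H q s-H q 0)/(s-0)"
 unfolding eventually_at_filter by (rule always_eventually) (auto simp: H_def)
 thus "((%s. (H q s-H q 0)/(s-0)) \<longlongrightarrow> 0) (at_left 0)"
 by (rule Lim_transform_eventually[OF tendsto_const])
 qed
 thus ?thesis using 3 unfolding has_field_derivative_iff by (simp add: H_def)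
 qed
 qed
 have "H 1=flat_exp" by (auto simp: H_def flat_exp_def fun_eq_iff)
 thus ?thesis unfolding smooth_real_def by (intro exI[of _ "%n. H ((N ^^ n) 1)"]) (use d in auto)
qed

section \<open>Immersions have smooth left inverses\<close>

text \<open>The left inverse of an injective matrix \<open>J\<close> is \<open>(J\<^sup>T J)\<^sup>-\<^sup>1 J\<^sup>T\<close>.\<close>

lemma matrix_left_inverse:
 fixes J :: "nat=>nat=>real"
 assumes "trivial_kernel n d J"
 obtains L where "!!i j. i<d==>j<d==>(SUM l<n. L i l * J l j)=(if i=j then 1 else 0)"
proof -
 define a where "a i j=(SUM l<n. J l i * J l j)" for i j
 have "(SUM j<d. J i j * v j)=0" if 0:"!!i. i<d==>(SUM j<d. a i j * v j)=0" and i:"i<n" for v i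
 proof -
 have "(SUM l<n. (SUM j<d. J l j * v j)\<^sup>2)=(SUM l<n. SUM i<d. SUM j<d. v i*(J l i * J l j * v j))"
 by (intro sum.cong refl) (simp add: power2_eq_square sum_product algebra_simps)
 also have "...=(SUM i<d. SUM j<d. SUM l<n. v i*(J l i * J l j * v j))"
 by (subst sum.swap) (intro sum.cong refl sum.swap)
 also have "...=(SUM i<d. v i*(SUM j<d. a i j * v j))"
 by (simp add: a_def sum_distrib_left sum_distrib_right)
 also have "...=0" using 0 by simp
 finally have "ALL l:{..<n}. (SUM j<d. J l j * v j)\<^sup>2=0" by (subst (asm) sum_nonneg_eq_0_iff) auto
 thus "(SUM j<d. J i j * v j)=0" using i by simp
 qed
 hence ker:"trivial_kernel d d a" using assms unfolding trivial_kernel_def by blast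
 define L where "L i l=(SUM p<d. inv_entry d a i p * J l p)" for i l
 have "(SUM l<n. L i l * J l j)=(if i=j then 1 else 0)" if ij:"i<d" "j<d" for i j
 proof -
 have "(SUM l<n. L i l * J l j)=(SUM l<n. SUM p<d. inv_entry d a i p*(J l p * J l j))"
 by (simp add: L_def sum_distrib_right mult.assoc)
 also have "...=(SUM p<d. SUM l<n. inv_entry d a i p*(J l p * J l j))" by (rule sum.swap)
 also have "...=(SUM p<d. inv_entry d a i p * a p j)" by (simp add: a_def sum_distrib_left)
 also have "...=(if i=j then 1 else 0)" by (rule inv_entry(1)[OF ker ij])
 finally show ?thesis .
 qed
 thus ?thesis using that by blast
qed

definition lin_app :: "nat=>nat=>(nat=>nat=>real)=>(nat=>real)=>nat=>real" where
 "lin_app d n L y=(%i. if i<d then SUM l<n. L i l * y l else 0)"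

lemma lin_app_E:"lin_app d n L y:E d" by (simp add: lin_app_def E_iff)

lemma ck_real_lin:
 "openin (Euc m) U==>(!!l. l<n==>ck_real k m U (%x. f x l))==>ck_real k m U (%x. lin_app d n L (f x) i)"
 unfolding lin_app_def by (cases "i<d") (auto intro!: ck_real_sum ck_real_mult ck_real_const)

lemma has_pd_sum_mult:
 assumes "!!l. l<n==>has_pd i (%x. f x l) x (d l)"
 shows "has_pd i (%x. SUM l<n. L l * f x l) x (SUM l<n. L l * d l)" unfolding has_pd_def
 by (rule DERIV_sum, rule DERIV_cmult) (use assms in "auto simp: has_pd_def")

text \<open>Apply the inverse function theorem to \<open>L \<circ> f\<close>, where \<open>L\<close> is a linear left inverse of the derivative at \<open>x0\<close>.\<close>

lemma immersion_left_inverse: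
 assumes k:"k\<ge>1" and U:"openin (Euc d) U"
 and f:"!!i. i<n==>ck_real k d U (%x. f x i)" and fE:"!!x. x:U==>f x:E n"
 and x0:"x0:U"
 and inj:"trivial_kernel n d (jac f x0)"
 obtains V N r where "openin (Euc d) V" "x0:V" "V<=U"
 "openin (Euc n) N" "!!x. x:V==>f x:N&r (f x)=x"
 "!!i. i<d==>ck_real k n N (%y. r y i)"
 "!!x. x:V==>trivial_kernel n d (jac f x)"
proof -
 define J where "J=jac f x0"
 obtain L where L:"!!i j. i<d==>j<d==>(SUM l<n. L i l * J l j)=(if i=j then 1 else 0)"
 using matrix_left_inverse[OF inj] unfolding J_def by blast
 define h where "h x=lin_app d n L (f x)" for x
 have hck:"ck_real k d U (%x. h x i)" for i unfolding h_def by (rule ck_real_lin[OF U f])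
 have hpd:"jac h x i j=(SUM l<n. L i l * jac f x l j)"
 if "i<d" "j<d" "x:U" for i j x
 proof -
 have "has_pd j (%x. SUM l<n. L i l * f x l) x (SUM l<n. L i l * pder j (%x. f x l) x)"
 by (rule has_pd_sum_mult) (rule ck_real_has_pd[OF k U f that(2,3)])
 thus ?thesis using that(1) unfolding h_def lin_app_def jac_def by (auto intro: has_pd_imp)
 qed
 obtain V g where V:"openin (Euc d) V" "x0:V" "V<=U" "inj_on h V"
 "openin (Euc d) (h`V)" "!!x. x:V==>g (h x)=x"
 "!!i. i<d==>ck_real k d (h`V) (%y. g y i)"
 "!!x. x:V==>trivial_kernel d d (jac h x)"
 proof -
 have 1:"h x:E d" for x by (simp add: h_def lin_app_E)
 have 2:"pder j (%x. h x i) x0=(if i=j then 1 else 0)" if "i<d" "j<d" for i j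
 using hpd[OF that x0] L[OF that] by (simp add: J_def jac_def)
 show ?thesis by (rule inverse_function[OF k U hck 1 x0 2]) (assumption+, rule that)
 qed
 define N where "N={y:E n. lin_app d n L y:h`V}"
 have oE:"openin (Euc n) (E n)" by simp
 have lc:"ck_real 0 n (E n) (%y. lin_app d n L y i)" "ck_real k n (E n) (%y. lin_app d n L y i)" for i
 using ck_real_lin[OF oE, of n 0 "%y. y"] ck_real_lin[OF oE, of n k "%y. y"] ck_real_coord[OF oE] by auto
 have "continuous_on (E n) (lin_app d n L)" by (rule continuous_into_E[OF ck_real_cont[OF oE lc(1)] lin_app_E])
 hence "continuous_map (Euc n) (Euc d) (lin_app d n L)"
 using cm_Euclidean_space_iff_continuous_on[of n "E n" d "lin_app d n L"] lin_app_E by auto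
 hence N:"openin (Euc n) N" unfolding N_def using V(5) openin_continuous_map_preimage by blast
 show ?thesis
 proof (rule that[OF V(1-3) N, of "%y. g (lin_app d n L y)"])
 show "f x:N&g (lin_app d n L (f x))=x" if "x:V" for x
 using that V(3) fE V(6) by (auto simp: N_def h_def)
 show "ck_real k n N (%y. g (lin_app d n L y) i)" if "i<d" for i
 by (rule ck_real_comp[OF N V(5), of "lin_app d n L"])
 (use V(7)[OF that] ck_real_subset[OF lc(2) oE N] in "auto simp: N_def")
 have "(SUM j<d. jac h x i j * v j)=0"
 if x:"x:V" and 0:"ALL i<n. (SUM j<d. jac f x i j * v j)=0" and i:"i<d" for x v i
 proof -
 have "(SUM j<d. jac h x i j * v j)=(SUM j<d. SUM l<n. L i l * jac f x l j * v j)"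
 using x V(3) by (intro sum.cong refl) (auto simp: hpd[OF i] sum_distrib_right)
 also have "...=(SUM l<n. L i l*(SUM j<d. jac f x l j * v j))"
 by (subst sum.swap) (simp add: sum_distrib_left mult.assoc)
 also have "...=0" using 0 by simp
 finally show ?thesis .
 qed
 thus "trivial_kernel n d (jac f x)" if "x:V" for x
 using that V(8)[OF that] unfolding trivial_kernel_def by blast
 qed
qed

section \<open>Functions on manifolds\<close>

definition charted :: "'a mfd=>bool" where
 "charted M\<longleftrightarrow>(\<forall>c\<in>atlas_of M. is_chart (space_of M) c)&(\<Union>c\<in>atlas_of M. cdom c)=points M"

lemma charted_chart:"charted M==>c:atlas_of M==>is_chart (space_of M) c"
 by (simp add: charted_def)

lemma charted_cover:"charted M==>x:points M==>EX c:atlas_of M. x:cdom c"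
 unfolding charted_def by blast

lemma chart_dom_subset:"is_chart X c==>cdom c<=topspace X"
 unfolding is_chart_def using openin_subset by blast

lemma chart_bij:"is_chart X c==>inj_on (cmap c) (cdom c)"
 unfolding is_chart_def homeomorphic_eq_everything_map
 by (metis chart_dom_subset inf.absorb2 is_chart_def homeomorphic_eq_everything_map topspace_subtopology)

lemma chart_inv_map:"is_chart X c==>x:cdom c==>cinv c (cmap c x)=x"
 unfolding chart_inv_def by (simp add: chart_bij)

lemma chart_map_inv:"v:cmap c`cdom c==>cmap c (cinv c v)=v"
 unfolding chart_inv_def by (simp add: f_inv_into_f)

lemma chart_inv_dom:"v:cmap c`cdom c==>cinv c v:cdom c"
 unfolding chart_inv_def by (simp add: inv_into_into)

lemma chart_img_open:"is_chart X c ==> openin (Euc (cdim c)) (cmap c`cdom c)" by (simp add: is_chart_def)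

lemma chart_map_E:"is_chart X c==>x:cdom c==>cmap c x:E (cdim c)"
 using openin_subset[OF chart_img_open] by blast

lemma chart_open_image:
 assumes "is_chart X c" "openin X (topspace X\<inter>S)"
 shows "openin (Euc (cdim c)) (cmap c`(cdom c\<inter>S))"
proof -
 let ?D = "subtopology X (cdom c)" and ?R = "subtopology (Euc (cdim c)) (cmap c`cdom c)"
 have h:"homeomorphic_map ?D ?R (cmap c)" using assms(1) by (simp add: is_chart_def)
 have "openin ?D (cdom c\<inter>S)"
 unfolding openin_subtopology using assms chart_dom_subset[OF assms(1)] by (intro exI[of _ "topspace X\<inter>S"]) auto
 hence "openin ?R (cmap c`(cdom c\<inter>S))" using h homeomorphic_imp_open_map unfolding open_map_def by blast
 thus ?thesis using chart_img_open[OF assms(1)] openin_trans_full by blast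
qed

lemma chart_open_preimage:
 assumes "is_chart X c" "openin (Euc (cdim c)) W"
 shows "openin X {x:cdom c. cmap c x:W}"
proof -
 let ?D = "subtopology X (cdom c)" and ?R = "subtopology (Euc (cdim c)) (cmap c`cdom c)"
 have "continuous_map ?D ?R (cmap c)" using assms(1) homeomorphic_imp_continuous_map by (auto simp: is_chart_def)
 hence "continuous_map ?D (Euc (cdim c)) (cmap c)" using continuous_map_in_subtopology by blast
 from openin_continuous_map_preimage[OF this assms(2)]
 have "openin ?D {x:cdom c. cmap c x:W}"
 using chart_dom_subset[OF assms(1)] by (simp add: inf.absorb2 Collect_conj_eq[symmetric] topspace_subtopology)
 thus ?thesis using assms(1) openin_trans_full unfolding is_chart_def by blast
qed

text \<open>Class \<open>C\<^sup>k\<close> of a real function on an open set \<open>V\<close>, read in the charts of the atlas. The functions need not be restricted to \<open>V\<close>.\<close>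

definition ck_on :: "enat=>'a mfd=>'a set=>('a=>real)=>bool" where
 "ck_on k M V f\<longleftrightarrow>(ALL c:atlas_of M. ck_real k (cdim c) (cmap c`(cdom c\<inter>V)) (%v. f (cinv c v)))"

abbreviation "opn M V \<equiv> openin (space_of M) (points M\<inter>V)"

lemma ck_map_iff:
 "ck_map k M N f\<longleftrightarrow>continuous_map (space_of M) (space_of N) f &
 (ALL e:atlas_of N. ALL i<cdim e. ck_on k M (f -` cdom e) (%x. cmap e (f x) i))"
 unfolding ck_map_def ck_on_def ck_vec_def o_def by blast

context
 fixes M :: "'a mfd" and V :: "'a set"
 assumes M:"charted M" and V:"opn M V"
begin

lemma ck_on_img_open:"c:atlas_of M ==> openin (Euc (cdim c)) (cmap c`(cdom c\<inter>V))"
 using chart_open_image[OF charted_chart[OF M]] V by blast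

lemma ck_on_cong:"(!!x. x:points M==>x:V==>f x=g x)==>ck_on k M V f\<longleftrightarrow>ck_on k M V g"
 unfolding ck_on_def
proof (intro ball_cong refl ck_real_cong ck_on_img_open)
 fix c v assume a:"!!x. x:points M==>x:V==>f x=g x" "c:atlas_of M" "v:cmap c`(cdom c\<inter>V)"
 then obtain x where x:"x:cdom c" "x:V" "v=cmap c x" by blast
 hence "cinv c v=x" "x:points M"
 using chart_inv_map[OF charted_chart[OF M a(2)] x(1)] chart_dom_subset[OF charted_chart[OF M a(2)]] by auto
 thus "f (cinv c v)=g (cinv c v)" using a(1) x(2) by simp
qed

lemma ck_on_const:"ck_on k M V (%_. c)"
 and ck_on_add:"ck_on k M V f==>ck_on k M V g==>ck_on k M V (%x. f x+g x)"
 and ck_on_diff:"ck_on k M V f==>ck_on k M V g==>ck_on k M V (%x. f x-g x)"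
 and ck_on_mult:"ck_on k M V f==>ck_on k M V g==>ck_on k M V (%x. f x * g x)"
 and ck_on_smooth:"smooth_real h==>ck_on k M V f==>ck_on k M V (%x. h (f x))"
 and ck_on_sum:"(!!l. l:S==>ck_on k M V (F l))==>ck_on k M V (%x. SUM l:S. F l x)"
proof -
 note o = ck_on_img_open and d = ck_on_def
 show "ck_on k M V (%_. c)" unfolding d by (rule ballI, rule ck_real_const, rule o)
 show "ck_on k M V f==>ck_on k M V g==>ck_on k M V (%x. f x+g x)"
 unfolding d by (rule ballI, rule ck_real_add, rule o) auto
 show "ck_on k M V f==>ck_on k M V g==>ck_on k M V (%x. f x-g x)"
 unfolding d by (rule ballI, rule ck_real_diff, rule o) auto
 show "ck_on k M V f==>ck_on k M V g==>ck_on k M V (%x. f x * g x)"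
 unfolding d by (rule ballI, rule ck_real_mult, rule o) auto
 show "smooth_real h==>ck_on k M V f==>ck_on k M V (%x. h (f x))"
 unfolding d by (rule ballI, rule ck_real_smooth[where h = h], rule o) auto
 show "(!!l. l:S==>ck_on k M V (F l))==>ck_on k M V (%x. SUM l:S. F l x)"
 unfolding d by (rule ballI, rule ck_real_sum, rule o) auto
qed

lemma ck_on_local:
 assumes "!!x. x:points M==>x:V==>EX W. opn M W&x:W&ck_on k M W f"
 shows "ck_on k M V f" unfolding ck_on_def
proof (intro ballI ck_real_local ck_on_img_open)
 fix c v assume c:"c:atlas_of M" "v:cmap c`(cdom c\<inter>V)"
 then obtain x where x:"x:cdom c" "x:V" "v=cmap c x" by blast
 hence "x:points M" using charted_chart[OF M c(1)] chart_dom_subset by blast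
 then obtain W where W:"opn M W" "x:W" "ck_on k M W f" using assms x by blast
 have o:"openin (Euc (cdim c)) (cmap c`(cdom c\<inter>(V\<inter>W)))"
 proof (rule chart_open_image[OF charted_chart[OF M c(1)]])
 have "points M\<inter>(V\<inter>W)=(points M\<inter>V)\<inter>(points M\<inter>W)" by auto
 thus "opn M (V\<inter>W)" using openin_Int[OF V W(1)] by simp
 qed
 have o2:"openin (Euc (cdim c)) (cmap c`(cdom c\<inter>W))"
 by (rule chart_open_image[OF charted_chart[OF M c(1)] W(1)])
 have "ck_real k (cdim c) (cmap c`(cdom c\<inter>(V\<inter>W))) (%v. f (cinv c v))"
 by (rule ck_real_subset[OF _ o2 o]) (use W(3) c(1) in "auto simp: ck_on_def")
 moreover have "v:cmap c`(cdom c\<inter>(V\<inter>W))" using x W(2) by blast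
 moreover have "cmap c`(cdom c\<inter>(V\<inter>W))<=cmap c`(cdom c\<inter>V)" by blast
 ultimately show "EX Va. openin (Euc (cdim c)) Va&v:Va&Va<=cmap c`(cdom c\<inter>V) &
 ck_real k (cdim c) Va (%v. f (cinv c v))" using o by blast
qed

lemma ck_on_cont:
 assumes "ck_on k M V f" "V<=points M"
 shows "continuous_map (subtopology (space_of M) V) euclideanreal f"
proof -
 have "openin (space_of M) {x:V. f x:T}" if T:"open T" for T
 proof (subst openin_subopen, intro ballI)
 fix x assume x:"x:{x:V. f x:T}"
 then obtain c where c:"c:atlas_of M" "x:cdom c" using charted_cover[OF M] assms(2) by blast
 note cc = charted_chart[OF M c(1)]
 have "continuous_on (cmap c`(cdom c\<inter>V)) (%v. f (cinv c v))"
 using ck_real_cont[OF ck_on_img_open[OF c(1)]] assms(1) c(1) unfolding ck_on_def by blast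
 from openin_E_cont_preimage[OF ck_on_img_open[OF c(1)] this T]
 have "openin (space_of M) {y:cdom c. cmap c y:{v:cmap c`(cdom c\<inter>V). f (cinv c v):T}}" (is "openin _ ?W")
 by (rule chart_open_preimage[OF cc])
 moreover have "?W<={x:V. f x:T}" "x:?W"
 using c(2) x chart_inv_map[OF cc] chart_bij[OF cc] by (auto simp: inj_on_def)
 ultimately show "EX W. openin (space_of M) W&x:W&W<={x:V. f x:T}" by blast
 qed
 moreover have "{x:topspace (subtopology (space_of M) V). f x:T}={x:V. f x:T}\<inter>V" for T
 using assms(2) by auto
 ultimately show ?thesis unfolding continuous_map_def openin_subtopology by auto
qed

end

lemma ck_on_set:
 assumes "charted M" "points M\<inter>V=points M\<inter>W"
 shows "ck_on k M V f\<longleftrightarrow>ck_on k M W f"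
proof -
 have "cdom c\<inter>V=cdom c\<inter>W" if "c:atlas_of M" for c
 using chart_dom_subset[OF charted_chart[OF assms(1) that]] assms(2) by blast
 thus ?thesis unfolding ck_on_def by simp
qed

lemma ck_on_subset:
 assumes "charted M" "opn M V" "opn M W" "W<=V" "ck_on k M V f"
 shows "ck_on k M W f" unfolding ck_on_def
proof
 fix c assume c:"c:atlas_of M"
 show "ck_real k (cdim c) (cmap c`(cdom c\<inter>W)) (%v. f (cinv c v))"
 by (rule ck_real_subset[OF _ ck_on_img_open[OF assms(1,2) c] ck_on_img_open[OF assms(1,3) c]])
 (use assms c in "auto simp: ck_on_def")
qed

lemma opn_vimage:
 assumes "continuous_map (space_of M) (space_of N) f" "opn N V"
 shows "opn M (f -` V)"
proof -
 have "openin (space_of M) {x:points M. f x:points N\<inter>V}"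
 using openin_continuous_map_preimage[OF assms] .
 moreover have "{x:points M. f x:points N\<inter>V}=points M\<inter>f -` V"
 using continuous_map_image_subset_topspace[OF assms(1)] by blast
 ultimately show ?thesis by simp
qed

lemma opn_Int:"opn M V ==> opn M W ==> opn M (V\<inter>W)"
proof -
 assume "opn M V" "opn M W"
 hence "openin (space_of M) ((points M\<inter>V)\<inter>(points M\<inter>W))" by (rule openin_Int)
 moreover have "(points M\<inter>V)\<inter>(points M\<inter>W)=points M\<inter>(V\<inter>W)" by blast
 ultimately show ?thesis by simp
qed

lemma opn_openin:"openin (space_of M) V ==> opn M V" by (simp add: openin_Int)

lemma opn_dom:"charted M==>c:atlas_of M ==> opn M (cdom c)"
 by (rule opn_openin) (use charted_chart in "auto simp: is_chart_def")

lemma ck_on_coord: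
 "ck_map k M N f==>e:atlas_of N==>i<cdim e==>ck_on k M (f -` cdom e) (%x. cmap e (f x) i)"
 by (simp add: ck_map_iff)

lemma ck_map_cont:"ck_map k M N f==>continuous_map (space_of M) (space_of N) f" by (simp add: ck_map_iff)

lemma ck_map_points:"ck_map k M N f==>x:points M==>f x:points N"
 by (meson ck_map_cont continuous_map_image_subset_topspace image_subset_iff)

lemma ck_on_comp:
 assumes M:"charted M" and N:"charted N" and f:"ck_map k M N f" and V:"opn N V" and g:"ck_on k N V g"
 shows "ck_on k M (f -` V) (%x. g (f x))"
proof (rule ck_on_local[OF M opn_vimage[OF ck_map_cont[OF f] V]])
 fix x assume x:"x:points M" "x:f -` V"
 obtain e where e:"e:atlas_of N" "f x:cdom e" using charted_cover[OF N ck_map_points[OF f x(1)]] by blast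
 note ec = charted_chart[OF N e(1)]
 define W where "W=f -` (cdom e\<inter>V)"
 have oV:"opn N (cdom e\<inter>V)" using opn_Int[OF opn_dom[OF N e(1)] V] .
 have W:"opn M W" unfolding W_def by (rule opn_vimage[OF ck_map_cont[OF f] oV])
 have oe:"opn M (f -` cdom e)" by (rule opn_vimage[OF ck_map_cont[OF f] opn_dom[OF N e(1)]])
 have "ck_on k M W (%x. g (f x))" unfolding ck_on_def
 proof
 fix c assume c:"c:atlas_of M"
 note cc = charted_chart[OF M c]
 let ?S = "cmap c`(cdom c\<inter>W)" and ?T = "cmap e`(cdom e\<inter>V)"
 have S:"openin (Euc (cdim c)) ?S" by (rule ck_on_img_open[OF M W c])
 have T:"openin (Euc (cdim e)) ?T" by (rule ck_on_img_open[OF N V e(1)])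
 have inv:"cinv c v:W" if "v:?S" for v using that chart_inv_map[OF cc] by auto
 have "ck_real k (cdim c) ?S (%v. g (cinv e (cmap e (f (cinv c v)))))"
 proof (rule ck_real_comp[OF S T, where f = "%v. cmap e (f (cinv c v))" and g = "%u. g (cinv e u)"])
 show "cmap e (f (cinv c v)):?T" if "v:?S" for v using inv[OF that] by (auto simp: W_def)
 show "ck_real k (cdim e) ?T (%u. g (cinv e u))" using g e(1) by (simp add: ck_on_def)
 show "ck_real k (cdim c) ?S (%v. cmap e (f (cinv c v)) i)" if "i<cdim e" for i
 using ck_on_subset[OF M oe W _ ck_on_coord[OF f e(1) that]] c by (auto simp: ck_on_def W_def)
 qed
 moreover have "g (cinv e (cmap e (f (cinv c v))))=g (f (cinv c v))" if "v:?S" for v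
 using inv[OF that] chart_inv_map[OF ec] by (simp add: W_def)
 ultimately show "ck_real k (cdim c) ?S (%v. g (f (cinv c v)))" by (rule ck_real_eq[OF _ S])
 qed
 thus "EX W. opn M W&x:W&ck_on k M W (%x. g (f x))"
 using W e(2) x(2) by (intro exI[of _ W]) (auto simp: W_def)
qed

lemma ck_map_comp:
 assumes M:"charted M" and N:"charted N" and R:"charted R"
 and f:"ck_map k M N f" and g:"ck_map k N R g"
 shows "ck_map k M R (%x. g (f x))" unfolding ck_map_iff
proof (intro conjI ballI allI impI)
 show "continuous_map (space_of M) (space_of R) (%x. g (f x))"
 using continuous_map_compose[OF ck_map_cont[OF f] ck_map_cont[OF g]] by (simp add: o_def)
 fix e i assume e:"e:atlas_of R" "i<cdim e"
 have "ck_on k M (f -` (g -` cdom e)) (%x. cmap e (g (f x)) i)"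
 by (rule ck_on_comp[OF M N f _ ck_on_coord[OF g e]]) (rule opn_vimage[OF ck_map_cont[OF g] opn_dom[OF R e(1)]])
 thus "ck_on k M ((%x. g (f x)) -` cdom e) (%x. cmap e (g (f x)) i)" by (simp add: vimage_def)
qed

lemma ck_map_id:"ck_manifold k M==>ck_map k M M (%x. x)"
 unfolding ck_map_def ck_manifold_def ck_transition_def o_def by (auto simp: vimage_def)

lemma ck_manifold_charted:"ck_manifold k M==>charted M" unfolding ck_manifold_def charted_def by blast

lemma is_chartI:
 assumes "openin X (cdom c)" "openin (Euc (cdim c)) W"
 "!!x. x:cdom c==>cmap c x:W&g (cmap c x)=x"
 "!!v. v:W==>g v:cdom c&cmap c (g v)=v"
 "continuous_map (subtopology X (cdom c)) (Euc (cdim c)) (cmap c)"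
 "continuous_map (subtopology (Euc (cdim c)) W) X g"
 shows "is_chart X c" "cmap c`cdom c=W"
proof -
 show W:"cmap c`cdom c=W" using assms(3,4) by force
 have s:"topspace X\<inter>cdom c=cdom c" "E (cdim c)\<inter>W=W"
 using openin_subset[OF assms(1)] openin_subset[OF assms(2)] by auto
 have "homeomorphic_maps (subtopology X (cdom c)) (subtopology (Euc (cdim c)) W) (cmap c) g"
 unfolding homeomorphic_maps_def continuous_map_in_subtopology using assms(3-6) s by auto
 thus "is_chart X c" unfolding is_chart_def W using assms(1,2) homeomorphic_maps_map by blast
qed

lemma chart_cont:
 "is_chart X c==>continuous_map (subtopology X (cdom c)) (Euc (cdim c)) (cmap c)"
 unfolding is_chart_def using homeomorphic_imp_continuous_map continuous_map_in_subtopology by blast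

lemma chart_inv_cont:
 assumes "is_chart X c"
 shows "continuous_map (subtopology (Euc (cdim c)) (cmap c`cdom c)) X (cinv c)"
proof -
 let ?D = "subtopology X (cdom c)" and ?R = "subtopology (Euc (cdim c)) (cmap c`cdom c)"
 obtain g where g:"homeomorphic_maps ?D ?R (cmap c) g"
 using assms unfolding is_chart_def homeomorphic_map_maps by blast
 have "continuous_map ?R ?D g" using g by (simp add: homeomorphic_maps_def)
 hence "continuous_map ?R X g" using continuous_map_in_subtopology by blast
 moreover have "g v=cinv c v" if "v:topspace ?R" for v
 proof -
 have v:"v:cmap c`cdom c" using that by simp
 have "g (cmap c (cinv c v))=cinv c v"
 using g chart_inv_dom[OF v] chart_dom_subset[OF assms] by (auto simp: homeomorphic_maps_def)
 thus ?thesis by (simp add: chart_map_inv[OF v])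
 qed
 ultimately show ?thesis by (rule continuous_map_eq)
qed

subsection \<open>Euclidean space\<close>

lemma charted_euclidean [simp]:"charted (euclidean_mfd n)"
proof -
 have "is_chart (Euc n) \<lparr>chart_dom=E n, chart_dim=n, chart_map=(%v. v)\<rparr>"
 by (rule is_chartI(1)[where W = "E n" and g = "%v. v"]) (auto intro: continuous_map_from_subtopology)
 thus ?thesis by (simp add: charted_def euclidean_mfd_def)
qed

lemma points_euclidean [simp]:"points (euclidean_mfd n)=E n" by (simp add: euclidean_mfd_def)

lemma space_euclidean [simp]:"space_of (euclidean_mfd n)=Euc n" by (simp add: euclidean_mfd_def)

lemma ck_on_euclidean:
 assumes "openin (Euc n) V"
 shows "ck_on k (euclidean_mfd n) V f\<longleftrightarrow>ck_real k n V f"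
proof -
 have V:"E n\<inter>V=V" using openin_subset[OF assms] by auto
 have i:"inv_into (E n) (%v. v) v=v" if "v:V" for v
 proof -
 have "v:(%v. v)`E n" using that V by auto
 from f_inv_into_f[OF this] show ?thesis .
 qed
 have "ck_real k n V (%v. f (inv_into (E n) (%v. v) v))\<longleftrightarrow>ck_real k n V f"
 by (rule ck_real_cong[OF assms]) (simp add: i)
 thus ?thesis by (simp add: ck_on_def euclidean_mfd_def V chart_inv_def)
qed

lemma ck_map_euclidean:
 assumes M:"charted M"
 shows "ck_map k M (euclidean_mfd n) F\<longleftrightarrow>(ALL x:points M. F x:E n)&(ALL i<n. ck_on k M UNIV (%x. F x i))"
 (is "?L\<longleftrightarrow>?R")
proof -
 have *: "ck_on k M (F -` E n) (%x. F x i)\<longleftrightarrow>ck_on k M UNIV (%x. F x i)" if "ALL x:points M. F x:E n" for i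
 by (rule ck_on_set[OF M]) (use that in auto)
 have at:"atlas_of (euclidean_mfd n)={\<lparr>chart_dom=E n, chart_dim=n, chart_map=(%v. v)\<rparr>}"
 by (simp add: euclidean_mfd_def)
 have oU:"opn M UNIV" by simp
 have "?L" if r: ?R
 proof -
 have "continuous_map (space_of M) euclideanreal (%x. F x i)" if "i<n" for i
 proof -
 have "ck_on k M (points M) (%x. F x i)" using r that ck_on_set[OF M, of UNIV "points M"] by simp
 from ck_on_cont[OF M _ this] show ?thesis by simp
 qed
 hence "continuous_map (space_of M) (Euc n) (%x i. if i<n then F x i else 0)"
 by (simp add: continuous_map_componentwise_Euclidean_space)
 hence "continuous_map (space_of M) (Euc n) F" by (rule continuous_map_eq) (use r in "auto simp: E_iff fun_eq_iff")
 thus ?L unfolding ck_map_iff using r * by (simp add: at)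
 qed
 moreover have ?R if l: ?L
 proof -
 have "ALL x:points M. F x:E n" using ck_map_points[OF l] by simp
 thus ?R using l * unfolding ck_map_iff by (simp add: at)
 qed
 ultimately show ?thesis by blast
qed

subsection \<open>The real line\<close>

lemma charted_real [simp]:"charted real_mfd"
proof -
 have "is_chart euclideanreal \<lparr>chart_dom=UNIV, chart_dim=1, chart_map=(%t i. if i=0 then t else 0)\<rparr>"
 proof (rule is_chartI(1)[where W = "E 1" and g = "%v. v 0"])
 have "continuous_map euclideanreal (Euc 1) (%t i. if i<1 then t else 0)"
 unfolding continuous_map_componentwise_Euclidean_space by simp
 thus "continuous_map
 (subtopology euclideanreal (cdom \<lparr>chart_dom=UNIV, chart_dim=1, chart_map=%t i. if i=0 then t else 0\<rparr>))
 (Euc (cdim \<lparr>chart_dom=UNIV, chart_dim=1, chart_map=%t i. if i=0 then t else 0\<rparr>))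
 (cmap \<lparr>chart_dom=UNIV, chart_dim=1, chart_map=%t i. if i=0 then t else 0\<rparr>)" by simp
 show "continuous_map
 (subtopology (Euc (cdim \<lparr>chart_dom=UNIV, chart_dim=1, chart_map=%t i. if i=0 then t else 0\<rparr>)) (E 1))
 euclideanreal (%v. v 0)" using cont_iff[of 1 "E 1" "%v. v 0"] continuous_coord[of "E 1" 0] by simp
 qed (auto simp: E_iff fun_eq_iff)
 thus ?thesis by (simp add: charted_def real_mfd_def)
qed

lemma points_real [simp]:"points real_mfd=UNIV" and space_real [simp]:"space_of real_mfd=euclideanreal"
 by (simp_all add: real_mfd_def)

lemma chart_inv_real:"v:E 1==>cinv \<lparr>chart_dom=UNIV, chart_dim=1, chart_map=(%t i. if i=0 then t else 0)\<rparr> v=v 0"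
proof -
 assume v:"v:E 1"
 let ?c = "\<lparr>chart_dom=UNIV, chart_dim=1, chart_map=(%(t::real) (i::nat). if i=0 then t else 0)\<rparr>"
 have "is_chart (space_of real_mfd) ?c" by (rule charted_chart[OF charted_real]) (simp add: real_mfd_def)
 from chart_inv_map[OF this, of "v 0"] have "cinv ?c (%i. if i=0 then v 0 else 0)=v 0" by simp
 moreover have "(%i. if i=0 then v 0 else 0)=v" using v by (auto simp: E_iff fun_eq_iff)
 ultimately show ?thesis by simp
qed

lemma ck_on_real_smooth:
 assumes "smooth_real h"
 shows "ck_on k real_mfd UNIV h"
proof -
 have "(%(t::real) (i::nat). if i=0 then t else 0)`UNIV=E 1"
 by (auto simp: E_iff fun_eq_iff image_iff intro!: exI[of _ "_ 0"])
 moreover have "ck_real k 1 (E 1) (%v. h (v 0))"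
 by (intro ck_real_smooth[where h = h] assms ck_real_coord) auto
 hence "ck_real k 1 (E 1) (%v. h (cinv \<lparr>chart_dom=UNIV, chart_dim=1, chart_map=(%t i. if i=0 then t else 0)\<rparr> v))"
 by (subst ck_real_cong[where g = "%v. h (v 0)"]) (auto simp: chart_inv_real simp del: One_nat_def)
 ultimately show ?thesis by (simp add: ck_on_def real_mfd_def)
qed

subsection \<open>Products\<close>

definition join :: "nat=>(nat=>real)=>(nat=>real)=>nat=>real" where
 "join m u w=(%i. if i<m then u i else w (i-m))"

definition fst_part :: "nat=>(nat=>real)=>nat=>real" where
 "fst_part m v=(%i. if i<m then v i else 0)"

definition snd_part :: "nat=>(nat=>real)=>nat=>real" where
 "snd_part m v=(%i. v (i+m))"

lemma join_E:"w:E n==>join m u w:E (m+n)" by (auto simp: join_def E_iff)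
lemma fst_part_E:"fst_part m v:E m" by (simp add: fst_part_def E_iff)
lemma fst_part_join:"u:E m==>fst_part m (join m u w)=u"
 by (auto simp: fst_part_def join_def E_iff fun_eq_iff)
lemma snd_part_join:"snd_part m (join m u w)=w" by (auto simp: snd_part_def join_def)
lemma join_parts:"join m (fst_part m v) (snd_part m v)=v" by (auto simp: fst_part_def snd_part_def join_def fun_eq_iff)

lemma continuous_fst_part:"continuous_map (Euc (m+n)) (Euc m) (fst_part m)"
 unfolding fst_part_def continuous_map_componentwise_Euclidean_space
 using cont_iff[of "m+n" "E (m+n)"] continuous_coord by auto

lemma continuous_snd_part:"continuous_map (Euc (m+n)) (Euc n) (snd_part m)"
proof -
 have "continuous_map (Euc (m+n)) (Euc n) (%v i. if i<n then v (i+m) else 0)"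
 unfolding continuous_map_componentwise_Euclidean_space using cont_iff[of "m+n" "E (m+n)"] continuous_coord by auto
 thus ?thesis by (rule continuous_map_eq) (auto simp: snd_part_def E_iff fun_eq_iff)
qed

lemma chart_map_prod:
 "cmap (prod_chart c e) p=join (cdim c) (cmap c (fst p)) (cmap e (snd p))"
 by (simp add: prod_chart_def join_def case_prod_beta fun_eq_iff)

lemma is_chart_prod:
 assumes c:"is_chart X c" and e:"is_chart Y e"
 shows "is_chart (prod_topology X Y) (prod_chart c e)"
 "cmap (prod_chart c e)`cdom (prod_chart c e) =
 {v:E (cdim c + cdim e). fst_part (cdim c) v:cmap c`cdom c &
 snd_part (cdim c) v:cmap e`cdom e}" (is "_=?W")
proof -
 let ?m = "cdim c" and ?n = "cdim e"
 let ?g = "%v. (cinv c (fst_part ?m v), cinv e (snd_part ?m v))"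
 have dim:"cdim (prod_chart c e)=?m+?n" and dom:"cdom (prod_chart c e)=cdom c\<times>cdom e"
 by (simp_all add: prod_chart_def)
 have 1:"openin (prod_topology X Y) (cdom (prod_chart c e))"
 unfolding dom using c e by (simp add: is_chart_def openin_prod_Times_iff)
 have "openin (Euc (?m+?n)) ({v:E (?m+?n). fst_part ?m v:cmap c`cdom c} \<inter>
 {v:E (?m+?n). snd_part ?m v:cmap e`cdom e})"
 using openin_continuous_map_preimage[OF continuous_fst_part chart_img_open[OF c]]
 openin_continuous_map_preimage[OF continuous_snd_part chart_img_open[OF e]] by (intro openin_Int)
 moreover have "{v:E (?m+?n). fst_part ?m v:cmap c`cdom c} \<inter>
 {v:E (?m+?n). snd_part ?m v:cmap e`cdom e}=?W" by blast
 ultimately have 2:"openin (Euc (cdim (prod_chart c e))) ?W" by (simp add: dim)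
 have 3:"cmap (prod_chart c e) p:?W&?g (cmap (prod_chart c e) p)=p"
 if "p:cdom (prod_chart c e)" for p using that chart_map_E[OF c] chart_map_E[OF e] unfolding dom chart_map_prod
 by (auto simp: fst_part_join snd_part_join join_E chart_inv_map[OF c] chart_inv_map[OF e])
 have 4:"?g v:cdom (prod_chart c e)&cmap (prod_chart c e) (?g v)=v" if "v:?W" for v
 using that chart_inv_dom[of "fst_part ?m v" c] chart_inv_dom[of "snd_part ?m v" e]
 chart_map_inv[of "fst_part ?m v" c] chart_map_inv[of "snd_part ?m v" e]
 by (simp add: dom chart_map_prod join_parts)
 have 5:"continuous_map (subtopology (prod_topology X Y) (cdom (prod_chart c e)))
 (Euc (cdim (prod_chart c e))) (cmap (prod_chart c e))"
 proof -
 have A:"continuous_map (prod_topology (subtopology X (cdom c)) (subtopology Y (cdom e))) euclideanreal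
 (%p. join ?m (cmap c (fst p)) (cmap e (snd p)) i)" for i
 proof (cases "i<?m")
 case True
 have "continuous_map (subtopology X (cdom c)) euclideanreal (%x. cmap c x i)"
 using continuous_map_compose[OF chart_cont[OF c], of euclideanreal "%v. v i"]
 cont_iff[of ?m "E ?m" "%v. v i"] continuous_coord by (simp add: o_def)
 thus ?thesis using continuous_map_compose[OF continuous_map_fst] True by (fastforce simp: join_def o_def)
 next
 case False
 have "continuous_map (subtopology Y (cdom e)) euclideanreal (%x. cmap e x (i-?m))"
 using continuous_map_compose[OF chart_cont[OF e], of euclideanreal "%v. v (i-?m)"]
 cont_iff[of ?n "E ?n" "%v. v (i-?m)"] continuous_coord by (simp add: o_def)
 thus ?thesis using continuous_map_compose[OF continuous_map_snd] False by (fastforce simp: join_def o_def)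
 qed
 hence "continuous_map (prod_topology (subtopology X (cdom c)) (subtopology Y (cdom e)))
 (Euc (?m+?n)) (%p i. if i<?m+?n then join ?m (cmap c (fst p)) (cmap e (snd p)) i else 0)"
 by (simp add: continuous_map_componentwise_Euclidean_space)
 hence "continuous_map (prod_topology (subtopology X (cdom c)) (subtopology Y (cdom e)))
 (Euc (?m+?n)) (cmap (prod_chart c e))"
 proof (rule continuous_map_eq)
 fix p assume "p:topspace (prod_topology (subtopology X (cdom c)) (subtopology Y (cdom e)))"
 hence "cmap (prod_chart c e) p:E (?m+?n)" using 3[of p] by (auto simp: dom)
 thus "(%i. if i<?m+?n then join ?m (cmap c (fst p)) (cmap e (snd p)) i else 0)=cmap (prod_chart c e) p"
 unfolding chart_map_prod by (auto simp: E_iff fun_eq_iff)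
 qed
 thus ?thesis by (simp only: dim dom subtopology_Times)
 qed
 have 6:"continuous_map (subtopology (Euc (cdim (prod_chart c e))) ?W) (prod_topology X Y) ?g"
 unfolding continuous_map_pairwise o_def fst_conv snd_conv dim
 proof
 have "continuous_map (subtopology (Euc (?m+?n)) ?W) (subtopology (Euc ?m) (cmap c`cdom c)) (fst_part ?m)"
 by (auto simp: continuous_map_in_subtopology intro!: continuous_map_from_subtopology continuous_fst_part)
 from continuous_map_compose[OF this chart_inv_cont[OF c]]
 show "continuous_map (subtopology (Euc (?m+?n)) ?W) X (%x. cinv c (fst_part ?m x))" by (simp add: o_def)
 have "continuous_map (subtopology (Euc (?m+?n)) ?W) (subtopology (Euc ?n) (cmap e`cdom e)) (snd_part ?m)"
 by (auto simp: continuous_map_in_subtopology intro!: continuous_map_from_subtopology continuous_snd_part)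
 from continuous_map_compose[OF this chart_inv_cont[OF e]]
 show "continuous_map (subtopology (Euc (?m+?n)) ?W) Y (%x. cinv e (snd_part ?m x))" by (simp add: o_def)
 qed
 show "is_chart (prod_topology X Y) (prod_chart c e)"
 "cmap (prod_chart c e)`cdom (prod_chart c e)=?W" using is_chartI[OF 1 2 3 4 5 6] by blast+
qed

lemma chart_inv_prod:
 assumes c:"is_chart X c" and e:"is_chart Y e" and v:"v:cmap (prod_chart c e)`cdom (prod_chart c e)"
 shows "cinv (prod_chart c e) v=(cinv c (fst_part (cdim c) v), cinv e (snd_part (cdim c) v))"
proof -
 obtain x y where xy:"x:cdom c" "y:cdom e" "v=cmap (prod_chart c e) (x, y)"
 using v by (auto simp: prod_chart_def)
 have "cinv (prod_chart c e) v=(x, y)"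
 using chart_inv_map[OF is_chart_prod(1)[OF c e], of "(x,y)"] xy by (simp add: prod_chart_def)
 thus ?thesis unfolding xy(3) chart_map_prod using chart_map_E[OF c xy(1)]
 by (simp add: fst_part_join snd_part_join chart_inv_map[OF c xy(1)] chart_inv_map[OF e xy(2)])
qed

lemma atlas_prod:"atlas_of (prod_mfd M N)=(%(c, e). prod_chart c e)`(atlas_of M\<times>atlas_of N)"
 by (auto simp: prod_mfd_def)

lemma charted_prod:"charted M==>charted N==>charted (prod_mfd M N)" unfolding charted_def
proof (intro conjI ballI)
 assume a:"(\<forall>c\<in>atlas_of M. is_chart (space_of M) c)&\<Union> (cdom`atlas_of M)=points M"
 "(\<forall>c\<in>atlas_of N. is_chart (space_of N) c)&\<Union> (cdom`atlas_of N)=points N"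
 show "is_chart (space_of (prod_mfd M N)) p" if p:"p:atlas_of (prod_mfd M N)" for p
 proof -
 obtain c e where "p=prod_chart c e" "c:atlas_of M" "e:atlas_of N" using p by (auto simp: prod_mfd_def)
 thus ?thesis using a is_chart_prod(1)[of "space_of M" c "space_of N" e] by (simp add: prod_mfd_def)
 qed
 have "\<Union> (cdom`atlas_of (prod_mfd M N))=(\<Union>(cdom`atlas_of M))\<times>(\<Union>(cdom`atlas_of N))"
 unfolding atlas_prod image_image by (auto simp: prod_chart_def)
 thus "\<Union> (cdom`atlas_of (prod_mfd M N))=points (prod_mfd M N)" using a by (simp add: prod_mfd_def)
qed

lemma opn_prod_fst:"opn M V ==> opn (prod_mfd M N) (fst -` V)"
 using opn_vimage[of "prod_mfd M N" M fst V] by (simp add: prod_mfd_def continuous_map_fst)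

lemma ck_on_fst:
 assumes M:"charted M" and N:"charted N" and V:"opn M V" and g:"ck_on k M V g"
 shows "ck_on k (prod_mfd M N) (fst -` V) (%p. g (fst p))" unfolding ck_on_def
proof
 fix p assume p:"p:atlas_of (prod_mfd M N)"
 then obtain c e where ce:"p=prod_chart c e" "c:atlas_of M" "e:atlas_of N" by (auto simp: prod_mfd_def)
 note cc = charted_chart[OF M ce(2)] and ec = charted_chart[OF N ce(3)]
 let ?S = "cmap p`(cdom p\<inter>fst -` V)" and ?T = "cmap c`(cdom c\<inter>V)"
 have S:"openin (Euc (cdim p)) ?S" by (rule ck_on_img_open[OF charted_prod[OF M N] opn_prod_fst[OF V] p])
 have T:"openin (Euc (cdim c)) ?T" by (rule ck_on_img_open[OF M V ce(2)])
 have "ck_real k (cdim p) ?S (%v. g (cinv c (fst_part (cdim c) v)))"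
 proof (rule ck_real_comp[OF S T, where g = "%u. g (cinv c u)" and f = "fst_part (cdim c)"])
 show "fst_part (cdim c) v:?T" if "v:?S" for v
 using that chart_map_E[OF cc] unfolding ce(1) chart_map_prod by (auto simp: prod_chart_def fst_part_join)
 show "ck_real k (cdim c) ?T (%u. g (cinv c u))" using g ce(2) by (simp add: ck_on_def)
 show "ck_real k (cdim p) ?S (%v. fst_part (cdim c) v i)" if "i<cdim c" for i
 using ck_real_coord[OF S] that by (simp add: fst_part_def)
 qed
 moreover have "g (cinv c (fst_part (cdim c) v))=g (fst (cinv p v))" if "v:?S" for v
 unfolding ce(1) by (subst chart_inv_prod[OF cc ec]) (use that ce(1) in auto)
 ultimately show "ck_real k (cdim p) ?S (%v. g (fst (cinv p v)))" by (rule ck_real_eq[OF _ S])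
qed

lemma opn_prod_snd:"opn N V ==> opn (prod_mfd M N) (snd -` V)"
 using opn_vimage[of "prod_mfd M N" N snd V] by (simp add: prod_mfd_def continuous_map_snd)

lemma ck_on_snd:
 assumes M:"charted M" and N:"charted N" and V:"opn N V" and g:"ck_on k N V g"
 shows "ck_on k (prod_mfd M N) (snd -` V) (%p. g (snd p))" unfolding ck_on_def
proof
 fix p assume p:"p:atlas_of (prod_mfd M N)"
 then obtain c e where ce:"p=prod_chart c e" "c:atlas_of M" "e:atlas_of N" by (auto simp: prod_mfd_def)
 note cc = charted_chart[OF M ce(2)] and ec = charted_chart[OF N ce(3)]
 let ?S = "cmap p`(cdom p\<inter>snd -` V)" and ?T = "cmap e`(cdom e\<inter>V)"
 have S:"openin (Euc (cdim p)) ?S" by (rule ck_on_img_open[OF charted_prod[OF M N] opn_prod_snd[OF V] p])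
 have T:"openin (Euc (cdim e)) ?T" by (rule ck_on_img_open[OF N V ce(3)])
 have "ck_real k (cdim p) ?S (%v. g (cinv e (snd_part (cdim c) v)))"
 proof (rule ck_real_comp[OF S T, where g = "%u. g (cinv e u)" and f = "snd_part (cdim c)"])
 show "snd_part (cdim c) v:?T" if "v:?S" for v
 using that unfolding ce(1) chart_map_prod by (auto simp: prod_chart_def snd_part_join)
 show "ck_real k (cdim e) ?T (%u. g (cinv e u))" using g ce(3) by (simp add: ck_on_def)
 show "ck_real k (cdim p) ?S (%v. snd_part (cdim c) v i)" for i
 using ck_real_coord[OF S] by (simp add: snd_part_def)
 qed
 moreover have "g (cinv e (snd_part (cdim c) v))=g (snd (cinv p v))" if "v:?S" for v
 unfolding ce(1) by (subst chart_inv_prod[OF cc ec]) (use that ce(1) in auto)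
 ultimately show "ck_real k (cdim p) ?S (%v. g (snd (cinv p v)))" by (rule ck_real_eq[OF _ S])
qed

lemma ck_map_Pair:
 assumes M:"charted M" and N:"charted N" and R:"charted R" and f:"ck_map k M N f" and g:"ck_map k M R g"
 shows "ck_map k M (prod_mfd N R) (%x. (f x, g x))" unfolding ck_map_iff
proof (intro conjI ballI allI impI)
 show "continuous_map (space_of M) (space_of (prod_mfd N R)) (%x. (f x, g x))"
 using ck_map_cont[OF f] ck_map_cont[OF g] by (simp add: prod_mfd_def continuous_map_pairwise o_def)
 fix p i assume p:"p:atlas_of (prod_mfd N R)" "i<cdim p"
 then obtain c e where ce:"p=prod_chart c e" "c:atlas_of N" "e:atlas_of R" by (auto simp: prod_mfd_def)
 let ?V = "(%x. (f x, g x)) -` cdom p"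
 have of:"opn M (f -` cdom c)" by (rule opn_vimage[OF ck_map_cont[OF f] opn_dom[OF N ce(2)]])
 have og:"opn M (g -` cdom e)" by (rule opn_vimage[OF ck_map_cont[OF g] opn_dom[OF R ce(3)]])
 have V:"?V=f -` cdom c\<inter>g -` cdom e" by (auto simp: ce(1) prod_chart_def)
 have oV:"opn M ?V" unfolding V by (rule opn_Int[OF of og])
 show "ck_on k M ?V (%x. cmap p (f x, g x) i)"
 proof (cases "i<cdim c")
 case True
 thus ?thesis using ck_on_subset[OF M of oV _ ck_on_coord[OF f ce(2) True]]
 unfolding V by (simp add: ce(1) chart_map_prod join_def)
 next
 case False
 hence "i-cdim c<cdim e" using p(2) by (auto simp: ce(1) prod_chart_def)
 thus ?thesis using ck_on_subset[OF M og oV _ ck_on_coord[OF g ce(3), of "i-cdim c"]] False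
 unfolding V by (simp add: ce(1) chart_map_prod join_def)
 qed
qed

lemma ck_map_const:
 assumes M:"charted M" and y:"y:points N"
 shows "ck_map k M N (%_. y)" unfolding ck_map_iff
proof (intro conjI ballI allI impI)
 fix e i
 have "opn M ((%_. y) -` cdom e)" by (cases "y:cdom e") auto
 thus "ck_on k M ((%_. y) -` cdom e) (%x. cmap e y i)" by (rule ck_on_const[OF M])
qed (use y in simp)

subsection \<open>Open submanifolds\<close>

lemma ck_on_open_mfd:
 assumes M:"charted M" and U:"openin (space_of M) U" and V:"opn M V" "V<=U"
 shows "ck_on k (open_mfd M U) V f\<longleftrightarrow>ck_on k M V f"
proof -
 have "ck_real k (cdim c) (cmap c`(cdom c\<inter>U\<inter>V)) (%v. f (cinv (c\<lparr>chart_dom := cdom c\<inter>U\<rparr>) v)) \<longleftrightarrow>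
 ck_real k (cdim c) (cmap c`(cdom c\<inter>V)) (%v. f (cinv c v))" if c:"c:atlas_of M" for c
 proof -
 note cc = charted_chart[OF M c]
 have eq:"cdom c\<inter>U\<inter>V=cdom c\<inter>V" using V(2) by auto
 have "cinv (c\<lparr>chart_dom := cdom c\<inter>U\<rparr>) v=cinv c v" if v:"v:cmap c`(cdom c\<inter>V)" for v
 proof -
 obtain x where x:"x:cdom c" "x:V" "v=cmap c x" using v by blast
 have "inj_on (cmap c) (cdom c\<inter>U)" using chart_bij[OF cc] inj_on_subset by blast
 hence "cinv (c\<lparr>chart_dom := cdom c\<inter>U\<rparr>) v=x"
 unfolding chart_inv_def x(3) using x V(2) by (simp add: inv_into_f_f subset_iff)
 thus ?thesis using chart_inv_map[OF cc x(1)] x(3) by simp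
 qed
 thus ?thesis unfolding eq by (intro ck_real_cong ck_on_img_open[OF M V(1) c]) auto
 qed
 thus ?thesis by (auto simp: ck_on_def open_mfd_def)
qed

lemma charted_open_mfd:
 assumes M:"charted M" and U:"openin (space_of M) U"
 shows "charted (open_mfd M U)" unfolding charted_def
proof (intro conjI ballI)
 fix c' assume "c':atlas_of (open_mfd M U)"
 then obtain c where c:"c:atlas_of M" "c'=c\<lparr>chart_dom := cdom c\<inter>U\<rparr>" by (auto simp: open_mfd_def)
 note cc = charted_chart[OF M c(1)]
 let ?W = "cmap c`(cdom c\<inter>U)"
 have "is_chart (subtopology (space_of M) U) c'"
 proof (rule is_chartI(1)[where W = ?W and g = "cinv c"])
 show "openin (subtopology (space_of M) U) (cdom c')" using cc unfolding c(2) is_chart_def openin_subtopology by auto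
 show W:"openin (Euc (cdim c')) ?W" using chart_open_image[OF cc opn_openin[OF U]] by (simp add: c(2))
 show "continuous_map (subtopology (subtopology (space_of M) U) (cdom c')) (Euc (cdim c')) (cmap c')"
 using continuous_map_from_subtopology_mono[OF chart_cont[OF cc], of "U\<inter>(cdom c\<inter>U)"]
 by (auto simp: c(2) subtopology_subtopology)
 have "continuous_map (subtopology (Euc (cdim c)) ?W) (space_of M) (cinv c)"
 using continuous_map_from_subtopology_mono[OF chart_inv_cont[OF cc], of ?W] by auto
 thus "continuous_map (subtopology (Euc (cdim c')) ?W) (subtopology (space_of M) U) (cinv c)"
 using chart_inv_map[OF cc] by (auto simp: c(2) continuous_map_in_subtopology)
 qed (auto simp: c(2) chart_inv_map[OF cc])
 thus "is_chart (space_of (open_mfd M U)) c'" by (simp add: open_mfd_def)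
next
 have "atlas_of (open_mfd M U)=(%c. c\<lparr>chart_dom := cdom c\<inter>U\<rparr>)`atlas_of M" by (auto simp: open_mfd_def)
 hence "\<Union> (cdom`atlas_of (open_mfd M U))=(\<Union>c\<in>atlas_of M. cdom c\<inter>U)" by (simp add: image_image)
 moreover have "(\<Union>c\<in>atlas_of M. cdom c\<inter>U)=points M\<inter>U" using M unfolding charted_def by blast
 ultimately show "\<Union> (cdom`atlas_of (open_mfd M U))=points (open_mfd M U)" by (simp add: open_mfd_def)
qed

section \<open>Admissible charts and tangent vectors\<close>

definition chart_mfd :: "'a mfd=>'a chart=>'a mfd" where
 "chart_mfd M c=\<lparr>space_of=subtopology (space_of M) (cdom c), atlas_of={c}\<rparr>"

lemma is_chart_subtopology:
 assumes "is_chart X c"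
 shows "is_chart (subtopology X (cdom c)) c" using assms chart_dom_subset[OF assms]
 by (auto simp: is_chart_def subtopology_subtopology openin_subtopology_refl)

lemma points_chart_mfd:"is_chart (space_of M) c==>points (chart_mfd M c)=cdom c"
 using chart_dom_subset by (auto simp: chart_mfd_def)

lemma charted_chart_mfd:"is_chart (space_of M) c==>charted (chart_mfd M c)"
 unfolding charted_def points_chart_mfd by (auto simp: chart_mfd_def is_chart_subtopology)

lemma adm_chart:"admissible_chart k M c==>is_chart (space_of M) c" by (simp add: admissible_chart_def)

lemma adm_inclusion:
 assumes "admissible_chart k M c"
 shows "ck_map k (chart_mfd M c) M (%x. x)" unfolding ck_map_iff
proof (intro conjI ballI allI impI)
 show "continuous_map (space_of (chart_mfd M c)) (space_of M) (%x. x)"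
 by (simp add: chart_mfd_def continuous_map_from_subtopology)
 fix e i assume "e:atlas_of M" "i<cdim e"
 thus "ck_on k (chart_mfd M c) ((%x. x) -` cdom e) (%x. cmap e x i)"
 using assms by (auto simp: admissible_chart_def ck_transition_def ck_vec_def ck_on_def chart_mfd_def o_def vimage_def)
qed

lemma adm_pull:
 assumes M:"charted M" and c:"admissible_chart k M c" and V:"opn M V" and f:"ck_on k M V f"
 shows "ck_real k (cdim c) (cmap c`(cdom c\<inter>V)) (%v. f (cinv c v))"
 using ck_on_comp[OF charted_chart_mfd[OF adm_chart[OF c]] M adm_inclusion[OF c] V f]
 by (simp add: ck_on_def chart_mfd_def vimage_def)

lemma adm_coord:"admissible_chart k M c==>i<cdim c==>ck_on k M (cdom c) (%x. cmap c x i)"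
 by (auto simp: admissible_chart_def ck_transition_def ck_vec_def ck_on_def o_def)

lemma adm_opn:"admissible_chart k M c ==> opn M (cdom c)"
 using adm_chart opn_openin unfolding is_chart_def by blast

lemma atlas_adm:"ck_manifold k M==>c:atlas_of M==>admissible_chart k M c"
 by (auto simp: ck_manifold_def admissible_chart_def)

definition ck_atlas :: "enat=>'a mfd=>bool" where
 "ck_atlas k M\<longleftrightarrow>charted M&(ALL c:atlas_of M. admissible_chart k M c)"

lemma ck_manifold_atlas:"ck_manifold k M==>ck_atlas k M"
 using atlas_adm ck_manifold_charted unfolding ck_atlas_def by blast

lemma ck_atlas_charted:"ck_atlas k M==>charted M" by (simp add: ck_atlas_def)

lemma zero_E:"(%_. 0):E n" by (simp add: E_iff)

text \<open>The differential of \<open>f\<close> at \<open>x\<close>, applied to the vector with coordinates \<open>w\<close> in the chart \<open>c\<close>.\<close>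

definition dch :: "'a chart=>'a=>('a=>real)=>(nat=>real)=>real" where
 "dch c x f w=(SUM j<cdim c. pder j (%v. f (cinv c v)) (cmap c x) * w j)"

definition trans_vec :: "'a chart=>'a chart=>'a=>(nat=>real)=>nat=>real" where
 "trans_vec c c' x w=(%i. if i<cdim c' then dch c x (%y. cmap c' y i) w else 0)"

lemma jacobian_trans:
 "jacobian_app (cdim c) (cdim c') (cmap c'\<circ>cinv c) (cmap c x) w=trans_vec c c' x w"
 by (auto simp: jacobian_app_def trans_vec_def dch_def o_def)

lemma trans_vec_E:"trans_vec c c' x w:E (cdim c')" by (simp add: trans_vec_def E_iff)

lemma dch_diff:"dch c x f (%i. v i-w i)=dch c x f v-dch c x f w"
 by (simp add: dch_def sum_subtractf algebra_simps)
lemma dch_zero:"dch c x f (%i. 0)=0" by (simp add: dch_def)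

lemma dch_cong:
 assumes c:"is_chart (space_of M) c" and x:"x:cdom c" and V:"opn M V" "x:V"
 and eq:"!!y. y:V==>y:points M==>f y=g y"
 shows "dch c x f w=dch c x g w" unfolding dch_def
proof (intro sum.cong refl arg_cong2[where f = "(*)"])
 fix j assume "j:{..<cdim c}"
 hence j:"j<cdim c" by simp
 have xi:"cmap c x:cmap c`(cdom c\<inter>V)" using x V by auto
 show "pder j (%v. f (cinv c v)) (cmap c x)=pder j (%v. g (cinv c v)) (cmap c x)"
 by (rule pd_cong[OF chart_open_image[OF c V(1)] xi j])
 (use chart_inv_map[OF c] chart_dom_subset[OF c] eq in auto)
qed

lemma dch_comp:
 assumes M:"charted M" and N:"charted N" and c:"admissible_chart k M c" and e:"admissible_chart k N e"
 and k:"k\<ge>1" and F:"ck_map k M N F"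
 and x:"x:cdom c" "F x:cdom e" and V:"opn N V" "F x:V" and f:"ck_on k N V f"
 shows "dch c x (%y. f (F y)) w=dch e (F x) f (%i. if i<cdim e then dch c x (%y. cmap e (F y) i) w else 0)"
proof -
 note cc = adm_chart[OF c] and ec = adm_chart[OF e]
 define W where "W=cdom e\<inter>V"
 have W:"opn N W" unfolding W_def by (rule opn_Int[OF adm_opn[OF e] V(1)])
 have FW:"opn M (F -` W)" by (rule opn_vimage[OF ck_map_cont[OF F] W])
 let ?S = "cmap c`(cdom c\<inter>F -` W)" and ?T = "cmap e`(cdom e\<inter>W)"
 have S:"openin (Euc (cdim c)) ?S" by (rule chart_open_image[OF cc FW])
 have T:"openin (Euc (cdim e)) ?T" by (rule chart_open_image[OF ec W])
 define h where "h v=cmap e (F (cinv c v))" for v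
 have inv:"cinv c v:F -` W" if "v:?S" for v using that chart_inv_map[OF cc] by auto
 have hT:"h v:?T" if "v:?S" for v using inv[OF that] by (auto simp: h_def W_def)
 have fk:"ck_real k (cdim e) ?T (%u. f (cinv e u))"
 using adm_pull[OF N e W ck_on_subset[OF N V(1) W _ f]] by (auto simp: W_def)
 have "ck_on k M (F -` cdom e) (%y. cmap e (F y) i)" if "i<cdim e" for i
 using ck_on_comp[OF M N F adm_opn[OF e] adm_coord[OF e that]] .
 hence "ck_on k M (F -` W) (%y. cmap e (F y) i)" if "i<cdim e" for i
 using ck_on_subset[OF M opn_vimage[OF ck_map_cont[OF F] adm_opn[OF e]] FW] that by (auto simp: W_def)
 hence hk:"ck_real k (cdim c) ?S (%v. h v i)" if "i<cdim e" for i
 using adm_pull[OF M c FW] that unfolding h_def by blast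
 have xS:"cmap c x:?S" using x V(2) by (auto simp: W_def)
 have hx:"h (cmap c x)=cmap e (F x)" by (simp add: h_def chart_inv_map[OF cc x(1)])
 have pd:"pder j (%v. f (F (cinv c v))) (cmap c x) =
 (SUM l<cdim e. pder l (%u. f (cinv e u)) (cmap e (F x)) * pder j (%v. h v l) (cmap c x))"
 if j:"j<cdim c" for j
 proof -
 have "pder j (%v. f (F (cinv c v))) (cmap c x)=pder j (%v. f (cinv e (h v))) (cmap c x)"
 by (rule pd_cong[OF S xS j]) (use inv in "auto simp: h_def W_def chart_inv_map[OF ec]")
 also have "...=(SUM l<cdim e. pder l (%u. f (cinv e u)) (h (cmap c x)) * pder j (%v. h v l) (cmap c x))"
 by (rule partial_deriv_comp[OF S T hT fk hk k xS j])
 finally show ?thesis by (simp add: hx)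
 qed
 have "dch c x (%y. f (F y)) w=(SUM j<cdim c. SUM l<cdim e.
 pder l (%u. f (cinv e u)) (cmap e (F x))*(pder j (%v. h v l) (cmap c x) * w j))"
 unfolding dch_def by (intro sum.cong refl) (simp add: pd sum_distrib_right mult.assoc)
 also have "...=(SUM l<cdim e. pder l (%u. f (cinv e u)) (cmap e (F x)) *
 (SUM j<cdim c. pder j (%v. h v l) (cmap c x) * w j))" by (subst sum.swap) (simp add: sum_distrib_left)
 finally show ?thesis unfolding dch_def h_def by simp
qed

lemma adm_id:
 assumes "ck_atlas k M" shows "ck_map k M M (%x. x)"
proof -
 have "ck_on k M (cdom e) (%x. cmap e x i)" if "e:atlas_of M" "i<cdim e" for e i
 using adm_coord[OF _ that(2)] assms that(1) unfolding ck_atlas_def by blast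
 thus ?thesis unfolding ck_map_iff by (auto simp: vimage_def)
qed

lemma dch_change:
 assumes M:"ck_atlas k M" and c:"admissible_chart k M c" "admissible_chart k M c'" and k:"k\<ge>1"
 and x:"x:cdom c" "x:cdom c'" and V:"opn M V" "x:V" and f:"ck_on k M V f"
 shows "dch c x f w=dch c' x f (trans_vec c c' x w)"
 using dch_comp[OF ck_atlas_charted[OF M] ck_atlas_charted[OF M] c k adm_id[OF M] x V f, of w]
 unfolding trans_vec_def .

lemma trans_vec_trans:
 assumes M:"ck_atlas k M" and c:"admissible_chart k M c" "admissible_chart k M c'" "admissible_chart k M c''" and k:"k\<ge>1"
 and x:"x:cdom c" "x:cdom c'" "x:cdom c''"
 shows "trans_vec c' c'' x (trans_vec c c' x w)=trans_vec c c'' x w"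
proof
 fix i
 show "trans_vec c' c'' x (trans_vec c c' x w) i=trans_vec c c'' x w i"
 using dch_change[OF M c(1,2) k x(1,2) adm_opn[OF c(3)] x(3) adm_coord[OF c(3)], of i w] by (simp add: trans_vec_def)
qed

lemma trans_vec_refl:
 assumes c:"is_chart (space_of M) c" and x:"x:cdom c" and w:"w:E (cdim c)"
 shows "trans_vec c c x w=w"
proof
 fix i
 have o:"openin (Euc (cdim c)) (cmap c`cdom c)" by (rule chart_img_open[OF c])
 have "pder j (%v. cmap c (cinv c v) i) (cmap c x)=(if i=j then 1 else 0)" if "j<cdim c" for j
 proof -
 have "pder j (%v. cmap c (cinv c v) i) (cmap c x)=pder j (%v. v i) (cmap c x)"
 by (rule pd_cong[OF o _ that]) (use x in "auto simp: chart_inv_map[OF c]")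
 also have "...=(if i=j then 1 else 0)" by (rule has_pd_imp) (auto simp: has_pd_def)
 finally show ?thesis .
 qed
 hence "i<cdim c==>dch c x (%y. cmap c y i) w=w i" unfolding dch_def by (simp add: delta_sum)
 thus "trans_vec c c x w i=w i" using w by (simp add: trans_vec_def E_iff)
qed

definition tvec :: "'a mfd=>'a chart=>'a=>(nat=>real)=>'a tangent" where
 "tvec M c x w=(%c'. if c':charts_at M x then trans_vec c c' x w else (%_. 0))"

lemma charts_at_nonempty:"charted M==>x:points M==>EX c. c:charts_at M x"
 using charted_cover unfolding charts_at_def by fastforce

lemma tangent_space_eq:
 assumes M:"ck_atlas k M" and k:"k\<ge>1" and c:"admissible_chart k M c" and x:"x:cdom c"
 shows "tangent_space M x=tvec M c x`E (cdim c)"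
proof (intro equalityI subsetI)
 fix v assume v:"v:tangent_space M x"
 have xM:"x:points M" using chart_dom_subset[OF adm_chart[OF c]] x by blast
 obtain c0 where c0:"c0:charts_at M x" using charts_at_nonempty[OF ck_atlas_charted[OF M] xM] by blast
 have a0:"admissible_chart k M c0" "x:cdom c0" using c0 M by (auto simp: charts_at_def ck_atlas_def)
 have "v=tvec M c x (trans_vec c0 c x (v c0))"
 proof
 fix c' show "v c'=tvec M c x (trans_vec c0 c x (v c0)) c'"
 proof (cases "c':charts_at M x")
 case True
 have a':"admissible_chart k M c'" "x:cdom c'" using True M by (auto simp: charts_at_def ck_atlas_def)
 have "v c'=trans_vec c0 c' x (v c0)" using v c0 True unfolding tangent_space_def jacobian_trans by blast
 thus ?thesis unfolding tvec_def trans_vec_trans[OF M a0(1) c a'(1) k a0(2) x a'(2)] using True by simp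
 qed (use v in "auto simp: tvec_def tangent_space_def")
 qed
 thus "v:tvec M c x`E (cdim c)" by (rule image_eqI[OF _ trans_vec_E])
next
 fix v assume "v:tvec M c x`E (cdim c)"
 then obtain w where w:"v=tvec M c x w" by blast
 have "v c''=trans_vec c' c'' x (v c')" if "c':charts_at M x" "c'':charts_at M x" for c' c''
 proof -
 have a:"admissible_chart k M c'" "x:cdom c'" "admissible_chart k M c''" "x:cdom c''"
 using that M by (auto simp: charts_at_def ck_atlas_def)
 show ?thesis using that trans_vec_trans[OF M c a(1,3) k x a(2,4)] by (simp add: w tvec_def)
 qed
 moreover have "v c'=(%_. 0)" if "c'~:charts_at M x" for c' using that by (simp add: w tvec_def)
 moreover have "v c':E (cdim c')" for c' by (simp add: w tvec_def trans_vec_E zero_E)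
 ultimately show "v:tangent_space M x" unfolding tangent_space_def jacobian_trans by blast
qed

lemma tvec_inj:
 assumes M:"ck_atlas k M" and k:"k\<ge>1" and c:"admissible_chart k M c" and x:"x:cdom c"
 shows "inj_on (tvec M c x) (E (cdim c))"
proof (rule inj_onI)
 fix w w' assume w:"w:E (cdim c)" "w':E (cdim c)" and eq:"tvec M c x w=tvec M c x w'"
 have xM:"x:points M" using chart_dom_subset[OF adm_chart[OF c]] x by blast
 obtain c0 where c0:"c0:charts_at M x" using charts_at_nonempty[OF ck_atlas_charted[OF M] xM] by blast
 have a0:"admissible_chart k M c0" "x:cdom c0" using c0 M by (auto simp: charts_at_def ck_atlas_def)
 have "trans_vec c c0 x w=trans_vec c c0 x w'" using fun_cong[OF eq, of c0] c0 by (simp add: tvec_def)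
 hence "trans_vec c0 c x (trans_vec c c0 x w)=trans_vec c0 c x (trans_vec c c0 x w')" by simp
 thus "w=w'" using trans_vec_trans[OF M c a0(1) c k x a0(2) x]
 trans_vec_refl[OF adm_chart[OF c] x] w by simp
qed

lemma tangent_map_tvec:
 assumes M:"ck_atlas k M" and N:"charted N" and k:"k\<ge>1" and c:"admissible_chart k M c" and x:"x:cdom c"
 and F:"!!e i. e:charts_at N (F x)==>i<cdim e==>EX V. opn M V&x:V&ck_on k M V (%y. cmap e (F y) i)"
 shows "tangent_map M N F x (tvec M c x w) =
 (%e. if e:charts_at N (F x) then (%i. if i<cdim e then dch c x (%y. cmap e (F y) i) w else 0) else (%_. 0))"
proof (rule ext)
 fix e
 have xM:"x:points M" using chart_dom_subset[OF adm_chart[OF c]] x by blast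
 define c0 where "c0=(SOME c. c:charts_at M x)"
 have c0:"c0:charts_at M x"
 unfolding c0_def using charts_at_nonempty[OF ck_atlas_charted[OF M] xM] by (rule someI_ex)
 have a0:"admissible_chart k M c0" "x:cdom c0" using c0 M by (auto simp: charts_at_def ck_atlas_def)
 have "jacobian_app (cdim c0) (cdim e) (cmap e\<circ>F\<circ>cinv c0) (cmap c0 x) (tvec M c x w c0) =
 (%i. if i<cdim e then dch c x (%y. cmap e (F y) i) w else 0)" if e:"e:charts_at N (F x)"
 proof
 fix i
 have "dch c0 x (%y. cmap e (F y) i) (trans_vec c c0 x w)=dch c x (%y. cmap e (F y) i) w" if i:"i<cdim e"
 using F[OF e i] dch_change[OF M c a0(1) k x a0(2)] by metis
 thus "jacobian_app (cdim c0) (cdim e) (cmap e\<circ>F\<circ>cinv c0) (cmap c0 x) (tvec M c x w c0) i =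
 (if i<cdim e then dch c x (%y. cmap e (F y) i) w else 0)"
 using c0 by (auto simp: jacobian_app_def tvec_def dch_def o_def)
 qed
 thus "tangent_map M N F x (tvec M c x w) e=(if e:charts_at N (F x) then (%i. if i<cdim e then dch c x (%y. cmap e (F y) i) w else 0) else (%_. 0))"
 unfolding tangent_map_def c0_def[symmetric] Let_def by simp
qed

definition eucl_chart :: "nat=>(nat=>real) chart" where
 "eucl_chart n=\<lparr>chart_dom=E n, chart_dim=n, chart_map=(%v. v)\<rparr>"

lemma atlas_euclidean:"atlas_of (euclidean_mfd n)={eucl_chart n}" by (simp add: euclidean_mfd_def eucl_chart_def)

lemma tangent_map_euclidean:
 assumes M:"ck_atlas k M" and k:"k\<ge>1" and c:"admissible_chart k M c" and x:"x:cdom c"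
 and V:"opn M V" "x:V" "!!i. i<n==>ck_on k M V (%y. F y i)" and Fx:"F x:E n"
 shows "tangent_map M (euclidean_mfd n) F x (tvec M c x w) =
 (%e. if e=eucl_chart n then (%i. if i<n then dch c x (%y. F y i) w else 0) else (%_. 0))"
proof -
 have at:"charts_at (euclidean_mfd n) (F x)={eucl_chart n}"
 using Fx by (auto simp: charts_at_def atlas_euclidean eucl_chart_def)
 have d:"cdim (eucl_chart n)=n" "cmap (eucl_chart n)=(%v. v)" by (simp_all add: eucl_chart_def)
 show ?thesis by (subst tangent_map_tvec[OF M charted_euclidean k c x]) (use at V in "auto simp: d fun_eq_iff")
qed

definition imm_at :: "nat=>'a chart=>'a=>('a=>nat=>real)=>bool" where
 "imm_at n c x F\<longleftrightarrow>(ALL w:E (cdim c). (ALL i<n. dch c x (%y. F y i) w=0)-->w=(%_. 0))"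

lemma immersion_iff:
 assumes M:"ck_atlas k M" and k:"k\<ge>1" and c:"admissible_chart k M c" and x:"x:cdom c"
 and F:"ck_map k M (euclidean_mfd n) F"
 shows "inj_on (tangent_map M (euclidean_mfd n) F x) (tangent_space M x)\<longleftrightarrow>imm_at n c x F"
proof -
 have xM:"x:points M" using chart_dom_subset[OF adm_chart[OF c]] x by blast
 have F':"!!i. i<n==>ck_on k M UNIV (%y. F y i)" "F x:E n"
 using F xM unfolding ck_map_euclidean[OF ck_atlas_charted[OF M]] by auto
 define D where "D w=(%i. if i<n then dch c x (%y. F y i) w else 0)" for w
 have tm:"tangent_map M (euclidean_mfd n) F x (tvec M c x w)=(%e. if e=eucl_chart n then D w else (%_. 0))" for w
 unfolding D_def by (rule tangent_map_euclidean[OF M k c x, of UNIV]) (use F' in auto)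
 have eq:"tangent_map M (euclidean_mfd n) F x (tvec M c x w)=tangent_map M (euclidean_mfd n) F x (tvec M c x w')\<longleftrightarrow>D w=D w'" for w w'
 unfolding tm fun_eq_iff[of "%e. if e=eucl_chart n then _ else _"] by auto
 have "inj_on (tangent_map M (euclidean_mfd n) F x) (tangent_space M x)\<longleftrightarrow>inj_on D (E (cdim c))"
 unfolding tangent_space_eq[OF M k c x] comp_inj_on_iff[OF tvec_inj[OF M k c x]] by (simp add: inj_on_def eq)
 also have "...\<longleftrightarrow>imm_at n c x F"
 proof
 assume i:"inj_on D (E (cdim c))"
 have "w=(%_. 0)" if "w:E (cdim c)" "ALL i<n. dch c x (%y. F y i) w=0" for w
 by (rule inj_onD[OF i _ that(1) zero_E]) (use that(2) in "auto simp: D_def dch_zero")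
 thus "imm_at n c x F" by (auto simp: imm_at_def)
 next
 assume i:"imm_at n c x F"
 show "inj_on D (E (cdim c))"
 proof (rule inj_onI)
 fix w w' assume w:"w:E (cdim c)" "w':E (cdim c)" "D w=D w'"
 have "(%i. w i-w' i)=(%_. 0)"
 proof (rule i[unfolded imm_at_def, rule_format])
 show "(%i. w i-w' i):E (cdim c)" using w by (auto simp: E_iff)
 show "dch c x (%y. F y i) (%i. w i-w' i)=0" if "i<n" for i
 using fun_cong[OF w(3), of i] that by (simp add: dch_diff D_def)
 qed
 thus "w=w'" by (auto simp: fun_eq_iff)
 qed
 qed
 finally show ?thesis .
qed

lemma imm_at_kernel:
 "imm_at n c x F\<longleftrightarrow>trivial_kernel n (cdim c) (jac (%v. F (cinv c v)) (cmap c x))"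
proof
 assume i:"imm_at n c x F"
 show "trivial_kernel n (cdim c) (jac (%v. F (cinv c v)) (cmap c x))" unfolding trivial_kernel_def
 proof (intro allI impI)
 fix v j assume v:"ALL i<n. (SUM j<cdim c. jac (%v. F (cinv c v)) (cmap c x) i j * v j)=0" and j:"j<cdim c"
 define w where "w=(%j. if j<cdim c then v j else 0)"
 have "w=(%_. 0)"
 by (rule i[unfolded imm_at_def, rule_format]) (use v in "auto simp: w_def E_iff dch_def jac_def")
 hence "w j=0" by simp
 thus "v j=0" using j by (simp add: w_def)
 qed
next
 assume t:"trivial_kernel n (cdim c) (jac (%v. F (cinv c v)) (cmap c x))"
 show "imm_at n c x F" unfolding imm_at_def
 proof (intro ballI impI)
 fix w assume "w:E (cdim c)" "ALL i<n. dch c x (%y. F y i) w=0"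
 thus "w=(%_. 0)" using t unfolding trivial_kernel_def dch_def jac_def by (intro E_eqI[OF _ zero_E]) auto
 qed
qed

section \<open>Submanifolds\<close>

lemma slice_adm:"slice_chart k M p S c==>admissible_chart k M c" by (simp add: slice_chart_def)

lemma slice_coord_zero:
 assumes "slice_chart k M p S c" "x:cdom c" "x:S"
 shows "cmap c x:E p" using assms unfolding slice_chart_def by blast

lemma slice_mem:
 assumes "slice_chart k M p S c" "x:cdom c" "cmap c x:E p"
 shows "x:S"
proof -
 have "cmap c x:cmap c`(cdom c\<inter>S)" using assms unfolding slice_chart_def by blast
 thus ?thesis using chart_bij[OF adm_chart[OF slice_adm[OF assms(1)]]] assms(2) by (auto simp: inj_on_def)
qed

definition sub_chart :: "'a chart=>'a set=>nat=>'a chart" where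
 "sub_chart c S p=\<lparr>chart_dom=cdom c\<inter>S, chart_dim=p, chart_map=cmap c\<rparr>"

lemma sub_chart_simps [simp]:"cdom (sub_chart c S p)=cdom c\<inter>S"
 "cdim (sub_chart c S p)=p" "cmap (sub_chart c S p)=cmap c" by (simp_all add: sub_chart_def)

lemma atlas_sub:"atlas_of (sub_mfd k M S)={sub_chart c S p | c p. slice_chart k M p S c}"
 by (simp add: sub_mfd_def sub_chart_def)

lemma E_mono:"p<=n==>E p<=E n" by (auto simp: E_iff)

lemma openin_E_Int:
 assumes "openin (Euc n) W" "p<=n" shows "openin (Euc p) (W\<inter>E p)"
proof -
 have "EX r>0. box_at p x r<=W\<inter>E p" if x:"x:W" "x:E p" for x
 proof -
 obtain r where r:"r > 0" "box_at n x r<=W" using assms(1) x unfolding openin_E_iff by blast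
 have "box_at p x r<=box_at n x r"
 proof
 fix y assume y:"y:box_at p x r"
 have "\<bar>y i-x i\<bar><r" if "i<n" for i using y x(2) r(1) by (cases "i<p") (auto simp: box_at_def E_iff)
 thus "y:box_at n x r" using y E_mono[OF assms(2)] unfolding box_at_def by blast
 qed
 hence "box_at p x r<=W\<inter>E p" using r unfolding box_at_def by blast
 thus ?thesis using r(1) by blast
 qed
 thus ?thesis unfolding openin_E_iff by blast
qed

lemma chart_inv_sub:
 assumes c:"is_chart X c" and v:"v:cmap c`(cdom c\<inter>S)"
 shows "cinv (sub_chart c S p) v=cinv c v"
proof -
 obtain x where x:"x:cdom c\<inter>S" "v=cmap c x" using v by blast
 have "inj_on (cmap c) (cdom c\<inter>S)" using chart_bij[OF c] inj_on_subset by blast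
 hence "cinv (sub_chart c S p) v=x" unfolding chart_inv_def x(2) using x(1) by (simp add: inv_into_f_f)
 thus ?thesis using chart_inv_map[OF c] x by auto
qed

lemma is_chart_sub:
 assumes c:"slice_chart k M p S c"
 shows "is_chart (subtopology (space_of M) S) (sub_chart c S p)"
 "cmap c`(cdom c\<inter>S)=cmap c`cdom c\<inter>E p"
proof -
 note cc = adm_chart[OF slice_adm[OF c]]
 have p:"p<=cdim c" using c by (simp add: slice_chart_def)
 show img:"cmap c`(cdom c\<inter>S)=cmap c`cdom c\<inter>E p" using c by (simp add: slice_chart_def)
 let ?W = "cmap c`cdom c\<inter>E p"
 show "is_chart (subtopology (space_of M) S) (sub_chart c S p)"
 proof (rule is_chartI(1)[where W = ?W and g = "cinv c"])
 show "openin (subtopology (space_of M) S) (cdom (sub_chart c S p))"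
 using cc unfolding is_chart_def openin_subtopology by auto
 show "openin (Euc (cdim (sub_chart c S p))) ?W" using openin_E_Int[OF chart_img_open[OF cc] p] by simp
 show "cmap (sub_chart c S p) x:?W&cinv c (cmap (sub_chart c S p) x)=x"
 if "x:cdom (sub_chart c S p)" for x using that img chart_inv_map[OF cc] by auto
 show "cinv c v:cdom (sub_chart c S p)&cmap (sub_chart c S p) (cinv c v)=v" if "v:?W" for v
 using that unfolding img[symmetric] by (auto simp: chart_inv_map[OF cc])
 have "continuous_map (subtopology (space_of M) (cdom c\<inter>S)) (Euc (cdim c)) (cmap c)"
 using continuous_map_from_subtopology_mono[OF chart_cont[OF cc]] by auto
 hence "continuous_map (subtopology (space_of M) (cdom c\<inter>S)) (subtopology (Euc (cdim c)) (E p)) (cmap c)"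
 using slice_coord_zero[OF c] by (auto simp: continuous_map_in_subtopology)
 moreover have "subtopology (Euc (cdim c)) (E p)=Euc p"
 using subtopology_E[OF E_mono[OF p]] subtopology_E[of "E p" p] by simp
 ultimately show "continuous_map (subtopology (subtopology (space_of M) S) (cdom (sub_chart c S p))) (Euc (cdim (sub_chart c S p))) (cmap (sub_chart c S p))"
 by (simp add: subtopology_subtopology Int_commute Int_left_commute)
 have "continuous_map (subtopology (Euc (cdim c)) ?W) (space_of M) (cinv c)"
 using continuous_map_from_subtopology_mono[OF chart_inv_cont[OF cc], of ?W] by auto
 moreover have "subtopology (Euc (cdim c)) ?W=subtopology (Euc p) ?W"
 proof -
 have "?W<=E (cdim c)" using E_mono[OF p] by blast
 thus ?thesis using subtopology_E[of ?W p] subtopology_E[of ?W "cdim c"] by auto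
 qed
 ultimately show "continuous_map (subtopology (Euc (cdim (sub_chart c S p))) ?W) (subtopology (space_of M) S) (cinv c)"
 using chart_inv_map[OF cc] by (auto simp: continuous_map_in_subtopology simp flip: img)
 qed
qed

text \<open>Being locally a slice of any dimension; the dimension may jump between components.\<close>

definition sliced :: "enat=>'a mfd=>'a set=>bool" where
 "sliced k M S\<longleftrightarrow>S<=points M&(ALL a:S. EX p c. slice_chart k M p S c&a:cdom c)"

lemma points_sub:"S<=points M==>points (sub_mfd k M S)=S" by (auto simp: sub_mfd_def)
lemma space_sub:"space_of (sub_mfd k M S)=subtopology (space_of M) S" by (simp add: sub_mfd_def)

lemma charted_sub:
 assumes S:"sliced k M S" shows "charted (sub_mfd k M S)" unfolding charted_def
proof (intro conjI ballI)
 show "is_chart (space_of (sub_mfd k M S)) c" if "c:atlas_of (sub_mfd k M S)" for c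
 using that is_chart_sub(1) by (auto simp: atlas_sub space_sub)
 have "(\<Union>c\<in>atlas_of (sub_mfd k M S). cdom c)=S" using S unfolding atlas_sub sliced_def by fastforce
 thus "\<Union> (cdom`atlas_of (sub_mfd k M S))=points (sub_mfd k M S)"
 using S points_sub unfolding sliced_def by metis
qed

lemma ck_on_restrict:
 assumes M:"charted M" and S:"sliced k M S" and V:"opn M V" and f:"ck_on k M V f"
 shows "ck_on k (sub_mfd k M S) V f" "opn (sub_mfd k M S) V"
proof -
 show oV:"opn (sub_mfd k M S) V"
 using V S points_sub[of S M k] unfolding space_sub openin_subtopology sliced_def by auto
 show "ck_on k (sub_mfd k M S) V f" unfolding ck_on_def
 proof
 fix c' assume "c':atlas_of (sub_mfd k M S)"
 then obtain c p where c:"slice_chart k M p S c" "c'=sub_chart c S p" by (auto simp: atlas_sub)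
 note ca = slice_adm[OF c(1)] note cc = adm_chart[OF ca]
 have p:"p<=cdim c" using c(1) by (simp add: slice_chart_def)
 let ?T = "cmap c`(cdom c\<inter>V)" and ?S = "cmap c`(cdom c\<inter>S\<inter>V)"
 have T:"openin (Euc (cdim c)) ?T" by (rule chart_open_image[OF cc V])
 have S':"openin (Euc p) ?S"
 using chart_open_image[of "space_of (sub_mfd k M S)" c' V] is_chart_sub(1)[OF c(1)] oV by (simp add: c(2) space_sub)
 have "ck_real k p ?S (%v. f (cinv c v))"
 by (rule ck_real_comp[OF S' T, where f = "%v. v" and g = "%v. f (cinv c v)"])
 (use adm_pull[OF M ca V f] ck_real_coord[OF S'] in auto)
 hence "ck_real k p ?S (%v. f (cinv c' v))"
 by (rule ck_real_eq[OF _ S']) (auto simp: c(2) chart_inv_sub[OF cc])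
 thus "ck_real k (cdim c') (cmap c'`(cdom c'\<inter>V)) (%v. f (cinv c' v))" by (simp add: c(2))
 qed
qed

lemma ck_map_into_sub:
 assumes M:"charted M" and N:"charted N" and S:"sliced k M S"
 and f:"ck_map k N M f" "!!x. x:points N==>f x:S"
 shows "ck_map k N (sub_mfd k M S) f" unfolding ck_map_iff
proof (intro conjI ballI allI impI)
 show "continuous_map (space_of N) (space_of (sub_mfd k M S)) f"
 using ck_map_cont[OF f(1)] f(2) by (auto simp: space_sub continuous_map_in_subtopology)
 fix e i assume e:"e:atlas_of (sub_mfd k M S)" "i<cdim e"
 then obtain c p where c:"slice_chart k M p S c" "e=sub_chart c S p" by (auto simp: atlas_sub)
 have i:"i<cdim c" using c e(2) by (simp add: slice_chart_def)
 have "ck_on k N (f -` cdom c) (%x. cmap c (f x) i)"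
 by (rule ck_on_comp[OF N M f(1) adm_opn[OF slice_adm[OF c(1)]] adm_coord[OF slice_adm[OF c(1)] i]])
 moreover have "points N\<inter>f -` cdom c=points N\<inter>f -` cdom e" using f(2) c(2) by auto
 ultimately show "ck_on k N (f -` cdom e) (%x. cmap e (f x) i)"
 using ck_on_set[OF N, of "f -` cdom c" "f -` cdom e"] unfolding c(2) sub_chart_simps by blast
qed

lemma ck_atlas_sub:
 assumes M:"ck_atlas k M" and S:"sliced k M S"
 shows "ck_atlas k (sub_mfd k M S)"
proof -
 note N = charted_sub[OF S]
 have "ck_transition k c c'" if cc:"c:atlas_of (sub_mfd k M S)" "c':atlas_of (sub_mfd k M S)" for c c'
 proof -
 obtain c1 p1 where c1:"slice_chart k M p1 S c1" "c'=sub_chart c1 S p1" using cc(2) by (auto simp: atlas_sub)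
 have "ck_on k (sub_mfd k M S) (cdom c1) (%x. cmap c1 x i)" if "i<p1" for i
 by (rule ck_on_restrict(1)[OF ck_atlas_charted[OF M] S adm_opn[OF slice_adm[OF c1(1)]] adm_coord[OF slice_adm[OF c1(1)]]])
 (use that c1(1) in "auto simp: slice_chart_def")
 moreover have "points (sub_mfd k M S)\<inter>cdom c1=points (sub_mfd k M S)\<inter>cdom c'"
 using points_sub[of S M k] S c1(2) by (auto simp: sliced_def)
 ultimately have "ck_on k (sub_mfd k M S) (cdom c') (%x. cmap c1 x i)" if "i<p1" for i
 using ck_on_set[OF N] that by blast
 thus ?thesis using cc(1) unfolding ck_transition_def ck_vec_def ck_on_def by (auto simp: c1(2) o_def)
 qed
 thus ?thesis using N charted_chart[OF N] unfolding ck_atlas_def admissible_chart_def by blast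
qed

lemma dch_sub_chart:
 assumes c:"slice_chart k M p S c" and a:"a:cdom c" "a:S" and w:"w:E p"
 shows "dch (sub_chart c S p) a f w=dch c a f w"
proof -
 let ?c = "sub_chart c S p"
 note cc = adm_chart[OF slice_adm[OF c]]
 have p:"p<=cdim c" using c by (simp add: slice_chart_def)
 have E:"cmap c a:E p" by (rule slice_coord_zero[OF c a])
 have "pder j (%v. f (cinv ?c v)) (cmap c a)=pder j (%v. f (cinv c v)) (cmap c a)"
 if j:"j<p" for j
 proof (rule pd_cong[where U = "cmap c`(cdom c\<inter>S)" and n = p, OF _ _ j])
 show "openin (Euc p) (cmap c`(cdom c\<inter>S))"
 unfolding is_chart_sub(2)[OF c] by (rule openin_E_Int[OF chart_img_open[OF cc] p])
 qed (use a chart_inv_sub[OF cc] in auto)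
 hence "dch ?c a f w=(SUM j<p. pder j (%v. f (cinv c v)) (cmap c a) * w j)" unfolding dch_def by simp
 also have "...=dch c a f w" unfolding dch_def by (rule sum.mono_neutral_left) (use p w in "auto simp: E_iff")
 finally show ?thesis .
qed

text \<open>In a slice chart the tangent space of the submanifold consists of the vectors whose
  coordinates lie in the slice.\<close>

lemma tangent_inclusion:
 assumes M:"ck_atlas k M" and k:"k\<ge>1" and S:"sliced k M S" and c:"slice_chart k M p S c"
 and a:"a:cdom c" "a:S"
 shows "tangent_map (sub_mfd k M S) M (%x. x) a`tangent_space (sub_mfd k M S) a=tvec M c a`E p"
proof -
 let ?N = "sub_mfd k M S" and ?c = "sub_chart c S p"
 note ca = slice_adm[OF c] note cc = adm_chart[OF ca]
 have p:"p<=cdim c" using c by (simp add: slice_chart_def)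
 have N:"ck_atlas k ?N" by (rule ck_atlas_sub[OF M S])
 have cN:"?c:atlas_of ?N" using c by (auto simp: atlas_sub)
 hence adm:"admissible_chart k ?N ?c" using N by (simp add: ck_atlas_def)
 have ts:"tangent_space ?N a=tvec ?N ?c a`E p" using tangent_space_eq[OF N k adm, of a] a by simp
 have d:"dch ?c a f w=dch c a f w" if w:"w:E p" for f w by (rule dch_sub_chart[OF c a w])
 have "tangent_map ?N M (%x. x) a (tvec ?N ?c a w)=tvec M c a w" if w:"w:E p" for w
 proof (subst tangent_map_tvec[OF N ck_atlas_charted[OF M] k adm])
 show "a:cdom ?c" using a by simp
 show "EX V. opn ?N V&a:V&ck_on k ?N V (%y. cmap e y i)"
 if e:"e:charts_at M a" and i:"i<cdim e" for e i
 proof -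
 have ea:"admissible_chart k M e" "a:cdom e" using e M by (auto simp: charts_at_def ck_atlas_def)
 show ?thesis using ck_on_restrict[OF ck_atlas_charted[OF M] S adm_opn[OF ea(1)] adm_coord[OF ea(1) i]] ea(2) by blast
 qed
 show "(%e. if e:charts_at M a then %i. if i<cdim e then dch ?c a (%y. cmap e y i) w else 0 else (%_. 0))=tvec M c a w"
 by (auto simp: tvec_def trans_vec_def d[OF w] fun_eq_iff)
 qed
 thus ?thesis unfolding ts image_image by simp
qed

section \<open>Smooth retracts are submanifolds\<close>

lemma openin_preimage_E:
 assumes "openin (Euc n) U" "continuous_on U f" "!!x. x:U==>f x:E m" "openin (Euc m) W"
 shows "openin (Euc n) {x:U. f x:W}"
proof -
 have U:"U<=E n" using openin_subset[OF assms(1)] .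
 hence i:"E n\<inter>U=U" by auto
 have "continuous_map (subtopology (Euc n) U) (Euc m) f"
 unfolding cm_Euclidean_space_iff_continuous_on using assms(2,3) by (simp add: i Pi_iff)
 from openin_continuous_map_preimage[OF this assms(4)]
 have "openin (subtopology (Euc n) U) {x:U. f x:W}" by (simp add: i)
 thus ?thesis using assms(1) openin_trans_full by blast
qed

text \<open>Charts may be composed with any diffeomorphism between open subsets of Euclidean space, here given by explicit mutually inverse maps.\<close>

lemma chart_reparam:
 assumes M:"charted M" and c:"admissible_chart k M c"
 and V:"openin (Euc (cdim c)) V" "V<=cmap c`cdom c"
 and W:"openin (Euc (cdim c)) W"
 and h:"!!v. v:V==>h v:W&h' (h v)=v" "!!w. w:W==>h' w:V&h (h' w)=w"
 and hk:"!!i. i<cdim c==>ck_real k (cdim c) V (%v. h v i)"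
 and hk':"!!i. i<cdim c==>ck_real k (cdim c) W (%w. h' w i)"
 defines "e\<equiv>\<lparr>chart_dom={y:cdom c. cmap c y:V}, chart_dim=cdim c, chart_map=(%y. h (cmap c y))\<rparr>"
 shows "admissible_chart k M e&cmap e`cdom e=W"
proof -
 note cc = adm_chart[OF c]
 have e:"cdom e={y:cdom c. cmap c y:V}" "cdim e=cdim c" "!!y. cmap e y=h (cmap c y)"
 by (simp_all add: e_def)
 have WE:"W<=E (cdim c)" and VE:"V<=E (cdim c)" using openin_subset[OF W] openin_subset[OF V(1)] by auto
 have iV:"E (cdim c)\<inter>V=V" and iW:"E (cdim c)\<inter>W=W" using WE VE by auto
 have hc:"continuous_on V h" and hc':"continuous_on W h'"
 using continuous_into_E[of "cdim c" V h, OF ck_real_cont[OF V(1) hk]]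
 continuous_into_E[of "cdim c" W h', OF ck_real_cont[OF W hk']] h WE VE by blast+
 have isc:"is_chart (space_of M) e&cmap e`cdom e=W"
 proof (rule conjI; rule is_chartI[where W = W and g = "%w. cinv c (h' w)"])
 show "openin (space_of M) (cdom e)" unfolding e by (rule chart_open_preimage[OF cc V(1)])
 thus "openin (space_of M) (cdom e)" .
 show 1:"openin (Euc (cdim e)) W" by (simp add: e W)
 show 1:"openin (Euc (cdim e)) W" by (simp add: e W)
 show 2:"cmap e x:W&cinv c (h' (cmap e x))=x" if "x:cdom e" for x
 using that h(1) chart_inv_map[OF cc] by (simp add: e)
 show 2:"cmap e x:W&cinv c (h' (cmap e x))=x" if "x:cdom e" for x
 using that h(1) chart_inv_map[OF cc] by (simp add: e)
 have 3:"cinv c (h' v):cdom e&cmap e (cinv c (h' v))=v" if "v:W" for v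
 proof -
 have *: "h' v:cmap c`cdom c" using h(2)[OF that] V(2) by blast
 show ?thesis using h(2)[OF that] chart_map_inv[OF *] chart_inv_dom[OF *] by (simp add: e)
 qed
 show "cinv c (h' v):cdom e&cmap e (cinv c (h' v))=v" if "v:W" for v using 3[OF that] .
 show "cinv c (h' v):cdom e&cmap e (cinv c (h' v))=v" if "v:W" for v using 3[OF that] .
 have "continuous_map (subtopology (space_of M) (cdom e)) (subtopology (Euc (cdim c)) V) (cmap c)"
 using continuous_map_from_subtopology_mono[OF chart_cont[OF cc], of "cdom e"]
 by (auto simp: continuous_map_in_subtopology e)
 moreover have "continuous_map (subtopology (Euc (cdim c)) V) (Euc (cdim c)) h"
 unfolding cm_Euclidean_space_iff_continuous_on using hc h(1) WE by (auto simp: iV)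
 ultimately have 4:"continuous_map (subtopology (space_of M) (cdom e)) (Euc (cdim e)) (cmap e)"
 using continuous_map_compose by (fastforce simp: e o_def e_def)
 show "continuous_map (subtopology (space_of M) (cdom e)) (Euc (cdim e)) (cmap e)" by (rule 4)
 show "continuous_map (subtopology (space_of M) (cdom e)) (Euc (cdim e)) (cmap e)" by (rule 4)
 have "continuous_map (subtopology (Euc (cdim c)) W) (Euc (cdim c)) h'"
 unfolding cm_Euclidean_space_iff_continuous_on using hc' h(2) VE by (auto simp: iW)
 hence "continuous_map (subtopology (Euc (cdim c)) W) (subtopology (Euc (cdim c)) (cmap c`cdom c)) h'"
 using h(2) V(2) by (auto simp: continuous_map_in_subtopology)
 from continuous_map_compose[OF this chart_inv_cont[OF cc]]
 have 5:"continuous_map (subtopology (Euc (cdim e)) W) (space_of M) (%w. cinv c (h' w))"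
 by (simp add: e o_def)
 show "continuous_map (subtopology (Euc (cdim e)) W) (space_of M) (%w. cinv c (h' w))" by (rule 5)
 show "continuous_map (subtopology (Euc (cdim e)) W) (space_of M) (%w. cinv c (h' w))" by (rule 5)
 qed
 hence img:"cmap e`cdom e=W" by blast
 have ec:"is_chart (space_of M) e" using isc by blast
 have einv:"cinv e w=cinv c (h' w)" if w:"w:W" for w
 proof -
 have "w:cmap e`cdom e" using img w by simp
 then obtain x where x:"x:cdom e" "w=h (cmap c x)" by (auto simp: e)
 have "cinv e w=x" using chart_inv_map[OF ec x(1)] x(2) by (simp add: e)
 moreover have "cinv c (h' w)=x" using x h(1) chart_inv_map[OF cc] by (simp add: e)
 ultimately show ?thesis by simp
 qed
 have esub:"cdom e<=cdom c" by (auto simp: e)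
 have oe:"opn M (cdom e)" using ec opn_openin unfolding is_chart_def by blast
 have "admissible_chart k M e" unfolding admissible_chart_def
 proof (intro conjI ballI ec)
 fix c' assume c':"c':atlas_of M"
 note cc' = charted_chart[OF M c']
 have oc':"opn M (cdom c')" by (rule opn_dom[OF M c'])
 let ?S = "cmap e`(cdom e\<inter>cdom c')" and ?T = "cmap c`(cdom c\<inter>cdom c')"
 have S:"openin (Euc (cdim e)) ?S" by (rule chart_open_image[OF ec oc'])
 have T:"openin (Euc (cdim c)) ?T" by (rule chart_open_image[OF cc oc'])
 have SW:"?S<=W" using img by blast
 have ck:"ck_real k (cdim c) ?T (%v. cmap c' (cinv c v) i)" if "i<cdim c'" for i
 using c c' that by (auto simp: admissible_chart_def ck_transition_def ck_vec_def o_def)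
 have "ck_real k (cdim e) ?S (%w. cmap c' (cinv c (h' w)) i)" if "i<cdim c'" for i
 proof (rule ck_real_comp[OF S T, where f = h' and g = "%v. cmap c' (cinv c v) i", OF _ ck[OF that]])
 show "h' w:?T" if "w:?S" for w using that h(1) by (auto simp: e)
 show "ck_real k (cdim e) ?S (%w. h' w i)" if "i<cdim c" for i
 using ck_real_subset[OF hk'[OF that] W _ SW] S by (simp add: e)
 qed
 hence "ck_real k (cdim e) ?S (%w. cmap c' (cinv e w) i)" if "i<cdim c'" for i
 by (rule ck_real_eq[OF _ S]) (use that SW einv in auto)
 thus "ck_transition k e c'" by (simp add: ck_transition_def ck_vec_def o_def)
 have "ck_on k M (cdom e) (%y. cmap e y i)" if i:"i<cdim e" for i unfolding ck_on_def
 proof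
 fix c1 assume c1:"c1:atlas_of M"
 note cc1 = charted_chart[OF M c1]
 let ?R = "cmap c1`(cdom c1\<inter>cdom e)"
 have R:"openin (Euc (cdim c1)) ?R" by (rule chart_open_image[OF cc1 oe])
 have ce:"ck_on k M (cdom e) (%y. cmap c y j)" if "j<cdim c" for j
 by (rule ck_on_subset[OF M adm_opn[OF c] oe esub adm_coord[OF c that]])
 have "ck_real k (cdim c1) ?R (%v. h (cmap c (cinv c1 v)) i)"
 by (rule ck_real_comp[OF R V(1), where f = "%v. cmap c (cinv c1 v)" and g = "%v. h v i"])
 (use hk i ce c1 chart_inv_map[OF cc1] in "auto simp: e ck_on_def")
 thus "ck_real k (cdim c1) ?R (%v. cmap e (cinv c1 v) i)" by (simp add: e)
 qed
 thus "ck_transition k c' e" using c' by (auto simp: ck_transition_def ck_vec_def ck_on_def o_def)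
 qed
 thus ?thesis using img by blast
qed

text \<open>Gauss--Jordan elimination straightens the range of an idempotent matrix to a coordinate
  subspace.\<close>

lemma idempotent_straighten:
 fixes Q :: "nat=>nat=>real"
 assumes idem:"!!i j. i<d==>j<d==>(SUM l<d. Q i l * Q l j)=Q i j"
 obtains p T S where "p<=d"
 "!!i j. i<d==>j<d==>(SUM l<d. T i l * S l j)=(if i=j then 1 else 0)"
 "!!i j. i<d==>j<d==>(SUM l<d. S i l * T l j)=(if i=j then 1 else 0)"
 "!!i j. p<=i==>i<d==>j<d==>(SUM l<d. T i l * Q l j)=0"
 "!!i j. i<d==>j<p==>(SUM l<d. Q i l * S l j)=S i j"
proof -
 define A where "A=Matrix.mat d d (%(i, j). Q i j)"
 have A:"A:carrier_mat d d" by (simp add: A_def)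
 define C where "C=gauss_jordan_single A"
 note gj = gauss_jordan_single[OF A C_def[symmetric]]
 obtain P R where PR:"C=P * A" "P:carrier_mat d d" "R:carrier_mat d d" "P * R=1\<^sub>m d" "R * P=1\<^sub>m d"
 using gj(4) by blast
 have C:"C:carrier_mat d d" using gj(2) .
 hence dC:"dim_row C=d" "dim_col C=d" by auto
 obtain f where f:"pivot_fun C f d" using gj(3) unfolding row_echelon_form_def dC by blast
 note piv = pivot_funD[OF dC(1) f]
 define p where "p=(LEAST i. d<=i\<or>f i=d)"
 have pd:"p<=d" unfolding p_def by (rule Least_le) simp
 have fp:"f i<d" if "i<p" for i
 proof -
 have "\<not> (d<=i\<or>f i=d)" using not_less_Least[of i "%i. d<=i\<or>f i=d"] that by (simp add: p_def)
 thus ?thesis using piv(1)[of i] by auto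
 qed
 have fd:"f i=d" if "p<=i" "i<d" for i using that
 proof (induction i rule: dec_induct)
 case base
 have "d<=p\<or>f p=d" unfolding p_def by (rule LeastI[of _ d]) simp
 thus ?case using base by simp
 next
 case (step i)
 thus ?case using piv(1)[of "Suc i"] piv(3)[of i] by auto
 qed
 have mm:"(X * Y)$$(i, j)=(SUM l<d. X$$(i, l) * Y$$(l, j))"
 if "X:carrier_mat d d" "Y:carrier_mat d d" "i<d" "j<d" for X Y :: "real mat" and i j
 using that by (auto simp: scalar_prod_def lessThan_atLeast0 intro!: sum.cong)
 define T where "T i j=P$$(i, j)" for i j
 define S where "S i j=R$$(i, j)" for i j
 have TS:"(SUM l<d. T i l * S l j)=(if i=j then 1 else 0)" if "i<d" "j<d" for i j
 using mm[OF PR(2,3) that] PR(4) that by (simp add: T_def S_def)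
 have ST:"(SUM l<d. S i l * T l j)=(if i=j then 1 else 0)" if "i<d" "j<d" for i j
 using mm[OF PR(3,2) that] PR(5) that by (simp add: T_def S_def)
 have TQ:"(SUM l<d. T i l * Q l j)=C$$(i, j)" if "i<d" "j<d" for i j
 using mm[OF PR(2) A that] that unfolding PR(1) by (simp add: T_def A_def)
 have RC:"R * C=A" unfolding PR(1) assoc_mult_mat[OF PR(3,2) A, symmetric] PR(5) using A by simp
 have SQ:"S i j=Q i (f j)" if "i<d" "j<p" for i j
 proof -
 have j:"j<d" "f j<d" using that pd fp by auto
 have "Q i (f j)=(SUM l<d. R$$(i, l) * C$$(l, f j))"
 using mm[OF PR(3) C that(1) j(2)] RC that(1) j(2) by (simp add: A_def)
 also have "...=(SUM l<d. (if j=l then 1 else 0) * R$$(i, l))"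
 by (intro sum.cong refl) (use piv(4,5)[OF j(1)] j in auto)
 also have "...=R$$(i, j)" using j by (simp add: delta_sum)
 finally show ?thesis by (simp add: S_def)
 qed
 show ?thesis
 proof (rule that[OF pd TS ST])
 show "(SUM l<d. T i l * Q l j)=0" if "p<=i" "i<d" "j<d" for i j
 using TQ[OF that(2,3)] piv(2)[OF that(2), of j] fd[OF that(1,2)] that(3) by simp
 show "(SUM l<d. Q i l * S l j)=S i j" if "i<d" "j<p" for i j
 using SQ[OF _ that(2)] idem[OF that(1) fp[OF that(2)]] that(1) by simp
 qed auto
qed

lemma lin_app_inverse:
 assumes "!!i j. i<d==>j<d==>(SUM l<d. T i l * S l j)=(if i=j then 1 else (0::real))" "w:E d"
 shows "lin_app d d T (lin_app d d S w)=w"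
proof (rule E_eqI[OF lin_app_E assms(2)])
 fix i assume i:"i<d"
 have "lin_app d d T (lin_app d d S w) i=(SUM l<d. SUM j<d. T i l * S l j * w j)"
 using i by (simp add: lin_app_def sum_distrib_left mult.assoc)
 also have "...=(SUM j<d. (SUM l<d. T i l * S l j) * w j)" by (subst sum.swap) (simp add: sum_distrib_right)
 also have "...=w i" using i by (simp add: assms(1) delta_sum)
 finally show "lin_app d d T (lin_app d d S w) i=w i" .
qed

text \<open>Near a fixed point \<open>x0\<close> of a retraction \<open>p\<close> with derivative \<open>Q\<close> (an idempotent), the map
  \<open>Q (p v - x0) + (1 - Q) (v - p v)\<close> has derivative the identity, and it carries the fixed points of \<open>p\<close>
  exactly to the range of \<open>Q\<close>.\<close>

lemma retract_slice:
 assumes M:"ck_atlas k M" and k:"k\<ge>1" and P:"ck_map k M M P" and PP:"!!x. x:points M==>P (P x)=P x"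
 and a:"a:points M" "P a=a"
 obtains p e where "slice_chart k M p (P`points M) e" "a:cdom e"
proof -
 note Mc = ck_atlas_charted[OF M]
 obtain c where c:"c:atlas_of M" "a:cdom c" using charted_cover[OF Mc a(1)] by blast
 have ca:"admissible_chart k M c" using M c(1) by (simp add: ck_atlas_def)
 note cc = adm_chart[OF ca]
 define d where "d=cdim c"
 define U where "U=cmap c`(cdom c\<inter>P -` cdom c)"
 have oP:"opn M (P -` cdom c)" by (rule opn_vimage[OF ck_map_cont[OF P] adm_opn[OF ca]])
 have U:"openin (Euc d) U" unfolding U_def d_def by (rule chart_open_image[OF cc oP])
 have Uc:"U<=cmap c`cdom c" by (auto simp: U_def)
 define x0 where "x0=cmap c a"
 have x0:"x0:U" using c a by (auto simp: x0_def U_def)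
 define p where "p v=cmap c (P (cinv c v))" for v
 have inv:"cinv c v:cdom c" "P (cinv c v):cdom c" "cinv c v:points M" if "v:U" for v
 using that chart_inv_map[OF cc] chart_dom_subset[OF cc] by (auto simp: U_def)
 have pU:"p v:U" if "v:U" for v using inv[OF that] PP[OF inv(3)[OF that]] by (auto simp: U_def p_def)
 have pp:"p (p v)=p v" if "v:U" for v
 using PP[OF inv(3)[OF that]] chart_inv_map[OF cc inv(2)[OF that]] by (simp add: p_def)
 have px0:"p x0=x0" using a c by (simp add: p_def x0_def chart_inv_map[OF cc])
 have pE:"p v:E d" if "v:U" for v using chart_map_E[OF cc inv(2)[OF that]] by (simp add: p_def d_def)
 have pk:"ck_real k d U (%v. p v i)" if "i<d" for i
 using ck_on_coord[OF P c(1), of i] c(1) that unfolding ck_on_def U_def d_def p_def by blast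
 define Q where "Q=jac p x0"
 have Qpd:"has_pd j (%v. p v i) x0 (Q i j)" if "i<d" "j<d" for i j
 using ck_real_has_pd[OF k U pk[OF that(1)] that(2) x0] by (simp add: Q_def jac_def)
 have idem:"(SUM l<d. Q i l * Q l j)=Q i j" if "i<d" "j<d" for i j
 proof -
 have "Q i j=pder j (%v. p (p v) i) x0"
 unfolding Q_def jac_def by (rule pd_cong[OF U x0 that(2)]) (simp add: pp)
 also have "...=(SUM l<d. pder l (%v. p v i) (p x0) * pder j (%v. p v l) x0)"
 by (rule partial_deriv_comp[OF U U pU pk[OF that(1)] pk k x0 that(2)])
 finally show ?thesis by (simp add: px0 Q_def jac_def)
 qed
 obtain r T S where r:"r<=d"
 and TS:"!!i j. i<d==>j<d==>(SUM l<d. T i l * S l j)=(if i=j then 1 else 0)"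
 and ST:"!!i j. i<d==>j<d==>(SUM l<d. S i l * T l j)=(if i=j then 1 else 0)"
 and TQ:"!!i j. r<=i==>i<d==>j<d==>(SUM l<d. T i l * Q l j)=0"
 and QS:"!!i j. i<d==>j<r==>(SUM l<d. Q i l * S l j)=S i j"
 proof (rule idempotent_straighten[of d Q])
 show "(SUM l<d. Q i l * Q l j)=Q i j" if "i<d" "j<d" for i j by (rule idem[OF that])
 qed (rule that; assumption)
 define \<psi> where "\<psi> v=(%i. if i<d then (SUM l<d. Q i l*(2 * p v l-x0 l-v l))+(v i-p v i) else 0)" for v
 have \<psi>E:"\<psi> v:E d" for v by (simp add: \<psi>_def E_iff)
 have \<psi>k:"ck_real k d U (%v. \<psi> v i)" if "i<d" for i
 proof -
 have "ck_real k d U (%v. (SUM l<d. Q i l*(2 * p v l-x0 l-v l))+(v i-p v i))"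
 by (intro ck_real_add[OF U] ck_real_sum[OF U] ck_real_mult[OF U] ck_real_diff[OF U] ck_real_const[OF U] pk ck_real_coord[OF U])
 (use that in auto)
 thus ?thesis using that by (simp add: \<psi>_def)
 qed
 have \<psi>j:"pder j (%v. \<psi> v i) x0=(if i=j then 1 else 0)" if "i<d" "j<d" for i j
 proof -
 have co:"has_pd j (%v. v l) x0 (if l=j then 1 else 0)" for l by (auto simp: has_pd_def)
 have "has_pd j (%v. (SUM l<d. Q i l*(2 * p v l-x0 l-v l))+(v i-p v i)) x0
 ((SUM l<d. Q i l*(2 * Q l j-0-(if l=j then 1 else 0)))+((if i=j then 1 else 0)-Q i j))" unfolding has_pd_def
 by (intro DERIV_add DERIV_sum DERIV_cmult DERIV_diff DERIV_const co[unfolded has_pd_def] Qpd[unfolded has_pd_def])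
 (use that in auto)
 moreover have "(SUM l<d. Q i l*(2 * Q l j-0-(if l=j then 1 else 0)))=2 * Q i j-Q i j"
 proof -
 have "(SUM l<d. Q i l*(2 * Q l j-0-(if l=j then 1 else 0)))=(SUM l<d. 2*(Q i l * Q l j)-(if j=l then 1 else 0) * Q i l)"
 by (intro sum.cong refl) (auto simp: algebra_simps)
 thus ?thesis using that by (simp add: sum_subtractf sum_distrib_left[symmetric] idem delta_sum)
 qed
 ultimately have "has_pd j (%v. \<psi> v i) x0 (if i=j then 1 else 0)" using that by (simp add: \<psi>_def)
 thus ?thesis by (rule has_pd_imp)
 qed
 obtain V g where V:"openin (Euc d) V" "x0:V" "V<=U" "inj_on \<psi> V"
 "openin (Euc d) (\<psi>`V)" "!!x. x:V==>g (\<psi> x)=x"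
 "!!i. i<d==>ck_real k d (\<psi>`V) (%y. g y i)"
 by (rule inverse_function[OF k U \<psi>k \<psi>E x0 \<psi>j]) auto
 define V' where "V'={v:V. p v:V}"
 have pc:"continuous_on V p"
 using continuous_into_E[of d U p, OF ck_real_cont[OF U pk] pE] V(3) continuous_on_subset by blast
 have V':"openin (Euc d) V'" unfolding V'_def by (rule openin_preimage_E[OF V(1) pc _ V(1)]) (use pE V(3) in auto)
 have gc:"continuous_on (\<psi>`V) g"
 by (rule continuous_into_E[of d, OF ck_real_cont[OF V(5) V(7)]]) (use V(6) openin_subset[OF V(1)] in auto)
 have "{w:\<psi>`V. g w:V'}=\<psi>`V'" using V(6) by (auto simp: V'_def)
 hence \<psi>V':"openin (Euc d) (\<psi>`V')"
 using openin_preimage_E[OF V(5) gc _ V'] V(6) openin_subset[OF V(1)] by fastforce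
 have oE:"openin (Euc d) (E d)" by simp
 have lin:"ck_real k' d (E d) (%w. lin_app d d L w i)" for k' L i
 by (rule ck_real_lin[OF oE]) (rule ck_real_coord[OF oE])
 have linc:"continuous_on (E d) (lin_app d d L)" for L
 by (rule continuous_into_E[OF ck_real_cont[OF oE lin] lin_app_E])
 define W where "W={w:E d. lin_app d d S w:\<psi>`V'}"
 have W:"openin (Euc d) W" unfolding W_def by (rule openin_preimage_E[OF oE linc lin_app_E \<psi>V'])
 define h where "h v=lin_app d d T (\<psi> v)" for v
 define h' where "h' w=g (lin_app d d S w)" for w
 have S\<psi>: "lin_app d d S (h v)=\<psi> v" for v unfolding h_def by (rule lin_app_inverse[OF ST \<psi>E])
 have VV:"V'<=V" by (auto simp: V'_def)
 let ?e = "\<lparr>chart_dom={y:cdom c. cmap c y:V'}, chart_dim=d, chart_map=(%y. h (cmap c y))\<rparr>"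
 have e:"admissible_chart k M ?e&cmap ?e`cdom ?e=W"
 proof (rule chart_reparam[OF Mc ca, of V' W h h', folded d_def, OF V' _ W])
 show "V'<=cmap c`cdom c" using VV V(3) Uc by blast
 show "h v:W&h' (h v)=v" if "v:V'" for v
 using that VV V(6) S\<psi> lin_app_E by (auto simp: W_def h'_def h_def)
 show "h' w:V'&h (h' w)=w" if w:"w:W" for w
 proof -
 obtain v where v:"v:V'" "lin_app d d S w=\<psi> v" using w by (auto simp: W_def)
 have "h' w=v" using v V(6) VV by (auto simp: h'_def)
 moreover have "h v=w" unfolding h_def v(2)[symmetric]
 by (rule lin_app_inverse[OF TS]) (use w in "auto simp: W_def")
 ultimately show ?thesis using v(1) by simp
 qed
 show "ck_real k d V' (%v. h v i)" if "i<d" for i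
 unfolding h_def by (rule ck_real_lin[OF V']) (use ck_real_subset[OF \<psi>k U V'] VV V(3) in blast)
 show "ck_real k d W (%w. h' w i)" if "i<d" for i unfolding h'_def
 proof (rule ck_real_comp[OF W V(5), where f = "lin_app d d S" and g = "%y. g y i"])
 show "lin_app d d S w:\<psi>`V" if "w:W" for w using that VV by (auto simp: W_def)
 show "ck_real k d W (%w. lin_app d d S w l)" for l
 by (rule ck_real_subset[OF lin oE W]) (auto simp: W_def)
 qed (use V(7)[OF that] in auto)
 qed
 have fix_iff:"y:P`points M\<longleftrightarrow>p (cmap c y)=cmap c y" if y:"y:cdom ?e" for y
 proof -
 have yc:"y:cdom c" "cmap c y:U" "y:points M" using y VV V(3) chart_dom_subset[OF cc] by auto
 have "y:P`points M\<longleftrightarrow>P y=y" using PP yc(3) by (metis imageE imageI)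
 also have "...\<longleftrightarrow>cmap c (P y)=cmap c y"
 using inv(2)[OF yc(2)] yc(1) chart_inv_map[OF cc] by metis
 finally show ?thesis by (simp add: p_def chart_inv_map[OF cc yc(1)])
 qed
 have slice:"p v=v\<longleftrightarrow>h v:E r" if v:"v:V'" for v
 proof
 assume pv:"p v=v"
 have "\<psi> v l=(SUM m<d. Q l m*(v m-x0 m))" if "l<d" for l using that by (simp add: \<psi>_def pv)
 hence "(SUM l<d. T i l*\<psi> v l)=(SUM l<d. SUM m<d. T i l * Q l m*(v m-x0 m))" for i
 by (simp add: sum_distrib_left mult.assoc)
 also have "... i=(SUM m<d. (SUM l<d. T i l * Q l m)*(v m-x0 m))" for i
 by (subst sum.swap) (simp add: sum_distrib_right)
 finally have "(SUM l<d. T i l*\<psi> v l)=(SUM m<d. (SUM l<d. T i l * Q l m)*(v m-x0 m))" for i .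
 hence "h v i=0" if "r<=i" for i using TQ[OF that] by (simp add: h_def lin_app_def)
 thus "h v:E r" by (simp add: E_iff)
 next
 assume hE:"h v:E r"
 have vU:"v:U" and vV:"v:V" "p v:V" using v V(3) by (auto simp: V'_def)
 \<comment> \<open>\<open>\<psi> v = S (h v)\<close> lies in the range of \<open>Q\<close>, so \<open>Q\<close> fixes it\<close>
 have Q\<psi>: "(SUM l<d. Q i l*\<psi> v l)=\<psi> v i" if i:"i<d" for i
 proof -
 have \<psi>S:"\<psi> v l=(SUM j<d. S l j * h v j)" if "l<d" for l
 using fun_cong[OF S\<psi>[of v], of l] that by (simp add: lin_app_def)
 have "(SUM l<d. Q i l*\<psi> v l)=(SUM l<d. SUM j<d. Q i l * S l j * h v j)"
 by (simp add: \<psi>S sum_distrib_left mult.assoc)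
 also have "...=(SUM j<d. (SUM l<d. Q i l * S l j) * h v j)" by (subst sum.swap) (simp add: sum_distrib_right)
 also have "...=(SUM j<d. S i j * h v j)"
 proof (intro sum.cong refl)
 fix j show "(SUM l<d. Q i l * S l j) * h v j=S i j * h v j"
 using QS[OF i, of j] hE by (cases "j<r") (auto simp: E_iff)
 qed
 finally show ?thesis using \<psi>S[OF i] by simp
 qed
 define u where "u l=v l-p v l" for l
 have \<psi>u:"\<psi> v i=(SUM l<d. Q i l*(p v l-x0 l))+u i-(SUM l<d. Q i l * u l)" if "i<d" for i
 proof -
 have "(SUM l<d. Q i l*(2 * p v l-x0 l-v l))=(SUM l<d. Q i l*(p v l-x0 l)-Q i l * u l)"
 by (intro sum.cong refl) (simp add: u_def algebra_simps)
 thus ?thesis using that by (simp add: \<psi>_def u_def sum_subtractf)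
 qed
 have QQ:"(SUM l<d. Q i l*(SUM m<d. Q l m * z m))=(SUM m<d. Q i m * z m)" if i:"i<d" for i z
 proof -
 have "(SUM l<d. Q i l*(SUM m<d. Q l m * z m))=(SUM l<d. SUM m<d. Q i l * Q l m * z m)"
 by (simp add: sum_distrib_left mult.assoc)
 also have "...=(SUM m<d. (SUM l<d. Q i l * Q l m) * z m)" by (subst sum.swap) (simp add: sum_distrib_right)
 finally show ?thesis using i by (simp add: idem)
 qed
 have uQ:"u i=(SUM l<d. Q i l * u l)" if i:"i<d" for i
 proof -
 have "(SUM l<d. Q i l*\<psi> v l)=(SUM l<d. Q i l*(SUM m<d. Q l m*(p v m-x0 m))+Q i l * u l-Q i l*(SUM m<d. Q l m * u m))"
 by (intro sum.cong refl) (simp add: \<psi>u algebra_simps)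
 also have "...=(SUM m<d. Q i m*(p v m-x0 m))" by (simp add: sum.distrib sum_subtractf QQ[OF i])
 finally show ?thesis using Q\<psi>[OF i] \<psi>u[OF i] by simp
 qed
 have "\<psi> v i=(SUM l<d. Q i l*(p v l-x0 l))" if "i<d" for i using \<psi>u[OF that] uQ[OF that] by linarith
 moreover have "\<psi> (p v) i=(SUM l<d. Q i l*(p v l-x0 l))" if "i<d" for i
 using that by (simp add: \<psi>_def pp[OF vU])
 ultimately have "\<psi> (p v)=\<psi> v" by (intro E_eqI[OF \<psi>E \<psi>E]) simp
 thus "p v=v" using V(4) vV by (auto simp: inj_on_def)
 qed
 have "cmap ?e`(cdom ?e\<inter>P`points M)=cmap ?e`cdom ?e\<inter>E r"
 proof (intro equalityI subsetI)
 fix w assume "w:cmap ?e`(cdom ?e\<inter>P`points M)"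
 then obtain y where y:"y:cdom ?e" "y:P`points M" "w=h (cmap c y)" by auto
 thus "w:cmap ?e`cdom ?e\<inter>E r" using fix_iff[OF y(1)] slice[of "cmap c y"] by auto
 next
 fix w assume "w:cmap ?e`cdom ?e\<inter>E r"
 then obtain y where y:"y:cdom ?e" "w=h (cmap c y)" "w:E r" by auto
 hence "y:P`points M" using fix_iff[OF y(1)] slice[of "cmap c y"] by auto
 thus "w:cmap ?e`(cdom ?e\<inter>P`points M)" using y by auto
 qed
 hence "slice_chart k M r (P`points M) ?e" using e r by (simp add: slice_chart_def)
 moreover have "a:cdom ?e" using c(2) V(2) px0 by (simp add: V'_def x0_def)
 ultimately show ?thesis using that by blast
qed

section \<open>Dimension and components of submanifolds\<close>

text \<open>The transition between two slice charts restricts to mutually inverse matrices of sizes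
  \<open>p' \<times> p\<close> and \<open>p \<times> p'\<close>; the traces of the two products are \<open>p\<close> and \<open>p'\<close>.\<close>

lemma trans_slice:
 assumes M:"ck_atlas k M" and c:"slice_chart k M p S c" and c':"slice_chart k M p' S c'"
 and a:"a:S" "a:cdom c" "a:cdom c'" and w:"w:E p"
 shows "trans_vec c c' a w:E p'"
proof -
 note ca = slice_adm[OF c] and ca' = slice_adm[OF c'] note cc = adm_chart[OF ca]
 have p:"p<=cdim c" using c by (simp add: slice_chart_def)
 have aE:"cmap c a:E p" by (rule slice_coord_zero[OF c a(2,1)])
 let ?U = "cmap c`(cdom c\<inter>cdom c')"
 have U:"openin (Euc p) (?U\<inter>E p)" by (rule openin_E_Int[OF chart_open_image[OF cc adm_opn[OF ca']] p])
 have 0:"pder j (%v. cmap c' (cinv c v) i) (cmap c a)=0" if "j<p" "p'<=i" for i j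
 proof -
 have "pder j (%v. cmap c' (cinv c v) i) (cmap c a)=pder j (%v. 0) (cmap c a)"
 proof (rule pd_cong[OF U _ that(1)])
 fix v assume "v:?U\<inter>E p"
 then obtain x where x:"x:cdom c" "x:cdom c'" "v=cmap c x" "cmap c x:E p" by auto
 have "x:S" by (rule slice_mem[OF c x(1,4)])
 hence "cmap c' x:E p'" by (rule slice_coord_zero[OF c' x(2)])
 thus "cmap c' (cinv c v) i=0" using that(2) x chart_inv_map[OF cc] by (simp add: E_iff)
 qed (use a aE in auto)
 also have "...=0" by (rule has_pd_imp) (simp add: has_pd_def)
 finally show ?thesis .
 qed
 have "dch c a (%y. cmap c' y i) w=0" if "p'<=i" for i
 unfolding dch_def by (rule sum.neutral) (use 0[OF _ that] w in "auto simp: E_iff not_less[symmetric]")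
 thus ?thesis by (auto simp: trans_vec_def E_iff)
qed

lemma trans_vec_unit:
 assumes "w:E p" "p<=cdim c"
 shows "trans_vec c c' x w i=(SUM j<p. trans_vec c c' x (%m. if m=j then 1 else 0) i * w j)"
proof -
 have "dch c x f (%m. if m=j then 1 else 0)=pder j (%v. f (cinv c v)) (cmap c x)" if "j<p" for f j
 proof -
 have "dch c x f (%m. if m=j then 1 else 0) =
 (SUM m<cdim c. (if j=m then 1 else 0) * pder m (%v. f (cinv c v)) (cmap c x))"
 unfolding dch_def by (intro sum.cong refl) auto
 thus ?thesis using that assms(2) by (simp add: delta_sum)
 qed
 moreover have "dch c x f w=(SUM j<p. pder j (%v. f (cinv c v)) (cmap c x) * w j)" for f
 unfolding dch_def by (rule sum.mono_neutral_right) (use assms in "auto simp: E_iff")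
 ultimately show ?thesis by (simp add: trans_vec_def)
qed

lemma slice_dim_unique:
 assumes M:"ck_atlas k M" and k:"k\<ge>1" and c:"slice_chart k M p S c" and c':"slice_chart k M p' S c'"
 and a:"a:S" "a:cdom c" "a:cdom c'"
 shows "p=p'"
proof -
 define u where "u j=(%m::nat. if m=j then 1 else (0::real))" for j
 define X where "X i j=trans_vec c c' a (u j) i" for i j
 define Y where "Y i j=trans_vec c' c a (u j) i" for i j
 have uE:"u j:E q" if "j<q" for j q using that by (auto simp: u_def E_iff)
 have half:"(SUM i<p. trans_vec c' c a (trans_vec c c' a (u i)) i)=(SUM i<p. SUM l<p'. trans_vec c' c a (u l) i * trans_vec c c' a (u i) l)"
 if c:"slice_chart k M p S c" and c':"slice_chart k M p' S c'" and a:"a:S" "a:cdom c" "a:cdom c'" for p p' c c'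
 proof (intro sum.cong refl)
 fix i assume "i:{..<p}"
 hence "trans_vec c c' a (u i):E p'" by (intro trans_slice[OF M c c' a] uE) simp
 from trans_vec_unit[OF this, of c' c a i]
 show "trans_vec c' c a (trans_vec c c' a (u i)) i=(SUM l<p'. trans_vec c' c a (u l) i * trans_vec c c' a (u i) l)"
 using c' by (simp add: slice_chart_def u_def)
 qed
 have one:"(SUM i<p. trans_vec c' c a (trans_vec c c' a (u i)) i)=real p"
 if c:"slice_chart k M p S c" and c':"slice_chart k M p' S c'" and a:"a:S" "a:cdom c" "a:cdom c'" for p p' c c'
 proof -
 have "trans_vec c' c a (trans_vec c c' a (u i))=u i" if "i<p" for i
 proof -
 have "u i:E (cdim c)" using that c by (intro uE) (simp add: slice_chart_def)
 thus ?thesis using trans_vec_trans[OF M slice_adm[OF c] slice_adm[OF c'] slice_adm[OF c] k a(2,3,2)]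
 trans_vec_refl[OF adm_chart[OF slice_adm[OF c]] a(2)] by simp
 qed
 hence "(SUM i<p. trans_vec c' c a (trans_vec c c' a (u i)) i)=(SUM i<p. u i i)" by (intro sum.cong) auto
 thus ?thesis by (simp add: u_def)
 qed
 have "real p=(SUM i<p. SUM l<p'. Y i l * X l i)" using one[OF c c' a] half[OF c c' a] by (simp add: X_def Y_def)
 also have "...=(SUM l<p'. SUM i<p. X l i * Y i l)" by (subst sum.swap) (simp add: mult.commute)
 also have "...=real p'" using one[OF c' c a(1,3,2)] half[OF c' c a(1,3,2)] by (simp add: X_def Y_def)
 finally show ?thesis by simp
qed

lemma connectedin_box:
 assumes "x:E n" "r > 0" shows "connectedin (Euc n) (box_at n x r)"
proof -
 define \<gamma> where "\<gamma> y t=(%i. x i+t*(y i-x i))" for y and t :: real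
 have xb:"x:box_at n x r" using assms by (simp add: box_at_def)
 have in_box:"\<gamma> y t:box_at n x r" if "y:box_at n x r" "t:{0..1}" for y t
 unfolding \<gamma>_def using box_segment[OF xb that(1), of t] that(2) by simp
 have "connectedin (Euc n) (\<gamma> y`{0..1})" if y:"y:box_at n x r" for y
 proof (rule connectedin_continuous_map_image)
 have "continuous_map euclideanreal (Euc n) (%t i. if i<n then x i+t*(y i-x i) else 0)"
 unfolding continuous_map_componentwise_Euclidean_space by (auto intro!: continuous_intros)
 moreover have "(%i. if i<n then x i+t*(y i-x i) else 0)=\<gamma> y t" for t
 using assms(1) y by (auto simp: \<gamma>_def box_at_def E_iff fun_eq_iff)
 ultimately show "continuous_map euclideanreal (Euc n) (\<gamma> y)" by simp
 show "connectedin euclideanreal {0..1::real}" by simp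
 qed
 hence "connectedin (Euc n) (\<Union>y\<in>box_at n x r. \<gamma> y`{0..1})"
 proof (intro connectedin_Union)
 have "x=\<gamma> y 0" for y by (simp add: \<gamma>_def)
 thus "\<Inter> ((%y. \<gamma> y`{0..1})`box_at n x r)~={}"
 by (metis (no_types, lifting) INT_I atLeastAtMost_iff empty_iff image_eqI order_refl zero_le_one)
 qed auto
 moreover have "(\<Union>y\<in>box_at n x r. \<gamma> y`{0..1})=box_at n x r"
 proof
 show "box_at n x r<=(\<Union>y\<in>box_at n x r. \<gamma> y`{0..1})"
 proof
 fix y assume "y:box_at n x r"
 moreover have "y=\<gamma> y 1" by (simp add: \<gamma>_def)
 ultimately show "y\<in>(\<Union>y\<in>box_at n x r. \<gamma> y`{0..1})" by (intro UN_I[of y] image_eqI[of _ _ 1]) auto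
 qed
 qed (use in_box in auto)
 ultimately show ?thesis by simp
qed

lemma chart_box_nbhd:
 assumes c:"is_chart X c" and x:"x:cdom c" and W:"openin X W" "x:W"
 obtains r where "r > 0" "box_at (cdim c) (cmap c x) r<=cmap c`(cdom c\<inter>W)"
 "openin X {y:cdom c. cmap c y:box_at (cdim c) (cmap c x) r}"
 "{y:cdom c. cmap c y:box_at (cdim c) (cmap c x) r}<=W"
 "x:{y:cdom c. cmap c y:box_at (cdim c) (cmap c x) r}"
proof -
 have "openin (Euc (cdim c)) (cmap c`(cdom c\<inter>W))" by (rule chart_open_image[OF c]) (simp add: W openin_Int)
 then obtain r where r:"r > 0" "box_at (cdim c) (cmap c x) r<=cmap c`(cdom c\<inter>W)"
 using x W(2) unfolding openin_E_iff by blast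
 have "y:W" if "y:cdom c" "cmap c y:box_at (cdim c) (cmap c x) r" for y
 using that r(2) chart_bij[OF c] by (auto simp: inj_on_def subset_iff image_iff)
 moreover have "cmap c x:box_at (cdim c) (cmap c x) r" using r(1) chart_map_E[OF c x] by (simp add: box_at_def)
 ultimately show ?thesis using that[OF r chart_open_preimage[OF c openin_box_at]] x by blast
qed

lemma locally_connected_charted:
 assumes M:"charted M" shows "locally_connected_space (space_of M)" unfolding locally_connected_space
proof (intro allI impI)
 fix W x assume Wx:"openin (space_of M) W&x:W"
 hence "x:points M" using openin_subset by blast
 then obtain c where c:"c:atlas_of M" "x:cdom c" using charted_cover[OF M] by blast
 note cc = charted_chart[OF M c(1)]
 let ?n = "cdim c" and ?x = "cmap c x"
 obtain r where r:"r > 0" "box_at ?n ?x r<=cmap c`(cdom c\<inter>W)"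
 "openin (space_of M) {y:cdom c. cmap c y:box_at ?n ?x r}"
 "{y:cdom c. cmap c y:box_at ?n ?x r}<=W" "x:{y:cdom c. cmap c y:box_at ?n ?x r}"
 using chart_box_nbhd[OF cc c(2)] Wx by blast
 have "connectedin (Euc ?n) (box_at ?n ?x r)" by (rule connectedin_box[OF chart_map_E[OF cc c(2)] r(1)])
 hence "connectedin (subtopology (Euc ?n) (cmap c`cdom c)) (box_at ?n ?x r)"
 using r(2) by (auto simp: connectedin_subtopology)
 from connectedin_continuous_map_image[OF chart_inv_cont[OF cc] this]
 have "connectedin (space_of M) (cinv c`box_at ?n ?x r)" .
 moreover have "cinv c`box_at ?n ?x r={y:cdom c. cmap c y:box_at ?n ?x r}"
 proof (intro equalityI subsetI)
 fix y assume "y:cinv c`box_at ?n ?x r"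
 then obtain v where v:"v:box_at ?n ?x r" "y=cinv c v" by blast
 hence *: "v:cmap c`cdom c" using r(2) by blast
 show "y:{y:cdom c. cmap c y:box_at ?n ?x r}" using v chart_inv_dom[OF *] chart_map_inv[OF *] by simp
 next
 fix y assume "y:{y:cdom c. cmap c y:box_at ?n ?x r}"
 thus "y:cinv c`box_at ?n ?x r" using chart_inv_map[OF cc] by (intro image_eqI[of _ _ "cmap c y"]) auto
 qed
 ultimately show "EX U. openin (space_of M) U&connectedin (space_of M) U&x:U&U<=W"
 using r by (intro exI[of _ "{y:cdom c. cmap c y:box_at ?n ?x r}"]) auto
qed

lemma finite_components:
 assumes "compact_space X" "locally_connected_space X"
 shows "finite (connected_components_of X)"
proof -
 have o:"ALL C:connected_components_of X. openin X C"
 using openin_connected_components_of_locally_connected_space[OF assms(2)] by blast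
 then obtain \<F> where F:"finite \<F>" "\<F><=connected_components_of X" "topspace X<=\<Union>\<F>"
 using assms(1) Union_connected_components_of[of X] unfolding compact_space_alt by (metis order_refl)
 have "connected_components_of X<=\<F>"
 proof
 fix C assume C:"C:connected_components_of X"
 hence "C~={}" "C<=topspace X"
 using nonempty_connected_components_of connected_components_of_subset by blast+
 then obtain x D where "x:C" "D:\<F>" "x:D" using F(3) by blast
 hence "C=D" using C F(2) pairwise_disjoint_connected_components_of[of X] unfolding pairwise_def disjnt_def by blast
 thus "C:\<F>" using \<open>D \<in> \<F>\<close> by simp
 qed
 thus ?thesis using F(1) finite_subset by blast
qed

lemma adm_restrict:
 assumes M:"charted M" and c:"admissible_chart k M c" and W:"openin (space_of M) W"
 shows "admissible_chart k M (c\<lparr>chart_dom := cdom c\<inter>W\<rparr>)"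
proof -
 note cc = adm_chart[OF c]
 let ?V = "cmap c`(cdom c\<inter>W)"
 have V:"openin (Euc (cdim c)) ?V" by (rule chart_open_image[OF cc opn_openin[OF W]])
 have "admissible_chart k M \<lparr>chart_dom={y:cdom c. cmap c y:?V}, chart_dim=cdim c, chart_map=(%y. cmap c y)\<rparr> &
 cmap \<lparr>chart_dom={y:cdom c. cmap c y:?V}, chart_dim=cdim c, chart_map=(%y. cmap c y)\<rparr> `
 cdom \<lparr>chart_dom={y:cdom c. cmap c y:?V}, chart_dim=cdim c, chart_map=(%y. cmap c y)\<rparr>=?V"
 by (rule chart_reparam[OF M c V _ V, of "%v. v" "%v. v"]) (auto intro: ck_real_coord[OF V])
 moreover have "{y:cdom c. cmap c y:?V}=cdom c\<inter>W" using chart_bij[OF cc] by (auto simp: inj_on_def)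
 moreover have "c\<lparr>chart_dom := cdom c\<inter>W\<rparr>=\<lparr>chart_dom=cdom c\<inter>W, chart_dim=cdim c, chart_map=(%y. cmap c y)\<rparr>"
 by simp
 ultimately show ?thesis by (metis (no_types, lifting))
qed

lemma slice_restrict:
 assumes M:"charted M" and c:"slice_chart k M p S c" and W:"openin (space_of M) W" and S':"W\<inter>S=W\<inter>S'"
 shows "slice_chart k M p S' (c\<lparr>chart_dom := cdom c\<inter>W\<rparr>)"
proof -
 note ca = slice_adm[OF c]
 have img:"cmap c`(cdom c\<inter>S)=cmap c`cdom c\<inter>E p" using c by (simp add: slice_chart_def)
 have "cmap c`(cdom c\<inter>W\<inter>S')=cmap c`(cdom c\<inter>W)\<inter>E p"
 proof (intro equalityI subsetI)
 fix v assume "v:cmap c`(cdom c\<inter>W\<inter>S')"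
 thus "v:cmap c`(cdom c\<inter>W)\<inter>E p" using img S' by blast
 next
 fix v assume "v:cmap c`(cdom c\<inter>W)\<inter>E p"
 then obtain x where x:"x:cdom c" "x:W" "v=cmap c x" "v:E p" by blast
 hence "x:S" using slice_mem[OF c] by blast
 thus "v:cmap c`(cdom c\<inter>W\<inter>S')" using x S' by blast
 qed
 thus ?thesis using adm_restrict[OF M ca W] c by (simp add: slice_chart_def)
qed

text \<open>The dimension is locally constant by \<open>slice_dim_unique\<close>, hence constant on components, and a compact locally connected space has finitely many components.\<close>

lemma sliced_components:
 assumes M:"ck_atlas k M" and k:"k\<ge>1" and S:"sliced k M S" and cpt:"compactin (space_of M) S"
 shows "finite (connected_components_of (subtopology (space_of M) S))"
 "!!K. K:connected_components_of (subtopology (space_of M) S) ==>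
 compactin (space_of M) K&(EX p. embedded_submanifold k M p K)"
proof -
 let ?Y = "subtopology (space_of M) S"
 note Mc = ck_atlas_charted[OF M]
 have SM:"S<=points M" using S by (simp add: sliced_def)
 have tY:"topspace ?Y=S" using SM by auto
 have lc:"locally_connected_space ?Y" using locally_connected_charted[OF charted_sub[OF S]] by (simp add: space_sub)
 have cs:"compact_space ?Y" using cpt by (simp add: compactin_subspace)
 show "finite (connected_components_of ?Y)" by (rule finite_components[OF cs lc])
 fix K assume K:"K:connected_components_of ?Y"
 have "compactin ?Y K" using closedin_compact_space[OF cs closedin_connected_components_of[OF K]] .
 hence cK:"compactin (space_of M) K" by (simp add: compactin_subtopology)
 have KS:"K<=S" using connected_components_of_subset[OF K] tY by simp
 have oK:"openin ?Y K" by (rule openin_connected_components_of_locally_connected_space[OF lc K])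
 then obtain W where W:"openin (space_of M) W" "K=W\<inter>S" by (auto simp: openin_subtopology)
 have conK:"connectedin ?Y K" by (rule connectedin_connected_components_of[OF K])
 define D where "D p={a:K. EX c. slice_chart k M p S c&a:cdom c}" for p
 have oD:"openin ?Y (D p)" for p
 proof (subst openin_subopen, intro ballI)
 fix a assume "a:D p"
 then obtain c where c:"slice_chart k M p S c" "a:cdom c" "a:K" by (auto simp: D_def)
 have "openin ?Y (cdom c\<inter>K)"
 proof (rule openin_Int[OF _ oK, THEN back_subst[of "openin ?Y"]])
 show "openin ?Y (cdom c\<inter>S)"
 using adm_chart[OF slice_adm[OF c(1)]] unfolding is_chart_def openin_subtopology by blast
 qed (use KS in auto)
 thus "EX T. openin ?Y T&a:T&T<=D p" using c by (intro exI[of _ "cdom c\<inter>K"]) (auto simp: D_def)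
 qed
 obtain a0 where a0:"a0:K" using nonempty_connected_components_of[OF K] by blast
 obtain p c0 where p:"slice_chart k M p S c0" "a0:cdom c0" using S a0 KS unfolding sliced_def by blast
 have cov:"K<=D p\<union>(\<Union>q\<in>-{p}. D q)"
 proof
 fix a assume a:"a:K"
 then obtain q c where "slice_chart k M q S c" "a:cdom c" using S KS unfolding sliced_def by blast
 hence "a:D q" using a by (auto simp: D_def)
 thus "a\<in>D p\<union>(\<Union>q\<in>-{p}. D q)" by (cases "q=p") auto
 qed
 have disj:"D p\<inter>(\<Union>q\<in>-{p}. D q)={}"
 proof (rule ccontr)
 assume "D p\<inter>(\<Union>q\<in>-{p}. D q)~={}"
 then obtain x q where x:"x:D p" "q~=p" "x:D q" by blast
 then obtain c c' where "slice_chart k M p S c" "x:cdom c" "slice_chart k M q S c'" "x:cdom c'" "x:S"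
 using KS by (auto simp: D_def)
 thus False using slice_dim_unique[OF M k, of p S c q c' x] x(2) by blast
 qed
 have "K<=D p"
 proof (rule ccontr)
 assume "\<not> K<=D p"
 hence 2:"K\<inter>(\<Union>q\<in>-{p}. D q)~={}" using cov by blast
 have 1:"K\<inter>D p~={}" using a0 p by (auto simp: D_def)
 have "openin ?Y (\<Union>q\<in>-{p}. D q)" using oD by blast
 thus False using conK oD[of p] cov disj 1 2 unfolding connectedin by blast
 qed
 hence "EX c. slice_chart k M p K c&a:cdom c" if "a:K" for a
 proof -
 have "a:D p" using that \<open>K <= D p\<close> by blast
 then obtain c where c:"slice_chart k M p S c" "a:cdom c" by (auto simp: D_def)
 have "slice_chart k M p K (c\<lparr>chart_dom := cdom c\<inter>W\<rparr>)"
 by (rule slice_restrict[OF Mc c(1) W(1)]) (use W(2) in auto)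
 thus ?thesis using c(2) that W(2) by (intro exI[of _ "c\<lparr>chart_dom := cdom c\<inter>W\<rparr>"]) auto
 qed
 hence "embedded_submanifold k M p K" using KS SM by (auto simp: embedded_submanifold_def)
 thus "compactin (space_of M) K&(EX p. embedded_submanifold k M p K)" using cK by blast
qed

lemma components_sliced:
 assumes M:"charted M" and H:"Hausdorff_space (space_of M)" and SM:"S<=points M"
 and fin:"finite (connected_components_of (subtopology (space_of M) S))"
 and K:"!!K. K:connected_components_of (subtopology (space_of M) S) ==>
 compactin (space_of M) K&(EX p. embedded_submanifold k M p K)"
 shows "sliced k M S" unfolding sliced_def
proof (intro conjI SM ballI)
 let ?Y = "subtopology (space_of M) S"
 have tY:"topspace ?Y=S" using SM by auto
 fix a assume a:"a:S"
 then obtain K where aK:"K:connected_components_of ?Y" "a:K"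
 using Union_connected_components_of[of ?Y] tY by blast
 obtain p c where c:"slice_chart k M p K c" "a:cdom c"
 using K[OF aK(1)] aK(2) unfolding embedded_submanifold_def by blast
 define R where "R=\<Union>(connected_components_of ?Y-{K})"
 have "compactin (space_of M) R" unfolding R_def by (rule compactin_Union) (use fin K in auto)
 hence "closedin (space_of M) R" using H compactin_imp_closedin by blast
 hence W:"openin (space_of M) (points M-R)" by blast
 have KR:"S=K\<union>R" unfolding R_def using Union_connected_components_of[of ?Y] tY aK(1) by blast
 have "K\<inter>R={}" unfolding R_def using aK(1) pairwise_disjoint_connected_components_of[of ?Y]
 unfolding pairwise_def disjnt_def by blast
 hence "slice_chart k M p S (c\<lparr>chart_dom := cdom c\<inter>(points M-R)\<rparr>)" "a~:R"
 using aK(2) KR by (auto intro!: slice_restrict[OF M c(1) W])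
 thus "EX p c. slice_chart k M p S c&a:cdom c"
 using c(2) a SM by (intro exI[of _ p] exI[of _ "c\<lparr>chart_dom := cdom c\<inter>(points M-R)\<rparr>"]) auto
qed

section \<open>The matrix exponential\<close>

lemma pow_mat_Suc_left:
 fixes A :: "'b::comm_semiring_1 mat"
 assumes "A:carrier_mat n n"
 shows "A ^\<^sub>m (Suc m)=A * A ^\<^sub>m m"
 using assms by (induction m) (simp_all add: assoc_mult_mat[of A n n _ n A n] pow_carrier_mat)

lemma mat_mult_entry:
 assumes "X:carrier_mat n n" "Y:carrier_mat n n" "i<n" "j<n"
 shows "(X * Y)$$(i, j)=(SUM l<n. X$$(i, l) * Y$$(l, j))"
 using assms by (auto simp: scalar_prod_def lessThan_atLeast0 intro!: sum.cong)

lemma smult_pow_mat: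
 fixes A :: "real mat"
 assumes A:"A:carrier_mat n n"
 shows "(t \<cdot>\<^sub>m A) ^\<^sub>m m=t^m \<cdot>\<^sub>m A ^\<^sub>m m"
proof (induction m)
 case 0 thus ?case using A by auto
next
 case (Suc m)
 have P:"A ^\<^sub>m m:carrier_mat n n" using A by (rule pow_carrier_mat)
 have "(t \<cdot>\<^sub>m A) ^\<^sub>m Suc m=(t^m \<cdot>\<^sub>m A ^\<^sub>m m)*(t \<cdot>\<^sub>m A)" by (simp add: Suc)
 also have "...=t^m \<cdot>\<^sub>m (A ^\<^sub>m m*(t \<cdot>\<^sub>m A))"
 using P A by (intro mult_smult_assoc_mat) auto
 also have "...=t^m \<cdot>\<^sub>m (t \<cdot>\<^sub>m (A ^\<^sub>m m * A))" using P A by (subst mult_smult_distrib) auto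
 finally show ?case using A P by (auto intro!: eq_matI)
qed

definition mexp :: "real mat=>real=>nat=>nat=>real" where
 "mexp B t i j=suminf (%m. (B ^\<^sub>m m)$$(i, j)/fact m * t^m)"

lemma mat_exp_entry:
 assumes "B:carrier_mat n n" "i<n" "j<n"
 shows "mat_exp (t \<cdot>\<^sub>m B)$$(i, j)=mexp B t i j"
proof -
 have "B ^\<^sub>m m:carrier_mat n n" for m using assms(1) by (rule pow_carrier_mat)
 hence "((t \<cdot>\<^sub>m B) ^\<^sub>m m)$$(i, j)/fact m=(B ^\<^sub>m m)$$(i, j)/fact m * t^m" for m
 using assms carrier_matD[of "B ^\<^sub>m m" n n] by (simp add: smult_pow_mat[OF assms(1)] mult.commute)
 thus ?thesis using assms by (simp add: mat_exp_def mexp_def)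
qed

lemma mat_app_exp:
 assumes "B:carrier_mat n n"
 shows "mat_app (mat_exp (t \<cdot>\<^sub>m B)) v=lin_app n n (mexp B t) v"
proof
 fix i
 have d:"dim_row (mat_exp (t \<cdot>\<^sub>m B))=n" "dim_col (mat_exp (t \<cdot>\<^sub>m B))=n" using assms by (auto simp: mat_exp_def)
 show "mat_app (mat_exp (t \<cdot>\<^sub>m B)) v i=lin_app n n (mexp B t) v i"
 unfolding mat_app_def lin_app_def d using mat_exp_entry[OF assms] by (auto intro!: sum.cong)
qed

subsection \<open>Jordan form of the exponential\<close>

text \<open>A matrix in Jordan form, given by its diagonal \<open>la\<close> and its superdiagonal \<open>s\<close>.\<close>

definition jform :: "(nat=>complex)=>(nat=>complex)=>nat=>nat=>complex" where
 "jform la s a b=(if a=b then la a else if b=Suc a then s a else 0)"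

lemma jordan_matrix_jform:
 fixes n_as :: "(nat\<times>complex) list"
 shows "EX la s. (ALL a. s a~=0-->la a=la (Suc a)) &
 (ALL a<sum_list (map fst n_as). ALL b<sum_list (map fst n_as). jordan_matrix n_as$$(a, b)=jform la s a b)"
proof (induction n_as)
 case Nil thus ?case by (intro exI[of _ "%_. 0"]) auto
next
 case (Cons na n_as)
 obtain n z where na:"na=(n, z)" by force
 let ?N = "sum_list (map fst n_as)"
 obtain la s where IH:"!!a. s a~=0==>la a=la (Suc a)"
 "!!a b. a<?N==>b<?N==>jordan_matrix n_as$$(a, b)=jform la s a b" using Cons by blast
 define la' where "la' a=(if a<n then z else la (a-n))" for a
 define s' where "s' a=(if Suc a<n then 1 else if a<n then 0 else s (a-n))" for a
 have "la' a=la' (Suc a)" if "s' a~=0" for a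
 using that IH(1)[of "a-n"] by (auto simp: s'_def la'_def Suc_diff_le split: if_splits)
 moreover have "jordan_matrix (na # n_as)$$(a, b)=jform la' s' a b" if "a<n+?N" "b<n+?N" for a b
 proof -
 have e:"jordan_matrix (na # n_as)$$(a, b) =
 (if a<n then if b<n then jordan_block n z$$(a, b) else 0
 else if b<n then 0 else jordan_matrix n_as$$(a-n, b-n))"
 unfolding na jordan_matrix_Cons using that by (subst index_mat_four_block(1)) auto
 consider "a<n" "b<n" | "a<n" "\<not> b<n" | "\<not> a<n" "b<n" | "\<not> a<n" "\<not> b<n" by blast
 thus ?thesis
 proof cases
 case 1 thus ?thesis unfolding e by (auto simp: jform_def la'_def s'_def)
 next
 case 2 thus ?thesis unfolding e by (auto simp: jform_def la'_def s'_def)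
 next
 case 3 thus ?thesis unfolding e by (auto simp: jform_def la'_def s'_def)
 next
 case 4
 hence "(b=Suc a)=(b-n=Suc (a-n))" "(a=b)=(a-n=b-n)" "\<not> Suc a<n" by auto
 thus ?thesis using 4 that IH(2)[of "a-n" "b-n"] unfolding e by (simp add: jform_def la'_def s'_def)
 qed
 qed
 ultimately show ?case by (intro exI[of _ la'] exI[of _ s']) (auto simp: na)
qed

definition chain_prod :: "(nat=>complex)=>nat=>nat=>complex" where
 "chain_prod s a b=(if a<=b then \<Prod>c\<in>{a..<b}. s c else 0)"

lemma chain_prod_refl [simp]:"chain_prod s a a=1" by (simp add: chain_prod_def)

lemma chain_prod_eigen:
 assumes "!!a. s a~=0==>la a=la (Suc a)"
 shows "chain_prod s a b~=0==>la a=(la b::complex)"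
proof (induction b)
 case 0 thus ?case by (auto simp: chain_prod_def split: if_splits)
next
 case (Suc b)
 show ?case
 proof (cases "a=Suc b")
 case False
 hence "a<=b" using Suc.prems by (auto simp: chain_prod_def split: if_splits)
 hence "chain_prod s a b~=0" "s b~=0" using Suc.prems by (auto simp: chain_prod_def)
 thus ?thesis using Suc.IH assms by metis
 qed simp
qed

lemma jform_pow:
 assumes J:"J:carrier_mat n n" "!!a b. a<n==>b<n==>J$$(a, b)=jform la s a b"
 and s:"!!a. s a~=0==>la a=la (Suc a)" and ab:"a<n" "b<n"
 shows "(J ^\<^sub>m m)$$(a, b) = of_nat (m choose (b-a)) * la a^(m-(b-a)) * chain_prod s a b" using ab
proof (induction m arbitrary: b)
 case 0
 thus ?case using J(1) by (auto simp: chain_prod_def binomial_eq_0)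
next
 case (Suc m)
 have P:"J ^\<^sub>m m:carrier_mat n n" using J(1) by (rule pow_carrier_mat)
 have "(J ^\<^sub>m Suc m)$$(a, b)=(SUM l<n. (J ^\<^sub>m m)$$(a, l) * J$$(l, b))"
 using mat_mult_entry[OF P J(1) Suc.prems] by simp
 also have "...=(SUM l<n. (if b=l then 1 else 0)*((J ^\<^sub>m m)$$(a, l) * la b) +
 (if Suc l=b then (J ^\<^sub>m m)$$(a, l) * s l else 0))"
 using Suc.prems by (intro sum.cong refl) (auto simp: J(2) jform_def)
 also have "...=(J ^\<^sub>m m)$$(a, b) * la b+(if b=0 then 0 else (J ^\<^sub>m m)$$(a, b-1) * s (b-1))"
 proof -
 have "(SUM l<n. (if Suc l=b then (J ^\<^sub>m m)$$(a, l) * s l else 0))=(if b=0 then 0 else (J ^\<^sub>m m)$$(a, b-1) * s (b-1))"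
 proof (cases b)
 case (Suc b')
 have "(SUM l<n. (if Suc l=b then (J ^\<^sub>m m)$$(a, l) * s l else 0))=(SUM l<n. (if b'=l then 1 else 0)*((J ^\<^sub>m m)$$(a, l) * s l))"
 by (intro sum.cong refl) (auto simp: Suc)
 thus ?thesis using Suc \<open>b < n\<close> by (simp add: delta_sum)
 qed simp
 thus ?thesis using Suc.prems by (simp add: sum.distrib delta_sum)
 qed
 also have "... = of_nat (Suc m choose (b-a)) * la a^(Suc m-(b-a)) * chain_prod s a b"
 proof (cases "a<=b")
 case False
 thus ?thesis using Suc.IH[of b] Suc.IH[of "b-1"] Suc.prems by (auto simp: chain_prod_def)
 next
 case True
 show ?thesis
 proof (cases "a=b")
 case True
 thus ?thesis using Suc.IH[of b] Suc.IH[of "b-1"] Suc.prems by (cases b) (auto simp: chain_prod_def)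
 next
 case False
 then obtain b' where b':"b=Suc b'" "a<=b'" using \<open>a <= b\<close> by (cases b) auto
 define d where "d=b'-a"
 have bd:"b-a=Suc d" using b' by (simp add: d_def)
 have cp:"chain_prod s a b=chain_prod s a b' * s b'" using b' by (simp add: chain_prod_def)
 show ?thesis
 proof (cases "chain_prod s a b=0")
 case True
 thus ?thesis using Suc.IH[of b] Suc.IH[of b'] Suc.prems b' cp by (auto simp: mult.assoc)
 next
 case False
 hence l:"la a=la b" using chain_prod_eigen[of s la, OF s] by blast
 have "la a^(m-Suc d) * la a=la a^(m-d)" if "Suc d<=m"
 using that by (simp add: power_Suc2[symmetric] Suc_diff_le[symmetric] del: power_Suc)
 hence *: "of_nat (m choose Suc d) * la a^(m-Suc d) * la a = of_nat (m choose Suc d) * la a^(m-d)"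
 by (cases "Suc d<=m") (simp_all add: binomial_eq_0 mult.assoc)
 have e1:"(J ^\<^sub>m m)$$(a, b) = of_nat (m choose Suc d) * la a^(m-Suc d) * chain_prod s a b"
 using Suc.IH[of b] Suc.prems by (simp only: bd)
 have e2:"(J ^\<^sub>m m)$$(a, b') = of_nat (m choose d) * la a^(m-d) * chain_prod s a b'"
 using Suc.IH[of b'] Suc.prems b'(1) by (simp only: d_def)
 have "(J ^\<^sub>m m)$$(a, b) * la b+(J ^\<^sub>m m)$$(a, b') * s b' =
 (of_nat (m choose Suc d) * la a^(m-Suc d) * la a + of_nat (m choose d) * la a^(m-d)) * chain_prod s a b"
 unfolding e1 e2 l[symmetric] cp by (simp add: algebra_simps)
 also have "...=(of_nat (m choose Suc d) + of_nat (m choose d)) * la a^(m-d) * chain_prod s a b"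
 unfolding * by (simp add: algebra_simps)
 finally have "(J ^\<^sub>m m)$$(a, b) * la b+(J ^\<^sub>m m)$$(a, b') * s b' =
 (of_nat (m choose Suc d) + of_nat (m choose d)) * la a^(m-d) * chain_prod s a b" .
 moreover have "b~=0" "b-1=b'" using b' by auto
 ultimately show ?thesis unfolding bd by (simp add: add.commute)
 qed
 qed
 qed
 finally show ?case .
qed

definition jexp :: "(nat=>complex)=>(nat=>complex)=>real=>nat=>nat=>complex" where
 "jexp la s t a b=exp (la a * of_real t)*(of_real t^(b-a)/fact (b-a)) * chain_prod s a b"

lemma jexp_sums:
 "(%m. of_nat (m choose d) * z^(m-d) * c/fact m * of_real t^m) sums (exp (z * of_real t)*(of_real t^d/fact d)*(c::complex))"
proof -
 have "(%m. (z * of_real t)^m /\<^sub>R fact m) sums exp (z * of_real t)" by (rule exp_converges)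
 hence "(%m. (z * of_real t)^m/fact m*((of_real t^d/fact d) * c)) sums (exp (z * of_real t)*((of_real t^d/fact d) * c))"
 by (intro sums_mult2) (simp add: scaleR_conv_of_real divide_simps mult.commute)
 moreover have "(z * of_real t)^m/fact m*((of_real t^d/fact d) * c) =
 of_nat ((m+d) choose d) * z^((m+d)-d) * c/fact (m+d) * of_real t^(m+d)" for m
 proof -
 have "(of_nat ((m+d) choose d)::complex)=fact (m+d)/(fact d * fact m)" by (subst binomial_fact) auto
 thus ?thesis by (simp add: power_mult_distrib power_add mult_ac)
 qed
 ultimately have "(%m. of_nat ((m+d) choose d) * z^((m+d)-d) * c/fact (m+d) * of_real t^(m+d)) sums (exp (z * of_real t)*((of_real t^d/fact d) * c))"
 by simp
 hence "(%m. of_nat (m choose d) * z^(m-d) * c/fact m * of_real t^m) sums (exp (z * of_real t)*((of_real t^d/fact d) * c))"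
 by (subst (asm) sums_zero_iff_shift[of d "%m. of_nat (m choose d) * z^(m-d) * c/fact m * of_real t^m"]) (auto simp: binomial_eq_0)
 thus ?thesis by (simp add: mult.assoc)
qed

lemma conj_mult:
 fixes P :: "complex mat"
 assumes "P:carrier_mat n n" "X:carrier_mat n n" "Q:carrier_mat n n" "J:carrier_mat n n"
 shows "(P * X * Q)*(P * J * Q)=P*(X*((Q * P) * J)) * Q"
 using assms by (simp add: assoc_mult_mat[of _ n n _ n _ n] mult_carrier_mat[of _ n n _ n])

text \<open>Everything about the flow \<open>exp (t B)\<close> is read off from this explicit form.\<close>

lemma jordan_exponential:
 assumes B:"B:carrier_mat n n"
 obtains P Q la s where
 "!!i j. i<n==>j<n==>(SUM a<n. P i a * Q a j)=(if i=j then 1 else 0)"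
 "!!a b. a<n==>b<n==>(SUM i<n. Q a i * P i b)=(if a=b then 1 else 0)"
 "!!a. s a~=0==>la a=la (Suc a)"
 "!!i j t. i<n==>j<n==>(%m. complex_of_real ((B ^\<^sub>m m)$$(i, j)/fact m * t^m)) sums (SUM a<n. SUM b<n. P i a * jexp la s t a b * Q b j)"
 "!!a. a<n==>eigenvalue (map_mat complex_of_real B) (la a)"
 "!!a j. a<n==>j<n==>(SUM i<n. Q a i * complex_of_real (B$$(i, j)))=(SUM b<n. jform la s a b * Q b j)"
proof -
 let ?B = "map_mat complex_of_real B"
 have cB:"?B:carrier_mat n n" using B by simp
 obtain as where "char_poly ?B=(\<Prod>a\<leftarrow>as. [:- a, 1:])" using char_poly_factorized[OF cB] by blast
 then obtain n_as where jnf:"jordan_nf ?B n_as" using jordan_nf_exists[OF cB] by blast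
 define J where "J=jordan_matrix n_as"
 obtain P Q where PQ:"P * Q=1\<^sub>m n" "Q * P=1\<^sub>m n" "?B=P * J * Q" and
 c:"J:carrier_mat n n" "P:carrier_mat n n" "Q:carrier_mat n n"
 using jnf cB unfolding jordan_nf_def J_def[symmetric] similar_mat_def similar_mat_wit_def Let_def by auto
 have N:"sum_list (map fst n_as)=n" using c(1) unfolding J_def by (metis carrier_matD(1) jordan_matrix_dim(1))
 obtain la s where s:"!!a. s a~=0==>la a=la (Suc a)" and Jj:"!!a b. a<n==>b<n==>J$$(a, b)=jform la s a b"
 using jordan_matrix_jform[of n_as] unfolding N J_def by blast
 have pow:"?B ^\<^sub>m m=P * J ^\<^sub>m m * Q" for m
 proof (induction m)
 case 0 thus ?case using c PQ cB by simp
 next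
 case (Suc m)
 have Jm:"J ^\<^sub>m m:carrier_mat n n" using c(1) by (rule pow_carrier_mat)
 have "?B ^\<^sub>m Suc m=(P * J ^\<^sub>m m * Q)*(P * J * Q)" using Suc PQ(3) by simp
 also have "...=P*(J ^\<^sub>m m*((Q * P) * J)) * Q" by (rule conj_mult[OF c(2) Jm c(3,1)])
 also have "(Q * P) * J=J" unfolding PQ(2) using c(1) by simp
 finally show ?case by simp
 qed
 have sums:"(%m. complex_of_real ((B ^\<^sub>m m)$$(i, j)/fact m * t^m)) sums (SUM a<n. SUM b<n. P$$(i, a) * jexp la s t a b * Q$$(b, j))"
 if ij:"i<n" "j<n" for i j t
 proof -
 have "complex_of_real ((B ^\<^sub>m m)$$(i, j)/fact m * t^m) =
 (SUM a<n. SUM b<n. P$$(i, a)*(of_nat (m choose (b-a)) * la a^(m-(b-a)) * chain_prod s a b/fact m * of_real t^m) * Q$$(b, j))" for m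
 proof -
 have Jm:"J ^\<^sub>m m:carrier_mat n n" using c(1) by (rule pow_carrier_mat)
 have Bm:"B ^\<^sub>m m:carrier_mat n n" using B by (rule pow_carrier_mat)
 have "complex_of_real ((B ^\<^sub>m m)$$(i, j))=(?B ^\<^sub>m m)$$(i, j)"
 using ij carrier_matD[OF Bm] by (simp add: of_real_hom.mat_hom_pow[OF B, symmetric])
 also have "...=(SUM b<n. (SUM a<n. P$$(i, a)*(J ^\<^sub>m m)$$(a, b)) * Q$$(b, j))"
 proof -
 have "(P * J ^\<^sub>m m * Q)$$(i, j)=(SUM b<n. (P * J ^\<^sub>m m)$$(i, b) * Q$$(b, j))"
 by (rule mat_mult_entry[OF mult_carrier_mat[OF c(2) Jm] c(3) ij])
 also have "...=(SUM b<n. (SUM a<n. P$$(i, a)*(J ^\<^sub>m m)$$(a, b)) * Q$$(b, j))"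
 by (intro sum.cong refl arg_cong2[where f = "(*)"] mat_mult_entry[OF c(2) Jm ij(1)]) auto
 finally show ?thesis unfolding pow .
 qed
 also have "...=(SUM b<n. SUM a<n. P$$(i, a)*(J ^\<^sub>m m)$$(a, b) * Q$$(b, j))"
 by (simp add: sum_distrib_right)
 also have "...=(SUM a<n. SUM b<n. P$$(i, a)*(J ^\<^sub>m m)$$(a, b) * Q$$(b, j))" by (rule sum.swap)
 also have "...=(SUM a<n. SUM b<n. P$$(i, a)*(of_nat (m choose (b-a)) * la a^(m-(b-a)) * chain_prod s a b) * Q$$(b, j))"
 by (intro sum.cong refl) (simp add: jform_pow[OF c(1) Jj s])
 finally have e:"complex_of_real ((B ^\<^sub>m m)$$(i, j)) =
 (SUM a<n. SUM b<n. P$$(i, a)*(of_nat (m choose (b-a)) * la a^(m-(b-a)) * chain_prod s a b) * Q$$(b, j))" .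
 have "complex_of_real ((B ^\<^sub>m m)$$(i, j)/fact m * t^m)=complex_of_real ((B ^\<^sub>m m)$$(i, j))/fact m * of_real t^m"
 by simp
 thus ?thesis unfolding e sum_divide_distrib sum_distrib_right by (simp add: mult_ac)
 qed
 thus ?thesis unfolding jexp_def by (simp only:) (intro sums_sum sums_mult sums_mult2 jexp_sums)
 qed
 have eig:"eigenvalue ?B (la a)" if a:"a<n" for a
 proof -
 have "char_poly ?B=char_poly J" by (rule char_poly_similar) (use jnf in "simp add: jordan_nf_def J_def")
 moreover have "char_poly J=(\<Prod>a\<leftarrow>diag_mat J. [:- a, 1:])"
 by (rule char_poly_upper_triangular[OF c(1)])
 (use c(1) Jj in "auto simp: upper_triangular_def jform_def")
 moreover have "la a:set (diag_mat J)"
 using a c(1) Jj[OF a a] by (auto simp: diag_mat_def jform_def intro!: image_eqI[of _ _ a])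
 ultimately have "poly (char_poly ?B) (la a)=0"
 by (auto simp: poly_prod_list prod_list_zero_iff image_iff intro!: bexI[of _ "la a"])
 thus ?thesis unfolding eigenvalue_root_char_poly[OF cB] .
 qed
 have "Q*?B=Q*(P*(J * Q))" unfolding PQ(3) assoc_mult_mat[OF c(2,1,3)] ..
 also have "...=(Q * P)*(J * Q)" by (rule assoc_mult_mat[OF c(3,2) mult_carrier_mat[OF c(1,3)], symmetric])
 also have "...=J * Q" unfolding PQ(2) using c by (intro left_mult_one_mat[OF mult_carrier_mat[OF c(1,3)]])
 finally have QB:"Q*?B=J * Q" .
 have ode:"(SUM i<n. Q$$(a, i) * complex_of_real (B$$(i, j)))=(SUM b<n. jform la s a b * Q$$(b, j))" if aj:"a<n" "j<n" for a j
 proof -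
 have "(SUM i<n. Q$$(a, i) * complex_of_real (B$$(i, j)))=(SUM i<n. Q$$(a, i)*?B$$(i, j))"
 using aj B by (intro sum.cong) auto
 also have "...=(SUM b<n. J$$(a, b) * Q$$(b, j))"
 using mat_mult_entry[OF c(3) cB aj] mat_mult_entry[OF c(1,3) aj] QB by simp
 also have "...=(SUM b<n. jform la s a b * Q$$(b, j))" by (intro sum.cong) (use Jj aj in auto)
 finally show ?thesis .
 qed
 show ?thesis
 proof (rule that[of "%i a. P$$(i, a)" "%a j. Q$$(a, j)" s la, OF _ _ s sums eig ode])
 show "(SUM a<n. P$$(i, a) * Q$$(a, j))=(if i=j then 1 else 0)" if "i<n" "j<n" for i j
 using mat_mult_entry[OF c(2,3) that] PQ(1) that by simp
 show "(SUM i<n. Q$$(a, i) * P$$(i, b))=(if a=b then 1 else 0)" if "a<n" "b<n" for a b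
 using mat_mult_entry[OF c(3,2) that] PQ(2) that by simp
 qed auto
qed

subsection \<open>The differential equation\<close>

lemma mexp_summable:
 fixes B :: "real mat"
 assumes "B:carrier_mat n n" "i<n" "j<n"
 shows "summable (%m. (B ^\<^sub>m m)$$(i, j)/fact m * t^m)"
proof (rule jordan_exponential[OF assms(1)])
 fix P Q la s
 assume "!!i j t. i<n==>j<n==>(%m. complex_of_real ((B ^\<^sub>m m)$$(i, j)/fact m * t^m)) sums (SUM a<n. SUM b<n. P i a * jexp la s t a b * Q b j)"
 from this[OF assms(2,3)] show ?thesis using sums_summable summable_complex_of_real by blast
qed

lemma mexp_deriv:
 assumes B:"B:carrier_mat n n" and ij:"i<n" "j<n"
 shows "((%t. mexp B t i j) has_real_derivative (SUM l<n. B$$(i, l) * mexp B t l j)) (at t)" (is ?A)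
 and "((%t. mexp B t i j) has_real_derivative (SUM l<n. mexp B t i l * B$$(l, j))) (at t)" (is ?C)
proof -
 define c where "c i j m=(B ^\<^sub>m m)$$(i, j)/fact m" for i j m
 have Bm:"B ^\<^sub>m m:carrier_mat n n" for m using B by (rule pow_carrier_mat)
 have sm:"summable (%m. c i j m * t^m)" if "i<n" "j<n" for i j t
 unfolding c_def by (rule mexp_summable[OF B that])
 have d:"((%t. mexp B t i j) has_real_derivative suminf (%m. diffs (c i j) m * t^m)) (at t)"
 unfolding mexp_def c_def[symmetric] by (rule termdiffs_strong_converges_everywhere) (rule sm[OF ij])
 have diffs:"diffs (c i j) m=(B ^\<^sub>m Suc m)$$(i, j)/fact m" for m
 by (simp add: diffs_def c_def fact_Suc del: of_nat_Suc pow_mat.simps)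
 have L:"diffs (c i j) m * t^m=(SUM l<n. B$$(i, l)*(c l j m * t^m))" for m
 unfolding diffs pow_mat_Suc_left[OF B] mat_mult_entry[OF B Bm ij] c_def
 by (simp add: sum_divide_distrib sum_distrib_right mult.assoc)
 have R:"diffs (c i j) m * t^m=(SUM l<n. (c i l m * t^m) * B$$(l, j))" for m
 unfolding diffs pow_mat.simps mat_mult_entry[OF Bm B ij] c_def
 unfolding sum_divide_distrib sum_distrib_right by (intro sum.cong refl) (simp add: field_simps)
 have "suminf (%m. diffs (c i j) m * t^m)=(SUM l<n. B$$(i, l) * mexp B t l j)"
 unfolding L mexp_def c_def[symmetric] using ij
 by (subst suminf_sum) (auto intro!: sum.cong summable_mult sm suminf_mult)
 thus ?A using d by simp
 have "suminf (%m. diffs (c i j) m * t^m)=(SUM l<n. mexp B t i l * B$$(l, j))"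
 unfolding R mexp_def c_def[symmetric] using ij
 by (subst suminf_sum) (auto intro!: sum.cong summable_mult2 sm suminf_mult2[symmetric])
 thus ?C using d by simp
qed

lemma mexp_0:
 assumes "B:carrier_mat n n" "i<n" "j<n"
 shows "mexp B 0 i j=(if i=j then 1 else 0)"
proof -
 have "mexp B 0 i j=(B ^\<^sub>m 0)$$(i, j)/fact 0" unfolding mexp_def by (rule powser_zero)
 thus ?thesis using assms by simp
qed

lemma mexp_inverse:
 assumes B:"B:carrier_mat n n" and ij:"i<n" "j<n"
 shows "(SUM l<n. mexp B t i l * mexp B (- t) l j)=(if i=j then 1 else 0)"
proof -
 define W where "W t=(SUM l<n. mexp B t i l * mexp B (- t) l j)" for t
 have "(W has_real_derivative 0) (at t)" for t
 proof -
 have m:"((%t. mexp B (- t) l j) has_real_derivative-(SUM m<n. B$$(l, m) * mexp B (- t) m j)) (at t)" if "l<n" for l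
 using DERIV_chain2[OF mexp_deriv(1)[OF B that ij(2), of "- t"] DERIV_minus[OF DERIV_ident]] by simp
 have "(W has_real_derivative (SUM l<n. (SUM m<n. mexp B t i m * B$$(m, l)) * mexp B (- t) l j +
 - (SUM m<n. B$$(l, m) * mexp B (- t) m j) * mexp B t i l)) (at t)"
 unfolding W_def by (intro DERIV_sum DERIV_mult mexp_deriv(2)[OF B ij(1)] m) auto
 moreover have "(SUM l<n. (SUM m<n. mexp B t i m * B$$(m, l)) * mexp B (- t) l j +
 - (SUM m<n. B$$(l, m) * mexp B (- t) m j) * mexp B t i l)=0"
 proof -
 have "(SUM l<n. (SUM m<n. mexp B t i m * B$$(m, l)) * mexp B (- t) l j)=(SUM m<n. SUM l<n. mexp B t i m * B$$(m, l) * mexp B (- t) l j)"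
 unfolding sum_distrib_right by (rule sum.swap)
 also have "...=(SUM l<n. (SUM m<n. B$$(l, m) * mexp B (- t) m j) * mexp B t i l)"
 by (simp add: sum_distrib_right sum_distrib_left mult.assoc mult.commute mult.left_commute)
 finally show ?thesis by (simp add: sum_subtractf)
 qed
 ultimately show ?thesis by simp
 qed
 hence "W t=W 0" using DERIV_isconst_all by blast
 also have "W 0=(SUM l<n. (if i=l then 1 else 0)*(if l=j then 1 else 0))"
 unfolding W_def using ij by (intro sum.cong refl) (simp add: mexp_0[OF B])
 also have "...=(if i=j then 1 else 0)" using ij by (simp add: delta_sum)
 finally show ?thesis by (simp add: W_def)
qed

text \<open>The derivative of \<open>e\<^bsup>-tB\<^esup> y(t)\<close> is \<open>0\<close>.\<close>

lemma linear_ode_unique: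
 assumes B:"B:carrier_mat n n"
 and y:"!!i t. i<n==>((%t. y t i) has_real_derivative (SUM j<n. B$$(i, j) * y t j)) (at t)" and i:"i<n"
 shows "y t i=(SUM j<n. mexp B t i j * y 0 j)"
proof -
 define z where "z t l=(SUM j<n. mexp B (- t) l j * y t j)" for t l
 have z:"z t l=y 0 l" if l:"l<n" for t l
 proof -
 have "((%t. z t l) has_real_derivative 0) (at t)" for t
 proof -
 have m:"((%t. mexp B (- t) l j) has_real_derivative-(SUM m<n. mexp B (- t) l m * B$$(m, j))) (at t)" if "j<n" for j
 using DERIV_chain2[OF mexp_deriv(2)[OF B l that, of "- t"] DERIV_minus[OF DERIV_ident]] by simp
 have "((%t. z t l) has_real_derivative (SUM j<n.-(SUM m<n. mexp B (- t) l m * B$$(m, j)) * y t j +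
 (SUM m<n. B$$(j, m) * y t m) * mexp B (- t) l j)) (at t)"
 unfolding z_def by (intro DERIV_sum DERIV_mult m y) auto
 moreover have "(SUM j<n.-(SUM m<n. mexp B (- t) l m * B$$(m, j)) * y t j +
 (SUM m<n. B$$(j, m) * y t m) * mexp B (- t) l j)=0"
 proof -
 have "(SUM j<n. (SUM m<n. mexp B (- t) l m * B$$(m, j)) * y t j)=(SUM m<n. SUM j<n. mexp B (- t) l m * B$$(m, j) * y t j)"
 unfolding sum_distrib_right by (rule sum.swap)
 also have "...=(SUM j<n. (SUM m<n. B$$(j, m) * y t m) * mexp B (- t) l j)"
 by (simp add: sum_distrib_right sum_distrib_left mult.assoc mult.commute mult.left_commute)
 finally show ?thesis by (simp add: sum.distrib sum_negf sum_subtractf)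
 qed
 ultimately show ?thesis by simp
 qed
 hence "z t l=z 0 l" using DERIV_isconst_all by blast
 also have "...=(SUM j<n. (if l=j then 1 else 0) * y 0 j)" unfolding z_def using l by (intro sum.cong refl) (simp add: mexp_0[OF B])
 finally show ?thesis using l by (simp add: delta_sum)
 qed
 have "(SUM l<n. mexp B t i l * y 0 l)=(SUM l<n. mexp B t i l * z t l)" by (simp add: z)
 also have "...=(SUM l<n. SUM j<n. mexp B t i l * mexp B (- t) l j * y t j)" by (simp add: z_def sum_distrib_left mult.assoc)
 also have "...=(SUM j<n. (SUM l<n. mexp B t i l * mexp B (- t) l j) * y t j)" by (subst sum.swap) (simp add: sum_distrib_right)
 also have "...=(SUM j<n. (if i=j then 1 else 0) * y t j)" by (intro sum.cong refl) (simp add: mexp_inverse[OF B i])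
 finally show ?thesis using i by (simp add: delta_sum)
qed

lemma lin_app_deriv:
 assumes B:"B:carrier_mat n n" and i:"i<n"
 shows "((%t. lin_app n n (mexp B t) v i) has_real_derivative (SUM j<n. B$$(i, j) * lin_app n n (mexp B t) v j)) (at t)"
proof -
 have "((%t. SUM l<n. mexp B t i l * v l) has_real_derivative (SUM l<n. (SUM j<n. B$$(i, j) * mexp B t j l) * v l)) (at t)"
 by (intro DERIV_sum DERIV_cmult_right mexp_deriv(1)[OF B i]) auto
 moreover have "(SUM l<n. (SUM j<n. B$$(i, j) * mexp B t j l) * v l)=(SUM j<n. B$$(i, j)*(SUM l<n. mexp B t j l * v l))"
 unfolding sum_distrib_right sum_distrib_left by (subst sum.swap) (simp add: mult.assoc)
 ultimately show ?thesis using i by (simp add: lin_app_def)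
qed

lemma mexp_add:
 assumes B:"B:carrier_mat n n"
 shows "lin_app n n (mexp B (t+s)) v=lin_app n n (mexp B t) (lin_app n n (mexp B s) v)"
proof
 fix i
 show "lin_app n n (mexp B (t+s)) v i=lin_app n n (mexp B t) (lin_app n n (mexp B s) v) i"
 proof (cases "i<n")
 case True
 have "((%t. lin_app n n (mexp B (t+s)) v i) has_real_derivative (SUM j<n. B$$(i, j) * lin_app n n (mexp B (t+s)) v j)) (at t)" if "i<n" for i t
 proof -
 have "((%t. t+s) has_real_derivative 1) (at t)" by (auto intro!: derivative_eq_intros)
 from DERIV_chain2[where g = "%t. t+s" and f = "%t. lin_app n n (mexp B t) v i", OF lin_app_deriv[OF B that] this]
 show ?thesis by simp
 qed
 from linear_ode_unique[OF B this True, of t] show ?thesis using True by (simp add: lin_app_def)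
 qed (simp add: lin_app_def)
qed

lemma mexp_0_app:"B:carrier_mat n n==>v:E n==>lin_app n n (mexp B 0) v=v"
 by (rule E_eqI[OF lin_app_E]) (auto simp: lin_app_def mexp_0 delta_sum)

subsection \<open>Decay and boundedness\<close>

lemma power_exp_decay:
 assumes "c > 0" shows "((%t::real. t^d * exp (- c * t)) \<longlongrightarrow> 0) at_top"
proof -
 have "filterlim (%t. c * t) at_top at_top"
 by (rule filterlim_tendsto_pos_mult_at_top[OF tendsto_const assms filterlim_ident])
 from filterlim_compose[OF tendsto_power_div_exp_0[of d] this]
 have "((%t. (1/c^d)*((c * t)^d/exp (c * t))) \<longlongrightarrow> (1/c^d)*0) at_top"
 by (intro tendsto_mult tendsto_const)
 thus ?thesis using assms by (simp add: power_mult_distrib exp_minus field_simps)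
qed

lemma jexp_decay:
 assumes "Re (la a)<0" shows "((%t. jexp la s t a b) \<longlongrightarrow> 0) at_top"
proof (rule tendsto_norm_zero_cancel)
 have "((%t. t^(b-a) * exp (- (- Re (la a)) * t)*(cmod (chain_prod s a b)/fact (b-a))) \<longlongrightarrow> 0*(cmod (chain_prod s a b)/fact (b-a))) at_top"
 using assms by (intro tendsto_mult tendsto_const power_exp_decay) auto
 hence "((%t. t^(b-a) * exp (Re (la a) * t)*(cmod (chain_prod s a b)/fact (b-a))) \<longlongrightarrow> 0) at_top" by simp
 moreover have "\<forall>\<^sub>F t in at_top. t^(b-a) * exp (Re (la a) * t)*(cmod (chain_prod s a b)/fact (b-a))=norm (jexp la s t a b)"
 using eventually_ge_at_top[of 0] by eventually_elim (simp add: jexp_def norm_mult norm_divide norm_power)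
 ultimately show "((%t. norm (jexp la s t a b)) \<longlongrightarrow> 0) at_top" by (rule Lim_transform_eventually)
qed

lemma mexp_decay:
 assumes B:"B:carrier_mat n n" and eig:"!!z. eigenvalue (map_mat complex_of_real B) z==>Re z<0"
 and ij:"i<n" "j<n"
 shows "((%t. mexp B t i j) \<longlongrightarrow> 0) at_top"
proof (rule jordan_exponential[OF B])
 fix P Q la s
 assume s:"!!i j t. i<n==>j<n==>(%m. complex_of_real ((B ^\<^sub>m m)$$(i, j)/fact m * t^m)) sums (SUM a<n. SUM b<n. P i a * jexp la s t a b * Q b j)"
 "!!a. a<n==>eigenvalue (map_mat complex_of_real B) (la a)"
 have "complex_of_real (mexp B t i j)=(SUM a<n. SUM b<n. P i a * jexp la s t a b * Q b j)" for t
 proof -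
 have "(%m. (B ^\<^sub>m m)$$(i, j)/fact m * t^m) sums mexp B t i j"
 unfolding mexp_def using mexp_summable[OF B ij] by (rule summable_sums)
 hence "(%m. complex_of_real ((B ^\<^sub>m m)$$(i, j)/fact m * t^m)) sums complex_of_real (mexp B t i j)"
 by (rule sums_of_real)
 thus ?thesis using s(1)[OF ij] by (rule sums_unique2)
 qed
 moreover have "((%t. SUM a<n. SUM b<n. P i a * jexp la s t a b * Q b j) \<longlongrightarrow> (SUM a<n. SUM b<n. P i a*0 * Q b j)) at_top"
 by (intro tendsto_sum tendsto_mult tendsto_const jexp_decay eig s(2)) auto
 ultimately have "((%t. complex_of_real (mexp B t i j)) \<longlongrightarrow> of_real 0) at_top" by simp
 thus ?thesis by (simp only: tendsto_of_real_iff)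
qed

text \<open>A polynomial times \<open>exp (z t)\<close> that stays bounded along a half line on which \<open>exp (z t)\<close> does not
  decay is constant, and vanishes if \<open>exp (z t)\<close> grows.\<close>

lemma bounded_poly_exp:
 assumes bd:"!!t. t\<ge>0==>cmod (exp (z * of_real t) * poly p (of_real (e * t)))<=K" and e:"\<bar>e\<bar>=1" and z:"Re z\<ge>0"
 shows "p=[:Polynomial.coeff p 0:]" and "Re z > 0==>Polynomial.coeff p 0=0"
proof -
 have pb:"cmod (poly p (of_real (e * t)))<=K" if "t\<ge>0" for t
 proof -
 have "1<=cmod (exp (z * of_real t))" using that z by simp
 hence "cmod (poly p (of_real (e * t)))<=cmod (exp (z * of_real t)) * cmod (poly p (of_real (e * t)))"
 by (metis mult_le_cancel_right1 norm_ge_zero not_less)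
 thus ?thesis using bd[OF that] by (simp add: norm_mult)
 qed
 obtain a q where p:"p=pCons a q" by (cases p) auto
 have "q=0"
 proof (rule ccontr)
 assume "q~=0"
 from poly_infinity[OF this, of "K+1" a] obtain r where r:"!!z. r<=cmod z==>K+1<=cmod (poly p z)" unfolding p by blast
 have "cmod (of_real (e*\<bar>r\<bar>))=\<bar>r\<bar>" unfolding norm_of_real abs_mult using e by simp
 hence "r<=cmod (of_real (e*\<bar>r\<bar>))" by linarith
 from r[OF this] show False using pb[of "\<bar>r\<bar>"] by simp
 qed
 thus c:"p=[:Polynomial.coeff p 0:]" using p by simp
 assume zp:"Re z > 0"
 show "Polynomial.coeff p 0=0"
 proof (rule ccontr)
 assume nz:"Polynomial.coeff p 0~=0"
 define c where "c=cmod (Polynomial.coeff p 0)"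
 have c0:"c > 0" using nz by (simp add: c_def)
 have le:"exp (Re z * t) * c<=K" if "t\<ge>0" for t
 proof -
 have "poly p (of_real (e * t))=Polynomial.coeff p 0" by (subst c) simp
 thus ?thesis using bd[OF that] by (simp add: norm_mult c_def)
 qed
 have K:"K > 0" using le[of 0] c0 by simp
 have "K/c\<ge>0" using K c0 by simp
 from divide_nonneg_pos[OF this zp] have t0:"K/c/Re z\<ge>0" .
 have "1+Re z*(K/c/Re z)<=exp (Re z*(K/c/Re z))" by (rule exp_ge_add_one_self)
 hence "(1+K/c) * c<=exp (Re z*(K/c/Re z)) * c" using zp c0 by simp
 also have "...<=K" by (rule le[OF t0])
 finally have "(1+K/c) * c<=K" .
 moreover have "(1+K/c) * c=c+K" using c0 by (simp add: field_simps)
 ultimately show False using c0 by simp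
 qed
qed

section \<open>Compactness of sublevel sets\<close>

lemma compactin_cbox:"compactin (Euc n) {y:E n. ALL i<n. \<bar>y i-x i\<bar><=r}"
proof -
 let ?P = "Pi\<^sub>E UNIV (%i. if i<n then {x i-r..x i+r} else {0})"
 have "compactin (powertop_real UNIV) ?P" by (subst compactin_PiE) auto
 moreover have "?P={y:E n. ALL i<n. \<bar>y i-x i\<bar><=r}"
 proof (intro equalityI subsetI)
 fix y assume y:"y:?P"
 have i:"y i:(if i<n then {x i-r..x i+r} else {0})" for i using PiE_mem[OF y, of i] by simp
 have "y i=0" if "n<=i" for i using i[of i] that by simp
 moreover have "\<bar>y i-x i\<bar><=r" if "i<n" for i using i[of i] that by (simp add: abs_le_iff)
 ultimately show "y:{y:E n. ALL i<n. \<bar>y i-x i\<bar><=r}" by (simp add: E_iff)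
 next
 fix y assume "y:{y:E n. ALL i<n. \<bar>y i-x i\<bar><=r}"
 thus "y:?P" by (auto simp: E_iff abs_le_iff)
 qed
 moreover have "{y:E n. ALL i<n. \<bar>y i-x i\<bar><=r}<={x. ALL i>=n. x i=0}" by (auto simp: E_iff)
 ultimately show ?thesis unfolding Euclidean_space_def compactin_subtopology by (simp add: Euclidean_space_def)
qed

lemma locally_compact_charted:
 assumes M:"charted M" shows "locally_compact_space (space_of M)" unfolding locally_compact_space_def
proof (intro ballI)
 fix x assume x:"x:points M"
 then obtain c where c:"c:atlas_of M" "x:cdom c" using charted_cover[OF M] by blast
 note cc = charted_chart[OF M c(1)]
 let ?n = "cdim c" and ?x = "cmap c x"
 obtain r where r:"r > 0" "box_at ?n ?x r<=cmap c`(cdom c\<inter>points M)"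
 by (rule chart_box_nbhd[OF cc c(2) openin_topspace x])
 define K where "K={y:E ?n. ALL i<?n. \<bar>y i-?x i\<bar><=r/2}"
 have K:"K<=cmap c`cdom c" using r by (force simp: K_def box_at_def)
 have "compactin (subtopology (Euc ?n) (cmap c`cdom c)) K"
 using compactin_cbox K unfolding compactin_subtopology K_def by blast
 from image_compactin[OF this chart_inv_cont[OF cc]] have "compactin (space_of M) (cinv c`K)" .
 moreover have "openin (space_of M) {y:cdom c. cmap c y:box_at ?n ?x (r/2)}"
 by (rule chart_open_preimage[OF cc openin_box_at])
 moreover have "x:{y:cdom c. cmap c y:box_at ?n ?x (r/2)}"
 using c(2) r(1) chart_map_E[OF cc c(2)] by (simp add: box_at_def)
 moreover have "{y:cdom c. cmap c y:box_at ?n ?x (r/2)}<=cinv c`K"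
 proof
 fix y assume y:"y:{y:cdom c. cmap c y:box_at ?n ?x (r/2)}"
 hence "cmap c y:K" by (auto simp: K_def box_at_def less_imp_le)
 thus "y:cinv c`K" using y chart_inv_map[OF cc] by (intro image_eqI[of _ _ "cmap c y"]) auto
 qed
 ultimately show "EX U K. openin (space_of M) U&compactin (space_of M) K&x:U&U<=K" by blast
qed

locale attracting_flow =
 fixes k :: enat and M :: "'a mfd" and \<Phi> :: "real=>'a=>'a" and A :: "'a set"
 assumes k:"k\<ge>1" and Mk:"ck_manifold k M" and flow:"ck_flow k M \<Phi>"
 and Acpt:"compactin (space_of M) A" and Ainv:"invariant_set \<Phi> A"
 and gas:"globally_asymptotically_stable (space_of M) \<Phi> A"
begin

abbreviation "X\<equiv>space_of M"

lemma Ma:"ck_atlas k M" using Mk by (rule ck_manifold_atlas)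
lemma Mc:"charted M" using Mk by (rule ck_manifold_charted)
lemma Hausdorff:"Hausdorff_space X" using Mk by (simp add: ck_manifold_def)
lemma AM:"A<=points M" using Acpt by (rule compactin_subset_topspace)

lemma ck_map_flow:"ck_map k (prod_mfd real_mfd M) M (%(t, x). \<Phi> t x)" using flow by (simp add: ck_flow_def)

lemma ck_map_time:"ck_map k M M (\<Phi> t)"
proof -
 have "ck_map k M (prod_mfd real_mfd M) (%x. (t, x))"
 by (rule ck_map_Pair[OF Mc charted_real Mc ck_map_const[OF Mc] ck_map_id[OF Mk]]) simp
 from ck_map_comp[OF Mc charted_prod[OF charted_real Mc] Mc this ck_map_flow] show ?thesis by simp
qed

lemma flow_points:"x:points M==>\<Phi> t x:points M" by (rule ck_map_points[OF ck_map_time])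
lemma flow_0:"x:points M==>\<Phi> 0 x=x" using flow by (simp add: ck_flow_def)
lemma flow_add:"x:points M==>\<Phi> (s+t) x=\<Phi> s (\<Phi> t x)" using flow by (simp add: ck_flow_def)
lemma flow_inv:"x:points M==>\<Phi> t (\<Phi> (- t) x)=x" "x:points M==>\<Phi> (- t) (\<Phi> t x)=x"
 using flow_add[of x t "- t"] flow_add[of x "- t" t] flow_0 by auto
lemma flow_A:"a:A==>\<Phi> t a:A" using Ainv unfolding invariant_set_def by blast

lemma flow_curve:
 assumes "x:points M" shows "continuous_map euclideanreal X (%t. \<Phi> t x)"
proof -
 have "continuous_map euclideanreal (prod_topology euclideanreal X) (%t. (t, x))"
 using assms by (simp add: continuous_map_pairwise o_def)
 from continuous_map_compose[OF this ck_map_cont[OF ck_map_flow, unfolded prod_mfd_def, simplified]]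
 show ?thesis by (simp add: o_def)
qed

lemma attracted:"x\<in>points M ==> openin X W==>A<=W==>\<forall>\<^sub>F t in at_top. \<Phi> t x\<in>W"
proof -
 assume x:"x:points M" and W:"openin X W" "A<=W"
 have "neighborhood X A W" using W openin_subset[OF W(1)] unfolding neighborhood_def by blast
 moreover have "\<forall>x\<in>points M. \<forall>U. neighborhood X A U-->(\<forall>\<^sub>F t in at_top. \<Phi> t x\<in>U)"
 using gas unfolding globally_asymptotically_stable_def by (rule conjunct2)
 ultimately show ?thesis using x by blast
qed

lemma compact_nbhd:
 obtains W K where "openin X W" "A<=W" "W<=K" "compactin X K" "closedin X K"
proof -
 have "EX U K. openin X U&compactin X K&a:U&U<=K" if "a:A" for a
 using locally_compact_charted[OF Mc] that AM unfolding locally_compact_space_def by blast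
 then obtain U K where UK:"!!a. a:A ==> openin X (U a)" "!!a. a:A==>compactin X (K a)"
 "!!a. a:A==>a:U a" "!!a. a:A==>U a<=K a" by metis
 have "\<exists>\<F>. finite \<F>&\<F><=U`A&A<=\<Union>\<F>"
 using Acpt UK unfolding compactin_def by (metis (no_types, lifting) UN_I imageE subsetI)
 then obtain F where F:"finite F" "F<=A" "A<=\<Union>(U`F)" by (metis finite_subset_image)
 show ?thesis
 proof (rule that[of "\<Union>(U`F)" "\<Union>(K`F)"])
 show "compactin X (\<Union>(K`F))" by (rule compactin_Union) (use F UK in auto)
 thus "closedin X (\<Union>(K`F))" by (rule compactin_imp_closedin[OF Hausdorff])
 show "openin X (\<Union>(U`F))" by (rule openin_Union) (use F UK in auto)
 show "\<Union>(U`F)<=\<Union>(K`F)" using F UK(4) by blast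
 qed (rule F(3))
qed

lemma sum_lin_app_le:
 assumes "!!i j. i<l==>j<l==>\<bar>L i j\<bar><=c"
 shows "(SUM i<l. \<bar>lin_app l l L v i\<bar>)<=real l * c*(SUM j<l. \<bar>v j\<bar>)"
proof -
 have "(SUM i<l. \<bar>lin_app l l L v i\<bar>)<=(SUM i<l. SUM j<l. c*\<bar>v j\<bar>)"
 proof (rule sum_mono)
 fix i assume i:"i:{..<l}"
 have "\<bar>lin_app l l L v i\<bar><=(SUM j<l. \<bar>L i j * v j\<bar>)" using i by (simp add: lin_app_def)
 also have "...<=(SUM j<l. c*\<bar>v j\<bar>)"
 using assms i by (intro sum_mono) (simp add: abs_mult mult_right_mono)
 finally show "\<bar>lin_app l l L v i\<bar><=(SUM j<l. c*\<bar>v j\<bar>)" .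
 qed
 thus ?thesis by (simp add: sum_distrib_left mult.assoc)
qed

lemma mexp_small:
 assumes B:"B:carrier_mat l l" and dec:"!!i j. i<l==>j<l==>((%t. mexp B t i j) \<longlongrightarrow> 0) at_top" and e:"e > 0"
 shows "\<forall>\<^sub>F t in at_top. \<forall>i<l. \<forall>j<l. \<bar>mexp B t i j\<bar><=e"
proof -
 have "\<forall>\<^sub>F t in at_top. \<bar>mexp B t i j\<bar><=e" if "i<l" "j<l" for i j
 using tendstoD[OF dec[OF that] e] by eventually_elim (simp add: less_imp_le)
 hence "\<forall>\<^sub>F t in at_top. \<forall>i\<in>{..<l}. \<forall>j\<in>{..<l}. \<bar>mexp B t i j\<bar><=e"
 by (intro eventually_ball_finite ballI) auto
 thus ?thesis by eventually_elim auto
qed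

lemma mexp_bounded:
 assumes B:"B:carrier_mat l l" and dec:"!!i j. i<l==>j<l==>((%t. mexp B t i j) \<longlongrightarrow> 0) at_top"
 shows "EX c>0. ALL t>=0. ALL i<l. ALL j<l. \<bar>mexp B t i j\<bar><=c"
proof -
 have "\<forall>\<^sub>F t in at_top. \<forall>i<l. \<forall>j<l. \<bar>mexp B t i j\<bar><=1" by (rule mexp_small[OF B dec]) auto
 then obtain T where T:"!!t i j. t\<ge>T==>i<l==>j<l==>\<bar>mexp B t i j\<bar><=1"
 unfolding eventually_at_top_linorder by blast
 have "EX c. ALL t:{0..T}. \<bar>mexp B t i j\<bar><=c" if "i<l" "j<l" for i j
 proof -
 have "continuous_on {0..T} (%t. mexp B t i j)"
 by (rule DERIV_continuous_on, rule has_field_derivative_at_within, rule mexp_deriv(1)[OF B that])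
 hence "bounded ((%t. mexp B t i j)`{0..T})" by (intro compact_imp_bounded compact_continuous_image) auto
 thus ?thesis unfolding bounded_iff by auto
 qed
 then obtain c where c:"!!i j t. i<l==>j<l==>t:{0..T}==>\<bar>mexp B t i j\<bar><=c i j" by metis
 define C where "C=1+(SUM i<l. SUM j<l. \<bar>c i j\<bar>)"
 have cC:"c i j<=C" if "i<l" "j<l" for i j
 proof -
 have "c i j<=\<bar>c i j\<bar>" by simp
 also have "...<=(SUM j<l. \<bar>c i j\<bar>)" using that by (intro member_le_sum) auto
 also have "...<=(SUM i<l. SUM j<l. \<bar>c i j\<bar>)" using that by (intro member_le_sum[of i "{..<l}" "%i. SUM j<l. \<bar>c i j\<bar>"]) (auto intro: sum_nonneg)
 finally show ?thesis by (simp add: C_def)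
 qed
 have C1:"C\<ge>1" by (simp add: C_def sum_nonneg)
 show ?thesis
 proof (intro exI[of _ C] conjI allI impI)
 show "C > 0" using C1 by simp
 show "\<bar>mexp B t i j\<bar><=C" if "t\<ge>0" "i<l" "j<l" for t i j
 proof (cases "t<=T")
 case True thus ?thesis using c[OF that(2,3), of t] cC[OF that(2,3)] that(1) by auto
 next
 case False thus ?thesis using T[OF _ that(2,3), of t] C1 by auto
 qed
 qed
qed

text \<open>An orbit that starts outside a compact neighbourhood of \<open>A\<close> crosses its boundary, where \<open>g\<close> is
  bounded away from \<open>0\<close>; since \<open>g\<close> can grow only by a bounded factor along forward orbits, it was
  bounded away from \<open>0\<close> at the start. So some sublevel set of \<open>g\<close> lies in a compact set, and the flow
  carries every sublevel set into that one.\<close>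

lemma sublevel_compact:
 assumes B:"B:carrier_mat l l" and dec:"!!i j. i<l==>j<l==>((%t. mexp B t i j) \<longlongrightarrow> 0) at_top"
 and g:"continuous_map X (Euc l) g"
 and eq:"!!x t. x:points M==>g (\<Phi> t x)=lin_app l l (mexp B t) (g x)"
 and zero:"!!x. x:points M==>(!!i. i<l==>g x i=0)==>x:A"
 shows "compactin X {x:points M. (SUM i<l. \<bar>g x i\<bar>)<=R}"
proof -
 define N where "N x=(SUM i<l. \<bar>g x i\<bar>)" for x
 have gi:"continuous_map X euclideanreal (%x. g x i)" for i
 using continuous_map_compose[OF g, of euclideanreal "%v. v i"] cont_iff[of l "E l" "%v. v i"] continuous_coord
 by (simp add: o_def)
 have Nc:"continuous_map X euclideanreal N" unfolding N_def by (intro continuous_intros gi) auto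
 have N0:"N x\<ge>0" for x by (simp add: N_def sum_nonneg)
 obtain W K where W:"openin X W" "A<=W" "W<=K" and K:"compactin X K" "closedin X K" by (rule compact_nbhd)
 obtain c where c:"c > 0" "!!t i j. t\<ge>0==>i<l==>j<l==>\<bar>mexp B t i j\<bar><=c"
 using mexp_bounded[OF B dec] by blast
 define C where "C=real l * c+1"
 have C:"C > 0" using c(1) by (simp add: C_def add_nonneg_pos)
 have NC:"N (\<Phi> t x)<=C * N x" if "t\<ge>0" "x:points M" for t x
 proof -
 have "N (\<Phi> t x)<=real l * c * N x" unfolding N_def eq[OF that(2)] by (rule sum_lin_app_le) (use c(2)[OF that(1)] in auto)
 also have "...<=C * N x" using N0 by (intro mult_right_mono) (simp add: C_def)
 finally show ?thesis .
 qed
 define S where "S=K-W"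
 have S:"compactin X S"
 proof -
 have "S=K\<inter>(points M-W)" using compactin_subset_topspace[OF K(1)] by (auto simp: S_def)
 moreover have "closedin X (K\<inter>(points M-W))" using W(1) by (intro closedin_Int K(2)) auto
 ultimately show ?thesis using closed_compactin[OF K(1)] by auto
 qed
 have SM:"S<=points M" using compactin_subset_topspace[OF S] .
 obtain \<delta> where \<delta>: "\<delta> > 0" "!!x. x:S==>\<delta><=N x"
 proof (cases "S={}")
 case True thus ?thesis using that[of 1] by simp
 next
 case False
 have "compact (N`S)" using image_compactin[OF S Nc] by simp
 then obtain x where x:"x:S" "!!y. y:S==>N x<=N y"
 using compact_attains_inf[of "N`S"] False by auto
 have "N x~=0"
 proof
 assume "N x=0"
 hence "!!i. i<l==>g x i=0" by (simp add: N_def sum_nonneg_eq_0_iff)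
 hence "x:A" using zero x(1) SM by blast
 thus False using x(1) W(2) by (auto simp: S_def)
 qed
 hence "N x > 0" using N0[of x] by simp
 thus ?thesis using that[of "N x"] x(2) by blast
 qed
 have far:"\<delta><=C * N y" if y:"y:points M" "y~:W" for y
 proof -
 define T where "T={t. 0<=t&\<Phi> t y~:W}"
 have cl:"closed {t. \<Phi> t y:Z}" if "closedin X Z" for Z
 using closedin_continuous_map_preimage[OF flow_curve[OF y(1)] that] by simp
 have "T={0..}\<inter>{t. \<Phi> t y:points M-W}" using flow_points[OF y(1)] by (auto simp: T_def)
 moreover have "closedin X (points M-W)" using W(1) by blast
 ultimately have Tc:"closed T" by (simp only:) (rule closed_Int[OF closed_atLeast cl])
 have T0:"0:T" using y flow_0 by (simp add: T_def)
 obtain t1 where t1:"!!t. t\<ge>t1==>\<Phi> t y:W"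
 using attracted[OF y(1) W(1,2)] unfolding eventually_at_top_linorder by blast
 have bdd:"bdd_above T"     proof (rule bdd_aboveI[of _ t1])
 fix t assume "t:T"
 thus "t<=t1" using t1[of t] by (cases "t<=t1") (auto simp: T_def)
 qed
 define s where "s=Sup T"
 have sT:"s:T" unfolding s_def using closed_contains_Sup[OF _ bdd Tc] T0 by blast
 have after:"\<Phi> t y:K" if "t > s" for t
 proof -
 have "t~:T" using cSup_upper[OF _ bdd, of t] that by (auto simp: s_def)
 thus ?thesis using that sT W(3) by (auto simp: T_def)
 qed
 have "closure {s<..}<={t. \<Phi> t y:K}" by (rule closure_minimal[OF _ cl[OF K(2)]]) (use after in auto)
 hence "\<Phi> s y:K" by (auto simp: closure_greaterThan)
 hence "\<Phi> s y:S" using sT by (auto simp: S_def T_def)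
 hence "\<delta><=N (\<Phi> s y)" by (rule \<delta>(2))
 also have "...<=C * N y" using NC[OF _ y(1)] sT by (auto simp: T_def)
 finally show ?thesis .
 qed
 define e where "e=\<delta>/(C*(real l*(\<bar>R\<bar>+1)+1))"
 have pos:"real l*(\<bar>R\<bar>+1)+1 > 0" by (simp add: add_nonneg_pos)
 have e:"e > 0" using \<delta> C pos by (simp add: e_def)
 obtain t where t:"!!i j. i<l==>j<l==>\<bar>mexp B t i j\<bar><=e"
 using mexp_small[OF B dec e] unfolding eventually_at_top_linorder by blast
 have sub:"{x:points M. N x<=R}<=\<Phi> (- t)`K"
 proof
 fix x assume "x:{x:points M. N x<=R}"
 hence x:"x:points M" "N x<=R" by auto
 have "N (\<Phi> t x)<=real l * e * N x" unfolding N_def eq[OF x(1)] by (rule sum_lin_app_le) (use t in auto)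
 also have "...<=real l * e*(\<bar>R\<bar>+1)" using x(2) e by (intro mult_left_mono) auto
 also have "...<e*(real l*(\<bar>R\<bar>+1)+1)" using e by (simp add: algebra_simps)
 finally have "C * N (\<Phi> t x)<C*(e*(real l*(\<bar>R\<bar>+1)+1))" using C by simp
 also have "...=\<delta>" using C pos by (simp add: e_def)
 finally have "\<Phi> t x:W" using far[OF flow_points[OF x(1)], of t] by force
 thus "x:\<Phi> (- t)`K" using W(3) flow_inv(2)[OF x(1), of t] by (metis imageI subsetD)
 qed
 have "compactin X (\<Phi> (- t)`K)" by (rule image_compactin[OF K(1) ck_map_cont[OF ck_map_time]])
 moreover have "closedin X {x:points M. N x<=R}"
 using closedin_continuous_map_preimage[OF Nc, of "{..R}"] by (simp add: closed_closedin[symmetric])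
 ultimately show ?thesis using sub closed_compactin unfolding N_def by blast
qed

end

section \<open>The torus as a manifold\<close>

lemma mod1_eq_iff:"mod1 v=mod1 w\<longleftrightarrow>(ALL i. v i-w i:\<int>)"
proof
 assume e:"mod1 v=mod1 w"
 show "ALL i. v i-w i:\<int>"
 proof
 fix i
 have "frac (v i)=frac (w i)" using fun_cong[OF e, of i] by (simp add: mod1_def)
 hence "v i-w i = of_int \<lfloor>v i\<rfloor> - of_int \<lfloor>w i\<rfloor>" by (simp add: frac_def)
 thus "v i-w i:\<int>" by simp
 qed
next
 assume a:"ALL i. v i-w i:\<int>"
 show "mod1 v=mod1 w"
 proof
 fix i
 obtain z :: int where "v i-w i = of_int z" using a Ints_cases by blast
 hence "v i=w i + of_int z" by simp
 thus "mod1 v i=mod1 w i" by (simp add: mod1_def)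
 qed
qed

definition torus_chart :: "nat=>(nat=>real) set=>(nat=>real) chart" where
 "torus_chart m W=\<lparr>chart_dom=mod1`W, chart_dim=m, chart_map=inv_into W mod1\<rparr>"

lemma atlas_torus:"atlas_of (torus_mfd m)={torus_chart m W | W. openin (Euc m) W&inj_on mod1 W}"
 by (simp add: torus_mfd_def torus_chart_def)

lemma openin_torus_image:
 assumes W:"openin (Euc m) W"
 shows "openin (torus_topology m) (mod1`W)" unfolding openin_torus_topology
proof
 have WE:"W<=E m" using W by (rule openin_subset)
 thus "mod1`W<=mod1`E m" by blast
 show "openin (Euc m) {v:E m. mod1 v:mod1`W}" unfolding openin_E_iff
 proof (intro conjI ballI)
 fix v assume "v:{v:E m. mod1 v:mod1`W}"
 then obtain w where w:"v:E m" "w:W" "mod1 v=mod1 w" by auto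
 have z:"!!i. v i-w i:\<int>" using w(3) mod1_eq_iff by blast
 obtain r where r:"r > 0" "box_at m w r<=W" using W w(2) unfolding openin_E_iff by blast
 have "y:{v:E m. mod1 v:mod1`W}" if y:"y:box_at m v r" for y
 proof -
 define y' where "y'=(%i. y i-(v i-w i))"
 have "y':box_at m w r" using y w WE by (auto simp: y'_def box_at_def E_iff subset_iff algebra_simps)
 moreover have "mod1 y=mod1 y'" unfolding mod1_eq_iff using z by (simp add: y'_def)
 ultimately show ?thesis using r(2) y by (auto simp: box_at_def)
 qed
 thus "EX r>0. box_at m v r<={v:E m. mod1 v:mod1`W}" using r(1) by blast
 qed auto
qed

lemma is_chart_torus:
 assumes W:"openin (Euc m) W" "inj_on mod1 W"
 shows "is_chart (torus_topology m) (torus_chart m W)" "cmap (torus_chart m W)`cdom (torus_chart m W)=W"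
proof -
 have WE:"W<=E m" using W(1) by (rule openin_subset)
 have *: "is_chart (torus_topology m) (torus_chart m W)&cmap (torus_chart m W)`cdom (torus_chart m W)=W"
 proof -
 have 1:"openin (torus_topology m) (cdom (torus_chart m W))"
 using openin_torus_image[OF W(1)] by (simp add: torus_chart_def)
 have 2:"openin (Euc (cdim (torus_chart m W))) W" using W(1) by (simp add: torus_chart_def)
 have 3:"cmap (torus_chart m W) x:W&mod1 (cmap (torus_chart m W) x)=x" if "x:cdom (torus_chart m W)" for x
 using that inv_into_into[of x mod1 W] f_inv_into_f[of x mod1 W] by (auto simp: torus_chart_def)
 have 4:"mod1 v:cdom (torus_chart m W)&cmap (torus_chart m W) (mod1 v)=v" if "v:W" for v
 using that inv_into_f_f[OF W(2) that] by (auto simp: torus_chart_def)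
 have 5:"continuous_map (subtopology (torus_topology m) (cdom (torus_chart m W)))
 (Euc (cdim (torus_chart m W))) (cmap (torus_chart m W))" unfolding continuous_map_def
 proof (intro conjI allI impI)
 show "cmap (torus_chart m W):topspace (subtopology (torus_topology m) (cdom (torus_chart m W))) \<rightarrow>
 E (cdim (torus_chart m W))" using 3 WE by (auto simp: torus_chart_def)
 fix U assume U:"openin (Euc (cdim (torus_chart m W))) U"
 hence o:"openin (Euc m) (W\<inter>U)" using W(1) by (simp add: torus_chart_def openin_Int)
 have "{x:topspace (subtopology (torus_topology m) (cdom (torus_chart m W))). cmap (torus_chart m W) x:U}=mod1`(W\<inter>U)"
 proof (intro equalityI subsetI)
 fix x assume "x:{x:topspace (subtopology (torus_topology m) (cdom (torus_chart m W))). cmap (torus_chart m W) x:U}"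
 thus "x:mod1`(W\<inter>U)" using 3[of x] by (intro image_eqI[of _ _ "cmap (torus_chart m W) x"]) auto
 next
 fix x assume "x:mod1`(W\<inter>U)"
 then obtain v where v:"v:W" "v:U" "x=mod1 v" by auto
 thus "x:{x:topspace (subtopology (torus_topology m) (cdom (torus_chart m W))). cmap (torus_chart m W) x:U}"
 using 4[OF v(1)] openin_subset[OF 1] by auto
 qed
 moreover have "openin (subtopology (torus_topology m) (cdom (torus_chart m W))) (mod1`(W\<inter>U))"
 unfolding openin_subtopology using openin_torus_image[OF o]
 by (intro exI[of _ "mod1`(W\<inter>U)"]) (auto simp: torus_chart_def)
 ultimately show "openin (subtopology (torus_topology m) (cdom (torus_chart m W)))
 {x:topspace (subtopology (torus_topology m) (cdom (torus_chart m W))). cmap (torus_chart m W) x:U}" by simp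
 qed
 have 6:"continuous_map (subtopology (Euc (cdim (torus_chart m W))) W) (torus_topology m) mod1"
 using quotient_imp_continuous_map[OF quotient_map_mod1]
 by (simp add: torus_chart_def continuous_map_from_subtopology)
 show ?thesis using is_chartI[OF 1 2 3 4 5 6] by blast
 qed
 thus "is_chart (torus_topology m) (torus_chart m W)" "cmap (torus_chart m W)`cdom (torus_chart m W)=W" by blast+
qed

lemma chart_inv_torus:
 assumes W:"openin (Euc m) W" "inj_on mod1 W" and v:"v:W"
 shows "cinv (torus_chart m W) v=mod1 v"
proof -
 have "mod1 v:cdom (torus_chart m W)" using v by (simp add: torus_chart_def)
 from chart_inv_map[OF is_chart_torus(1)[OF W] this] show ?thesis using inv_into_f_f[OF W(2) v] by (simp add: torus_chart_def)
qed

lemma inj_mod1_box:"inj_on mod1 (box_at m v (1/2))"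
proof (rule inj_onI)
 fix x y assume x:"x:box_at m v (1/2)" and y:"y:box_at m v (1/2)" and e:"mod1 x=mod1 y"
 show "x=y"
 proof (rule E_eqI)
 show "x:E m" "y:E m" using x y by (auto simp: box_at_def)
 fix i assume i:"i<m"
 obtain z :: int where z:"x i-y i = of_int z" using e mod1_eq_iff Ints_cases by metis
 have "\<bar>x i-v i\<bar><1/2" "\<bar>y i-v i\<bar><1/2" using x y i by (auto simp: box_at_def)
 hence "\<bar>x i-y i\<bar><1" by linarith
 hence "z=0" unfolding z by linarith
 thus "x i=y i" using z by simp
 qed
qed

lemma points_torus:"points (torus_mfd m)=mod1`E m" by (simp add: torus_mfd_def topspace_torus_topology)

lemma charted_torus:"charted (torus_mfd m)" unfolding charted_def
proof (intro conjI ballI)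
 show "is_chart (space_of (torus_mfd m)) c" if "c:atlas_of (torus_mfd m)" for c
 using that is_chart_torus(1) unfolding atlas_torus by (auto simp: torus_mfd_def)
 show "\<Union> (cdom`atlas_of (torus_mfd m))=points (torus_mfd m)"
 proof (intro equalityI subsetI)
 fix x assume "x\<in>\<Union> (cdom`atlas_of (torus_mfd m))"
 thus "x:points (torus_mfd m)" unfolding atlas_torus points_torus
 using openin_subset by (fastforce simp: torus_chart_def)
 next
 fix x assume "x:points (torus_mfd m)"
 then obtain v where v:"v:E m" "x=mod1 v" unfolding points_torus by blast
 have "torus_chart m (box_at m v (1/2)):atlas_of (torus_mfd m)"
 unfolding atlas_torus using openin_box_at inj_mod1_box by blast
 moreover have "x:cdom (torus_chart m (box_at m v (1/2)))" using v by (auto simp: torus_chart_def box_at_def)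
 ultimately show "x\<in>\<Union> (cdom`atlas_of (torus_mfd m))" by blast
 qed
qed

text \<open>A function on the torus is \<open>C\<^sup>k\<close> as soon as its lift to \<open>\<real>\<^sup>m\<close> is.\<close>

lemma ck_on_torus:
 assumes "ck_real k m (E m) (%v. f (mod1 v))"
 shows "ck_on k (torus_mfd m) UNIV f" unfolding ck_on_def
proof
 fix c assume "c:atlas_of (torus_mfd m)"
 then obtain W where W:"openin (Euc m) W" "inj_on mod1 W" "c=torus_chart m W" by (auto simp: atlas_torus)
 have "ck_real k m W (%v. f (mod1 v))"
 by (rule ck_real_subset[OF assms _ W(1)]) (use openin_subset[OF W(1)] in auto)
 hence "ck_real k m W (%v. f (cinv c v))"
 by (rule ck_real_eq[OF _ W(1)]) (simp add: W(3) chart_inv_torus[OF W(1,2)])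
 thus "ck_real k (cdim c) (cmap c`(cdom c\<inter>UNIV)) (%v. f (cinv c v))"
 using is_chart_torus(2)[OF W(1,2)] by (simp add: W(3)) (simp add: torus_chart_def)
qed

definition circle :: "nat=>real=>nat=>real" where
 "circle i s=mod1 (%j. if j=i then s else 0)"

lemma smooth_real_id:"smooth_real (%s. s)" unfolding smooth_real_def
 by (intro exI[of _ "%n s. if n=0 then s else if n=1 then 1 else 0"]) auto

lemma ck_map_circle:
 assumes i:"i<m"
 shows "ck_map k real_mfd (torus_mfd m) (circle i)" unfolding ck_map_iff
proof (intro conjI ballI allI impI)
 define u where "u s=(%j. if j=i then s else (0::real))" for s
 have uE:"u s:E m" for s using i by (auto simp: u_def E_iff)
 have "continuous_map euclideanreal (Euc m) (%s j. if j<m then if j=i then s else 0 else 0)"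
 unfolding continuous_map_componentwise_Euclidean_space by auto
 moreover have "(%j. if j<m then if j=i then s else 0 else 0)=u s" for s using i by (auto simp: u_def fun_eq_iff)
 ultimately have uc:"continuous_map euclideanreal (Euc m) u" by simp
 show cont:"continuous_map (space_of real_mfd) (space_of (torus_mfd m)) (circle i)"
 proof -
 have "circle i=mod1\<circ>u" by (rule ext) (simp add: circle_def u_def)
 thus ?thesis using continuous_map_compose[OF uc quotient_imp_continuous_map[OF quotient_map_mod1]]
 by (simp add: torus_mfd_def)
 qed
 fix e l assume e:"e:atlas_of (torus_mfd m)" and l:"l<cdim e"
 then obtain W where W:"openin (Euc m) W" "inj_on mod1 W" "e=torus_chart m W" by (auto simp: atlas_torus)
 have oV:"opn real_mfd (circle i -` cdom e)" by (rule opn_vimage[OF cont opn_dom[OF charted_torus e]])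
 show "ck_on k real_mfd (circle i -` cdom e) (%s. cmap e (circle i s) l)"
 proof (rule ck_on_local[OF charted_real oV])
 fix s0 assume "s0:circle i -` cdom e"
 then obtain w0 where w0:"w0:W" "circle i s0=mod1 w0" by (auto simp: W(3) torus_chart_def)
 define z where "z j=w0 j-u s0 j" for j
 have zI:"z j:\<int>" for j using w0(2) unfolding circle_def mod1_eq_iff z_def u_def by (metis Ints_minus minus_diff_eq)
 have zE:"(%j. u s j+z j):E m" for s using uE openin_subset[OF W(1)] w0(1) by (auto simp: z_def E_iff subset_iff)
 have "continuous_map euclideanreal (Euc m) (%s j. u s j+z j)"
 by (intro continuous_map_Euclidean_space_add uc)
 (use openin_subset[OF W(1)] w0(1) uE in "auto simp: z_def E_iff subset_iff")
 from openin_continuous_map_preimage[OF this W(1)]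
 have oW:"open {s. (%j. u s j+z j):W}" by simp
 define V where "V={s. (%j. u s j+z j):W}"
 have eq:"cmap e (circle i s) l=u s l+z l" if "s:V" for s
 proof -
 have "circle i s=mod1 (%j. u s j+z j)" unfolding circle_def mod1_eq_iff u_def using zI by auto
 thus ?thesis using inv_into_f_f[OF W(2), of "%j. u s j+z j"] that by (simp add: W(3) torus_chart_def V_def)
 qed
 have oV:"opn real_mfd V" using oW by (simp add: V_def)
 have "ck_on k real_mfd V (%s. (if l=i then s else 0)+z l)"
 proof (rule ck_on_add[OF charted_real oV _ ck_on_const[OF charted_real oV]])
 show "ck_on k real_mfd V (%s. if l=i then s else 0)"
 using ck_on_subset[OF charted_real _ oV _ ck_on_real_smooth[OF smooth_real_id]] ck_on_const[OF charted_real oV, of k 0]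
 by (cases "l=i") auto
 qed
 hence "ck_on k real_mfd V (%s. cmap e (circle i s) l)"
 by (subst ck_on_cong[OF charted_real oV, where g = "%s. (if l=i then s else 0)+z l"]) (auto simp: eq u_def)
 moreover have "s0:V" using w0(1) by (simp add: V_def z_def)
 ultimately show "EX V. opn real_mfd V&s0:V&ck_on k real_mfd V (%s. cmap e (circle i s) l)" using oV by blast
 qed
qed

section \<open>Fourier coefficients determine a continuous periodic function\<close>

inductive trig_poly :: "(real=>complex)=>bool" where
 trig_monom:"trig_poly (%s. c * cis (2 * pi * of_int n * s))"
| trig_add:"trig_poly f==>trig_poly g==>trig_poly (%s. f s+g s)"

lemma trig_mult:
 assumes "trig_poly f" "trig_poly g" shows "trig_poly (%s. f s * g s)" using assms
proof (induction arbitrary: g)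
 case (trig_monom c n)
 from trig_monom show ?case
 proof (induction)
 case (trig_monom d l)
 have "cis (2 * pi * of_int (n+l) * s)=cis (2 * pi * of_int n * s) * cis (2 * pi * of_int l * s)" for s
 unfolding cis_mult by (rule arg_cong[of _ _ cis]) (simp add: algebra_simps)
 hence "(%s. c * cis (2 * pi * of_int n * s)*(d * cis (2 * pi * of_int l * s)))=(%s. (c * d) * cis (2 * pi * of_int (n+l) * s))"
 by (simp add: fun_eq_iff mult_ac)
 thus ?case using trig_poly.trig_monom[of "c * d" "n+l"] by (simp only:)
 next
 case (trig_add f g)
 thus ?case using trig_poly.trig_add[OF trig_add.IH] by (simp add: distrib_left)
 qed
next
 case (trig_add f h)
 show ?case using trig_poly.trig_add[OF trig_add.IH(1)[OF trig_add.prems] trig_add.IH(2)[OF trig_add.prems]]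
 by (simp add: distrib_right)
qed

lemma trig_real_polynomial:
 assumes "real_polynomial_function p"
 shows "trig_poly (%s. complex_of_real (p (cis (2 * pi * s))))" using assms
proof induction
 case (linear f)
 have "f z=Re z * f 1+Im z * f \<i>" for z
 proof -
 have "f z=f (Re z *\<^sub>R 1+Im z *\<^sub>R \<i>)" by (rule arg_cong[of _ _ f]) (simp add: complex_eq_iff)
 also have "...=Re z * f 1+Im z * f \<i>" using linear by (simp add: bounded_linear.linear linear_add linear_scale)
 finally show ?thesis .
 qed
 note lin = this
 have f:"f (cis (2 * pi * s))=cos (2 * pi * s) * f 1+sin (2 * pi * s) * f \<i>" for s using lin[of "cis (2 * pi * s)"] by (simp only: cis.sel)
 have e:"complex_of_real (cos x * a+sin x * b)=((of_real a-\<i> * of_real b)/2) * cis x+((of_real a+\<i> * of_real b)/2) * cis (- x)" for x a b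
 by (rule complex_eqI) (simp_all add: algebra_simps add_divide_distrib diff_divide_distrib)
 have "complex_of_real (f (cis (2 * pi * s))) =
 ((f 1-\<i> * f \<i>)/2) * cis (2 * pi * of_int 1 * s)+((f 1+\<i> * f \<i>)/2) * cis (2 * pi * of_int (-1) * s)" for s
 using e[of "2 * pi * s" "f 1" "f \<i>"] f[of s] by simp
 hence "(%s. complex_of_real (f (cis (2 * pi * s)))) =
 (%s. ((f 1-\<i> * f \<i>)/2) * cis (2 * pi * of_int 1 * s)+((f 1+\<i> * f \<i>)/2) * cis (2 * pi * of_int (-1) * s))" by (rule ext)
 thus ?case by (simp only: trig_add[OF trig_monom trig_monom])
next
 case (const c)
 show ?case using trig_monom[of "of_real c" 0] by simp
next
 case (add f g) thus ?case using trig_add[OF add.IH] by simp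
next
 case (mult f g) thus ?case using trig_mult[OF mult.IH] by simp
qed

lemma periodic_int:
 fixes \<phi> :: "real=>'b"
 assumes "!!s. \<phi> (s+1)=\<phi> s" shows "\<phi> (s + of_int n)=\<phi> s"
proof -
 have 1:"\<phi> (s + of_nat m)=\<phi> s" for m s
 proof (induction m)
 case (Suc m)
 have "s + of_nat (Suc m)=(s + of_nat m)+1" by simp
 thus ?case using assms[of "s + of_nat m"] Suc by (simp only:)
 qed simp
 show ?thesis
 proof (cases "n\<ge>0")
 case True thus ?thesis using 1[of s "nat n"] by simp
 next
 case False thus ?thesis using 1[of "s + of_int n" "nat (- n)"] by simp
 qed
qed

lemma periodic_on_circle:
 fixes \<phi> :: "real=>real"
 assumes c:"continuous_on UNIV \<phi>" and p:"!!s. \<phi> (s+1)=\<phi> s"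
 obtains \<psi> where "continuous_on (sphere 0 1) \<psi>" "!!s. \<psi> (cis (2 * pi * s))=\<phi> s"
proof -
 define \<psi> where "\<psi> z=\<phi> (SOME s. cis (2 * pi * s)=z)" for z
 have eq:"\<psi> (cis (2 * pi * s))=\<phi> s" for s
 proof -
 define t where "t=(SOME t. cis (2 * pi * t)=cis (2 * pi * s))"
 have "cis (2 * pi * t)=cis (2 * pi * s)" unfolding t_def by (rule someI[of _ s]) simp
 hence "exp (\<i> * of_real (2 * pi * t))=exp (\<i> * of_real (2 * pi * s))" by (simp add: cis_conv_exp)
 then obtain n :: int where "\<i> * of_real (2 * pi * t)=\<i> * of_real (2 * pi * s)+(of_int (2 * n) * pi)*\<i>"
 unfolding exp_eq by blast
 hence "\<i> * of_real (2 * pi * t)=\<i> * of_real (2 * pi * s+2 * of_int n * pi)" by (simp add: algebra_simps)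
 hence "2 * pi * t=2 * pi * s+2 * of_int n * pi" by (simp only: mult_cancel_left of_real_eq_iff) simp
 hence "2 * pi * t=2 * pi*(s + of_int n)" by (simp add: algebra_simps)
 hence "t=s + of_int n" by simp
 thus ?thesis using periodic_int[of \<phi>, OF p] by (simp add: \<psi>_def t_def)
 qed
 have surj:"EX s:{0..1}. z=cis (2 * pi * s)" if z:"z:sphere 0 1" for z
 proof -
 obtain t where t:"0<=t" "t<2 * pi" "z=cis t"
 using complex_unimodular_polar[of z] z by (auto simp: cis.ctr complex_eq_iff)
 thus ?thesis by (intro bexI[of _ "t/(2 * pi)"]) auto
 qed
 have "continuous_on (sphere 0 1) \<psi>" unfolding continuous_on_closed_vimage[OF closed_sphere]
 proof (intro allI impI)
 fix B :: "real set" assume B:"closed B"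
 have "\<psi> -` B\<inter>sphere 0 1=(%s. cis (2 * pi * s))`({0..1}\<inter>\<phi> -` B)"
 using surj eq by (force simp: image_iff)
 moreover have "closed (\<phi> -` B)" by (rule closed_vimage[OF B c])
 hence "compact ({0..1}\<inter>\<phi> -` B)" by (intro compact_Int_closed) auto
 hence "compact ((%s. cis (2 * pi * s))`({0..1}\<inter>\<phi> -` B))"
 by (intro compact_continuous_image continuous_intros)
 ultimately show "closed (\<psi> -` B\<inter>sphere 0 1)" using compact_imp_closed by simp
 qed
 thus ?thesis using that eq by blast
qed

text \<open>All integrals against trigonometric polynomials vanish; by the Stone--Weierstrass theorem on the circle so does the integral of the square.\<close>

lemma fourier_unique:
 fixes \<phi> :: "real=>complex"
 assumes c:"continuous_on UNIV \<phi>" and p:"!!s. \<phi> (s+1)=\<phi> s"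
 and 0:"!!n::int. integral {0..1} (%s. cis (- (2 * pi * of_int n * s))*\<phi> s)=0"
 shows "\<phi> s=0"
proof -
 have c':"continuous_on S \<phi>" for S using c continuous_on_subset by blast
 have tc:"continuous_on S f" if "trig_poly f" for f S using that by induction (auto intro!: continuous_intros)
 have tr:"integral {0..1} (%s. f s*\<phi> s)=0" if "trig_poly f" for f using that
 proof induction
 case (trig_monom c n)
 have "(%s. c * cis (2 * pi * of_int n * s)*\<phi> s)=(%s. c*(cis (- (2 * pi * of_int (- n) * s))*\<phi> s))"
 by (auto simp: fun_eq_iff)
 thus ?case using 0[of "- n"] by simp
 next
 case (trig_add f g)
 have "(%s. f s*\<phi> s) integrable_on {0..1}" "(%s. g s*\<phi> s) integrable_on {0..1}"
 by (intro integrable_continuous_interval continuous_intros tc c' trig_add)+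
 thus ?case using trig_add.IH by (simp add: distrib_right integral_add)
 qed
 have real0:"\<gamma> s=0" if \<gamma>: "continuous_on UNIV \<gamma>" "!!s. \<gamma> (s+1)=\<gamma> s"
 and L:"bounded_linear L" "!!s. L (\<phi> s)=\<gamma> s" "!!x z. L (of_real x * z)=x * L z" for \<gamma> :: "real=>real" and L and s
 proof -
 have \<gamma>':"continuous_on S \<gamma>" for S using \<gamma>(1) continuous_on_subset by blast
 obtain \<psi> where \<psi>: "continuous_on (sphere 0 1) \<psi>" "!!s. \<psi> (cis (2 * pi * s))=\<gamma> s"
 by (rule periodic_on_circle[OF \<gamma>]) (rule that)
 have "bounded (\<phi>`{0..1})" by (intro compact_imp_bounded compact_continuous_image c') auto
 then obtain K where K:"K > 0" "!!s. s:{0..1}==>norm (\<phi> s)<=K" unfolding bounded_pos by auto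
 have small:"norm (integral {0..1} (%s. of_real (\<gamma> s)*\<phi> s))<=e * K" if e:"e > 0" for e
 proof -
 obtain q where q:"real_polynomial_function q" "!!z. z:sphere 0 1==>\<bar>\<psi> z-q z\<bar><e"
 using Stone_Weierstrass_real_polynomial_function[OF compact_sphere \<psi>(1) e] by metis
 note tq = trig_real_polynomial[OF q(1)]
 have i1:"(%s. of_real (\<gamma> s)*\<phi> s) integrable_on {0..1}"
 by (intro integrable_continuous_interval continuous_intros \<gamma>' c')
 have i2:"(%s. of_real (q (cis (2 * pi * s)))*\<phi> s) integrable_on {0..1}"
 by (rule integrable_continuous_interval, rule continuous_on_mult[OF tc[OF tq] c'])
 have "integral {0..1} (%s. of_real (\<gamma> s)*\<phi> s)=integral {0..1} (%s. of_real (\<gamma> s)*\<phi> s - of_real (q (cis (2 * pi * s)))*\<phi> s)"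
 unfolding integral_diff[OF i1 i2] tr[OF tq] by simp
 hence eq:"integral {0..1} (%s. of_real (\<gamma> s)*\<phi> s)=integral (cbox 0 1) (%s. of_real (\<gamma> s)*\<phi> s - of_real (q (cis (2 * pi * s)))*\<phi> s)" by simp
 have "norm (integral (cbox 0 1) (%s. of_real (\<gamma> s)*\<phi> s - of_real (q (cis (2 * pi * s)))*\<phi> s))<=(e * K) * measure lborel (cbox (0::real) 1)"
 proof (rule has_integral_bound[OF _ integrable_integral])
 show "0<=e * K" using e K by simp
 show "(%s. of_real (\<gamma> s)*\<phi> s - of_real (q (cis (2 * pi * s)))*\<phi> s) integrable_on cbox 0 1"
 using integrable_diff[OF i1 i2] by simp
 fix s :: real assume s:"s:cbox 0 1"
 have "norm (of_real (\<gamma> s)*\<phi> s - of_real (q (cis (2 * pi * s)))*\<phi> s)=\<bar>\<psi> (cis (2 * pi * s))-q (cis (2 * pi * s))\<bar> * norm (\<phi> s)"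
 unfolding left_diff_distrib[symmetric] of_real_diff[symmetric] norm_mult norm_of_real \<psi>(2) ..
 also have "...<=e * K" using q(2)[of "cis (2 * pi * s)"] K(2)[of s] s e by (intro mult_mono) auto
 finally show "norm (of_real (\<gamma> s)*\<phi> s - of_real (q (cis (2 * pi * s)))*\<phi> s)<=e * K" .
 qed
 thus ?thesis using eq by simp
 qed
 have "norm (integral {0..1} (%s. of_real (\<gamma> s)*\<phi> s))<=0"
 proof (rule field_le_epsilon)
 fix e :: real assume "e > 0"
 thus "norm (integral {0..1} (%s. of_real (\<gamma> s)*\<phi> s))<=0+e" using small[of "e/K"] K(1) by simp
 qed
 hence z:"integral {0..1} (%s. of_real (\<gamma> s)*\<phi> s)=0" by simp
 have "integral {0..1} (%s. \<gamma> s*\<gamma> s)=integral {0..1} (L\<circ>(%s. of_real (\<gamma> s)*\<phi> s))"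
 by (simp add: o_def L)
 also have "...=L (integral {0..1} (%s. of_real (\<gamma> s)*\<phi> s))"
 by (rule integral_linear[OF _ L(1)]) (intro integrable_continuous_interval continuous_intros \<gamma>' c')
 also have "...=0" unfolding z using L(1) by (simp add: bounded_linear.linear linear_0)
 finally have "integral {0..1} (%s. \<gamma> s*\<gamma> s)=0" .
 hence "ALL s:{0..1}. \<gamma> s*\<gamma> s=0"
 using integral_eq_0_iff[of 0 1 "%s. \<gamma> s*\<gamma> s"] continuous_on_mult[OF \<gamma>'[of "{0..1}"] \<gamma>'[of "{0..1}"]] by simp
 hence "\<gamma> (frac s)=0" using frac_ge_0 frac_lt_1[of s] by (force simp: less_imp_le)
 moreover have "\<gamma> s=\<gamma> (frac s)" using periodic_int[of \<gamma> "frac s" "\<lfloor>s\<rfloor>", OF \<gamma>(2)] by (simp add: frac_def)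
 ultimately show ?thesis by simp
 qed
 have "Re (\<phi> s)=0"
 by (rule real0[of "%s. Re (\<phi> s)" Re]) (auto intro!: continuous_intros c simp: p bounded_linear_Re)
 moreover have "Im (\<phi> s)=0"
 by (rule real0[of "%s. Im (\<phi> s)" Im]) (auto intro!: continuous_intros c simp: p bounded_linear_Im)
 ultimately show ?thesis by (simp add: complex_eq_iff)
qed

section \<open>Integrals depending on a parameter\<close>

definition cons :: "real=>(nat=>real)=>nat=>real" where
 "cons s x=(%i. if i=0 then s else x (i-1))"

lemma cons_E:"x:E d==>cons s x:E (Suc d)" by (auto simp: cons_def E_iff)

lemma cons_upd:"cons s (x(i := t))=(cons s x)(Suc i := t)" by (auto simp: cons_def fun_eq_iff)

lemma continuous_cons:"continuous_on S (%(x, s). cons s x)"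
proof -
 have fs:"continuous_on S (%p::(nat=>real)\<times>real. fst p j)" for j :: nat and S
 using continuous_on_compose2[OF continuous_coord[of UNIV j] continuous_on_fst[OF continuous_on_id[of S]]] by auto
 have "continuous_on S (%p. cons (snd p) (fst p) i)" for i
 unfolding cons_def by (cases "i=0") (auto intro!: continuous_intros fs)
 hence "continuous_on S (%p. cons (snd p) (fst p))" by (rule continuous_on_coordinatewise_then_product)
 thus ?thesis by (simp add: case_prod_beta)
qed

lemma integral_param_pd:
 assumes W:"openin (Euc d) W" and U:"openin (Euc (Suc d)) U"
 and WU:"!!x s. x:W==>cons s x:U"
 and H:"ckf (Suc 0) (Suc d) U H" and w:"continuous_on {0..1} w" and x:"x:W" and i:"i<d"
 shows "has_pd i (%x. integral {0..1} (%s. w s * H (cons s x))) x (integral {0..1} (%s. w s * pder (Suc i) H (cons s x)))"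
proof -
 note Hs = H[unfolded ck_fin_Suc[OF U]]
 have WE:"W<=E d" using W by (rule openin_subset)
 obtain r where r:"r > 0" "box_at d x r<=W" using W x unfolding openin_E_iff by blast
 define T where "T={x i-r<..<x i+r}"
 have TW:"x(i := t):W" if "t:T" for t
 proof -
 have "x(i := t):box_at d x r" using that r(1) x WE i by (auto simp: T_def box_at_def E_iff abs_less_iff)
 thus ?thesis using r(2) by blast
 qed
 have cH:"continuous_on U H" and cD:"continuous_on U (pder (Suc i) H)"
 using Hs i ck_fin_cont[OF U, of 0 "pder (Suc i) H"] by (simp_all del: ck_real_finite.simps)
 have cons_t:"continuous_on S (%(t, s). cons s (x(i := t)))" for S
 proof -
 have "continuous_on S (%p::real\<times>real. x(i := fst p))"
 proof (rule continuous_on_coordinatewise_then_product)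
 fix j show "continuous_on S (%p. (x(i := fst p)) j)" by (cases "j=i") (auto intro!: continuous_intros)
 qed
 hence "continuous_on S (%p::real\<times>real. (x(i := fst p), snd p))"
 by (rule continuous_on_Pair[OF _ continuous_on_snd[OF continuous_on_id]])
 from continuous_on_compose2[OF continuous_cons[of UNIV] this] show ?thesis by (simp add: case_prod_beta)
 qed
 have "((%t. integral (cbox 0 1) (%s. w s * H (cons s (x(i := t))))) has_field_derivative
 integral (cbox 0 1) (%s. w s * pder (Suc i) H (cons s (x(i := x i))))) (at (x i) within T)"
 proof (rule leibniz_rule_field_derivative[where ?x0.0 = "x i" and U = T and a = 0 and b = 1 and f = "%t s. w s * H (cons s (x(i := t)))" and fx = "%t s. w s * pder (Suc i) H (cons s (x(i := t)))"])
 show "((%t. w s * H (cons s (x(i := t)))) has_field_derivative w s * pder (Suc i) H (cons s (x(i := t)))) (at t within T)"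
 if "t:T" for t s
 proof -
 have "has_pd (Suc i) H (cons s (x(i := t))) (pder (Suc i) H (cons s (x(i := t))))"
 using Hs i WU[OF TW[OF that]] by auto
 hence "((%t. H (cons s (x(i := t)))) has_real_derivative pder (Suc i) H (cons s (x(i := t)))) (at t)"
 unfolding has_pd_def by (simp add: cons_upd)
 thus ?thesis by (rule DERIV_cmult[OF has_field_derivative_at_within])
 qed
 show "(%s. w s * H (cons s (x(i := t)))) integrable_on cbox 0 1" if "t:T" for t
 proof -
 have "continuous_on {0..1} (%s. cons s (x(i := t)))"
 using continuous_on_compose2[OF continuous_cons[of UNIV] continuous_on_Pair[OF continuous_on_const[of "{0..1}" "x(i := t)"] continuous_on_id]] by simp
 hence "continuous_on {0..1} (%s. H (cons s (x(i := t))))"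
 by (rule continuous_on_compose2[OF cH]) (use WU TW[OF that] in auto)
 thus ?thesis using w by (auto intro!: integrable_continuous_interval continuous_intros)
 qed
 have "continuous_on (T\<times>cbox 0 1) (%p. pder (Suc i) H (case p of (t, s)=>cons s (x(i := t))))"
 by (rule continuous_on_compose2[OF cD cons_t]) (use WU TW in auto)
 moreover have "continuous_on (T\<times>cbox 0 1) (%p. w (snd p))"
 by (rule continuous_on_compose2[OF w continuous_on_snd[OF continuous_on_id]]) auto
 ultimately show "continuous_on (T\<times>cbox 0 1) (%(t, s). w s * pder (Suc i) H (cons s (x(i := t))))"
 unfolding case_prod_beta by (intro continuous_on_mult)
 show "x i:T" using r(1) by (simp add: T_def)
 show "convex T" by (simp add: T_def)
 qed
 moreover have "at (x i) within T=at (x i)" by (rule at_within_open[of "x i" T]) (use r(1) in "simp_all add: T_def")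
 ultimately show ?thesis unfolding has_pd_def by (simp only: cbox_interval fun_upd_triv)
qed

lemma ck_fin_integral:
 assumes W:"openin (Euc d) W" and U:"openin (Euc (Suc d)) U"
 and WU:"!!x s. x:W==>cons s x:U" and w:"continuous_on {0..1} w"
 shows "ckf j (Suc d) U H==>ckf j d W (%x. integral {0..1} (%s. w s * H (cons s x)))"
proof -
 have cont:"continuous_on W (%x. integral {0..1} (%s. w s * H (cons s x)))" if "continuous_on U H" for H
 proof -
 have "continuous_on (W\<times>cbox 0 1) (%p. H (case p of (x, s)=>cons s x))"
 by (rule continuous_on_compose2[OF that continuous_cons]) (use WU in auto)
 moreover have "continuous_on (W\<times>cbox 0 1) (%p. w (snd p))"
 by (rule continuous_on_compose2[OF w continuous_on_snd[OF continuous_on_id]]) auto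
 ultimately have "continuous_on (W\<times>cbox 0 1) (%(x, s). w s * H (cons s x))"
 unfolding case_prod_beta by (intro continuous_on_mult)
 from integral_continuous_on_param[OF this] show ?thesis by simp
 qed
 show "ckf j (Suc d) U H==>ckf j d W (%x. integral {0..1} (%s. w s * H (cons s x)))"
 proof (induction j arbitrary: H)
 case 0
 thus ?case using cont by (simp add: cont_iff[OF W] cont_iff[OF U])
 next
 case (Suc j)
 note a = Suc.prems[unfolded ck_fin_Suc[OF U]]
 have H1:"ckf (Suc 0) (Suc d) U H" using a by (auto simp: ck_fin_Suc[OF U] cont_iff[OF U] intro: ck_fin_cont[OF U])
 show ?case
 proof (rule ck_fin_SucI[OF W cont, where D = "%i x. integral {0..1} (%s. w s * pder (Suc i) H (cons s x))"])
 show "has_pd i (%x. integral {0..1} (%s. w s * H (cons s x))) x (integral {0..1} (%s. w s * pder (Suc i) H (cons s x)))"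
 if "i<d" "x:W" for i x by (rule integral_param_pd[OF W U WU H1 w that(2,1)])
 show "ckf j d W (%x. integral {0..1} (%s. w s * pder (Suc i) H (cons s x)))" if "i<d" for i
 by (rule Suc.IH) (use a that in auto)
 qed (use a in auto)
 qed
qed

text \<open>In a chart, a family of functions that depends on a real parameter is one function on \<open>\<real>\<^sup>1\<^sup>+\<^sup>d\<close>.\<close>

lemma chart_family:
 assumes N:"charted N" and c:"c:atlas_of N" and h:"ck_on k (prod_mfd real_mfd N) UNIV (%p. h (fst p) (snd p))"
 obtains H U where "openin (Euc (Suc (cdim c))) U" "!!x s. x:cmap c`cdom c==>cons s x:U"
 "ck_real k (Suc (cdim c)) U H" "!!x s. x:cmap c`cdom c==>H (cons s x)=h s (cinv c x)"
proof -
 let ?r = "\<lparr>chart_dom=UNIV, chart_dim=1, chart_map=(%t i. if i=0 then t else 0)\<rparr>::real chart"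
 let ?p = "prod_chart ?r c"
 note cc = charted_chart[OF N c]
 have ra:"?r:atlas_of real_mfd" by (simp add: real_mfd_def)
 note rc = charted_chart[OF charted_real ra]
 have pa:"?p:atlas_of (prod_mfd real_mfd N)" unfolding prod_mfd_def using ra c by auto
 note pc = charted_chart[OF charted_prod[OF charted_real N] pa]
 define U where "U=cmap ?p`cdom ?p"
 define H where "H=(%v. h (fst (cinv ?p v)) (snd (cinv ?p v)))"
 have rimg:"u:cmap ?r`cdom ?r" if "u:E 1" for u
 proof -
 have "u=cmap ?r (u 0)" using that by (auto simp: E_iff fun_eq_iff)
 thus ?thesis by (rule image_eqI) simp
 qed
 have d:"cdim ?p=Suc (cdim c)" by (simp add: prod_chart_def)
 have sn:"snd_part 1 (cons s x)=x" for s x by (simp add: snd_part_def cons_def)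
 have inU:"cons s x:U" if "x:cmap c`cdom c" for s x
 proof -
 have "cons s x:E (1 + cdim c)" using cons_E[of x "cdim c"] chart_map_E[OF cc] that by auto
 thus ?thesis unfolding U_def is_chart_prod(2)[OF rc cc] using rimg[OF fst_part_E] that sn by simp
 qed
 show ?thesis
 proof (rule that[of U H])
 show "openin (Euc (Suc (cdim c))) U" using chart_img_open[OF pc] unfolding U_def d .
 have "ck_real k (cdim ?p) (cmap ?p`(cdom ?p\<inter>UNIV)) H" using h pa unfolding ck_on_def H_def by blast
 thus "ck_real k (Suc (cdim c)) U H" unfolding U_def d by simp
 show "H (cons s x)=h s (cinv c x)" if "x:cmap c`cdom c" for s x
 proof -
 have "cinv ?p (cons s x)=(cinv ?r (fst_part (cdim ?r) (cons s x)), cinv c (snd_part (cdim ?r) (cons s x)))"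
 by (rule chart_inv_prod[OF rc cc]) (use inU[OF that, of s] in "simp add: U_def")
 moreover have "cinv ?r (fst_part 1 (cons s x))=s"
 using chart_inv_real[OF fst_part_E[of 1 "cons s x"]] by (simp add: fst_part_def cons_def)
 ultimately show ?thesis using sn by (simp add: H_def)
 qed
 qed (rule inU)
qed

lemma ck_on_integral:
 assumes N:"charted N" and h:"ck_on k (prod_mfd real_mfd N) UNIV (%p. h (fst p) (snd p))" and w:"continuous_on {0..1} w"
 shows "ck_on k N UNIV (%a. integral {0..1} (%s. w s * h s a))" unfolding ck_on_def
proof
 fix c assume c:"c:atlas_of N"
 obtain H U where U:"openin (Euc (Suc (cdim c))) U" "!!x s. x:cmap c`cdom c==>cons s x:U"
 "ck_real k (Suc (cdim c)) U H" "!!x s. x:cmap c`cdom c==>H (cons s x)=h s (cinv c x)"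
 by (rule chart_family[OF N c h]) (rule that)
 note o = chart_img_open[OF charted_chart[OF N c]]
 have "ck_real k (cdim c) (cmap c`cdom c) (%x. integral {0..1} (%s. w s * H (cons s x)))"
 unfolding ck_real_def using ck_fin_integral[OF o U(1,2) w] U(3) unfolding ck_real_def by blast
 hence "ck_real k (cdim c) (cmap c`cdom c) (%x. integral {0..1} (%s. w s * h s (cinv c x)))"
 by (rule ck_real_eq[OF _ o]) (simp add: U(4))
 thus "ck_real k (cdim c) (cmap c`(cdom c\<inter>UNIV)) (%x. integral {0..1} (%s. w s * h s (cinv c x)))" by simp
qed

lemma dch_integral:
 assumes N:"charted N" and h:"ck_on k (prod_mfd real_mfd N) UNIV (%p. h (fst p) (snd p))" and w:"continuous_on {0..1} w"
 and k:"k\<ge>1" and c:"c:atlas_of N" and a:"a:cdom c"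
 shows "dch c a (%a. integral {0..1} (%s. w s * h s a)) v=integral {0..1} (%s. w s * dch c a (h s) v)"
 and "continuous_on UNIV (%s. dch c a (h s) v)" and "continuous_on UNIV (%s. h s a)"
proof -
 let ?d = "cdim c" and ?W = "cmap c`cdom c" and ?x = "cmap c a"
 obtain H U where U:"openin (Euc (Suc ?d)) U" "!!x s. x:?W==>cons s x:U"
 "ck_real k (Suc ?d) U H" "!!x s. x:?W==>H (cons s x)=h s (cinv c x)"
 by (rule chart_family[OF N c h]) (rule that)
 note cc = charted_chart[OF N c]
 note o = chart_img_open[OF cc]
 have x:"?x:?W" using a by simp
 have pdH:"pder i (%x. h s (cinv c x)) ?x=pder (Suc i) H (cons s ?x)" if i:"i<?d" for i s
 proof -
 have "pder i (%x. h s (cinv c x)) ?x=pder i (%x. H (cons s x)) ?x"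
 by (rule pd_cong[OF o x i]) (simp add: U(4))
 also have "has_pd (Suc i) H (cons s ?x) (pder (Suc i) H (cons s ?x))"
 by (rule ck_real_has_pd[OF k U(1,3)]) (use i U(2)[OF x] in auto)
 hence "has_pd i (%x. H (cons s x)) ?x (pder (Suc i) H (cons s ?x))"
 unfolding has_pd_def by (simp add: cons_upd) (simp add: cons_def)
 hence "pder i (%x. H (cons s x)) ?x=pder (Suc i) H (cons s ?x)" by (rule has_pd_imp)
 finally show ?thesis .
 qed
 have cx:"continuous_on UNIV (%s. cons s ?x)"
 using continuous_on_compose2[OF continuous_cons[of UNIV] continuous_on_Pair[OF continuous_on_const[of UNIV ?x] continuous_on_id]] by simp
 have cp:"continuous_on UNIV (%s. pder (Suc i) H (cons s ?x))" if i:"i<?d" for i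
 by (rule continuous_on_compose2[OF ck_real_pd_cont[OF k U(1,3)] cx]) (use i U(2)[OF x] in auto)
 have dchH:"dch c a (h s) v=(SUM j<?d. pder (Suc j) H (cons s ?x) * v j)" for s
 unfolding dch_def by (intro sum.cong refl arg_cong2[where f = "(*)"]) (use pdH in auto)
 show "continuous_on UNIV (%s. dch c a (h s) v)" unfolding dchH by (intro continuous_intros cp) auto
 have "continuous_on UNIV (%s. H (cons s ?x))"
 by (rule continuous_on_compose2[OF ck_real_cont[OF U(1,3)] cx]) (use U(2)[OF x] in auto)
 thus "continuous_on UNIV (%s. h s a)" by (simp add: U(4)[OF x] chart_inv_map[OF cc a])
 have pdI:"pder i (%x. integral {0..1} (%s. w s * h s (cinv c x))) ?x
 = integral {0..1} (%s. w s * pder (Suc i) H (cons s ?x))" if i:"i<?d" for i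
 proof -
 have "pder i (%x. integral {0..1} (%s. w s * h s (cinv c x))) ?x
 = pder i (%x. integral {0..1} (%s. w s * H (cons s x))) ?x"
 by (rule pd_cong[OF o x i]) (simp add: U(4))
 also have "...=integral {0..1} (%s. w s * pder (Suc i) H (cons s ?x))"
 by (rule has_pd_imp[OF integral_param_pd[OF o U(1,2) ck_real_1[OF k U(3)] w x i]])
 finally show ?thesis .
 qed
 have int:"(%s. w s * pder (Suc i) H (cons s ?x) * v i) integrable_on {0..1}" if i:"i<?d" for i
 by (intro integrable_continuous_interval continuous_intros w continuous_on_subset[OF cp[OF i]]) auto
 have "dch c a (%a. integral {0..1} (%s. w s * h s a)) v
 = (SUM i<?d. integral {0..1} (%s. w s * pder (Suc i) H (cons s ?x)) * v i)"
 unfolding dch_def by (intro sum.cong refl arg_cong2[where f = "(*)"]) (use pdI in auto)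
 also have "...=(SUM i<?d. integral {0..1} (%s. w s * pder (Suc i) H (cons s ?x) * v i))" by simp
 also have "...=integral {0..1} (%s. SUM i<?d. w s * pder (Suc i) H (cons s ?x) * v i)"
 by (rule integral_sum[symmetric]) (use int in auto)
 also have "...=integral {0..1} (%s. w s * dch c a (h s) v)"
 unfolding dchH by (simp add: sum_distrib_left mult.assoc)
 finally show "dch c a (%a. integral {0..1} (%s. w s * h s a)) v=integral {0..1} (%s. w s * dch c a (h s) v)" .
qed

section \<open>Averaging over the circles of a torus action\<close>

text \<open>The shifted interval is cut at \<open>1\<close>, and periodicity moves the second piece back.\<close>

lemma integral_periodic_shift:
 fixes f :: "real=>complex"
 assumes c:"continuous_on UNIV f" and p:"!!s. f (s+1)=f s"
 shows "integral {0..1} (%s. f (s+t))=integral {0..1} f"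
proof -
 define u where "u=frac t"
 have u:"0<=u" "u<=1" using frac_ge_0 frac_lt_1[of t] by (auto simp: u_def less_imp_le)
 have ft:"f (s+t)=f (u+s)" for s
 using periodic_int[of f "u+s" "\<lfloor>t\<rfloor>", OF p] by (simp add: u_def frac_def add.commute)
 have i:"f integrable_on {a..b}" for a b by (rule integrable_continuous_interval[OF continuous_on_subset[OF c]]) simp
 have "integral {0..1} (%s. f (s+t))=integral {0+u..1+u} f"
 using integral_shift_Icc_real[of 0 1 f u] by (simp only: ft o_def)
 also have "...=integral {u..1} f+integral {1..1+u} f"
 using Henstock_Kurzweil_Integration.integral_combine[of u 1 "1+u" f] u i by simp
 also have "integral {1..1+u} f=integral {0..u} f"
 using integral_shift_Icc_real[of 0 u f 1] p by (simp add: o_def add.commute)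
 also have "integral {u..1} f+integral {0..u} f=integral {0..1} f"
 using Henstock_Kurzweil_Integration.integral_combine[of 0 u 1 f] u i by (simp add: add.commute)
 finally show ?thesis .
qed

lemma opn_UNIV:"opn L UNIV" by simp

lemma dch_lincomb:
 assumes N:"charted N" and k:"k\<ge>1" and c:"c:atlas_of N" and a:"a:cdom c"
 and f:"ck_on k N UNIV f" and g:"ck_on k N UNIV g"
 shows "dch c a (%x. p * f x+q * g x) v=p * dch c a f v+q * dch c a g v"
proof -
 note o = chart_img_open[OF charted_chart[OF N c]]
 have x:"cmap c a:cmap c`cdom c" using a by simp
 have h:"has_pd j (%v. h (cinv c v)) (cmap c a) (pder j (%v. h (cinv c v)) (cmap c a))"
 if "ck_on k N UNIV h" "j<cdim c" for h j
 by (rule ck_real_has_pd[OF k o _ that(2) x]) (use that(1) c in "simp add: ck_on_def")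
 have "pder j (%v. p * f (cinv c v)+q * g (cinv c v)) (cmap c a) =
 p * pder j (%v. f (cinv c v)) (cmap c a)+q * pder j (%v. g (cinv c v)) (cmap c a)"
 if j:"j<cdim c" for j
 proof (rule has_pd_imp)
 show "has_pd j (%v. p * f (cinv c v)+q * g (cinv c v)) (cmap c a)
 (p * pder j (%v. f (cinv c v)) (cmap c a)+q * pder j (%v. g (cinv c v)) (cmap c a))"
 using h[OF f j] h[OF g j] unfolding has_pd_def by (intro DERIV_add DERIV_cmult)
 qed
 hence "dch c a (%x. p * f x+q * g x) v=(SUM j<cdim c.
 (p * pder j (%v. f (cinv c v)) (cmap c a)+q * pder j (%v. g (cinv c v)) (cmap c a)) * v j)"
 unfolding dch_def by (intro sum.cong) auto
 thus ?thesis by (simp add: dch_def sum.distrib sum_distrib_left algebra_simps)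
qed

lemma smooth_trig:"smooth_real (%s. cos (c * s))" "smooth_real (%s. sin (c * s))"
proof -
 have d:"smooth_real (%s. A * cos (c * s)+B * sin (c * s))" for A B unfolding smooth_real_def
 proof (intro exI[of _ "%n s. c^n*(A * cos (c * s+n * pi/2)+B * sin (c * s+n * pi/2))"] conjI allI)
 fix n s
 have e:"cos (c * s+real (Suc n) * pi/2) =-sin (c * s+n * pi/2)" "sin (c * s+real (Suc n) * pi/2)=cos (c * s+n * pi/2)"
 using cos_add[of "c * s+n * pi/2" "pi/2"] sin_add[of "c * s+n * pi/2" "pi/2"] by (simp_all add: field_simps)
 show "((%s. c^n*(A * cos (c * s+n * pi/2)+B * sin (c * s+n * pi/2))) has_real_derivative
 c^Suc n*(A * cos (c * s+real (Suc n) * pi/2)+B * sin (c * s+real (Suc n) * pi/2))) (at s)"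
 unfolding e by (auto intro!: derivative_eq_intros simp: algebra_simps)
 qed auto
 show "smooth_real (%s. cos (c * s))" "smooth_real (%s. sin (c * s))" using d[of 1 0] d[of 0 1] by simp_all
qed

text \<open>Functionals that may be exchanged with averaging: differences of values and directional derivatives.\<close>

definition averageable :: "enat=>'a mfd=>(('a=>real)=>real)=>bool" where
 "averageable k N T \<longleftrightarrow>
 (ALL f g. (ALL a:points N. f a=g a)-->T f=T g) &
 (ALL f g p q. ck_on k N UNIV f-->ck_on k N UNIV g-->T (%a. p * f a+q * g a)=p * T f+q * T g) &
 (ALL h. ck_on k (prod_mfd real_mfd N) UNIV (%p. h (fst p) (snd p))-->continuous_on UNIV (%s. T (h s)) &
 T (%a. integral {0..1} (%s. h s a))=integral {0..1} (%s. T (h s)))"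

lemma averageable_difference:
 assumes N:"charted N" and k:"k\<ge>1" and ab:"a:points N" "b:points N"
 shows "averageable k N (%f. f a-f b)" unfolding averageable_def
proof (intro conjI allI impI)
 fix h assume h:"ck_on k (prod_mfd real_mfd N) UNIV (%p. h (fst p) (snd p))"
 have c:"continuous_on UNIV (%s. h s a)" if "a:points N" for a
 proof -
 obtain c where "c:atlas_of N" "a:cdom c" using charted_cover[OF N, of a] \<open>a \<in> points N\<close> by blast
 thus ?thesis using dch_integral(3)[OF N h continuous_on_const k] by blast
 qed
 show "continuous_on UNIV (%s. h s a-h s b)" by (intro continuous_intros c ab)
 have i:"(%s. h s a) integrable_on {0..1}" if "a:points N" for a
 by (rule integrable_continuous_interval[OF continuous_on_subset[OF c[OF that]]]) simp
 show "integral {0..1} (%s. h s a)-integral {0..1} (%s. h s b)=integral {0..1} (%s. h s a-h s b)"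
 using integral_diff[OF i[OF ab(1)] i[OF ab(2)]] by simp
qed (use ab in "auto simp: algebra_simps")

lemma averageable_dch:
 assumes N:"charted N" and k:"k\<ge>1" and c:"c:atlas_of N" and a:"a:cdom c"
 shows "averageable k N (%f. dch c a f v)" unfolding averageable_def
proof (intro conjI allI impI)
 show "dch c a f v=dch c a g v" if "ALL a:points N. f a=g a" for f g
 by (rule dch_cong[OF charted_chart[OF N c] a opn_openin[OF openin_topspace]])
 (use that chart_dom_subset[OF charted_chart[OF N c]] a in auto)
 show "dch c a (%x. p * f x+q * g x) v=p * dch c a f v+q * dch c a g v"
 if "ck_on k N UNIV f" "ck_on k N UNIV g" for f g p q by (rule dch_lincomb[OF N k c a that])
 fix h assume h:"ck_on k (prod_mfd real_mfd N) UNIV (%p. h (fst p) (snd p))"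
 show "continuous_on UNIV (%s. dch c a (h s) v)" by (rule dch_integral(2)[OF N h continuous_on_const k c a])
 show "dch c a (%a. integral {0..1} (%s. h s a)) v=integral {0..1} (%s. dch c a (h s) v)"
 using dch_integral(1)[OF N h continuous_on_const[of _ 1] k c a, of v] by simp
qed

definition ck_complex :: "enat=>'a mfd=>('a=>complex)=>bool" where
 "ck_complex k N h\<longleftrightarrow>ck_on k N UNIV (%a. Re (h a))&ck_on k N UNIV (%a. Im (h a))"

definition complexify :: "(('a=>real)=>real)=>('a=>complex)=>complex" where
 "complexify T h=Complex (T (%a. Re (h a))) (T (%a. Im (h a)))"

locale torus_action =
 fixes k :: enat and m :: nat and N :: "'a mfd" and \<Theta> :: "(nat=>real)=>'a=>'a"
 assumes k:"k\<ge>1" and N:"ck_atlas k N" and action:"ck_torus_action k m N \<Theta>"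
begin

lemma Nc:"charted N" using N by (rule ck_atlas_charted)

definition rot :: "nat=>real=>'a=>'a" where "rot i s a=\<Theta> (circle i s) a"

lemma action_ck:"ck_map k (prod_mfd (torus_mfd m) N) N (%(h, a). \<Theta> h a)"
 and action_0:"a:points N==>\<Theta> (%_. 0) a=a"
 and action_add:"g:points (torus_mfd m)==>h:points (torus_mfd m)==>a:points N ==>
 \<Theta> (mod1 (%i. g i+h i)) a=\<Theta> g (\<Theta> h a)" using action by (auto simp: ck_torus_action_def)

lemma mod1_add:"mod1 (%i. mod1 u i+mod1 v i)=mod1 (%i. u i+v i)" unfolding mod1_eq_iff
proof
 fix i
 have "mod1 u i+mod1 v i-(u i+v i) = of_int (- \<lfloor>u i\<rfloor>-\<lfloor>v i\<rfloor>)" by (simp add: mod1_def frac_def)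
 thus "mod1 u i+mod1 v i-(u i+v i):\<int>" by (metis Ints_of_int)
qed

lemma action_mod1_add:
 assumes "u:E m" "v:E m" "a:points N"
 shows "\<Theta> (mod1 (%i. u i+v i)) a=\<Theta> (mod1 u) (\<Theta> (mod1 v) a)"
 using action_add[of "mod1 u" "mod1 v" a] assms by (simp add: points_torus mod1_add)

lemma mod1_0:"mod1 (%_. 0)=(%_. 0)" by (simp add: mod1_def)

lemma ck_map_rot:
 assumes i:"i<m" shows "ck_map k (prod_mfd real_mfd N) N (%p. rot i (fst p) (snd p))"
proof -
 let ?P = "prod_mfd real_mfd N"
 note P = charted_prod[OF charted_real Nc]
 have f:"ck_map k ?P real_mfd fst" unfolding ck_map_iff
 proof (intro conjI ballI allI impI)
 show "continuous_map (space_of ?P) (space_of real_mfd) fst" by (simp add: prod_mfd_def continuous_map_fst)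
 fix e l assume e:"e:atlas_of real_mfd" "l<cdim e"
 have "ck_on k ?P (fst -` UNIV) (%p. (%s. s) (fst p))"
 by (rule ck_on_fst[OF charted_real Nc opn_UNIV ck_on_real_smooth[OF smooth_real_id]])
 thus "ck_on k ?P (fst -` cdom e) (%p. cmap e (fst p) l)" using e by (auto simp: real_mfd_def)
 qed
 have s:"ck_map k ?P N snd" unfolding ck_map_iff
 proof (intro conjI ballI allI impI)
 show "continuous_map (space_of ?P) (space_of N) snd" by (simp add: prod_mfd_def continuous_map_snd)
 fix e l assume e:"e:atlas_of N" "l<cdim e"
 hence a:"admissible_chart k N e" using N by (simp add: ck_atlas_def)
 show "ck_on k ?P (snd -` cdom e) (%p. cmap e (snd p) l)"
 by (rule ck_on_snd[OF charted_real Nc adm_opn[OF a] adm_coord[OF a e(2)]])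
 qed
 have "ck_map k ?P (prod_mfd (torus_mfd m) N) (%p. (circle i (fst p), snd p))"
 by (rule ck_map_Pair[OF P charted_torus Nc ck_map_comp[OF P charted_real charted_torus f ck_map_circle[OF i]] s])
 from ck_map_comp[OF P charted_prod[OF charted_torus Nc] Nc this action_ck] show ?thesis by (simp add: rot_def)
qed

lemma rot_points: assumes "i<m" "a:points N" shows "rot i s a:points N"
 using ck_map_points[OF ck_map_rot[OF assms(1)], of "(s, a)"] assms(2) by (simp add: prod_mfd_def)

lemma axis_E:"i<m==>(%j. if j=i then s else 0):E m" by (auto simp: E_iff)

lemma rot_add: assumes "i<m" "a:points N" shows "rot i (s+t) a=rot i s (rot i t a)"
proof -
 have "(%j. if j=i then s+t else 0)=(%j. (if j=i then s else 0)+(if j=i then t else 0))" by auto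
 thus ?thesis
 using action_mod1_add[OF axis_E[OF assms(1), of s] axis_E[OF assms(1), of t] assms(2)] by (simp only: rot_def circle_def)
qed

lemma rot_0:"i<m==>a:points N==>rot i 0 a=a"
 using action_0[of a] by (simp add: rot_def circle_def mod1_0)

lemma rot_1:"rot i (s+1) a=rot i s a"
proof -
 have "circle i (s+1)=circle i s" unfolding circle_def mod1_eq_iff by auto
 thus ?thesis by (simp add: rot_def)
qed

lemma rot_commute: assumes "i<m" "j<m" "a:points N" shows "rot i s (rot j t a)=rot j t (rot i s a)"
 using action_mod1_add[OF axis_E[OF assms(1), of s] axis_E[OF assms(2), of t] assms(3)]
 action_mod1_add[OF axis_E[OF assms(2), of t] axis_E[OF assms(1), of s] assms(3)]
 by (simp add: rot_def circle_def add.commute)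

definition fourier :: "nat=>int=>('a=>complex)=>'a=>complex" where
 "fourier i n h a=integral {0..1} (%s. cis (- (2 * pi * of_int n * s)) * h (rot i s a))"

lemma ck_rot: assumes "i<m" "ck_on k N UNIV f" shows "ck_on k (prod_mfd real_mfd N) UNIV (%p. f (rot i (fst p) (snd p)))"
 using ck_on_comp[OF charted_prod[OF charted_real Nc] Nc ck_map_rot[OF assms(1)] _ assms(2)]
 opn_openin[OF openin_topspace, of N] by simp

lemma fourier_family:
 fixes n :: int
 assumes i:"i<m" and h:"ck_complex k N h"
 defines "R s a\<equiv>cos (2 * pi * of_int n * s) * Re (h (rot i s a))+sin (2 * pi * of_int n * s) * Im (h (rot i s a))"
 and "I s a\<equiv>cos (2 * pi * of_int n * s) * Im (h (rot i s a))+(- sin (2 * pi * of_int n * s)) * Re (h (rot i s a))"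
 shows "ck_on k (prod_mfd real_mfd N) UNIV (%p. R (fst p) (snd p))" "ck_on k (prod_mfd real_mfd N) UNIV (%p. I (fst p) (snd p))"
 and "a:points N==>continuous_on UNIV (%s. cis (- (2 * pi * of_int n * s)) * h (rot i s a))"
 and "a:points N==>Re (fourier i n h a)=integral {0..1} (%s. R s a)"
 and "a:points N==>Im (fourier i n h a)=integral {0..1} (%s. I s a)"
proof -
 note P = charted_prod[OF charted_real Nc]
 let ?P = "prod_mfd real_mfd N"
 note r = ck_rot[OF i conjunct1[OF h[unfolded ck_complex_def]]] ck_rot[OF i conjunct2[OF h[unfolded ck_complex_def]]]
 have t:"ck_on k ?P UNIV (%p. f (fst p))" if "smooth_real f" for f
 using ck_on_fst[OF charted_real Nc opn_UNIV ck_on_real_smooth[OF that]] by simp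
 show R:"ck_on k ?P UNIV (%p. R (fst p) (snd p))"
 unfolding R_def by (intro ck_on_add[OF P opn_UNIV] ck_on_mult[OF P opn_UNIV] r t[OF smooth_trig(1)] t[OF smooth_trig(2)])
 have "ck_on k ?P UNIV (%p. cos (2 * pi * of_int n * fst p) * Im (h (rot i (fst p) (snd p)))-sin (2 * pi * of_int n * fst p) * Re (h (rot i (fst p) (snd p))))"
 by (intro ck_on_diff[OF P opn_UNIV] ck_on_mult[OF P opn_UNIV] r t[OF smooth_trig(1)] t[OF smooth_trig(2)])
 thus I:"ck_on k ?P UNIV (%p. I (fst p) (snd p))" unfolding I_def by simp
 {
 assume a:"a:points N"
 obtain c where c:"c:atlas_of N" "a:cdom c" using charted_cover[OF Nc] a by blast
 have eq:"cis (- (2 * pi * of_int n * s)) * h (rot i s a)=Complex (R s a) (I s a)" for s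
 by (rule complex_eqI) (simp_all add: R_def I_def)
 have cR:"continuous_on UNIV (%s. R s a)" by (rule dch_integral(3)[OF Nc R continuous_on_const k c])
 have cI:"continuous_on UNIV (%s. I s a)" by (rule dch_integral(3)[OF Nc I continuous_on_const k c])
 show co:"continuous_on UNIV (%s. cis (- (2 * pi * of_int n * s)) * h (rot i s a))"
 unfolding eq Complex_eq by (intro continuous_intros cR cI)
 have int:"(%s. cis (- (2 * pi * of_int n * s)) * h (rot i s a)) integrable_on {0..1}"
 by (rule integrable_continuous_interval[OF continuous_on_subset[OF co]]) simp
 show "Re (fourier i n h a)=integral {0..1} (%s. R s a)"
 using integral_linear[OF int bounded_linear_Re] unfolding fourier_def eq by (simp add: o_def)
 show "Im (fourier i n h a)=integral {0..1} (%s. I s a)"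
 using integral_linear[OF int bounded_linear_Im] unfolding fourier_def eq by (simp add: o_def)
 }
qed

lemma ck_fourier:
 assumes i:"i<m" and h:"ck_complex k N h"
 shows "ck_complex k N (fourier i n h)"
proof -
 note F = fourier_family[where n = n, OF i h]
 have "ck_on k N UNIV (%a. Re (fourier i n h a))"
 using ck_on_integral[OF Nc F(1) continuous_on_const[of _ 1]] by (subst ck_on_cong[OF Nc opn_UNIV F(4)]) auto
 moreover have "ck_on k N UNIV (%a. Im (fourier i n h a))"
 using ck_on_integral[OF Nc F(2) continuous_on_const[of _ 1]] by (subst ck_on_cong[OF Nc opn_UNIV F(5)]) auto
 ultimately show ?thesis by (simp add: ck_complex_def)
qed

lemma fourier_eigen:
 assumes i:"i<m" and h:"ck_complex k N h" and a:"a:points N"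
 shows "fourier i n h (rot i t a)=cis (2 * pi * of_int n * t) * fourier i n h a"
proof -
 define f where "f s=cis (- (2 * pi * of_int n * s)) * h (rot i s a)" for s
 have per:"f (s+1)=f s" for s
 proof -
 have "cis (- (2 * pi * of_int n*(s+1)))=cis (- (2 * pi * of_int n * s)) * cis (2 * pi * of_int (- n))"
 unfolding cis_mult by (rule arg_cong[of _ _ cis]) (simp add: algebra_simps)
 moreover have "cis (2 * pi * of_int (- n))=1" by (rule cis_multiple_2pi) simp
 ultimately show ?thesis by (simp only: f_def rot_1 mult_1_right)
 qed
 have "fourier i n h (rot i t a)=integral {0..1} (%s. cis (2 * pi * of_int n * t) * f (s+t))"
 proof -
 have "cis (- (2 * pi * of_int n * s)) * h (rot i s (rot i t a))=cis (2 * pi * of_int n * t) * f (s+t)" for s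
 unfolding f_def rot_add[OF i a, symmetric] mult.assoc[symmetric] cis_mult
 by (rule arg_cong2[where f = "(*)"]) (simp_all add: algebra_simps)
 thus ?thesis by (simp add: fourier_def)
 qed
 also have "...=cis (2 * pi * of_int n * t) * integral {0..1} (%s. f (s+t))" by simp
 also have "integral {0..1} (%s. f (s+t))=integral {0..1} f"
 by (rule integral_periodic_shift) (use fourier_family(3)[where n = n, OF i h a] per in "auto simp: f_def")
 also have "integral {0..1} f=fourier i n h a" by (simp add: fourier_def f_def[abs_def])
 finally show ?thesis .
qed

lemma fourier_keeps_eigen:
 assumes i:"i<m" and j:"j<m" and e:"!!t a. a:points N==>h (rot j t a)=cis (c * t) * h a" and a:"a:points N"
 shows "fourier i n h (rot j t a)=cis (c * t) * fourier i n h a"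
proof -
 have "cis (- (2 * pi * of_int n * s)) * h (rot i s (rot j t a))=cis (c * t)*(cis (- (2 * pi * of_int n * s)) * h (rot i s a))" for s
 unfolding rot_commute[OF i j a] using e[OF rot_points[OF i a]] by (simp add: mult_ac)
 thus ?thesis unfolding fourier_def by (simp only: integral_mult_right)
qed

lemma complexify_fourier:
 assumes i:"i<m" and h:"ck_complex k N h" and T:"averageable k N T"
 shows "complexify T (fourier i n h)=integral {0..1} (%s. cis (- (2 * pi * of_int n * s)) * complexify T (%a. h (rot i s a)))"
 and "continuous_on UNIV (%s. complexify T (%a. h (rot i s a)))"
proof -
 have Tc:"T f=T g" if "!!a. a:points N==>f a=g a" for f g
 using T that unfolding averageable_def by blast
 have Tl:"T (%a. p * f a+q * g a)=p * T f+q * T g" if "ck_on k N UNIV f" "ck_on k N UNIV g" for f g p q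
 using T that unfolding averageable_def by blast
 have TI:"continuous_on UNIV (%s. T (h s))" "T (%a. integral {0..1} (%s. h s a))=integral {0..1} (%s. T (h s))"
 if "ck_on k (prod_mfd real_mfd N) UNIV (%p. h (fst p) (snd p))" for h
 using T that unfolding averageable_def by blast+
 have h':"ck_on k N UNIV (%a. Re (h a))" "ck_on k N UNIV (%a. Im (h a))" using h by (auto simp: ck_complex_def)
 note r = ck_rot[OF i h'(1)] ck_rot[OF i h'(2)]
 show co:"continuous_on UNIV (%s. complexify T (%a. h (rot i s a)))"
 unfolding complexify_def Complex_eq by (intro continuous_intros TI(1)) (use r in auto)
 have slice:"ck_map k N N (%a. rot i s a)" for s
 proof -
 have "ck_map k N (prod_mfd real_mfd N) (%a. (s, a))"
 by (rule ck_map_Pair[OF Nc charted_real Nc ck_map_const[OF Nc] adm_id[OF N]]) simp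
 from ck_map_comp[OF Nc charted_prod[OF charted_real Nc] Nc this ck_map_rot[OF i]] show ?thesis by simp
 qed
 have rs:"ck_on k N UNIV (%a. f (rot i s a))" if "ck_on k N UNIV f" for f s
 using ck_on_comp[OF Nc Nc slice opn_UNIV that] by simp
 note F = fourier_family[where n = n, OF i h]
 have e:"cis (- (2 * pi * of_int n * s)) * complexify T (%a. h (rot i s a)) =
 Complex (T (%a. cos (2 * pi * of_int n * s) * Re (h (rot i s a))+sin (2 * pi * of_int n * s) * Im (h (rot i s a))))
 (T (%a. cos (2 * pi * of_int n * s) * Im (h (rot i s a))+(- sin (2 * pi * of_int n * s)) * Re (h (rot i s a))))" for s
 unfolding Tl[OF rs[OF h'(1)] rs[OF h'(2)]] Tl[OF rs[OF h'(2)] rs[OF h'(1)]]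
 by (rule complex_eqI) (simp_all add: complexify_def)
 have int:"(%s. cis (- (2 * pi * of_int n * s)) * complexify T (%a. h (rot i s a))) integrable_on {0..1}"
 by (intro integrable_continuous_interval continuous_on_mult continuous_on_subset[OF co]) (auto intro!: continuous_intros)
 show "complexify T (fourier i n h)=integral {0..1} (%s. cis (- (2 * pi * of_int n * s)) * complexify T (%a. h (rot i s a)))"
 proof (rule complex_eqI)
 have "Re (complexify T (fourier i n h))=T (%a. integral {0..1} (%s. cos (2 * pi * of_int n * s) * Re (h (rot i s a))+sin (2 * pi * of_int n * s) * Im (h (rot i s a))))"
 unfolding complexify_def by (simp, rule Tc, rule F(4))
 also have "...=Re (integral {0..1} (%s. cis (- (2 * pi * of_int n * s)) * complexify T (%a. h (rot i s a))))"
 unfolding TI(2)[OF F(1)] e by (rule integral_linear[OF int bounded_linear_Re, unfolded e o_def complex.sel])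
 finally show "Re (complexify T (fourier i n h))=..." .
 have "Im (complexify T (fourier i n h))=T (%a. integral {0..1} (%s. cos (2 * pi * of_int n * s) * Im (h (rot i s a))+(- sin (2 * pi * of_int n * s)) * Re (h (rot i s a))))"
 unfolding complexify_def by (simp only: complex.sel, rule Tc, rule F(5))
 also have "...=Im (integral {0..1} (%s. cis (- (2 * pi * of_int n * s)) * complexify T (%a. h (rot i s a))))"
 unfolding TI(2)[OF F(2)] e by (rule integral_linear[OF int bounded_linear_Im, unfolded e o_def complex.sel])
 finally show "Im (complexify T (fourier i n h))=..." .
 qed
qed

text \<open>If a functional does not vanish on \<open>h\<close>, its values on the rotated functions form a periodic function
  that is not \<open>0\<close>, so one of its Fourier coefficients, that is its value on a Fourier component of \<open>h\<close>,
  is not \<open>0\<close>. Treating the circles one after the other yields a simultaneous eigenfunction.\<close>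

lemma eigenfunction_exists:
 assumes T:"averageable k N T" and f:"ck_on k N UNIV f" "T f~=0"
 obtains h :: "'a=>complex" and n :: "nat=>int" where "ck_complex k N h" "complexify T h~=0"
 "!!i t a. i<m==>a:points N==>h (rot i t a)=cis (2 * pi * of_int (n i) * t) * h a"
proof -
 have T0:"T (%a. 0)=0"
 proof -
 have "T (%a. 0 * f a+0 * f a)=0 * T f+0 * T f" using T f(1) unfolding averageable_def by blast
 thus ?thesis by simp
 qed
 have "EX h n. ck_complex k N h&complexify T h~=0 &
 (ALL i<j. ALL t. ALL a:points N. h (rot i t a)=cis (2 * pi * of_int (n i::int) * t) * h a)" if "j<=m" for j
 using that
 proof (induction j)
 case 0
 have "ck_complex k N (%a. of_real (f a))" using f(1) ck_on_const[OF Nc opn_UNIV] by (simp add: ck_complex_def)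
 moreover have "complexify T (%a. of_real (f a))~=0" using f(2) T0 by (simp add: complexify_def complex_eq_iff)
 ultimately show ?case by blast
 next
 case (Suc j)
 from Suc.IH[OF Suc_leD[OF Suc.prems]] obtain h n where hn:"ck_complex k N h&complexify T h~=0 &
 (ALL i<j. ALL t. ALL a:points N. h (rot i t a)=cis (2 * pi * of_int (n i::int) * t) * h a)" by blast
 hence h:"ck_complex k N h" "complexify T h~=0"
 and e:"!!i t a. i<j==>a:points N==>h (rot i t a)=cis (2 * pi * of_int (n i) * t) * h a" by auto
 have j:"j<m" using Suc.prems by simp
 define \<phi> where "\<phi> s=complexify T (%a. h (rot j s a))" for s
 have "\<phi> 0=complexify T h"
 proof -
 have "T f=T g" if "!!a. a:points N==>f a=g a" for f g
 using T that unfolding averageable_def by blast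
 thus ?thesis unfolding \<phi>_def complexify_def by (metis (mono_tags, lifting) rot_0[OF j])
 qed
 hence "\<phi> 0~=0" using h(2) by simp
 moreover have "continuous_on UNIV \<phi>" unfolding \<phi>_def by (rule complexify_fourier(2)[OF j h(1) T])
 moreover have "\<phi> (s+1)=\<phi> s" for s by (simp add: \<phi>_def rot_1)
 ultimately obtain l :: int where l:"integral {0..1} (%s. cis (- (2 * pi * of_int l * s))*\<phi> s)~=0"
 using fourier_unique[of \<phi> 0] by blast
 define h' n' where "h'=fourier j l h" and "n'=n(j := l)"
 have "complexify T h'~=0" using l unfolding h'_def complexify_fourier(1)[OF j h(1) T] \<phi>_def .
 moreover have "ck_complex k N h'" unfolding h'_def by (rule ck_fourier[OF j h(1)])
 moreover have "h' (rot i t a)=cis (2 * pi * of_int (n' i) * t) * h' a" if "i<Suc j" "a:points N" for i t a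
 proof (cases "i=j")
 case True thus ?thesis using fourier_eigen[OF j h(1) that(2)] by (simp add: h'_def n'_def)
 next
 case False
 hence "i<j" "i<m" using that j by auto
 thus ?thesis using fourier_keeps_eigen[OF j \<open>i < m\<close> e[OF \<open>i < j\<close>] that(2)] False by (simp add: h'_def n'_def)
 qed
 ultimately show ?case by blast
 qed
 from this[OF order.refl] obtain h n where hn:"ck_complex k N h&complexify T h~=0 &
 (ALL i<m. ALL t. ALL a:points N. h (rot i t a)=cis (2 * pi * of_int (n i::int) * t) * h a)" by blast
 show ?thesis by (rule that[of h n]) (use hn in auto)
qed

lemma eigenfunction_torus:
 assumes e:"!!i t a. i<m==>a:points N==>h (rot i t a)=cis (2 * pi * of_int (n i) * t) * h a"
 and v:"v:E m" and a:"a:points N"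
 shows "h (\<Theta> (mod1 v) a)=cis (2 * pi*(SUM i<m. of_int (n i) * v i)) * h a"
proof -
 define u where "u j=(%i. if i<j then v i else 0)" for j :: nat
 have uE:"u j:E m" for j using v by (auto simp: u_def E_iff)
 have "h (\<Theta> (mod1 (u j)) a)=cis (2 * pi*(SUM i<j. of_int (n i) * v i)) * h a&\<Theta> (mod1 (u j)) a:points N" if "j<=m" for j
 using that
 proof (induction j)
 case 0 thus ?case using action_0[OF a] a by (simp add: u_def mod1_0)
 next
 case (Suc j)
 hence j:"j<m" and IH:"h (\<Theta> (mod1 (u j)) a)=cis (2 * pi*(SUM i<j. of_int (n i) * v i)) * h a" "\<Theta> (mod1 (u j)) a:points N" by auto
 have "u (Suc j)=(%i. (if i=j then v j else 0)+u j i)" by (auto simp: u_def less_Suc_eq)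
 hence s:"\<Theta> (mod1 (u (Suc j))) a=rot j (v j) (\<Theta> (mod1 (u j)) a)"
 using action_mod1_add[OF axis_E[OF j, of "v j"] uE a] by (simp add: rot_def circle_def)
 have "h (\<Theta> (mod1 (u (Suc j))) a)=cis (2 * pi * of_int (n j) * v j)*(cis (2 * pi*(SUM i<j. of_int (n i) * v i)) * h a)"
 unfolding s e[OF j IH(2)] IH(1) ..
 also have "...=cis (2 * pi*(SUM i<Suc j. of_int (n i) * v i)) * h a"
 unfolding mult.assoc[symmetric] cis_mult by (simp add: algebra_simps)
 finally show ?case using rot_points[OF j IH(2)] s by simp
 qed
 moreover have "u m=v" using v by (auto simp: u_def E_iff fun_eq_iff)
 ultimately show ?thesis by auto
qed

end

section \<open>Embeddings from finitely many observables\<close>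

text \<open>The unit sphere is compact, and each functional is nonzero on an open subset of it.\<close>

lemma finite_trivial_kernel:
 fixes D :: "'i=>nat=>real"
 assumes D:"!!w. w:E d==>w~=(%_. 0)==>EX i:I. (SUM j<d. D i j * w j)~=0"
 obtains J where "finite J" "J<=I" "!!w. w:E d==>w~=(%_. 0)==>EX i:J. (SUM j<d. D i j * w j)~=0"
proof -
 define S where "S={w:E d. (ALL i<d. \<bar>w i-0\<bar><=1)}\<inter>{w:E d. (SUM i<d. \<bar>w i\<bar>):{1..}}"
 have co:"continuous_map (Euc d) euclideanreal f" if "continuous_on (E d) f" for f
 using cont_iff[of d "E d" f] that by simp
 have c1:"continuous_on (E d) (%w. SUM i<d. \<bar>w i\<bar>)" by (intro continuous_intros)
 have "closedin (Euc d) {w:E d. (SUM i<d. \<bar>w i\<bar>):{1..}}"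
 by (rule closedin_continuous_map_preimage[OF co[OF c1]]) auto
 moreover have "compactin (Euc d) {w:E d. (ALL i<d. \<bar>w i-0\<bar><=1)}" by (rule compactin_cbox[of d "%_. 0" 1])
 ultimately have S:"compactin (Euc d) S" unfolding S_def
 by (metis (no_types, lifting) Hausdorff_Euclidean_space Int_lower1 closed_compactin closedin_Int compactin_imp_closedin)
 define O' where "O' i={w:E d. (SUM j<d. D i j * w j) \<in>-{0}}" for i
 have c2:"continuous_on (E d) (%w. SUM j<d. D i j * w j)" for i by (intro continuous_intros)
 have O':"openin (Euc d) (O' i)" for i
 unfolding O'_def by (rule openin_continuous_map_preimage[OF co[OF c2]]) (simp add: open_Compl)
 have "S<=\<Union>(O'`I)"
 proof
 fix w assume w:"w:S"
 hence "w~=(%_. 0)" by (auto simp: S_def)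
 thus "w\<in>\<Union>(O'`I)" using D[of w] w by (auto simp: S_def O'_def)
 qed
 hence "\<exists>\<F>. finite \<F>&\<F><=O'`I&S<=\<Union>\<F>"
 using S O' unfolding compactin_def by (metis (no_types, lifting) imageE)
 then obtain J where J:"finite J" "J<=I" "S<=\<Union>(O'`J)" by (metis finite_subset_image)
 show ?thesis
 proof (rule that[OF J(1,2)])
 fix w assume w:"w:E d" "w~=(%_. 0)"
 define c where "c=(SUM i<d. \<bar>w i\<bar>)"
 obtain i where "w i~=0" using w(2) by auto
 hence i:"i<d" "w i~=0" using w(1) by (auto simp: E_iff not_le[symmetric])
 have le:"\<bar>w l\<bar><=c" if "l<d" for l unfolding c_def using that by (intro member_le_sum[of l "{..<d}" "%l. \<bar>w l\<bar>"]) auto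
 have c:"c > 0" using le[OF i(1)] i(2) by linarith
 define u where "u l=w l/c" for l
 have "u:S" using w(1) c le by (auto simp: S_def u_def E_iff sum_divide_distrib[symmetric] c_def[symmetric])
 then obtain l where l:"l:J" "(SUM j<d. D l j * u j)~=0" using J(3) by (auto simp: O'_def)
 have "(SUM j<d. D l j * u j)=(SUM j<d. D l j * w j)/c" by (simp add: u_def sum_divide_distrib)
 thus "EX i:J. (SUM j<d. D i j * w j)~=0" using l by auto
 qed
qed

lemma dch_sum:
 assumes M:"charted M" and c:"admissible_chart k M c" and k:"k\<ge>1" and x:"x:cdom c"
 and f:"!!j. j<n==>ck_on k M UNIV (%y. F y j)"
 shows "dch c x (%y. SUM j<n. L j * F y j) w=(SUM j<n. L j * dch c x (%y. F y j) w)"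
proof -
 let ?v = "cmap c x" and ?i = "cinv c"
 note o = chart_img_open[OF adm_chart[OF c]]
 have "has_pd l (%v. F (?i v) j) ?v (pder l (%v. F (?i v) j) ?v)" if "j<n" "l<cdim c" for j l
 by (rule ck_real_has_pd[OF k o _ that(2)]) (use adm_pull[OF M c opn_UNIV f[OF that(1)]] x in auto)
 hence "has_pd l (%v. SUM j<n. L j * F (?i v) j) ?v (SUM j<n. L j * pder l (%v. F (?i v) j) ?v)" if "l<cdim c" for l
 using has_pd_sum_mult[of n l "%v j. F (?i v) j" ?v "%j. pder l (%v. F (?i v) j) ?v" L] that by blast
 hence "pder l (%v. SUM j<n. L j * F (?i v) j) ?v=(SUM j<n. L j * pder l (%v. F (?i v) j) ?v)" if "l<cdim c" for l
 using that has_pd_imp by blast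
 hence "dch c x (%y. SUM j<n. L j * F y j) w=(SUM l<cdim c. (SUM j<n. L j * pder l (%v. F (?i v) j) ?v) * w l)"
 unfolding dch_def by (intro sum.cong) auto
 also have "...=(SUM j<n. L j * dch c x (%y. F y j) w)"
 unfolding dch_def sum_distrib_left sum_distrib_right by (subst sum.swap) (simp add: mult.assoc)
 finally show ?thesis .
qed

context attracting_flow
begin

text \<open>Along every orbit, the components of an observable satisfy one linear differential equation.\<close>

definition observable :: "nat=>('a=>nat=>real)=>bool" where
 "observable n F\<longleftrightarrow>(ALL x:points M. F x:E n)&(ALL i<n. ck_on k M UNIV (%x. F x i)) &
 (EX C::nat=>nat=>real. ALL x:points M. ALL t. ALL i<n.
 ((%t. F (\<Phi> t x) i) has_real_derivative (SUM j<n. C i j * F (\<Phi> t x) j)) (at t))"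

lemma observable_exp:
 assumes F:"observable n F"
 obtains C where "C:carrier_mat n n" "!!x t. x:points M==>F (\<Phi> t x)=lin_app n n (mexp C t) (F x)"
proof -
 obtain C :: "nat=>nat=>real" where C:"!!x t i. x:points M==>i<n ==>
 ((%t. F (\<Phi> t x) i) has_real_derivative (SUM j<n. C i j * F (\<Phi> t x) j)) (at t)"
 and FE:"!!x. x:points M==>F x:E n" using F unfolding observable_def by blast
 define B where "B=Matrix.mat n n (%(i, j). C i j)"
 have B:"B:carrier_mat n n" by (simp add: B_def)
 show ?thesis
 proof (rule that[OF B])
 fix x t assume x:"x:points M"
 have "F (\<Phi> t x) i=(SUM j<n. mexp B t i j * F (\<Phi> 0 x) j)" if "i<n" for i
 by (rule linear_ode_unique[OF B, where y = "%t. F (\<Phi> t x)"]) (use C[OF x] that in "simp_all add: B_def")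
 thus "F (\<Phi> t x)=lin_app n n (mexp B t) (F x)"
 by (intro E_eqI[OF FE[OF flow_points[OF x]] lin_app_E]) (simp add: lin_app_def flow_0[OF x])
 qed
qed

lemma observable_ck:"observable n F==>ck_map k M (euclidean_mfd n) F"
 unfolding ck_map_euclidean[OF Mc] observable_def by blast

lemma observable_join:
 assumes F:"observable m F" and G:"observable n G"
 shows "observable (m+n) (%x. join m (F x) (G x))"
proof -
 obtain C D :: "nat=>nat=>real" where C:"!!x t i. x:points M==>i<m ==>
 ((%t. F (\<Phi> t x) i) has_real_derivative (SUM j<m. C i j * F (\<Phi> t x) j)) (at t)"
 and D:"!!x t i. x:points M==>i<n ==>
 ((%t. G (\<Phi> t x) i) has_real_derivative (SUM j<n. D i j * G (\<Phi> t x) j)) (at t)"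
 using F G unfolding observable_def by blast
 define H where "H i j=(if i<m then if j<m then C i j else 0 else if j<m then 0 else D (i-m) (j-m))" for i j
 have split:"(SUM j<m+n. f j)=(SUM j<m. f j)+(SUM j<n. f (m+j))" for f :: "nat=>real"
 by (induction n) (simp_all add: add.assoc)
 have "((%t. join m (F (\<Phi> t x)) (G (\<Phi> t x)) i) has_real_derivative (SUM j<m+n. H i j * join m (F (\<Phi> t x)) (G (\<Phi> t x)) j)) (at t)"
 if x:"x:points M" and i:"i<m+n" for x t i
 proof (cases "i<m")
 case True thus ?thesis using C[OF x True, of t] unfolding split by (simp add: H_def join_def)
 next
 case False
 hence "i-m<n" using i by simp
 thus ?thesis using D[OF x \<open>i - m < n\<close>, of t] False unfolding split by (simp add: H_def join_def)
 qed
 moreover have "ck_on k M UNIV (%x. join m (F x) (G x) i)" if "i<m+n" for i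
 using F G that unfolding observable_def by (cases "i<m") (auto simp: join_def)
 moreover have "join m (F x) (G x):E (m+n)" if "x:points M" for x
 using join_E[of "G x" n] G that unfolding observable_def by blast
 ultimately show ?thesis unfolding observable_def by blast
qed

definition components :: "nat=>('a=>nat=>real)=>('a=>real) set" where
 "components n F=(%i x. F x i)`{..<n}"

lemma components_join:"components (m+n) (%x. join m (F x) (G x))=components m F\<union>components n G"
proof (intro equalityI subsetI)
 fix g assume "g:components (m+n) (%x. join m (F x) (G x))"
 then obtain i where i:"i<m+n" "g=(%x. join m (F x) (G x) i)" by (auto simp: components_def)
 show "g:components m F\<union>components n G"
 proof (cases "i<m")
 case True thus ?thesis using i(2) by (auto simp: components_def join_def)
 next
 case False
 hence "i-m:{..<n}" "g=(%x. G x (i-m))" using i by (auto simp: join_def)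
 thus ?thesis unfolding components_def by blast
 qed
next
 fix g assume "g:components m F\<union>components n G"
 then consider i where "i<m" "g=(%x. F x i)" | i where "i<n" "g=(%x. G x i)" by (auto simp: components_def)
 thus "g:components (m+n) (%x. join m (F x) (G x))"
 proof cases
 case (1 i)
 thus ?thesis unfolding components_def by (intro image_eqI[of _ _ i]) (auto simp: join_def)
 next
 case (2 i)
 thus ?thesis unfolding components_def by (intro image_eqI[of _ _ "m+i"]) (auto simp: join_def)
 qed
qed

lemma observable_finite:
 assumes "finite S" "!!n F. (n, F):S ==> observable n F"
 obtains n F where "observable n F" "!!n' F' i. (n', F'):S==>i<n'==>EX j<n. ALL x. F' x i=F x j"
 "!!j. j<n==>EX (n', F'):S. EX i<n'. ALL x. F x j=F' x i"
proof -
 have "\<exists>n F. observable n F&components n F=(\<Union>(n', F')\<in>S. components n' F')" using assms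
 proof (induction S)
 case empty
 have "observable 0 (%_ _. 0)" by (auto simp: observable_def E_iff)
 thus ?case by (intro exI[of _ 0] exI[of _ "%_ _. 0"]) (simp add: components_def)
 next
 case (insert p S)
 obtain m G where p:"p=(m, G)" by (cases p)
 have G:"observable m G" using insert.prems p by auto
 obtain n F where F:"observable n F" "components n F=(\<Union>(n', F')\<in>S. components n' F')"
 using insert.IH insert.prems by blast
 show ?case by (intro exI[of _ "m+n"] exI[of _ "%x. join m (G x) (F x)"] conjI observable_join[OF G F(1)])
 (simp add: components_join F(2) p)
 qed
 then obtain n F where F:"observable n F" "components n F=(\<Union>(n', F')\<in>S. components n' F')" by blast
 show ?thesis
 proof (rule that[OF F(1)])
 fix n' F' i assume "(n', F'):S" "i<n'"
 hence "(%x. F' x i):components n F" unfolding F(2) by (force simp: components_def)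
 thus "EX j<n. ALL x. F' x i=F x j" by (auto simp: components_def dest: fun_cong)
 next
 fix j assume "j<n"
 hence "(%x. F x j)\<in>(\<Union>(n', F')\<in>S. components n' F')" unfolding F(2)[symmetric] by (auto simp: components_def)
 then obtain n' F' i where "(n', F'):S" "i<n'" "(%x. F x j)=(%x. F' x i)" by (auto simp: components_def)
 thus "EX (n', F'):S. EX i<n'. ALL x. F x j=F' x i" by (auto dest: fun_cong intro!: bexI[of _ "(n', F')"])
 qed
qed

text \<open>Near the attractor finitely many observables already separate points and tangent vectors, by
  compactness of \<open>A \<times> A\<close>; the flow carries every pair of points into that neighbourhood.\<close>

theorem embedding_of_observables:
 assumes obs:"!!n F. (n, F):\<F> ==> observable n F"
 and sep:"!!a b. a:A==>b:A==>a~=b==>EX (n, F):\<F>. EX i<n. F a i~=F b i"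
 and imm:"!!a. a:A==>EX c. admissible_chart k M c&a:cdom c &
 (ALL w:E (cdim c). w~=(%_. 0)-->(EX (n, F):\<F>. EX i<n. dch c a (%y. F y i) w~=0))"
 and S0:"finite S0" "S0<=\<F>"
 obtains n F where "observable n F" "inj_on F (points M)" "!!c x. admissible_chart k M c==>x:cdom c==>imm_at n c x F"
 "!!n' F' i. (n', F'):S0==>i<n'==>EX j<n. ALL x. F' x i=F x j"
 "!!j. j<n==>EX (n', F'):\<F>. EX i<n'. ALL x. F x j=F' x i"
proof -
 define agree where "agree S x y\<longleftrightarrow>(ALL (n, F):S. ALL i<n. F x i=F y i)" for S :: "(nat\<times>('a=>nat=>real)) set" and x y
 define immS where "immS S x\<longleftrightarrow>(EX c. admissible_chart k M c&x:cdom c &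
 (ALL w:E (cdim c). (ALL (n, F):S. ALL i<n. dch c x (%y. F y i) w=0)-->w=(%_. 0)))" for S :: "(nat\<times>('a=>nat=>real)) set" and x
 have local:"EX S U V. finite S&S<=\<F> & openin X U & openin X V&a:U&b:V &
 (ALL x:U. ALL y:V. agree S x y-->x=y)&(ALL x:U\<inter>V. immS S x)" if ab:"a:A" "b:A" for a b
 proof (cases "a=b")
 case False
 from sep[OF ab this] obtain n F i where F:"(n, F):\<F>" "i<n" "F a i~=F b i" by blast
 have "ck_on k M UNIV (%x. F x i)" using obs[OF F(1)] F(2) by (simp add: observable_def)
 hence "ck_on k M (points M) (%x. F x i)" by (rule ck_on_subset[OF Mc opn_UNIV _ _, rotated 2]) auto
 from ck_on_cont[OF Mc _ this] have cF:"continuous_map X euclideanreal (%x. F x i)" by simp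
 define \<delta> where "\<delta>=\<bar>F a i-F b i\<bar>/2"
 have \<delta>: "\<delta> > 0" using F(3) by (simp add: \<delta>_def)
 let ?B = "%a. {x:points M. F x i:{F a i-\<delta><..<F a i+\<delta>}}"
 have o:"openin X (?B a)" for a by (rule openin_continuous_map_preimage[OF cF]) simp
 have disj:"F x i~=F y i" if "x:?B a" "y:?B b" for x y
 proof
 assume "F x i=F y i"
 moreover have "\<bar>F x i-F a i\<bar><\<delta>" "\<bar>F y i-F b i\<bar><\<delta>" using that by (auto simp: abs_less_iff)
 moreover have "\<bar>F a i-F b i\<bar>=2*\<delta>" by (simp add: \<delta>_def)
 ultimately show False by linarith
 qed
 have ag:"agree {(n, F)} x y==>F x i=F y i" for x y using F(2) by (simp add: agree_def)
 show ?thesis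
 proof (rule exI[of _ "{(n, F)}"], rule exI[of _ "?B a"], rule exI[of _ "?B b"], intro conjI ballI impI)
 show "a:?B a" "b:?B b" using ab AM \<delta> by auto
 show "x=y" if "x:?B a" "y:?B b" "agree {(n, F)} x y" for x y using disj[OF that(1,2)] ag[OF that(3)] by blast
 show "immS {(n, F)} x" if "x:?B a\<inter>?B b" for x using disj[of x x] that by blast
 qed (use o F(1) in auto)
 next
 case True
 obtain c where c:"admissible_chart k M c" "a:cdom c"
 "!!w. w:E (cdim c)==>w~=(%_. 0)==>EX (n, F):\<F>. EX i<n. dch c a (%y. F y i) w~=0"
 using imm[OF ab(1)] by blast
 note cc = adm_chart[OF c(1)]
 define I where "I={(q, i). q:\<F>&i<fst q}"
 define D where "D=(%(q::nat\<times>('a=>nat=>real), i::nat) j. pder j (%v. snd q (cinv c v) i) (cmap c a))"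
 have DI:"EX p:I. (SUM j<cdim c. D p j * w j)~=0" if "w:E (cdim c)" "w~=(%_. 0)" for w
 using c(3)[OF that] unfolding I_def D_def dch_def by fastforce
 obtain J where J:"finite J" "J<=I" "!!w. w:E (cdim c)==>w~=(%_. 0)==>EX p:J. (SUM j<cdim c. D p j * w j)~=0"
 by (rule finite_trivial_kernel[where D = D and I = I, OF DI]) (assumption, assumption, rule that)
 define S where "S=fst`J"
 have S:"finite S" "S<=\<F>" using J by (auto simp: S_def I_def)
 obtain n F where F:"observable n F" "!!n' F' i. (n', F'):S==>i<n'==>EX j<n. ALL x. F' x i=F x j"
 "!!j. j<n==>EX (n', F'):S. EX i<n'. ALL x. F x j=F' x i"
 by (rule observable_finite[OF S(1)]) (use S(2) obs in blast, rule that)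
 have ia:"imm_at n c a F" unfolding imm_at_def
 proof (intro ballI impI, rule ccontr)
 fix w assume w:"w:E (cdim c)" "ALL i<n. dch c a (%y. F y i) w=0" "w~=(%_. 0)"
 obtain p where p:"p:J" "(SUM j<cdim c. D p j * w j)~=0" using J(3)[OF w(1,3)] by blast
 obtain n' F' i where pi:"p=((n', F'), i)" by (metis prod.exhaust)
 have "(n', F'):S" "i<n'" using p(1) J(2) pi by (force simp: S_def I_def)+
 from F(2)[OF this] obtain j where j:"j<n" "ALL x. F' x i=F x j" by blast
 have "dch c a (%y. F y j) w~=0" using p(2) j(2) by (simp add: D_def pi dch_def)
 thus False using w(2) j(1) by blast
 qed
 have FE:"!!x. x:points M==>F x:E n" and Fck:"!!i. i<n==>ck_on k M UNIV (%x. F x i)"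
 using F(1) unfolding observable_def by blast+
 obtain V N r where V:"openin (Euc (cdim c)) V" "cmap c a:V" "V<=cmap c`cdom c"
 "!!v. v:V==>F (cinv c v):N&r (F (cinv c v))=v"
 "!!v. v:V==>trivial_kernel n (cdim c) (jac (%v. F (cinv c v)) v)"
 proof (rule immersion_left_inverse[OF k chart_img_open[OF cc], of n "%v. F (cinv c v)" "cmap c a"])
 show "ck_real k (cdim c) (cmap c`cdom c) (%v. F (cinv c v) i)" if "i<n" for i
 using adm_pull[OF Mc c(1) opn_UNIV Fck[OF that]] by simp
 show "F (cinv c v):E n" if "v:cmap c`cdom c" for v
 using FE chart_inv_dom[OF that] chart_dom_subset[OF cc] by blast
 show "cmap c a:cmap c`cdom c" using c(2) by simp
 show "trivial_kernel n (cdim c) (jac (%v. F (cinv c v)) (cmap c a))" using ia by (simp only: imm_at_kernel)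
 qed (rule that)
 define W where "W={y:cdom c. cmap c y:V}"
 have W:"openin X W" unfolding W_def by (rule chart_open_preimage[OF cc V(1)])
 have aW:"a:W" using V(2) c(2) by (simp add: W_def)
 have agF:"F x=F y" if "agree S x y" "x:points M" "y:points M" for x y
 proof (rule E_eqI[OF FE[OF that(2)] FE[OF that(3)]])
 fix j assume "j<n"
 from F(3)[OF this] obtain n' F' i where "(n', F'):S" "i<n'" "ALL x. F x j=F' x i" by blast
 thus "F x j=F y j" using that(1) unfolding agree_def by fastforce
 qed
 have inj:"x=y" if "x:W" "y:W" "agree S x y" for x y
 proof -
 have "F x=F y" using agF that chart_dom_subset[OF cc] by (auto simp: W_def)
 hence "cmap c x=cmap c y"
 using V(4)[of "cmap c x"] V(4)[of "cmap c y"] that chart_inv_map[OF cc] by (auto simp: W_def)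
 thus "x=y" using chart_inv_map[OF cc] that by (metis (no_types, lifting) W_def mem_Collect_eq)
 qed
 have im:"immS S x" if "x:W" for x unfolding immS_def
 proof (intro exI[of _ c] conjI c(1) ballI impI)
 show "x:cdom c" using that by (simp add: W_def)
 fix w assume w:"w:E (cdim c)" "ALL (n, F):S. ALL i<n. dch c x (%y. F y i) w=0"
 have "imm_at n c x F" using V(5)[of "cmap c x"] that by (simp add: imm_at_kernel W_def)
 moreover have "dch c x (%y. F y j) w=0" if "j<n" for j
 proof -
 from F(3)[OF that] obtain n' F' i where q:"(n', F'):S" "i<n'" "ALL x. F x j=F' x i" by blast
 hence "dch c x (%y. F' y i) w=0" using w(2) by fastforce
 thus ?thesis using q(3) by simp
 qed
 ultimately show "w=(%_. 0)" using w(1) unfolding imm_at_def by blast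
 qed
 have "finite S&S<=\<F> & openin X W & openin X W&a:W&b:W &
 (ALL x:W. ALL y:W. agree S x y-->x=y)&(ALL x:W\<inter>W. immS S x)"
 using S W aW True inj im by simp
 thus ?thesis by blast
 qed
 define good where "good S U V\<longleftrightarrow>finite S&S<=\<F> & openin X U & openin X V&(ALL x:U. ALL y:V. agree S x y-->x=y)&(ALL x:U\<inter>V. immS S x)" for S U V
 define \<U> where "\<U>={U\<times>V | S U V. good S U V}"
 have "compactin (prod_topology X X) (A\<times>A)" using Acpt by (simp add: compactin_Times)
 moreover have "openin (prod_topology X X) R" if "R:\<U>" for R using that by (auto simp: \<U>_def good_def openin_prod_Times_iff)
 moreover have "A\<times>A<=\<Union>\<U>"
 proof clarify
 fix a b assume "a:A" "b:A"
 from local[OF this] obtain S U V where "good S U V" "a:U" "b:V" unfolding good_def by blast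
 thus "(a, b)\<in>\<Union>\<U>" unfolding \<U>_def by blast
 qed
 ultimately obtain \<V> where \<V>: "finite \<V>" "\<V><=\<U>" "A\<times>A<=\<Union>\<V>" unfolding compactin_def by meson
 have "ALL R:\<V>. EX S U V. R=U\<times>V&good S U V" using \<V>(2) by (auto simp: \<U>_def)
 then obtain S U V where SUV:"!!R. R:\<V>==>R=U R\<times>V R&good (S R) (U R) (V R)" by metis
 have "openin (prod_topology X X) (\<Union>\<V>)" using \<V>(2) by (auto simp: \<U>_def good_def openin_prod_Times_iff intro!: openin_Union)
 from Wallace_theorem_prod_topology[OF Acpt Acpt this \<V>(3)] obtain O1 O2
 where O':"openin X O1" "openin X O2" "A<=O1" "A<=O2" "O1\<times>O2<=\<Union>\<V>" by metis
 define Oo where "Oo=O1\<inter>O2"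
 have Oo:"openin X Oo" "A<=Oo" using O' by (auto simp: Oo_def)
 define T where "T=S0\<union>\<Union>(S`\<V>)"
 have "finite (S R)" "S R<=\<F>" if "R:\<V>" for R using SUV[OF that] unfolding good_def by blast+
 hence T:"finite T" "T<=\<F>" using \<V>(1) S0 unfolding T_def by auto
 have sub:"agree T x y==>R:\<V>==>agree (S R) x y" for x y R unfolding agree_def T_def by blast
 have sub2:"immS (S R) x==>R:\<V>==>immS T x" for x R
 unfolding immS_def T_def by (elim exE) (rule exI, blast)
 obtain n F where F:"observable n F" "!!n' F' i. (n', F'):T==>i<n'==>EX j<n. ALL x. F' x i=F x j"
 "!!j. j<n==>EX (n', F'):T. EX i<n'. ALL x. F x j=F' x i"
 by (rule observable_finite[OF T(1)]) (use T(2) obs in blast, rule that)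
 have FE:"!!x. x:points M==>F x:E n" and Fck:"!!i. i<n==>ck_on k M UNIV (%x. F x i)"
 using F(1) unfolding observable_def by blast+
 have Fag:"agree T x y" if "F x=F y" for x y unfolding agree_def
 proof (intro ballI, clarify)
 fix n' F' i assume "(n', F'):T" "i<n'"
 from F(2)[OF this] that show "F' x i=F' y i" by auto
 qed
 have injO:"x=y" if "x:Oo" "y:Oo" "F x=F y" for x y
 proof -
 have "(x, y)\<in>\<Union>\<V>" using that O'(5) by (auto simp: Oo_def)
 then obtain R where R:"R:\<V>" "(x, y):R" by blast
 from SUV[OF R(1), THEN conjunct1, THEN equalityD1, THEN subsetD, OF R(2)] have "x:U R" "y:V R" by auto
 note R = R(1) this
 thus ?thesis using SUV[OF R(1)] sub[OF Fag[OF that(3)] R(1)] unfolding good_def by blast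
 qed
 have immO:"EX c. admissible_chart k M c&x:cdom c&imm_at n c x F" if "x:Oo" for x
 proof -
 have "(x, x)\<in>\<Union>\<V>" using that O'(5) by (auto simp: Oo_def)
 then obtain R where R:"R:\<V>" "(x, x):R" by blast
 from SUV[OF R(1), THEN conjunct1, THEN equalityD1, THEN subsetD, OF R(2)] have "x:U R" "x:V R" by auto
 hence "immS T x" using SUV[OF R(1)] sub2[OF _ R(1)] unfolding good_def by blast
 then obtain c where c:"admissible_chart k M c" "x:cdom c"
 "!!w. w:E (cdim c)==>(ALL (n, F):T. ALL i<n. dch c x (%y. F y i) w=0)==>w=(%_. 0)" unfolding immS_def by blast
 have "imm_at n c x F" unfolding imm_at_def
 proof (intro ballI impI)
 fix w assume w:"w:E (cdim c)" "ALL i<n. dch c x (%y. F y i) w=0"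
 show "w=(%_. 0)"
 proof (rule c(3)[OF w(1)], clarify)
 fix n' F' i assume "(n', F'):T" "i<n'"
 from F(2)[OF this] obtain j where "j<n" "ALL x. F' x i=F x j" by blast
 thus "dch c x (%y. F' y i) w=0" using w(2) by simp
 qed
 qed
 thus ?thesis using c by blast
 qed
 obtain C where C:"C:carrier_mat n n" "!!x t. x:points M==>F (\<Phi> t x)=lin_app n n (mexp C t) (F x)"
 by (rule observable_exp[OF F(1)]) (rule that)
 show ?thesis
 proof (rule that[OF F(1)])
 show "inj_on F (points M)"
 proof (rule inj_onI)
 fix x y assume xy:"x:points M" "y:points M" "F x=F y"
 have "\<forall>\<^sub>F t in at_top. \<Phi> t x\<in>Oo&\<Phi> t y\<in>Oo"
 using attracted[OF xy(1) Oo] attracted[OF xy(2) Oo] by eventually_elim simp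
 from eventually_happens'[OF trivial_limit_at_top_linorder this]
 obtain t where t:"\<Phi> t x:Oo" "\<Phi> t y:Oo" by blast
 have "F (\<Phi> t x)=F (\<Phi> t y)" unfolding C(2)[OF xy(1)] C(2)[OF xy(2)] xy(3) ..
 hence "\<Phi> t x=\<Phi> t y" by (rule injO[OF t])
 hence "\<Phi> (- t) (\<Phi> t x)=\<Phi> (- t) (\<Phi> t y)" by (rule arg_cong)
 thus "x=y" unfolding flow_inv(2)[OF xy(1)] flow_inv(2)[OF xy(2)] .
 qed
 show "imm_at n c x F" if c:"admissible_chart k M c" "x:cdom c" for c x unfolding imm_at_def
 proof (intro ballI impI)
 fix w assume w:"w:E (cdim c)" "ALL i<n. dch c x (%y. F y i) w=0"
 have x:"x:points M" using c chart_dom_subset[OF adm_chart[OF c(1)]] by blast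
 obtain t where t:"\<Phi> t x:Oo" using eventually_happens'[OF trivial_limit_at_top_linorder attracted[OF x Oo]] by blast
 obtain e where e:"admissible_chart k M e" "\<Phi> t x:cdom e" "imm_at n e (\<Phi> t x) F" using immO[OF t] by blast
 define w' where "w'=(%i. if i<cdim e then dch c x (%y. cmap e (\<Phi> t y) i) w else 0)"
 have "w'=(%_. 0)"
 proof -
 have "dch e (\<Phi> t x) (%y. F y i) w'=0" if i:"i<n" for i
 proof -
 have "dch e (\<Phi> t x) (%y. F y i) w'=dch c x (%y. F (\<Phi> t y) i) w"
 unfolding w'_def by (rule dch_comp[OF Mc Mc c(1) e(1) k ck_map_time c(2) e(2) opn_UNIV _ Fck[OF i], symmetric]) simp
 also have "...=dch c x (%y. SUM j<n. mexp C t i j * F y j) w"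
 by (rule dch_cong[OF adm_chart[OF c(1)] c(2) opn_UNIV]) (use C(2) i in "auto simp: lin_app_def")
 also have "...=(SUM j<n. mexp C t i j * dch c x (%y. F y j) w)" by (rule dch_sum[OF Mc c(1) k c(2) Fck])
 also have "...=0" using w(2) by simp
 finally show ?thesis .
 qed
 moreover have "w':E (cdim e)" by (simp add: w'_def E_iff)
 ultimately show ?thesis using e(3) unfolding imm_at_def by blast
 qed
 have "w i=0" if i:"i<cdim c" for i
 proof -
 have xx:"\<Phi> (- t) (\<Phi> t x):cdom c" using flow_inv(2)[OF x] c(2) by simp
 have ckf:"ck_on k M (\<Phi> (- t) -` cdom c) (%z. cmap c (\<Phi> (- t) z) i)"
 by (rule ck_on_comp[OF Mc Mc ck_map_time adm_opn[OF c(1)] adm_coord[OF c(1) i]])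
 have oo:"opn M (\<Phi> (- t) -` cdom c)" by (rule opn_vimage[OF ck_map_cont[OF ck_map_time] adm_opn[OF c(1)]])
 have "w i=trans_vec c c x w i" using trans_vec_refl[OF adm_chart[OF c(1)] c(2) w(1)] by simp
 also have "...=dch c x (%y. cmap c y i) w" using i by (simp add: trans_vec_def)
 also have "...=dch c x (%y. cmap c (\<Phi> (- t) (\<Phi> t y)) i) w"
 by (rule dch_cong[OF adm_chart[OF c(1)] c(2) opn_UNIV]) (use flow_inv(2) in auto)
 also have "...=dch e (\<Phi> t x) (%z. cmap c (\<Phi> (- t) z) i) w'"
 unfolding w'_def by (rule dch_comp[OF Mc Mc c(1) e(1) k ck_map_time c(2) e(2) oo _ ckf]) (use xx in simp)
 also have "...=0" unfolding \<open>w' = (%_. 0)\<close> by (rule dch_zero)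
 finally show ?thesis .
 qed
 thus "w=(%_. 0)" using w(1) by (auto simp: E_iff fun_eq_iff not_le[symmetric])
 qed
 show "EX j<n. ALL x. F' x i=F x j" if "(n', F'):S0" "i<n'" for n' F' i
 using F(2) that by (auto simp: T_def)
 show "EX (n', F'):\<F>. EX i<n'. ALL x. F x j=F' x i" if "j<n" for j
 using F(3)[OF that] T(2) by blast
 qed
qed

text \<open>Preimages of bounded sets lie in sublevel sets of \<open>g\<close>, which \<open>F\<close> dominates.\<close>

lemma proper_of_sublevels:
 fixes l n :: nat and K :: real
 assumes F:"continuous_map X (Euc n) F"
 and g:"!!R. compactin X {x:points M. (SUM i<l. \<bar>g x i\<bar>)<=R}"
 and bd:"!!x i. x:points M==>i<l==>\<bar>g x i\<bar><=K*(SUM j<n. \<bar>F x j\<bar>)"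
 shows "proper X (Euc n) F" unfolding proper_def
proof (intro allI impI)
 fix C assume C:"compactin (Euc n) C"
 have cN:"continuous_on (E n) (%v. SUM j<n. \<bar>v j\<bar>)" by (intro continuous_intros)
 have "continuous_map (Euc n) euclideanreal (%v. SUM j<n. \<bar>v j\<bar>)"
 using cont_iff[of n "E n" "%v. SUM j<n. \<bar>v j\<bar>"] cN by simp
 from image_compactin[OF C this] have "bounded ((%v. SUM j<n. \<bar>v j\<bar>)`C)" using compact_imp_bounded by simp
 then obtain R where R:"!!v. v:C==>(SUM j<n. \<bar>v j\<bar>)<=R" unfolding bounded_iff by fastforce
 have "closedin X {x:points M. F x:C}"
 by (rule closedin_continuous_map_preimage[OF F compactin_imp_closedin[OF Hausdorff_Euclidean_space C]])
 moreover have "{x:points M. F x:C}<={x:points M. (SUM i<l. \<bar>g x i\<bar>)<=real l*(\<bar>K\<bar> * R)}"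
 proof clarify
 fix x assume x:"x:points M" "F x:C"
 have "\<bar>g x i\<bar><=\<bar>K\<bar> * R" if "i<l" for i
 proof -
 have "\<bar>g x i\<bar><=K*(SUM j<n. \<bar>F x j\<bar>)" by (rule bd[OF x(1) that])
 also have "...<=\<bar>K\<bar>*(SUM j<n. \<bar>F x j\<bar>)" by (intro mult_right_mono) (auto simp: sum_nonneg)
 also have "...<=\<bar>K\<bar> * R" using R[OF x(2)] by (intro mult_left_mono) auto
 finally show ?thesis .
 qed
 hence "(SUM i<l. \<bar>g x i\<bar>)<=(SUM i<l. \<bar>K\<bar> * R)" by (intro sum_mono) auto
 thus "(SUM i<l. \<bar>g x i\<bar>)<=real l*(\<bar>K\<bar> * R)" by simp
 qed
 ultimately show "compactin X {x:points M. F x:C}" by (rule closed_compactin[OF g, rotated])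
qed

end

section \<open>Bump functions\<close>

lemma ck_on_extend_zero:
 assumes N:"charted N" and V:"opn N V" and f:"ck_on k N V f" and K:"closedin (space_of N) K" "K<=V"
 and z:"!!y. y:points N==>y~:K==>f y=0"
 shows "ck_on k N UNIV f"
proof (rule ck_on_local[OF N opn_UNIV])
 fix x assume x:"x:points N"
 show "EX W. opn N W&x:W&ck_on k N W f"
 proof (cases "x:V")
 case True thus ?thesis using V f by blast
 next
 case False
 have o:"opn N (points N-K)" by (rule opn_openin) (use K(1) in auto)
 have "ck_on k N (points N-K) f"
 by (subst ck_on_cong[OF N o, where g = "%_. 0"]) (use z ck_on_const[OF N o] in auto)
 thus ?thesis using o x False K(2) by blast
 qed
qed

text \<open>The function \<open>exp (- 1 / (r\<^sup>2 - |y - a|\<^sup>2))\<close> in a chart, extended by \<open>0\<close>.\<close>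

lemma bump:
 assumes N:"charted N" and H:"Hausdorff_space (space_of N)" and e:"admissible_chart k N e" and a:"a:cdom e"
 and W:"openin (space_of N) W" "a:W"
 obtains \<beta> where "ck_on k N UNIV \<beta>" "\<beta> a > 0" "!!y. y:points N==>y~:W==>\<beta> y=0"
 "!!j. j<cdim e==>ck_on k N UNIV (%y. \<beta> y*(cmap e y j-cmap e a j))"
proof -
 let ?n = "cdim e" and ?a = "cmap e a"
 note ec = adm_chart[OF e]
 obtain r where r:"r > 0" "box_at ?n ?a r<=cmap e`(cdom e\<inter>W)"
 by (rule chart_box_nbhd[OF ec a W]) (rule that)
 define s where "s=r/2"
 have s:"s > 0" "s<r" using r(1) by (auto simp: s_def)
 define C where "C={v:E ?n. ALL i<?n. \<bar>v i-?a i\<bar><=s}"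
 have Cb:"C<=cmap e`(cdom e\<inter>W)" using r(2) s by (force simp: C_def box_at_def)
 have "compactin (subtopology (Euc ?n) (cmap e`cdom e)) C"
 using compactin_cbox Cb unfolding compactin_subtopology C_def by blast
 from image_compactin[OF this chart_inv_cont[OF ec]] have "compactin (space_of N) (cinv e`C)" .
 hence K:"closedin (space_of N) (cinv e`C)" by (rule compactin_imp_closedin[OF H])
 have KW:"cinv e`C<=cdom e\<inter>W"
 proof clarify
 fix v assume "v:C"
 then obtain y where "y:cdom e" "y:W" "v=cmap e y" using Cb by blast
 thus "cinv e v:cdom e\<inter>W" using chart_inv_map[OF ec] by simp
 qed
 define b where "b y=flat_exp (s^2-(SUM i<?n. (cmap e y i-?a i)*(cmap e y i-?a i)))" for y
 define \<beta> where "\<beta> y=(if y:cdom e then b y else 0)" for y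
 have o:"opn N (cdom e)" by (rule adm_opn[OF e])
 have ckb:"ck_on k N (cdom e) b" unfolding b_def
 by (intro ck_on_smooth[OF N o smooth_real_flat_exp] ck_on_diff[OF N o] ck_on_const[OF N o] ck_on_sum[OF N o] ck_on_mult[OF N o] adm_coord[OF e]) auto
 have ckB:"ck_on k N (cdom e) \<beta>" by (subst ck_on_cong[OF N o, where g = b]) (use ckb in \<open>auto simp: \<beta>_def\<close>)
 have z:"\<beta> y=0" if "y:points N" "y~:cinv e`C" for y
 proof (cases "y:cdom e")
 case True
 have "cmap e y~:C" using that(2) chart_inv_map[OF ec True] by (metis image_eqI)
 then obtain i where i:"i<?n" "\<bar>cmap e y i-?a i\<bar> > s" using chart_map_E[OF ec True] by (auto simp: C_def)
 have "s^2<\<bar>cmap e y i-?a i\<bar>^2" using i(2) s(1) by (intro power_strict_mono) auto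
 also have "...=(cmap e y i-?a i)*(cmap e y i-?a i)" by (simp add: power2_eq_square)
 also have "...<=(SUM i<?n. (cmap e y i-?a i)*(cmap e y i-?a i))"
 by (rule member_le_sum[of i "{..<?n}" "%i. (cmap e y i-?a i)*(cmap e y i-?a i)"]) (use i in auto)
 finally show ?thesis using True by (simp add: \<beta>_def b_def flat_exp_def)
 qed (simp add: \<beta>_def)
 show ?thesis
 proof (rule that[of \<beta>])
 show "ck_on k N UNIV \<beta>" by (rule ck_on_extend_zero[OF N o ckB K _ z]) (use KW in auto)
 show "\<beta> a > 0" using a s by (simp add: \<beta>_def b_def flat_exp_def)
 show "\<beta> y=0" if "y:points N" "y~:W" for y by (rule z[OF that(1)]) (use KW that(2) in auto)
 show "ck_on k N UNIV (%y. \<beta> y*(cmap e y j-?a j))" if "j<?n" for j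
 proof (rule ck_on_extend_zero[OF N o _ K])
 show "ck_on k N (cdom e) (%y. \<beta> y*(cmap e y j-?a j))"
 by (rule ck_on_mult[OF N o ckB ck_on_diff[OF N o adm_coord[OF e that] ck_on_const[OF N o]]])
 qed (use KW z in auto)
 qed
qed

text \<open>The second factor vanishes at \<open>a\<close>, so only its own derivative survives in the product rule.\<close>

lemma dch_bump:
 assumes N:"charted N" and k:"k\<ge>1" and e:"admissible_chart k N e" and a:"a:cdom e" and \<beta>: "ck_on k N UNIV \<beta>" and j:"j<cdim e"
 shows "dch e a (%y. \<beta> y*(cmap e y j-cmap e a j)) w=\<beta> a * w j"
proof -
 let ?n = "cdim e" and ?a = "cmap e a" and ?U = "cmap e`cdom e"
 note ec = adm_chart[OF e]
 note o = chart_img_open[OF ec]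
 have aU:"?a:?U" using a by simp
 have "pder i (%v. \<beta> (cinv e v)*(cmap e (cinv e v) j-?a j)) ?a=(if i=j then \<beta> a else 0)" if i:"i<?n" for i
 proof -
 have "pder i (%v. \<beta> (cinv e v)*(cmap e (cinv e v) j-?a j)) ?a
 = pder i (%v. \<beta> (cinv e v)*(v j-?a j)) ?a" by (rule pd_cong[OF o aU i]) (simp add: chart_map_inv)
 also have "...=(if i=j then \<beta> a else 0)"
 proof (rule has_pd_imp)
 have "has_pd i (%v. \<beta> (cinv e v)) ?a (pder i (%v. \<beta> (cinv e v)) ?a)"
 by (rule ck_real_has_pd[OF k o _ i aU]) (use adm_pull[OF N e opn_UNIV \<beta>] in simp)
 moreover have "has_pd i (%v. v j-?a j) ?a (if i=j then 1 else 0)"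
 unfolding has_pd_def by (cases "i=j") (auto intro!: derivative_eq_intros)
 ultimately have "has_pd i (%v. \<beta> (cinv e v)*(v j-?a j)) ?a
 (pder i (%v. \<beta> (cinv e v)) ?a*(?a j-?a j)+(if i=j then 1 else 0)*\<beta> (cinv e ?a))"
 unfolding has_pd_def using DERIV_mult by fastforce
 thus "has_pd i (%v. \<beta> (cinv e v)*(v j-?a j)) ?a (if i=j then \<beta> a else 0)"
 by (cases "i=j") (simp_all add: chart_inv_map[OF ec a])
 qed
 finally show ?thesis .
 qed
 hence "dch e a (%y. \<beta> y*(cmap e y j-?a j)) w=(SUM i<?n. (if i=j then \<beta> a else 0) * w i)"
 unfolding dch_def by (intro sum.cong) auto
 also have "...=(SUM i<?n. if i=j then \<beta> a * w i else 0)" by (intro sum.cong) auto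
 also have "...=\<beta> a * w j" using j by simp
 finally show ?thesis .
qed

section \<open>The three conditions yield an embedding\<close>

context attracting_flow
begin

text \<open>The transverse linearization extends to \<open>X\<close> by \<open>x \<mapsto> e\<^bsup>-tB\<^esup> G (\<Phi>\<^sup>t x)\<close> for any \<open>t\<close> with \<open>\<Phi>\<^sup>t x \<in> U\<close>.\<close>

lemma globalize_transverse:
 assumes B:"B:carrier_mat l l" and eig:"!!z. eigenvalue (map_mat complex_of_real B) z==>Re z<0"
 and U:"openin X U" "A<=U" and G:"ck_map k (open_mfd M U) (euclidean_mfd l) G"
 and eq:"!!x t. x:U==>\<Phi> t x:U==>G (\<Phi> t x)=mat_app (mat_exp (t \<cdot>\<^sub>m B)) (G x)"
 obtains g where "observable l g" "!!x t. x:points M==>g (\<Phi> t x)=lin_app l l (mexp B t) (g x)"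
 "!!x. x:U==>g x=G x" "!!a. a:A==>g a=(%_. 0)" "!!i. i<l==>ck_on k M U (%x. G x i)" "!!x. x:U==>G x:E l"
proof -
 have UM:"U<=points M" by (rule openin_subset[OF U(1)])
 have oU:"opn M U" by (rule opn_openin[OF U(1)])
 note OM = charted_open_mfd[OF Mc U(1)]
 have pO:"points (open_mfd M U)=U" using UM by (auto simp: open_mfd_def)
 have GE:"!!x. x:U==>G x:E l" and G1:"!!i. i<l==>ck_on k (open_mfd M U) UNIV (%x. G x i)"
 using G unfolding ck_map_euclidean[OF OM] pO by auto
 have ckG:"ck_on k M U (%x. G x i)" if "i<l" for i
 proof -
 have "opn (open_mfd M U) U" using openin_topspace[of "space_of (open_mfd M U)"] unfolding pO by simp
 from ck_on_subset[OF OM opn_UNIV this _ G1[OF that]] show ?thesis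
 unfolding ck_on_open_mfd[OF Mc U(1) oU order.refl] by simp
 qed
 have flow:"G (\<Phi> t x)=lin_app l l (mexp B t) (G x)" if "x:U" "\<Phi> t x:U" for x t
 using eq[OF that] by (simp add: mat_app_exp[OF B])
 have ex:"EX t. \<Phi> t x:U" if "x:points M" for x
 using eventually_happens'[OF trivial_limit_at_top_linorder attracted[OF that U]] by blast
 define g where "g x=lin_app l l (mexp B (- (SOME t. \<Phi> t x:U))) (G (\<Phi> (SOME t. \<Phi> t x:U) x))" for x
 have g:"g x=lin_app l l (mexp B (- t)) (G (\<Phi> t x))" if x:"x:points M" and t:"\<Phi> t x:U" for x t
 proof -
 define s where "s=(SOME t. \<Phi> t x:U)"
 have s:"\<Phi> s x:U" unfolding s_def using ex[OF x] by (rule someI_ex)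
 have st:"\<Phi> (s-t) (\<Phi> t x)=\<Phi> s x" using flow_add[OF x, of "s-t" t] by simp
 have "g x=lin_app l l (mexp B (- s)) (G (\<Phi> (s-t) (\<Phi> t x)))" unfolding st by (simp add: g_def s_def)
 also have "G (\<Phi> (s-t) (\<Phi> t x))=lin_app l l (mexp B (s-t)) (G (\<Phi> t x))"
 by (rule flow[OF t]) (use s st in simp)
 also have "lin_app l l (mexp B (- s)) ...=lin_app l l (mexp B (- s+(s-t))) (G (\<Phi> t x))" by (rule mexp_add[OF B, symmetric])
 finally show ?thesis by simp
 qed
 have gflow:"g (\<Phi> r x)=lin_app l l (mexp B r) (g x)" if x:"x:points M" for x r
 proof -
 obtain t where t:"\<Phi> t (\<Phi> r x):U" using ex[OF flow_points[OF x]] by blast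
 hence t':"\<Phi> (t+r) x:U" by (simp add: flow_add[OF x])
 have "lin_app l l (mexp B r) (g x)=lin_app l l (mexp B (r+(- (t+r)))) (G (\<Phi> (t+r) x))"
 unfolding g[OF x t'] by (rule mexp_add[OF B, symmetric])
 also have "...=g (\<Phi> r x)" using g[OF flow_points[OF x] t] by (simp add: flow_add[OF x])
 finally show ?thesis by simp
 qed
 have gE:"g x:E l" for x unfolding g_def by (rule lin_app_E)
 have gU:"g x=G x" if "x:U" for x using g[of x 0] that UM flow_0[of x] mexp_0_app[OF B GE[OF that]] by auto
 have gck:"ck_on k M UNIV (%x. g x i)" if i:"i<l" for i
 proof (rule ck_on_local[OF Mc opn_UNIV])
 fix x assume x:"x:points M"
 obtain t where t:"\<Phi> t x:U" using ex[OF x] by blast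
 let ?V = "\<Phi> t -` U"
 have o:"opn M ?V" by (rule opn_vimage[OF ck_map_cont[OF ck_map_time] oU])
 have "ck_on k M ?V (%y. SUM j<l. mexp B (- t) i j * G (\<Phi> t y) j)"
 by (intro ck_on_sum[OF Mc o] ck_on_mult[OF Mc o] ck_on_const[OF Mc o] ck_on_comp[OF Mc Mc ck_map_time oU ckG]) auto
 hence "ck_on k M ?V (%x. g x i)"
 by (subst ck_on_cong[OF Mc o, where g = "%y. SUM j<l. mexp B (- t) i j * G (\<Phi> t y) j"]) (use i in "auto simp: g lin_app_def")
 thus "EX W. opn M W&x:W&ck_on k M W (%x. g x i)" using o t by blast
 qed
 have obs:"observable l g" unfolding observable_def
 proof (intro conjI exI[of _ "%i j. B$$(i, j)"] ballI allI impI gE gck)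
 fix x t i assume x:"x:points M" and i:"i<l"
 show "((%t. g (\<Phi> t x) i) has_real_derivative (SUM j<l. B$$(i, j) * g (\<Phi> t x) j)) (at t)"
 unfolding gflow[OF x] by (rule lin_app_deriv[OF B i])
 qed
 have dec:"((%t. mexp B t i j) \<longlongrightarrow> 0) at_top" if "i<l" "j<l" for i j by (rule mexp_decay[OF B eig that])
 have gA:"g a=(%_. 0)" if a:"a:A" for a
 proof -
 have ci:"continuous_map X euclideanreal (%x. g x i)" if "i<l" for i
 using ck_on_cont[OF Mc _ ck_on_subset[OF Mc opn_UNIV opn_openin[OF openin_topspace] subset_UNIV gck[OF that]]] by simp
 have "continuous_map X euclideanreal (%x. SUM i<l. \<bar>g x i\<bar>)" by (intro continuous_intros ci) auto
 from image_compactin[OF Acpt this] have "bounded ((%x. SUM i<l. \<bar>g x i\<bar>)`A)" using compact_imp_bounded by simp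
 then obtain R where R:"!!x. x:A==>(SUM i<l. \<bar>g x i\<bar>)<=R" unfolding bounded_iff by fastforce
 have "0<=(SUM i<l. \<bar>g a i\<bar>)" by (simp add: sum_nonneg)
 hence R0:"R\<ge>0" using R[OF a] by linarith
 have "(SUM i<l. \<bar>g a i\<bar>)<=0+\<epsilon>" if \<epsilon>: "\<epsilon> > 0" for \<epsilon>
 proof -
 define \<delta> where "\<delta>=\<epsilon>/((real l+1)*(R+1))"
 have \<delta>: "\<delta> > 0" using \<epsilon> R0 by (simp add: \<delta>_def)
 obtain t where t:"!!i j. i<l==>j<l==>\<bar>mexp B t i j\<bar><=\<delta>"
 using eventually_happens'[OF trivial_limit_at_top_linorder mexp_small[OF B dec \<delta>]] by blast
 have aM:"\<Phi> (- t) a:points M" "a:points M" using a AM flow_points by auto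
 have "(SUM i<l. \<bar>g a i\<bar>)=(SUM i<l. \<bar>lin_app l l (mexp B t) (g (\<Phi> (- t) a)) i\<bar>)"
 using gflow[OF aM(1), of t] flow_inv(1)[OF aM(2)] by simp
 also have "...<=real l*\<delta>*(SUM i<l. \<bar>g (\<Phi> (- t) a) i\<bar>)" by (rule sum_lin_app_le[OF t])
 also have "...<=real l*\<delta> * R" using R[OF flow_A[OF a]] \<delta> by (intro mult_left_mono) auto
 also have "...<=(real l+1)*\<delta>*(R+1)" using \<delta> R0 by (intro mult_mono) auto
 also have "...=\<epsilon>"
 proof -
 have "real l+1~=0" "R+1~=0" using R0 of_nat_0_le_iff[of l, where ?'a = real] by linarith+
 thus ?thesis by (simp add: \<delta>_def)
 qed
 finally show ?thesis by simp
 qed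
 hence "(SUM i<l. \<bar>g a i\<bar>)<=0" by (rule field_le_epsilon)
 hence "(SUM i<l. \<bar>g a i\<bar>)=0" by (intro antisym) (auto simp: sum_nonneg)
 hence "!!i. i<l==>g a i=0" by (simp add: sum_nonneg_eq_0_iff)
 thus ?thesis using gE[of a] by (intro E_eqI[of _ l]) (auto simp: E_iff)
 qed
 show ?thesis by (rule that[OF obs gflow gU gA ckG GE])
qed

lemma observable_eigenfunction:
 assumes P:"ck_map k M N P" and N:"charted N" and h:"ck_complex k N h"
 and e:"!!x t. x:points M==>h (P (\<Phi> t x))=cis (\<mu> * t) * h (P x)"
 shows "observable 2 (%x i. if i=0 then Re (h (P x)) else if i=1 then Im (h (P x)) else 0)"
 unfolding observable_def
proof (intro conjI ballI allI impI)
 let ?C = "%i j. if i=0&j=1 then-\<mu> else if i=1&j=0 then \<mu> else 0::real"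
 show "ck_on k M UNIV (%x. if i=0 then Re (h (P x)) else if i=1 then Im (h (P x)) else 0)" for i :: nat
 using ck_on_comp[OF Mc N P opn_UNIV, of "%a. Re (h a)"] ck_on_comp[OF Mc N P opn_UNIV, of "%a. Im (h a)"] h ck_on_const[OF Mc opn_UNIV]
 by (cases "i=0"; cases "i=1") (simp_all add: ck_complex_def)
 show "EX C::nat=>nat=>real. ALL x:points M. ALL t. ALL i<2. ((%t. if i=0 then Re (h (P (\<Phi> t x))) else if i=1 then Im (h (P (\<Phi> t x))) else 0) has_real_derivative
 (SUM j<2. C i j*(if j=0 then Re (h (P (\<Phi> t x))) else if j=1 then Im (h (P (\<Phi> t x))) else 0))) (at t)"
 proof (rule exI[of _ ?C], intro ballI allI impI)
 fix x t and i :: nat assume x:"x:points M" and i:"i<2"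
 have re:"Re (cis (\<mu> * t) * z)=cos (\<mu> * t) * Re z-sin (\<mu> * t) * Im z"
 and im:"Im (cis (\<mu> * t) * z)=cos (\<mu> * t) * Im z+sin (\<mu> * t) * Re z" for t z by simp_all
 have "((%t. cos (\<mu> * t) * Re (h (P x))-sin (\<mu> * t) * Im (h (P x))) has_real_derivative
 - \<mu>*(cos (\<mu> * t) * Im (h (P x))+sin (\<mu> * t) * Re (h (P x)))) (at t)"
 by (auto intro!: derivative_eq_intros simp: algebra_simps)
 hence d0:"((%t. Re (h (P (\<Phi> t x)))) has_real_derivative-\<mu> * Im (h (P (\<Phi> t x)))) (at t)"
 by (simp only: e[OF x] re im)
 have "((%t. cos (\<mu> * t) * Im (h (P x))+sin (\<mu> * t) * Re (h (P x))) has_real_derivative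
 \<mu>*(cos (\<mu> * t) * Re (h (P x))-sin (\<mu> * t) * Im (h (P x)))) (at t)"
 by (auto intro!: derivative_eq_intros simp: algebra_simps)
 hence d1:"((%t. Im (h (P (\<Phi> t x)))) has_real_derivative \<mu> * Re (h (P (\<Phi> t x)))) (at t)"
 by (simp only: e[OF x] re im)
 show "((%t. if i=0 then Re (h (P (\<Phi> t x))) else if i=1 then Im (h (P (\<Phi> t x))) else 0) has_real_derivative
 (SUM j<(2::nat). ?C i j*(if j=0 then Re (h (P (\<Phi> t x))) else if j=1 then Im (h (P (\<Phi> t x))) else 0))) (at t)"
 proof -
 have l2:"{..<2}={0, 1::nat}" by auto
 show ?thesis
 proof (cases "i=0")
 case True thus ?thesis unfolding l2 using d0 by simp
 next
 case False
 hence "i=1" using i by simp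
 thus ?thesis unfolding l2 using d1 by simp
 qed
 qed
 qed
qed (auto simp: E_iff)

text \<open>Observables are the transverse linearization and the eigenfunctions on \<open>A\<close> composed with the phase. The former sees the directions transverse to \<open>A\<close>, the latter those along \<open>A\<close>.\<close>

theorem embedding_if:
 assumes c1:"submanifold_with_phase k M \<Phi> A" and c2:"torus_subgroup_flow k M \<Phi> A" and c3:"transverse_linearization k M \<Phi> A"
 shows "linearizable_by_embedding k M \<Phi>"
proof -
 let ?N = "sub_mfd k M A"
 obtain P where P:"ck_map k M ?N P" "!!a. a:A==>P a=a" "!!t x. x:points M==>P (\<Phi> t x)=\<Phi> t (P x)"
 proof -
 obtain P where "ck_asymptotic_phase k M \<Phi> A P" using c1 unfolding submanifold_with_phase_def by blast
 note q = this[unfolded ck_asymptotic_phase_def]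
 show ?thesis
 proof (rule that[OF conjunct1[OF q]])
 show "P a=a" if "a:A" for a by (rule conjunct1[OF conjunct2[OF q], rule_format, OF that])
 show "P (\<Phi> t x)=\<Phi> t (P x)" if "x:points M" for t x by (rule conjunct2[OF conjunct2[OF q], rule_format, OF that])
 qed
 qed
 have S:"sliced k M A"
 by (rule components_sliced[OF Mc Hausdorff AM]) (use c1 in "auto simp: submanifold_with_phase_def")
 have pN:"points ?N=A" by (rule points_sub[OF AM])
 note Na = ck_atlas_sub[OF Ma S]
 note Nc = ck_atlas_charted[OF Na]
 have NH:"Hausdorff_space (space_of ?N)" unfolding space_sub by (rule Hausdorff_space_subtopology[OF Hausdorff])
 have PA:"P x:A" if "x:points M" for x using ck_map_points[OF P(1) that] pN by simp
 obtain m \<Theta> where T:"ck_torus_action k m ?N \<Theta>" "one_parameter_subgroup m \<Theta> \<Phi> A" using c2 unfolding torus_subgroup_flow_def by blast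
 obtain \<omega> where \<omega>: "\<omega>:E m" "!!t a. a:A==>\<Phi> t a=\<Theta> (mod1 (%i. \<omega> i * t)) a" using T(2) unfolding one_parameter_subgroup_def by blast
 interpret TA: torus_action k m ?N \<Theta> by unfold_locales (rule k, rule Na, rule T(1))
 obtain l B U G where B1:"B:carrier_mat l l" and q:"(ALL z. eigenvalue (map_mat complex_of_real B) z-->Re z<0) &
 openin X U&A<=U&ck_map k (open_mfd M U) (euclidean_mfd l) G &
 (ALL a:A. {v:tangent_space M a. tangent_map M (euclidean_mfd l) G a v=zero_tangent} =
 tangent_map ?N M (%x. x) a`tangent_space ?N a) &
 (ALL x:U. ALL t. \<Phi> t x:U-->G (\<Phi> t x)=mat_app (mat_exp (t \<cdot>\<^sub>m B)) (G x))"
 by (rule c3[unfolded transverse_linearization_def, THEN exE], elim bexE exE) (rule that)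
 note q1 = conjunct1[OF q] and q2 = conjunct2[OF q]
 note U1 = conjunct1[OF q2] and q3 = conjunct2[OF q2]
 note U2 = conjunct1[OF q3] and q4 = conjunct2[OF q3]
 note G = conjunct1[OF q4] and q5 = conjunct2[OF q4]
 have B:"B:carrier_mat l l" "!!z. eigenvalue (map_mat complex_of_real B) z==>Re z<0" using B1 q1 by blast+
 note U = U1 U2
 note ker = bspec[OF conjunct1[OF q5]]
 note eq = bspec[OF conjunct2[OF q5], THEN spec, THEN mp]
 obtain g where g:"observable l g" "!!x t. x:points M==>g (\<Phi> t x)=lin_app l l (mexp B t) (g x)"
 "!!x. x:U==>g x=G x" "!!a. a:A==>g a=(%_. 0)" "!!i. i<l==>ck_on k M U (%x. G x i)" "!!x. x:U==>G x:E l"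
 by (rule globalize_transverse[OF B U G eq]) (assumption | rule that)+
 define F2 where "F2 h=(%x i. if i=0 then Re (h (P x)) else if i=(1::nat) then Im (h (P x)) else 0)" for h :: "'a=>complex"
 define eigen where "eigen h\<longleftrightarrow>ck_complex k ?N h&(EX \<mu>. ALL a:A. ALL t. h (\<Phi> t a)=cis (\<mu> * t) * h a)" for h
 define \<F> where "\<F>=insert (l, g) ((%h. (2, F2 h))`{h. eigen h})"
 have obs:"observable n F" if "(n, F):\<F>" for n F
 proof (cases "(n, F)=(l, g)")
 case True thus ?thesis using g(1) by simp
 next
 case False
 hence "(n, F):(%h. (2, F2 h))`{h. eigen h}" using that unfolding \<F>_def by blast
 then obtain h where h:"eigen h" "n=2" "F=F2 h" by auto
 obtain \<mu> where \<mu>: "!!a t. a:A==>h (\<Phi> t a)=cis (\<mu> * t) * h a" using h(1) by (auto simp: eigen_def)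
 show ?thesis unfolding h(2,3) F2_def
 by (rule observable_eigenfunction[OF P(1) Nc, where \<mu> = \<mu>]) (use h(1) \<mu> PA P(3) in "auto simp: eigen_def")
 qed
 have find:"EX h. eigen h&complexify T h~=0" if T:"averageable k ?N T" and f:"ck_on k ?N UNIV f" "T f~=0" for T f
 proof -
 obtain h and n :: "nat=>int" where h:"ck_complex k ?N h" "complexify T h~=0"
 "!!i t a. i<m==>a:points ?N==>h (TA.rot i t a)=cis (2 * pi * of_int (n i) * t) * h a"
 by (rule TA.eigenfunction_exists[OF T f]) (assumption | rule that)+
 have "h (\<Phi> t a)=cis (2 * pi*(SUM i<m. of_int (n i)*\<omega> i) * t) * h a" if "a:A" for t a
 proof -
 have "(%i. \<omega> i * t):E m" using \<omega>(1) by (auto simp: E_iff)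
 from TA.eigenfunction_torus[OF h(3) this] that
 have "h (\<Phi> t a)=cis (2 * pi*(SUM i<m. of_int (n i)*(\<omega> i * t))) * h a" by (simp add: pN \<omega>(2)[OF that])
 moreover have "(SUM i<m. of_int (n i)*(\<omega> i * t))=(SUM i<m. of_int (n i)*\<omega> i) * t" by (simp add: sum_distrib_right mult.assoc)
 ultimately show ?thesis by (simp add: mult.assoc)
 qed
 thus ?thesis using h(1,2) unfolding eigen_def by blast
 qed
 have eF:"(2, F2 h):\<F>" if "eigen h" for h using that by (auto simp: \<F>_def)
 have sep:"EX (n, F):\<F>. EX i<n. F a i~=F b i" if ab:"a:A" "b:A" "a~=b" for a b
 proof -
 obtain c where c:"c:atlas_of ?N" "a:cdom c" using charted_cover[OF Nc, of a] ab(1) pN by auto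
 obtain W W' where W:"openin (space_of ?N) W" "openin (space_of ?N) W'" "a:W" "b:W'" "disjnt W W'"
 using NH ab pN unfolding Hausdorff_space_def by metis
 have ca:"admissible_chart k ?N c" using Na c(1) by (simp add: ck_atlas_def)
 obtain f where f:"ck_on k ?N UNIV f" "f a > 0" "!!y. y:points ?N==>y~:W==>f y=0"
 by (rule bump[OF Nc NH ca c(2) W(1,3)]) (rule that)
 have "f b=0" by (rule f(3)) (use W ab pN in "auto simp: disjnt_iff")
 hence "f a-f b~=0" using f(2) by simp
 from find[OF averageable_difference[OF Nc k] f(1) this] obtain h where h:"eigen h" "complexify (%f. f a-f b) h~=0"
 using ab pN by auto
 hence "F2 h a 0~=F2 h b 0\<or>F2 h a 1~=F2 h b 1" using P(2) ab by (auto simp: F2_def complexify_def complex_eq_iff)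
 thus ?thesis using eF[OF h(1)] by (intro bexI[of _ "(2, F2 h)"]) (auto intro: exI[of _ 0] exI[of _ 1])
 qed
 have imm:"EX c. admissible_chart k M c&a:cdom c &
 (ALL w:E (cdim c). w~=(%_. 0)-->(EX (n, F):\<F>. EX i<n. dch c a (%y. F y i) w~=0))" if a:"a:A" for a
 proof -
 obtain p s where s:"slice_chart k M p A s" "a:cdom s" using S a unfolding sliced_def by blast
 note sa = slice_adm[OF s(1)] note sc = adm_chart[OF sa]
 have pd:"p<=cdim s" using s(1) by (simp add: slice_chart_def)
 let ?c = "sub_chart s A p"
 have cN:"?c:atlas_of ?N" using s(1) by (auto simp: atlas_sub)
 hence ca:"admissible_chart k ?N ?c" using Na by (simp add: ck_atlas_def)
 have ac:"a:cdom ?c" using s(2) a by simp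
 have "EX (n, F):\<F>. EX i<n. dch s a (%y. F y i) w~=0" if w:"w:E (cdim s)" "w~=(%_. 0)" for w
 proof (cases "EX i<l. dch s a (%y. g y i) w~=0")
 case True thus ?thesis by (intro bexI[of _ "(l, g)"]) (auto simp: \<F>_def)
 next
 case False
 have aU:"a:U" using a U(2) by blast
 have "tangent_map M (euclidean_mfd l) G a (tvec M s a w)=zero_tangent"
 proof -
 have "dch s a (%y. G y i) w=0" if "i<l" for i
 using False that dch_cong[OF sc s(2) opn_openin[OF U(1)] aU, of "%y. g y i" "%y. G y i" w] g(3) by auto
 thus ?thesis unfolding zero_tangent_def
 by (subst tangent_map_euclidean[OF Ma k sa s(2) opn_openin[OF U(1)] aU g(5) g(6)[OF aU]]) (auto simp: fun_eq_iff)
 qed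
 moreover have "tvec M s a w:tangent_space M a" using tangent_space_eq[OF Ma k sa s(2)] w(1) by blast
 ultimately have "tvec M s a w:tvec M s a`E p" using ker[OF a] tangent_inclusion[OF Ma k S s(1,2) a] by blast
 then obtain u where u:"u:E p" "tvec M s a w=tvec M s a u" by blast
 have "u:E (cdim s)" using E_mono[OF pd] u(1) by blast
 from inj_onD[OF tvec_inj[OF Ma k sa s(2)] u(2) w(1) this] have wp:"w:E p" using u(1) by simp
 obtain j where "w j~=0" using w(2) by auto
 hence j:"j<p" "w j~=0" using wp by (auto simp: E_iff not_le[symmetric])
 obtain \<beta> where \<beta>: "ck_on k ?N UNIV \<beta>" "\<beta> a > 0" "!!j. j<cdim ?c==>ck_on k ?N UNIV (%y. \<beta> y*(cmap ?c y j-cmap ?c a j))"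
 by (rule bump[OF Nc NH ca ac openin_topspace]) (use a pN in simp, rule that)
 have "dch ?c a (%y. \<beta> y*(cmap ?c y j-cmap ?c a j)) w~=0"
 using dch_bump[OF Nc k ca ac \<beta>(1), of j w] j \<beta>(2) by simp
 from find[OF averageable_dch[OF Nc k cN ac] \<beta>(3) this] obtain h where h:"eigen h" "complexify (%f. dch ?c a f w) h~=0"
 using j(1) by auto
 have tr:"dch ?c a q w=dch s a (%y. q (P y)) w" for q
 proof -
 have "dch ?c a q w=dch ?c a (%y. q (P y)) w"
 by (rule dch_cong[OF adm_chart[OF ca] ac opn_UNIV]) (use P(2) pN in auto)
 also have "...=dch s a (%y. q (P y)) w" by (rule dch_sub_chart[OF s(1,2) a wp])
 finally show ?thesis .
 qed
 have "dch s a (%y. F2 h y 0) w~=0\<or>dch s a (%y. F2 h y 1) w~=0"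
 using h(2) by (auto simp: complexify_def complex_eq_iff tr F2_def)
 thus ?thesis using eF[OF h(1)] by (intro bexI[of _ "(2, F2 h)"]) (auto intro: exI[of _ 0] exI[of _ 1])
 qed
 thus ?thesis using sa s(2) by blast
 qed
 have S0:"finite {(l, g)}" "{(l, g)}<=\<F>" by (simp_all add: \<F>_def)
 obtain n F where F:"observable n F" "inj_on F (points M)" "!!c x. admissible_chart k M c==>x:cdom c==>imm_at n c x F"
 "!!n' F' i. (n', F'):{(l, g)}==>i<n'==>EX j<n. ALL x. F' x i=F x j"
 "!!j. j<n==>EX (n', F'):\<F>. EX i<n'. ALL x. F x j=F' x i"
 by (rule embedding_of_observables[OF obs sep imm S0]) (assumption | rule that)+
 have FE:"!!x. x:points M==>F x:E n" using F(1) by (simp add: observable_def)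
 have zero:"x:A" if x:"x:points M" and z:"!!i. i<l==>g x i=0" for x
 proof -
 have xA:"P x:A" "P x:points M" using PA[OF x] AM by auto
 have "F x=F (P x)"
 proof (rule E_eqI[OF FE[OF x] FE[OF xA(2)]])
 fix j assume "j<n"
 from F(5)[OF this] obtain n' F' i where q:"(n', F'):\<F>" "i<n'" "ALL x. F x j=F' x i" by blast
 have "F' x i=F' (P x) i"
 proof (cases "(n', F')=(l, g)")
 case True thus ?thesis using z[of i] q(2) g(4)[OF xA(1)] by simp
 next
 case False
 hence "(n', F'):(%h. (2, F2 h))`{h. eigen h}" using q(1) unfolding \<F>_def by blast
 then obtain h where "F'=F2 h" by auto
 thus ?thesis using P(2)[OF xA(1)] by (simp add: F2_def)
 qed
 thus "F x j=F (P x) j" using q(3) by simp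
 qed
 hence "x=P x" using inj_onD[OF F(2)] x xA(2) by blast
 thus "x:A" using xA(1) by simp
 qed
 have dec:"((%t. mexp B t i j) \<longlongrightarrow> 0) at_top" if "i<l" "j<l" for i j by (rule mexp_decay[OF B that])
 have cont:"continuous_map X (Euc n) F" using ck_map_cont[OF observable_ck[OF F(1)]] by simp
 have gc:"continuous_map X (Euc l) g" using ck_map_cont[OF observable_ck[OF g(1)]] by simp
 have "proper X (Euc n) F"
 proof (rule proper_of_sublevels[OF cont sublevel_compact[OF B(1) dec gc g(2) zero], of 1])
 show "\<bar>g x i\<bar><=1*(SUM j<n. \<bar>F x j\<bar>)" if xi:"x:points M" "i<l" for x i
 proof -
 obtain j where "j<n" "ALL x. g x i=F x j" using F(4)[of l g i] xi(2) by auto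
 thus ?thesis using member_le_sum[of j "{..<n}" "%j. \<bar>F x j\<bar>"] by simp
 qed
 qed
 hence "proper_map X (Euc n) F" unfolding proper_def using cont by (intro compact_imp_proper_map)
 (auto simp: metrizable_imp_k_space metrizable_Euclidean_space Hausdorff_imp_kc_space Hausdorff_Euclidean_space locally_compact_imp_k_space locally_compact_Euclidean_space dest: continuous_map_funspace)
 hence emb:"embedding_map X (Euc n) F" by (intro injective_closed_imp_embedding_map cont F(2) proper_imp_closed_map)
 obtain C where C:"C:carrier_mat n n" "!!x t. x:points M==>F (\<Phi> t x)=lin_app n n (mexp C t) (F x)"
 by (rule observable_exp[OF F(1)]) (rule that)
 have "linearizing M \<Phi> n F" unfolding linearizing_def using C mat_app_exp[OF C(1)] by (intro bexI[OF _ C(1)]) auto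
 moreover have "ck_embedding k M (euclidean_mfd n) F" unfolding ck_embedding_def
 proof (intro conjI ballI observable_ck[OF F(1)])
 fix x assume "x:points M"
 then obtain c where c:"c:atlas_of M" "x:cdom c" using charted_cover[OF Mc] by blast
 note ca = atlas_adm[OF Mk c(1)]
 show "inj_on (tangent_map M (euclidean_mfd n) F x) (tangent_space M x)"
 unfolding immersion_iff[OF Ma k ca c(2) observable_ck[OF F(1)]] by (rule F(3)[OF ca c(2)])
 qed (simp add: emb)
 ultimately show ?thesis unfolding linearizable_by_embedding_def linearizing_embedding_def by blast
qed

end

section \<open>Frequencies and density on the torus\<close>

text \<open>If the next number depends rationally on the basis found so far, divide the basis by the denominator; otherwise add the number to it.\<close>

lemma integer_basis:
 fixes f :: "nat=>real"
 obtains m and \<omega> :: "nat=>real" and c :: "nat=>nat=>int" where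
 "!!u::nat=>int. (SUM l<m. of_int (u l)*\<omega> l)=0==>ALL l<m. u l=0" "!!i. i<n==>f i=(SUM l<m. of_int (c i l)*\<omega> l)"
proof -
 have "EX m (\<omega>::nat=>real) (c::nat=>nat=>int). (ALL u::nat=>int. (SUM l<m. of_int (u l)*\<omega> l)=0-->(ALL l<m. u l=0)) &
 (ALL i<n. f i=(SUM l<m. of_int (c i l)*\<omega> l))"
 proof (induction n)
 case 0 show ?case by (intro exI[of _ 0]) simp
 next
 case (Suc n)
 then obtain m and \<omega> :: "nat=>real" and c :: "nat=>nat=>int" where
 ind:"!!u::nat=>int. (SUM l<m. of_int (u l)*\<omega> l)=0==>ALL l<m. u l=0" and
 f:"!!i. i<n==>f i=(SUM l<m. of_int (c i l)*\<omega> l)" by blast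
 show ?case
 proof (cases "EX u::nat=>int. (SUM l<m. of_int (u l)*\<omega> l) + of_int (u m) * f n=0&u m~=0")
 case True
 then obtain u :: "nat=>int" where u:"(SUM l<m. of_int (u l)*\<omega> l) + of_int (u m) * f n=0" "u m~=0" by blast
 define d where "d=(of_int (u m)::real)"
 have d:"d~=0" using u(2) by (simp add: d_def)
 have 1:"ALL l<m. v l=0" if "(SUM l<m. of_int (v l)*(\<omega> l/d))=0" for v :: "nat=>int"
 proof -
 have "(SUM l<m. of_int (v l)*(\<omega> l/d))=(SUM l<m. of_int (v l)*\<omega> l)/d" by (simp add: sum_divide_distrib)
 thus ?thesis using ind that d by simp
 qed
 have 2:"f i=(SUM l<m. of_int (if i<n then c i l * u m else-u l)*(\<omega> l/d))" if "i<Suc n" for i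
 proof (cases "i<n")
 case True
 have "(SUM l<m. of_int (c i l * u m)*(\<omega> l/d))=(SUM l<m. of_int (c i l)*\<omega> l)"
 using d by (intro sum.cong) (simp_all add: d_def)
 thus ?thesis using f True by simp
 next
 case False
 hence i:"i=n" using that by simp
 have "(SUM l<m. of_int (- u l)*(\<omega> l/d)) =-(SUM l<m. of_int (u l)*\<omega> l)/d"
 by (simp add: sum_divide_distrib sum_negf)
 also have "...=f n" using u(1) d by (simp add: d_def field_simps)
 finally show ?thesis using i by simp
 qed
 show ?thesis
 proof (rule exI[of _ m], rule exI[of _ "%l. \<omega> l/d"], rule exI[of _ "%i l. if i<n then c i l * u m else-u l"], intro conjI allI impI)
 show "v l=0" if "(SUM l<m. of_int (v l)*(\<omega> l/d))=0" "l<m" for v :: "nat=>int" and l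
 using 1[OF that(1)] that(2) by blast
 qed (rule 2)
 next
 case False
 define \<nu> where "\<nu>=fun_upd \<omega> m (f n)"
 have 1:"ALL l<Suc m. v l=0" if "(SUM l<Suc m. of_int (v l)*\<nu> l)=0" for v :: "nat=>int"
 proof -
 have "(SUM l<m. of_int (v l)*\<nu> l)=(SUM l<m. of_int (v l)*\<omega> l)" by (intro sum.cong) (auto simp: \<nu>_def)
 hence "(SUM l<Suc m. of_int (v l)*\<nu> l)=(SUM l<m. of_int (v l)*\<omega> l) + of_int (v m) * f n"
 unfolding sum.lessThan_Suc by (simp add: \<nu>_def)
 hence e:"(SUM l<m. of_int (v l)*\<omega> l) + of_int (v m) * f n=0" using that by (rule trans[OF sym])
 have vm:"v m=0"
 proof (rule ccontr)
 assume "v m~=0"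
 hence "EX u::nat=>int. (SUM l<m. of_int (u l)*\<omega> l) + of_int (u m) * f n=0&u m~=0"
 by (intro exI[of _ v] conjI e)
 thus False using False by (rule notE[rotated])
 qed
 have "(SUM l<m. of_int (v l)*\<omega> l)=0" using e unfolding vm by simp
 from ind[OF this] show ?thesis using vm by (simp add: less_Suc_eq)
 qed
 have 2:"f i=(SUM l<Suc m. of_int (if i<n then (if l<m then c i l else 0) else (if l=m then 1 else 0))*\<nu> l)" if "i<Suc n" for i
 proof (cases "i<n")
 case True
 have "(SUM l<m. of_int (if l<m then c i l else 0)*\<nu> l)=(SUM l<m. of_int (c i l)*\<omega> l)" by (intro sum.cong) (auto simp: \<nu>_def)
 thus ?thesis unfolding sum.lessThan_Suc using f True by simp
 next
 case False
 hence "i=n" using that by simp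
 moreover have "(SUM l<m. real_of_int (if l=m then 1 else 0)*\<nu> l)=0" by (intro sum.neutral) auto
 ultimately show ?thesis unfolding sum.lessThan_Suc by (simp add: \<nu>_def)
 qed
 show ?thesis
 proof (rule exI[of _ "Suc m"], rule exI[of _ \<nu>], rule exI[of _ "%i l. if i<n then (if l<m then c i l else 0) else (if l=m then 1 else 0)"], intro conjI allI impI)
 show "v l=0" if "(SUM l<Suc m. of_int (v l)*\<nu> l)=0" "l<Suc m" for v :: "nat=>int" and l
 using 1[OF that(1)] that(2) by blast
 qed (rule 2)
 qed
 qed
 then obtain m and \<omega> :: "nat=>real" and c :: "nat=>nat=>int" where
 "(ALL u::nat=>int. (SUM l<m. of_int (u l)*\<omega> l)=0-->(ALL l<m. u l=0))&(ALL i<n. f i=(SUM l<m. of_int (c i l)*\<omega> l))" by blast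
 note c = this
 have b1:"!!u::nat=>int. (SUM l<m. of_int (u l)*\<omega> l)=0==>ALL l<m. u l=0"
 by (rule conjunct1[OF c, THEN spec, THEN mp])
 have b2:"!!i. i<n==>f i=(SUM l<m. of_int (c i l)*\<omega> l)" by (rule conjunct2[OF c, THEN spec, THEN mp])
 show ?thesis by (rule that[OF b1 b2])
qed

lemma torus_density:
 fixes \<omega> \<alpha> :: "nat=>real"
 assumes ind:"!!u::nat=>int. (SUM l<m. of_int (u l)*\<omega> l)=0==>ALL l<m. u l=0" and e:"\<epsilon> > 0"
 obtains t h where "!!i. i<m==>\<bar>t*\<omega> i - of_int (h i)-\<alpha> i\<bar><\<epsilon>"
proof -
 have mod:"Modules.module (%r. (*) (real_of_int r))" by (simp add: Modules.module.intro distrib_left mult.commute)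
 have inj:"inj_on \<omega> {..<m}"
 proof (rule inj_onI, rule ccontr)
 fix i j assume ij:"i:{..<m}" "j:{..<m}" "\<omega> i=\<omega> j" "i~=j"
 define u where "u l=(if l=i then 1 else if l=j then-1 else (0::int))" for l
 have "(SUM l<m. of_int (u l)*\<omega> l)=(SUM l:{i, j}. of_int (u l)*\<omega> l)"
 by (rule sum.mono_neutral_right) (use ij in "auto simp: u_def")
 also have "...=0" using ij by (simp add: u_def)
 finally have "u i=0" using ind[of u] ij(1) by blast
 thus False by (simp add: u_def)
 qed
 have indep:"ALL t u v. finite t-->t<=\<omega>`{..<m}-->(SUM v:t. real_of_int (u v) * v)=0-->v:t-->u v=0"
 proof (intro allI impI)
 fix t and u :: "real=>int" and v assume t:"finite t" "t<=\<omega>`{..<m}" "(SUM v:t. real_of_int (u v) * v)=0" "v:t"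
 define S where "S={l. l<m&\<omega> l:t}"
 have tS:"t=\<omega>`S" using t(2) by (auto simp: S_def)
 have "(SUM l<m. of_int (if \<omega> l:t then u (\<omega> l) else 0)*\<omega> l)=(SUM l:S. of_int (u (\<omega> l))*\<omega> l)"
 by (rule sum.mono_neutral_cong_right) (auto simp: S_def)
 also have "...=(SUM v:t. of_int (u v) * v)" unfolding tS
 by (subst sum.reindex) (auto simp: S_def intro: inj_on_subset[OF inj])
 finally have "(SUM l<m. of_int (if \<omega> l:t then u (\<omega> l) else 0)*\<omega> l)=0" unfolding t(3) .
 from ind[of "%l. if \<omega> l:t then u (\<omega> l) else 0", OF this] have z:"ALL l<m. (if \<omega> l:t then u (\<omega> l) else 0)=0" .
 obtain l where "l<m" "v=\<omega> l" using t(2,4) by blast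
 thus "u v=0" using z t(4) by auto
 qed
 show ?thesis
 by (rule Kronecker_thm_1[of \<omega> m \<epsilon> \<alpha>, unfolded Modules.module.independent_explicit_module[OF mod], OF indep inj e]) (rule that)
qed

lemma inverse_apply:
 fixes P Q :: "nat=>nat=>complex"
 assumes "!!a b. a<n==>b<n==>(SUM i<n. Q a i * P i b)=(if a=b then 1 else 0)" and a:"a<n"
 shows "(SUM i<n. Q a i*(SUM c<n. P i c * w c))=w a"
proof -
 have "(SUM i<n. Q a i*(SUM c<n. P i c * w c))=(SUM c<n. SUM i<n. Q a i * P i c * w c)"
 unfolding sum_distrib_left by (subst sum.swap) (simp add: mult.assoc)
 also have "...=(SUM c<n. (if a=c then 1 else 0) * w c)"
 unfolding sum_distrib_right[symmetric] using assms by (intro sum.cong) auto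
 also have "...=(SUM c<n. if a=c then w c else 0)" by (intro sum.cong) auto
 also have "...=w a" using a by simp
 finally show ?thesis .
qed

lemma cis_add_int:"cis (2 * pi*(x + of_int k))=cis (2 * pi * x)"
proof -
 have "cis (2 * pi*(x + of_int k))=cis (2 * pi * x) * cis (2 * pi * of_int k)" unfolding cis_mult by (simp add: distrib_left)
 moreover have "cis (2 * pi * of_int k)=1" by (rule cis_multiple_2pi) simp
 ultimately show ?thesis by simp
qed

lemma dch_zero_fun:"dch c x (%_. 0) w=0" by (simp add: dch_def partial_deriv_def)

section \<open>A linearizing embedding in spectral coordinates\<close>

locale spectral_embedding = attracting_flow k M \<Phi> A for k :: enat and M :: "'a mfd" and \<Phi> A +
 fixes n :: nat and F :: "'a=>nat=>real" and P Q :: "nat=>nat=>complex" and la s :: "nat=>complex"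
 assumes Fck:"ck_map k M (euclidean_mfd n) F" and Femb:"embedding_map X (Euc n) F"
 and Fimm:"!!x. x:points M==>inj_on (tangent_map M (euclidean_mfd n) F x) (tangent_space M x)"
 and PQ:"!!i j. i<n==>j<n==>(SUM a<n. P i a * Q a j)=(if i=j then 1 else 0)"
 and QP:"!!a b. a<n==>b<n==>(SUM i<n. Q a i * P i b)=(if a=b then 1 else 0)"
 and s:"!!a. s a~=0==>la a=la (Suc a)"
 and evol:"!!x t a. x:points M==>a<n==>(SUM i<n. Q a i * of_real (F (\<Phi> t x) i)) =
 (SUM b<n. jexp la s t a b*(SUM i<n. Q b i * of_real (F x i)))"
 and ode:"!!x t a. x:points M==>a<n==>((%t. SUM i<n. Q a i * of_real (F (\<Phi> t x) i)) has_vector_derivative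
 (SUM b<n. jform la s a b*(SUM i<n. Q b i * of_real (F (\<Phi> t x) i)))) (at t)"
begin

definition u :: "nat=>'a=>complex" where "u a x=(SUM i<n. Q a i * of_real (F x i))"

lemma FE:"x:points M==>F x:E n" and Fi:"i<n==>ck_on k M UNIV (%x. F x i)"
 using Fck unfolding ck_map_euclidean[OF Mc] by blast+

lemma Finj:"inj_on F (points M)" using Femb unfolding embedding_map_def by (rule homeomorphic_imp_injective_map)

lemma Fcont:"continuous_map X euclideanreal (%x. F x i)"
proof (cases "i<n")
 case True
 show ?thesis using ck_on_cont[OF Mc _ ck_on_subset[OF Mc opn_UNIV opn_openin[OF openin_topspace] subset_UNIV Fi[OF True]]] by simp
next
 case False
 hence "F x i=0" if "x:points M" for x using FE[OF that] by (simp add: E_iff)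
 thus ?thesis by (subst continuous_map_eq[where f = "%_. 0" for f]) (auto intro: continuous_map_eq[of _ _ "%_. 0"])
qed

lemma F_u:"i<n ==> of_real (F x i)=(SUM a<n. P i a * u a x)"
 unfolding u_def by (rule inverse_apply[OF PQ, symmetric]) auto

lemma u_flow:"x:points M==>a<n==>u a (\<Phi> t x)=(SUM b<n. jexp la s t a b * u b x)"
 using evol[of x a t] by (simp add: u_def)

lemma u_separates:
 assumes "x:points M" "y:points M" "!!a. a<n==>u a x=u a y" shows "x=y"
proof -
 have "F x i=F y i" if "i<n" for i
 proof -
 have "complex_of_real (F x i) = of_real (F y i)" unfolding F_u[OF that] by (intro sum.cong) (auto simp: assms(3))
 thus ?thesis by simp
 qed
 hence "F x=F y" by (intro E_eqI[OF FE[OF assms(1)] FE[OF assms(2)]])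
 thus ?thesis using inj_onD[OF Finj] assms by blast
qed

lemma F_scaled:
 assumes z:"!!a. a<n==>u a y=z a * u a x" and i:"i<n"
 shows "F y i=(SUM j<n. Re (SUM a<n. P i a * z a * Q a j) * F x j)"
proof -
 have "complex_of_real (F y i)=(SUM a<n. P i a*(z a*(SUM j<n. Q a j * of_real (F x j))))"
 unfolding F_u[OF i] u_def[of _ x, symmetric] by (intro sum.cong) (auto simp: z)
 also have "...=(SUM a<n. SUM j<n. P i a * z a * Q a j * of_real (F x j))" by (simp add: sum_distrib_left mult.assoc)
 also have "...=(SUM j<n. SUM a<n. P i a * z a * Q a j * of_real (F x j))" by (rule sum.swap)
 also have "...=(SUM j<n. (SUM a<n. P i a * z a * Q a j) * of_real (F x j))" by (simp add: sum_distrib_right)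
 finally have "Re (complex_of_real (F y i))=Re (SUM j<n. (SUM a<n. P i a * z a * Q a j) * of_real (F x j))" by (rule arg_cong)
 thus ?thesis by simp
qed

lemma forward_bounded:
 assumes x:"x:points M"
 obtains K where "!!t i. t\<ge>0==>i<n==>\<bar>F (\<Phi> t x) i\<bar><=K"
proof -
 obtain W C where W:"openin X W" "A<=W" "W<=C" and C:"compactin X C" by (rule compact_nbhd)
 define N where "N x=(SUM i<n. \<bar>F x i\<bar>)" for x
 have Nc:"continuous_map X euclideanreal N" unfolding N_def by (intro continuous_intros Fcont) auto
 obtain T where T:"!!t. t\<ge>T==>\<Phi> t x:W" using attracted[OF x W(1,2)] unfolding eventually_at_top_linorder by blast
 have "bounded (N`C)" using image_compactin[OF C Nc] compact_imp_bounded by simp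
 then obtain K1 where "ALL z:N`C. norm z<=K1" unfolding bounded_iff by blast
 hence K1:"N y<=K1" if "y:C" for y using that by (auto simp: abs_le_iff)
 have "continuous_map euclideanreal euclideanreal (%t. N (\<Phi> t x))"
 using continuous_map_compose[OF flow_curve[OF x] Nc] by (simp add: o_def)
 hence "continuous_on UNIV (%t. N (\<Phi> t x))" by simp
 hence "bounded ((%t. N (\<Phi> t x))`{0..T})"
 by (rule compact_imp_bounded[OF compact_continuous_image[OF continuous_on_subset[OF _ subset_UNIV] compact_Icc]])
 then obtain K2 where "ALL z:(%t. N (\<Phi> t x))`{0..T}. norm z<=K2" unfolding bounded_iff by blast
 hence K2:"N (\<Phi> t x)<=K2" if "t:{0..T}" for t using that by (auto simp: abs_le_iff)
 show ?thesis
 proof (rule that[of "max K1 K2"])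
 fix t :: real and i assume t:"t\<ge>0" and i:"i<n"
 have "\<bar>F (\<Phi> t x) i\<bar><=N (\<Phi> t x)" unfolding N_def by (rule member_le_sum[of i "{..<n}" "%i. \<bar>F (\<Phi> t x) i\<bar>"]) (use i in auto)
 also have "...<=max K1 K2" using T[of t] K1[of "\<Phi> t x"] K2[of t] t W(3) by (cases "t<=T") (auto simp: le_max_iff_disj)
 finally show "\<bar>F (\<Phi> t x) i\<bar><=max K1 K2" .
 qed
qed

text \<open>Forward orbits are bounded because they approach the compact set \<open>A\<close>. A bounded exponential
  polynomial whose exponent has real part \<open>\<ge> 0\<close> has constant coefficient part, and vanishes if the
  real part is positive.\<close>

lemma unstable_and_center:
 assumes x:"x:points M" and a:"a<n" and re:"Re (la a)\<ge>0"
 shows "u a (\<Phi> t x)=exp (la a * of_real t) * u a x" and "Re (la a) > 0==>u a x=0"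
proof -
 define p where "p=(SUM b<n. Polynomial.monom (chain_prod s a b * u b x/fact (b-a)) (b-a))"
 have up:"u a (\<Phi> t x)=exp (la a * of_real t) * poly p (of_real t)" for t
 proof -
 have "u a (\<Phi> t x)=(SUM b<n. exp (la a * of_real t)*(chain_prod s a b * u b x/fact (b-a) * of_real t^(b-a)))"
 unfolding u_flow[OF x a] by (intro sum.cong) (simp_all add: jexp_def)
 thus ?thesis by (simp add: p_def poly_sum poly_monom sum_distrib_left)
 qed
 have c0:"Polynomial.coeff p 0=u a x"
 proof -
 have "Polynomial.coeff p 0=(SUM b<n. if b=a then u a x else 0)"
 unfolding p_def coeff_sum by (intro sum.cong) (auto simp: chain_prod_def)
 thus ?thesis using a by simp
 qed
 obtain K where K:"!!t i. t\<ge>0==>i<n==>\<bar>F (\<Phi> t x) i\<bar><=K" by (rule forward_bounded[OF x]) (rule that)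
 have bd:"cmod (exp (la a * of_real t) * poly p (of_real (1 * t)))<=(SUM i<n. cmod (Q a i) * K)" if t:"t\<ge>0" for t
 proof -
 have "cmod (u a (\<Phi> t x))<=(SUM i<n. cmod (Q a i * of_real (F (\<Phi> t x) i)))" unfolding u_def by (rule norm_sum)
 also have "...<=(SUM i<n. cmod (Q a i) * K)" using K[OF t] by (intro sum_mono) (simp add: norm_mult mult_left_mono)
 finally show ?thesis by (simp add: up)
 qed
 have one:"\<bar>1::real\<bar>=1" by simp
 from bounded_poly_exp(1)[OF bd one re] have "p=[:u a x:]" unfolding c0 .
 thus "u a (\<Phi> t x)=exp (la a * of_real t) * u a x" unfolding up by simp
 show "u a x=0" if "Re (la a) > 0" using bounded_poly_exp(2)[OF bd one re that] c0 by simp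
qed

lemma center:
 assumes "x:points M" "a<n" "Re (la a)=0"
 shows "u a (\<Phi> t x)=cis (Im (la a) * t) * u a x"
proof -
 have "la a * of_real t=\<i> * of_real (Im (la a) * t)" using assms(3) by (intro complex_eqI) simp_all
 hence "exp (la a * of_real t)=cis (Im (la a) * t)" by (simp only: cis_conv_exp)
 thus ?thesis using unstable_and_center(1)[OF assms(1,2), of t] assms(3) by simp
qed

lemma stable_decay:
 assumes "x:points M" "a<n" "Re (la a)<0"
 shows "((%t. u a (\<Phi> t x)) \<longlongrightarrow> 0) at_top"
proof -
 have "((%t. SUM b<n. jexp la s t a b * u b x) \<longlongrightarrow> (SUM b<n. 0 * u b x)) at_top"
 by (intro tendsto_sum tendsto_mult tendsto_const jexp_decay assms(3))
 thus ?thesis by (simp add: u_flow[OF assms(1,2)])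
qed

lemma stable_zero_on_A:
 assumes x:"x:A" and a:"a<n" and re:"Re (la a)<0"
 shows "u a x=0"
proof -
 have xM:"x:points M" using x AM by blast
 have "EX K. ALL y:A. \<bar>F y i\<bar><=K" for i
 proof -
 have "bounded ((%y. F y i)`A)" using image_compactin[OF Acpt Fcont[of i]] compact_imp_bounded by simp
 thus ?thesis unfolding bounded_iff by auto
 qed
 then obtain K where K:"!!i y. y:A==>\<bar>F y i\<bar><=K i" by metis
 define L where "L b=(SUM i<n. cmod (Q b i) * K i)" for b
 have L:"cmod (u b y)<=L b" if "y:A" for b y
 proof -
 have "cmod (u b y)<=(SUM i<n. cmod (Q b i * of_real (F y i)))" unfolding u_def by (rule norm_sum)
 also have "...<=L b" unfolding L_def using K[OF that] by (intro sum_mono) (simp add: norm_mult mult_left_mono)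
 finally show ?thesis .
 qed
 have le:"cmod (u a x)<=(SUM b<n. cmod (jexp la s t a b) * L b)" for t
 proof -
 have y:"\<Phi> (- t) x:A" "\<Phi> (- t) x:points M" using flow_A[OF x] AM by auto
 have "u a x=(SUM b<n. jexp la s t a b * u b (\<Phi> (- t) x))" using u_flow[OF y(2) a, of t] flow_inv(1)[OF xM] by simp
 also have "cmod ...<=(SUM b<n. cmod (jexp la s t a b * u b (\<Phi> (- t) x)))" by (rule norm_sum)
 also have "...<=(SUM b<n. cmod (jexp la s t a b) * L b)" using L[OF y(1)] by (intro sum_mono) (simp add: norm_mult mult_left_mono)
 finally show ?thesis .
 qed
 have "((%t. SUM b<n. cmod (jexp la s t a b) * L b) \<longlongrightarrow> (SUM b<n. 0 * L b)) at_top"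
 by (intro tendsto_sum tendsto_mult tendsto_const tendsto_norm_zero jexp_decay re)
 hence lim:"((%t. SUM b<n. cmod (jexp la s t a b) * L b) \<longlongrightarrow> 0) at_top" by simp
 have "cmod (u a x)<=0" by (rule tendsto_lowerbound[OF lim]) (use le in auto)
 thus ?thesis by simp
qed

text \<open>A limit of values of \<open>F\<close> along points that approach \<open>A\<close> is a value on \<open>A\<close>, because \<open>F(A)\<close> is compact.\<close>

lemma limit_in_A:
 fixes y :: "nat=>'a"
 assumes yM:"!!N. y N:points M" and near:"!!W. openin X W==>A<=W==>\<forall>\<^sub>F N in sequentially. y N\<in>W"
 and lim:"!!a. a<n==>(%N. u a (y N)) \<longlonglongrightarrow> z a"
 obtains b where "b:A" "!!a. a<n==>u a b=z a"
proof -
 define v where "v i=(SUM a<n. P i a * z a)" for i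
 have Fl:"(%N. complex_of_real (F (y N) i)) \<longlonglongrightarrow> v i" if "i<n" for i
 unfolding F_u[OF that] v_def by (intro tendsto_sum tendsto_mult tendsto_const lim) auto
 have Fr:"(%N. F (y N) i) \<longlonglongrightarrow> Re (v i)" if "i<n" for i using tendsto_Re[OF Fl[OF that]] by simp
 have vr:"of_real (Re (v i))=v i" if "i<n" for i
 using LIMSEQ_unique[OF tendsto_Im[OF Fl[OF that]]] by (simp add: complex_eq_iff)
 define D where "D x=(SUM i<n. \<bar>F x i-Re (v i)\<bar>)" for x
 have Dc:"continuous_map X euclideanreal D" unfolding D_def by (intro continuous_intros Fcont) auto
 have "(%N. D (y N)) \<longlonglongrightarrow> (SUM i<n. \<bar>Re (v i)-Re (v i)\<bar>)" unfolding D_def by (intro tendsto_intros Fr) auto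
 hence D0:"(%N. D (y N)) \<longlonglongrightarrow> 0" by simp
 have "A~={}"
 proof
 assume "A={}"
 hence "\<forall>\<^sub>F N in sequentially. y N\<in>{}" by (intro near) auto
 thus False by simp
 qed
 moreover have "compact (D`A)" using image_compactin[OF Acpt Dc] by simp
 ultimately obtain b where b:"b:A" "!!x. x:A==>D b<=D x" using compact_attains_inf[of "D`A"] by auto
 have "D b<=0"
 proof (rule ccontr)
 assume pos:"\<not> D b<=0"
 let ?W = "{x:points M. D x:{D b/2<..}}"
 have "openin X ?W" by (rule openin_continuous_map_preimage[OF Dc]) auto
 moreover have "D x > D b/2" if "x:A" for x using b(2)[OF that] pos by linarith
 hence "A<=?W" using AM by auto
 ultimately have "\<forall>\<^sub>F N in sequentially. y N\<in>?W" by (rule near)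
 moreover have "\<forall>\<^sub>F N in sequentially. D (y N)<D b/2" by (rule order_tendstoD(2)[OF D0]) (use pos in simp)
 ultimately have "\<forall>\<^sub>F N in sequentially. False" by eventually_elim simp
 thus False by simp
 qed
 hence "D b=0" by (intro antisym) (auto simp: D_def sum_nonneg)
 hence Fb:"F b i=Re (v i)" if "i<n" for i using that by (simp add: D_def sum_nonneg_eq_0_iff)
 show ?thesis
 proof (rule that[OF b(1)])
 fix a assume a:"a<n"
 have "u a b=(SUM i<n. Q a i * v i)" unfolding u_def by (intro sum.cong) (simp_all add: Fb vr)
 also have "...=z a" unfolding v_def by (rule inverse_apply[OF QP a])
 finally show "u a b=z a" .
 qed
qed

text \<open>Simultaneous Dirichlet approximation applied to large multiples of the frequencies makes the return times unbounded.\<close>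

lemma recurrence:
 obtains \<tau> :: "nat=>real" where "filterlim \<tau> at_top sequentially" "!!a. a<n==>(%N. cis (Im (la a)*\<tau> N)) \<longlonglongrightarrow> 1"
proof -
 have "EX t. t\<ge>real (Suc N)&(ALL a<n. EX r. \<bar>r\<bar><=1/real (Suc N)&cis (Im (la a) * t)=cis (2 * pi * r))" for N
 proof -
 obtain q p where qp:"0<q" "!!i. i<n==>\<bar>of_int q*(real (Suc N)*(Im (la i)/(2 * pi))) - of_int (p i)\<bar><1/Suc N"
 by (rule Dirichlet_approx_simult[of "Suc N" n "%i. real (Suc N)*(Im (la i)/(2 * pi))"]) (simp, rule that, auto)
 define t where "t = of_int q * real (Suc N)"
 have q1:"1<=real_of_int q" using qp(1) by simp
 have "t\<ge>real (Suc N)" unfolding t_def using mult_right_mono[OF q1, of "real (Suc N)"] by simp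
 moreover have "EX r. \<bar>r\<bar><=1/real (Suc N)&cis (Im (la a) * t)=cis (2 * pi * r)" if "a<n" for a
 proof (intro exI conjI)
 let ?r = "of_int q*(real (Suc N)*(Im (la a)/(2 * pi))) - of_int (p a)"
 show "\<bar>?r\<bar><=1/real (Suc N)" using qp(2)[OF that] by simp
 have "Im (la a) * t=2 * pi*(?r + of_int (p a))" by (simp add: t_def)
 thus "cis (Im (la a) * t)=cis (2 * pi*?r)" by (simp only: cis_add_int)
 qed
 ultimately show ?thesis by blast
 qed
 then obtain \<tau> where \<tau>: "!!N. \<tau> N\<ge>real (Suc N)" "!!N a. a<n==>EX r. \<bar>r\<bar><=1/real (Suc N)&cis (Im (la a)*\<tau> N)=cis (2 * pi * r)"
 by metis
 have "filterlim (%N. real (Suc N)) at_top sequentially"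
 by (rule filterlim_compose[OF filterlim_real_sequentially filterlim_Suc])
 hence 1:"filterlim \<tau> at_top sequentially" by (rule filterlim_at_top_mono) (use \<tau>(1) in auto)
 have 2:"(%N. cis (Im (la a)*\<tau> N)) \<longlonglongrightarrow> 1" if a:"a<n" for a
 proof -
 obtain r where r:"!!N. \<bar>r N\<bar><=1/real (Suc N)" "!!N. cis (Im (la a)*\<tau> N)=cis (2 * pi * r N)" using \<tau>(2)[OF a] by metis
 have "r \<longlonglongrightarrow> 0"
 by (rule tendsto_rabs_zero_cancel, rule tendsto_sandwich[OF _ _ tendsto_const LIMSEQ_Suc[OF lim_1_over_n]]) (use r(1) in auto)
 hence "(%N. cis (2 * pi * r N)) \<longlonglongrightarrow> cis (2 * pi*0)" by (intro tendsto_intros)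
 thus ?thesis using r(2) by simp
 qed
 show ?thesis by (rule that[OF 1 2])
qed

lemma projection_exists:
 assumes x:"x:points M"
 shows "EX y. y:A&(ALL a<n. u a y=(if Re (la a)=0 then 1 else 0) * u a x)"
proof -
 obtain \<tau> :: "nat=>real" where \<tau>: "filterlim \<tau> at_top sequentially" "!!a. a<n==>(%N. cis (Im (la a)*\<tau> N)) \<longlonglongrightarrow> 1"
 by (rule recurrence) (rule that)
 obtain y where "y:A" "!!a. a<n==>u a y=(if Re (la a)=0 then 1 else 0) * u a x"
 proof (rule limit_in_A[of "%N. \<Phi> (\<tau> N) x" "%a. (if Re (la a)=0 then 1 else 0) * u a x"])
 show "\<Phi> (\<tau> N) x:points M" for N by (rule flow_points[OF x])
 show "\<forall>\<^sub>F N in sequentially. \<Phi> (\<tau> N) x\<in>W" if "openin X W" "A<=W" for W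
 using attracted[OF x that] \<tau>(1) by (rule eventually_compose_filterlim)
 show "(%N. u a (\<Phi> (\<tau> N) x)) \<longlonglongrightarrow> (if Re (la a)=0 then 1 else 0) * u a x" if a:"a<n" for a
 proof (cases "Re (la a)" "0::real" rule: linorder_cases)
 case less
 thus ?thesis using filterlim_compose[OF stable_decay[OF x a less] \<tau>(1)] by simp
 next
 case equal
 thus ?thesis using tendsto_mult_right[OF \<tau>(2)[OF a], of "u a x"] by (simp add: center[OF x a equal])
 next
 case greater
 thus ?thesis using unstable_and_center(2)[OF flow_points[OF x] a _ greater] by simp
 qed
 qed (rule that)
 thus ?thesis by blast
qed

definition Pr :: "'a=>'a" where
 "Pr x=(SOME y. y:A&(ALL a<n. u a y=(if Re (la a)=0 then 1 else 0) * u a x))"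

lemma Pr:
 assumes "x:points M"
 shows "Pr x:A" "a<n==>u a (Pr x)=(if Re (la a)=0 then 1 else 0) * u a x"
 using someI_ex[OF projection_exists[OF assms]] unfolding Pr_def by auto

lemma Pr_points:"x:points M==>Pr x:points M" using Pr(1) AM by blast

lemma Pr_eq:
 assumes x:"x:points M" and z:"!!a. a<n==>Re (la a)<0==>u a x=0"
 shows "Pr x=x"
proof (rule u_separates[OF Pr_points[OF x] x])
 fix a assume a:"a<n"
 show "u a (Pr x)=u a x"
 using Pr(2)[OF x a] z[OF a] unstable_and_center(2)[OF x a] by (cases "Re (la a)" "0::real" rule: linorder_cases) auto
qed

lemma Pr_id:"x:A==>Pr x=x" using Pr_eq stable_zero_on_A AM by blast

lemma in_A:"x:points M==>(!!a. a<n==>Re (la a)<0==>u a x=0)==>x:A"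
 using Pr_eq Pr(1) by metis

lemma noncenter_zero:"x:A==>a<n==>Re (la a)~=0==>u a x=0"
 using stable_zero_on_A unstable_and_center(2)[of x a] AM by (cases "Re (la a)<0") auto

lemma Pr_flow:
 assumes x:"x:points M" shows "Pr (\<Phi> t x)=\<Phi> t (Pr x)"
proof (rule u_separates[OF Pr_points[OF flow_points[OF x]] flow_points[OF Pr_points[OF x]]])
 fix a assume a:"a<n"
 show "u a (Pr (\<Phi> t x))=u a (\<Phi> t (Pr x))"
 proof (cases "Re (la a)=0")
 case True
 thus ?thesis using Pr(2)[OF flow_points[OF x] a] Pr(2)[OF x a] center[OF x a True] center[OF Pr_points[OF x] a True] by simp
 next
 case False
 thus ?thesis using Pr(2)[OF flow_points[OF x] a] noncenter_zero[OF flow_A[OF Pr(1)[OF x]] a False] by simp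
 qed
qed

text \<open>The local left inverses of the immersion \<open>F\<close> show that a map into \<open>X\<close> is \<open>C\<^sup>k\<close> as soon as its
  composition with \<open>F\<close> is.\<close>

lemma lift_ck:
 assumes N:"charted N" and f:"!!y. y:points N==>f y:points M" and ck:"!!i. i<n==>ck_on k N UNIV (%y. F (f y) i)"
 shows "ck_map k N M f"
proof -
 have Ff:"ck_map k N (euclidean_mfd n) (%y. F (f y))" unfolding ck_map_euclidean[OF N] using ck FE f by blast
 have cF:"continuous_map (space_of N) (Euc n) (%y. F (f y))" using ck_map_cont[OF Ff] by simp
 obtain g where g:"homeomorphic_maps X (subtopology (Euc n) (F`points M)) F g"
 using Femb unfolding embedding_map_def homeomorphic_map_maps by blast
 have gc:"continuous_map (subtopology (Euc n) (F`points M)) X g" and gF:"!!x. x:points M==>g (F x)=x"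
 using g unfolding homeomorphic_maps_def by auto
 have "continuous_map (space_of N) (subtopology (Euc n) (F`points M)) (%y. F (f y))"
 using cF f by (auto simp: continuous_map_in_subtopology)
 from continuous_map_compose[OF this gc] have "continuous_map (space_of N) X (%y. g (F (f y)))" by (simp add: o_def)
 hence fc:"continuous_map (space_of N) X f" by (rule continuous_map_eq) (use f gF in auto)
 show ?thesis unfolding ck_map_iff
 proof (intro conjI fc ballI allI impI)
 fix e i assume e:"e:atlas_of M" and i:"i<cdim e"
 note ea = atlas_adm[OF Mk e] note ec = adm_chart[OF ea]
 have oV:"opn N (f -` cdom e)" by (rule opn_vimage[OF fc adm_opn[OF ea]])
 show "ck_on k N (f -` cdom e) (%y. cmap e (f y) i)"
 proof (rule ck_on_local[OF N oV])
 fix y assume y:"y:points N" "y:f -` cdom e"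
 hence fy:"f y:cdom e" by simp
 have im:"imm_at n e (f y) F" using Fimm[OF f[OF y(1)]] unfolding immersion_iff[OF Ma k ea fy Fck] .
 obtain V D' r where V:"openin (Euc (cdim e)) V" "cmap e (f y):V" "V<=cmap e`cdom e"
 "openin (Euc n) D'" "!!v. v:V==>F (cinv e v):D'&r (F (cinv e v))=v"
 "!!i. i<cdim e==>ck_real k n D' (%y. r y i)"
 proof (rule immersion_left_inverse[OF k chart_img_open[OF ec], of n "%v. F (cinv e v)" "cmap e (f y)"])
 show "ck_real k (cdim e) (cmap e`cdom e) (%v. F (cinv e v) i)" if "i<n" for i
 using adm_pull[OF Mc ea opn_UNIV Fi[OF that]] by simp
 show "F (cinv e v):E n" if "v:cmap e`cdom e" for v
 using FE chart_inv_dom[OF that] chart_dom_subset[OF ec] by blast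
 show "cmap e (f y):cmap e`cdom e" using fy by simp
 show "trivial_kernel n (cdim e) (jac (%v. F (cinv e v)) (cmap e (f y)))" using im by (simp only: imm_at_kernel)
 qed (rule that)
 define W where "W={x:cdom e. cmap e x:V}"
 have W:"openin X W" unfolding W_def by (rule chart_open_preimage[OF ec V(1)])
 have oW:"opn N (f -` W)" by (rule opn_vimage[OF fc opn_openin[OF W]])
 have oO:"opn (euclidean_mfd n) D'" by (rule opn_openin) (use V(4) in simp)
 have "ck_on k (euclidean_mfd n) D' (%v. r v i)" unfolding ck_on_euclidean[OF V(4)] by (rule V(6)[OF i])
 from ck_on_comp[OF N charted_euclidean Ff oO this]
 have c1:"ck_on k N ((%y. F (f y)) -` D') (%y. r (F (f y)) i)" .
 have eq:"F (f y'):D'&r (F (f y'))=cmap e (f y')" if "y':f -` W" for y'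
 using V(5)[of "cmap e (f y')"] that chart_inv_map[OF ec] by (auto simp: W_def)
 have "ck_on k N (f -` W) (%y. r (F (f y)) i)"
 by (rule ck_on_subset[OF N opn_vimage[OF _ oO] oW _ c1]) (use cF eq in auto)
 hence "ck_on k N (f -` W) (%y. cmap e (f y) i)"
 by (subst ck_on_cong[OF N oW, where g = "%y. r (F (f y)) i"]) (use eq in auto)
 moreover have "y:f -` W" using fy V(2) by (simp add: W_def)
 ultimately show "EX W. opn N W&y:W&ck_on k N W (%y. cmap e (f y) i)" using oW by blast
 qed
 qed
qed

lemma Pr_ck:"ck_map k M M Pr"
proof (rule lift_ck[OF Mc Pr_points])
 fix i assume i:"i<n"
 have "ck_on k M UNIV (%y. SUM j<n. Re (SUM a<n. P i a*(if Re (la a)=0 then 1 else 0) * Q a j) * F y j)"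
 by (intro ck_on_sum[OF Mc opn_UNIV] ck_on_mult[OF Mc opn_UNIV] ck_on_const[OF Mc opn_UNIV] Fi) auto
 thus "ck_on k M UNIV (%y. F (Pr y) i)"
 by (subst ck_on_cong[OF Mc opn_UNIV, where g = "%y. SUM j<n. Re (SUM a<n. P i a*(if Re (la a)=0 then 1 else 0) * Q a j) * F y j"])
 (use F_scaled[OF Pr(2) i] in auto)
qed

lemma Pr_image:"Pr`points M=A"
proof (intro equalityI subsetI)
 show "x:A" if "x:Pr`points M" for x using that Pr(1) by blast
 show "x:Pr`points M" if "x:A" for x using that Pr_id[OF that] AM by (intro image_eqI[of _ _ x]) auto
qed

lemma sliced_A:"sliced k M A" unfolding sliced_def
proof (intro conjI AM ballI)
 fix a assume a:"a:A"
 obtain p e where "slice_chart k M p (Pr`points M) e" "a:cdom e"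
 by (rule retract_slice[OF Ma k Pr_ck, of a]) (use a AM Pr_id Pr(1) in auto)
 thus "EX p c. slice_chart k M p A c&a:cdom c" unfolding Pr_image by blast
qed

theorem condition_1:"submanifold_with_phase k M \<Phi> A" unfolding submanifold_with_phase_def
proof (intro conjI ballI)
 show "finite (connected_components_of (subtopology X A))" by (rule sliced_components(1)[OF Ma k sliced_A Acpt])
 show "compactin X K" "EX p. embedded_submanifold k M p K" if "K:connected_components_of (subtopology X A)" for K
 using sliced_components(2)[OF Ma k sliced_A Acpt that] by auto
 have "ck_map k M (sub_mfd k M A) Pr" by (rule ck_map_into_sub[OF Mc Mc sliced_A Pr_ck Pr(1)])
 thus "EX P. ck_asymptotic_phase k M \<Phi> A P" unfolding ck_asymptotic_phase_def using Pr_id Pr_flow by blast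
qed

end

context spectral_embedding
begin

text \<open>In coordinates a torus acts on \<open>F(A)\<close> by rotations; by density of \<open>t \<mapsto> \<omega> t mod 1\<close> in the torus
  every rotation is a limit of time maps of the flow and so it preserves the compact set \<open>F(A)\<close>.\<close>

theorem condition_2:"torus_subgroup_flow k M \<Phi> A"
proof -
 obtain m and \<omega> :: "nat=>real" and c :: "nat=>nat=>int" where
 ind:"!!v::nat=>int. (SUM l<m. of_int (v l)*\<omega> l)=0==>ALL l<m. v l=0" and
 freq:"!!a. a<n==>Im (la a)/(2 * pi)=(SUM l<m. of_int (c a l)*\<omega> l)"
 by (rule integer_basis[where n = n and f = "%a. Im (la a)/(2 * pi)"]) (rule that)
 define \<phi> where "\<phi> a h=(SUM l<m. of_int (c a l) * h l)" for a and h :: "nat=>real"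
 have ex:"EX y. y:A&(ALL a<n. u a y=cis (2 * pi*\<phi> a h) * u a x)" if x:"x:A" for h x
 proof -
 have xM:"x:points M" using x AM by blast
 have "EX t g. ALL i<m. \<bar>t*\<omega> i - of_int (g i)-h i\<bar><1/real (Suc N)" for N
 proof -
 obtain t g where "!!i. i<m==>\<bar>t*\<omega> i - of_int (g i)-h i\<bar><1/real (Suc N)"
 by (rule torus_density[where m = m and \<omega> = \<omega> and \<epsilon> = "1/real (Suc N)" and \<alpha> = h, OF ind]) (assumption, simp, rule that)
 thus ?thesis by blast
 qed
 then obtain t :: "nat=>real" and g :: "nat=>nat=>int" where tg:"!!N i. i<m==>\<bar>t N*\<omega> i - of_int (g N i)-h i\<bar><1/real (Suc N)" by metis
 have conv:"(%N. t N*\<omega> i - of_int (g N i)) \<longlonglongrightarrow> h i" if i:"i<m" for i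
 proof -
 have "(%N. t N*\<omega> i - of_int (g N i)-h i) \<longlonglongrightarrow> 0"
 by (rule tendsto_rabs_zero_cancel, rule tendsto_sandwich[OF _ _ tendsto_const LIMSEQ_Suc[OF lim_1_over_n]])
 (use tg[OF i] in "auto simp: less_imp_le")
 thus ?thesis by (rule LIM_zero_cancel)
 qed
 obtain y where "y:A" "!!a. a<n==>u a y=cis (2 * pi*\<phi> a h) * u a x"
 proof (rule limit_in_A[of "%N. \<Phi> (t N) x" "%a. cis (2 * pi*\<phi> a h) * u a x"])
 show "\<Phi> (t N) x:points M" for N by (rule flow_points[OF xM])
 show "\<forall>\<^sub>F N in sequentially. \<Phi> (t N) x\<in>W" if "openin X W" "A<=W" for W by (intro always_eventually allI) (use flow_A[OF x] that(2) in blast)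
 show "(%N. u a (\<Phi> (t N) x)) \<longlonglongrightarrow> cis (2 * pi*\<phi> a h) * u a x" if a:"a<n" for a
 proof (cases "Re (la a)=0")
 case False
 thus ?thesis using noncenter_zero[OF x a] noncenter_zero[OF flow_A[OF x] a] by simp
 next
 case True
 have e:"cis (Im (la a) * t N)=cis (2 * pi*\<phi> a (%i. t N*\<omega> i - of_int (g N i)))" for N
 proof -
 have "\<phi> a (%i. t N*\<omega> i - of_int (g N i)) + of_int (SUM l<m. c a l * g N l)=(SUM l<m. of_int (c a l)*\<omega> l) * t N"
 by (simp add: \<phi>_def sum_distrib_left sum_distrib_right sum.distrib[symmetric] algebra_simps)
 also have "...=Im (la a) * t N/(2 * pi)" unfolding freq[OF a, symmetric] by simp
 finally have "Im (la a) * t N=2 * pi*(\<phi> a (%i. t N*\<omega> i - of_int (g N i)) + of_int (SUM l<m. c a l * g N l))"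
 by (simp add: field_simps)
 thus ?thesis by (simp only: cis_add_int)
 qed
 have "(%N. cis (2 * pi*\<phi> a (%i. t N*\<omega> i - of_int (g N i))) * u a x) \<longlonglongrightarrow> cis (2 * pi*\<phi> a h) * u a x"
 unfolding \<phi>_def by (intro tendsto_intros conv) auto
 thus ?thesis by (simp only: center[OF xM a True] e)
 qed
 qed (rule that)
 thus ?thesis by blast
 qed
 define \<Theta> where "\<Theta> h x=(SOME y. y:A&(ALL a<n. u a y=cis (2 * pi*\<phi> a h) * u a x))" for h x
 have \<Theta>: "\<Theta> h x:A" "!!a. a<n==>u a (\<Theta> h x)=cis (2 * pi*\<phi> a h) * u a x" if "x:A" for h x
 using someI_ex[OF ex[OF that]] unfolding \<Theta>_def by auto
 have sep:"x=y" if "x:A" "y:A" "!!a. a<n==>u a x=u a y" for x y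
 using u_separates that AM by blast
 have mod1:"cis (2 * pi*\<phi> a (mod1 h))=cis (2 * pi*\<phi> a h)" for a h
 proof -
 have "\<phi> a h=\<phi> a (mod1 h) + of_int (SUM l<m. c a l*\<lfloor>h l\<rfloor>)"
 by (simp add: \<phi>_def mod1_def frac_def sum.distrib[symmetric] algebra_simps)
 thus ?thesis by (simp only: cis_add_int)
 qed
 let ?N = "sub_mfd k M A"
 note Nc = charted_sub[OF sliced_A]
 have pN:"points ?N=A" by (rule points_sub[OF AM])
 let ?T = "torus_mfd m"
 note Tc = charted_torus[of m]
 note R = charted_prod[OF Tc Nc]
 have trig:"ck_on k (prod_mfd ?T ?N) UNIV (%p. g (\<phi> a (fst p)))"
 if g:"smooth_real g" "!!h. g (\<phi> a (mod1 h))=g (\<phi> a h)" for g a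
 proof -
 have oE:"openin (Euc m) (E m)" using openin_topspace .
 have "ck_real k m (E m) (%h. \<phi> a h)"
 unfolding \<phi>_def by (intro ck_real_sum ck_real_mult ck_real_const ck_real_coord oE)
 hence "ck_real k m (E m) (%h. g (\<phi> a h))" by (rule ck_real_smooth[OF oE g(1)])
 hence "ck_on k ?T UNIV (%h. g (\<phi> a h))" by (intro ck_on_torus) (simp add: g(2))
 from ck_on_fst[OF Tc Nc opn_UNIV this] show ?thesis by simp
 qed
 have cosck:"ck_on k (prod_mfd ?T ?N) UNIV (%p. cos (2 * pi*\<phi> a (fst p)))" for a
 by (rule trig[OF smooth_trig(1)]) (use mod1 in "auto simp: complex_eq_iff")
 have sinck:"ck_on k (prod_mfd ?T ?N) UNIV (%p. sin (2 * pi*\<phi> a (fst p)))" for a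
 by (rule trig[OF smooth_trig(2)]) (use mod1 in "auto simp: complex_eq_iff")
 have Fsnd:"ck_on k (prod_mfd ?T ?N) UNIV (%p. F (snd p) j)" if "j<n" for j
 proof -
 have "ck_on k ?N UNIV (%x. F x j)" by (rule ck_on_restrict(1)[OF Mc sliced_A opn_UNIV Fi[OF that]])
 from ck_on_snd[OF Tc Nc opn_UNIV this] show ?thesis by simp
 qed
 have "ck_map k (prod_mfd ?T ?N) ?N (%(h, x). \<Theta> h x)"
 proof (rule ck_map_into_sub[OF Mc R sliced_A lift_ck[OF R]])
 have pts:"snd p:A" if "p:points (prod_mfd ?T ?N)" for p
 proof -
 have "p:points ?T\<times>points ?N" using that by (simp add: prod_mfd_def)
 thus ?thesis by (simp only: pN mem_Times_iff)
 qed
 show "(case p of (h, x)=>\<Theta> h x):A" if "p:points (prod_mfd ?T ?N)" for p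
 using \<Theta>(1) pts[OF that] by (simp add: case_prod_beta)
 thus "(case p of (h, x)=>\<Theta> h x):points M" if "p:points (prod_mfd ?T ?N)" for p using that AM by blast
 fix i assume i:"i<n"
 have "ck_on k (prod_mfd ?T ?N) UNIV (%p. SUM j<n. (SUM a<n. Re (P i a * Q a j) * cos (2 * pi*\<phi> a (fst p))-Im (P i a * Q a j) * sin (2 * pi*\<phi> a (fst p))) * F (snd p) j)"
 by (intro ck_on_sum[OF R opn_UNIV] ck_on_mult[OF R opn_UNIV] ck_on_diff[OF R opn_UNIV] ck_on_const[OF R opn_UNIV] cosck sinck Fsnd) auto
 moreover have "F (case p of (h, x)=>\<Theta> h x) i =
 (SUM j<n. (SUM a<n. Re (P i a * Q a j) * cos (2 * pi*\<phi> a (fst p))-Im (P i a * Q a j) * sin (2 * pi*\<phi> a (fst p))) * F (snd p) j)"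
 if p:"p:points (prod_mfd ?T ?N)" for p
 proof -
 have "F (\<Theta> (fst p) (snd p)) i=(SUM j<n. Re (SUM a<n. P i a * cis (2 * pi*\<phi> a (fst p)) * Q a j) * F (snd p) j)"
 by (rule F_scaled[OF \<Theta>(2)[OF pts[OF p]] i])
 also have "...=(SUM j<n. (SUM a<n. Re (P i a * Q a j) * cos (2 * pi*\<phi> a (fst p))-Im (P i a * Q a j) * sin (2 * pi*\<phi> a (fst p))) * F (snd p) j)"
 proof -
 have "Re (P i a * cis y * Q a j)=Re (P i a * Q a j) * cos y-Im (P i a * Q a j) * sin y" for a j y
 by (simp add: algebra_simps)
 thus ?thesis by (simp only: Re_sum)
 qed
 finally show ?thesis by (simp add: case_prod_beta)
 qed
 ultimately show "ck_on k (prod_mfd ?T ?N) UNIV (%p. F (case p of (h, x)=>\<Theta> h x) i)"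
 by (subst ck_on_cong[OF R opn_UNIV]) auto
 qed
 moreover have "\<Theta> (%_. 0) a=a" if "a:A" for a
 by (rule sep[OF \<Theta>(1)[OF that] that]) (simp add: \<Theta>(2)[OF that] \<phi>_def)
 moreover have "\<Theta> (mod1 (%i. g i+h i)) a=\<Theta> g (\<Theta> h a)" if a:"a:A" for g h a
 proof (rule sep[OF \<Theta>(1)[OF a] \<Theta>(1)[OF \<Theta>(1)[OF a]]])
 fix b assume b:"b<n"
 have "\<phi> b (%i. g i+h i)=\<phi> b g+\<phi> b h" by (simp add: \<phi>_def distrib_left sum.distrib)
 hence "cis (2 * pi*\<phi> b (mod1 (%i. g i+h i)))=cis (2 * pi*\<phi> b g) * cis (2 * pi*\<phi> b h)"
 unfolding mod1 cis_mult by (simp add: distrib_left)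
 thus "u b (\<Theta> (mod1 (%i. g i+h i)) a)=u b (\<Theta> g (\<Theta> h a))"
 by (simp add: \<Theta>(2)[OF a b] \<Theta>(2)[OF \<Theta>(1)[OF a] b] mult.assoc)
 qed
 ultimately have act:"ck_torus_action k m ?N \<Theta>" unfolding ck_torus_action_def pN by blast
 have "one_parameter_subgroup m \<Theta> \<Phi> A" unfolding one_parameter_subgroup_def
 proof (intro bexI[of _ "%i. if i<m then \<omega> i else 0"] allI ballI)
 fix t x assume x:"x:A"
 let ?w = "%i. (if i<m then \<omega> i else 0) * t"
 show "\<Phi> t x=\<Theta> (mod1 ?w) x"
 proof (rule sep[OF flow_A[OF x] \<Theta>(1)[OF x]])
 fix a assume a:"a<n"
 show "u a (\<Phi> t x)=u a (\<Theta> (mod1 ?w) x)"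
 proof (cases "Re (la a)=0")
 case False thus ?thesis using noncenter_zero[OF flow_A[OF x] a] noncenter_zero[OF \<Theta>(1)[OF x] a] by simp
 next
 case True
 have "\<phi> a ?w=(SUM l<m. of_int (c a l)*\<omega> l) * t" unfolding \<phi>_def sum_distrib_right by (intro sum.cong) auto
 also have "...=Im (la a) * t/(2 * pi)" unfolding freq[OF a, symmetric] by simp
 finally have "2 * pi*\<phi> a ?w=Im (la a) * t" by simp
 thus ?thesis using center[OF _ a True, of x t] x AM \<Theta>(2)[OF x a] by (auto simp: mod1)
 qed
 qed
 qed (auto simp: E_iff)
 thus ?thesis using act unfolding torus_subgroup_flow_def by blast
qed

definition stable :: "nat=>'a=>complex" where "stable a x=(if Re (la a)<0 then u a x else 0)"

text \<open>The Jordan matrix on the stable coordinates, completed by \<open>-1\<close> on the diagonal so that all eigenvalues have negative real part.\<close>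

definition K :: "nat=>nat=>complex" where
 "K a b=(if Re (la a)<0 then jform la s a b else if a=b then-1 else 0)"

definition G :: "'a=>nat=>real" where
 "G x i=(if i<n then Re (stable i x) else if i<n+n then Im (stable (i-n) x) else 0)"

text \<open>The real form of \<open>K\<close>, acting on pairs of real and imaginary parts.\<close>

definition B :: "real mat" where
 "B=Matrix.mat (n+n) (n+n) (%(i, j). if i<n then (if j<n then Re (K i j) else-Im (K i (j-n)))
 else (if j<n then Im (K (i-n) j) else Re (K (i-n) (j-n))))"

lemma B:"B:carrier_mat (n+n) (n+n)" by (simp add: B_def)

lemma sum_double:"(SUM j<n+n. f j)=(SUM j<n. f j)+(SUM j<n. f (n+j))" for f :: "nat=>'b::comm_monoid_add"
proof -
 have "(SUM j<n+m. f j)=(SUM j<n. f j)+(SUM j<m. f (n+j))" for m by (induction m) (simp_all add: add.assoc)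
 thus ?thesis .
qed

lemma G_E:"G x:E (n+n)" by (simp add: G_def E_iff)

lemma stable_ode:
 assumes x:"x:points M" and a:"a<n"
 shows "((%t. stable a (\<Phi> t x)) has_vector_derivative (SUM b<n. K a b * stable b (\<Phi> t x))) (at t)"
proof (cases "Re (la a)<0")
 case True
 have "jform la s a b * u b y=K a b * stable b y" for b y
 by (cases "s a=0") (use True s[of a] in "auto simp: K_def stable_def jform_def")
 thus ?thesis using ode[OF x a, of t] True unfolding u_def[symmetric] by (simp add: stable_def)
next
 case False
 have "(SUM b<n. K a b * stable b (\<Phi> t x))=0" by (rule sum.neutral) (use False in "auto simp: K_def stable_def")
 thus ?thesis using False by (simp add: stable_def)
qed

lemma G_flow:
 assumes x:"x:points M" shows "G (\<Phi> t x)=lin_app (n+n) (n+n) (mexp B t) (G x)"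
proof -
 have ode:"((%t. G (\<Phi> t x) i) has_real_derivative (SUM j<n+n. B$$(i, j) * G (\<Phi> t x) j)) (at t)" if i:"i<n+n" for i t
 proof (cases "i<n")
 case True
 have "((%t. Re (stable i (\<Phi> t x))) has_real_derivative Re (SUM b<n. K i b * stable b (\<Phi> t x))) (at t)"
 using bounded_linear.has_vector_derivative[OF bounded_linear_Re stable_ode[OF x True, of t]]
 by (simp only: has_real_derivative_iff_has_vector_derivative)
 moreover have "(SUM j<n+n. B$$(i, j) * G (\<Phi> t x) j)=Re (SUM b<n. K i b * stable b (\<Phi> t x))"
 proof -
 have "(SUM j<n. B$$(i, j) * G (\<Phi> t x) j)=(SUM b<n. Re (K i b) * Re (stable b (\<Phi> t x)))"
 by (intro sum.cong) (use True in "auto simp: B_def G_def")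
 moreover have "(SUM j<n. B$$(i, n+j) * G (\<Phi> t x) (n+j))=(SUM b<n.-(Im (K i b) * Im (stable b (\<Phi> t x))))"
 by (intro sum.cong) (use True in "auto simp: B_def G_def")
 moreover have "Re (SUM b<n. K i b * stable b (\<Phi> t x))=(SUM b<n. Re (K i b) * Re (stable b (\<Phi> t x)))-(SUM b<n. Im (K i b) * Im (stable b (\<Phi> t x)))"
 by (simp add: sum_subtractf)
 ultimately show ?thesis unfolding sum_double by (simp only: sum_negf)
 qed
 ultimately show ?thesis using True by (simp add: G_def)
 next
 case False
 hence i':"i-n<n" using i by simp
 have "((%t. Im (stable (i-n) (\<Phi> t x))) has_real_derivative Im (SUM b<n. K (i-n) b * stable b (\<Phi> t x))) (at t)"
 using bounded_linear.has_vector_derivative[OF bounded_linear_Im stable_ode[OF x i', of t]]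
 by (simp only: has_real_derivative_iff_has_vector_derivative)
 moreover have "(SUM j<n+n. B$$(i, j) * G (\<Phi> t x) j)=Im (SUM b<n. K (i-n) b * stable b (\<Phi> t x))"
 proof -
 have "(SUM j<n. B$$(i, j) * G (\<Phi> t x) j)=(SUM b<n. Im (K (i-n) b) * Re (stable b (\<Phi> t x)))"
 by (intro sum.cong) (use False i in "auto simp: B_def G_def")
 moreover have "(SUM j<n. B$$(i, n+j) * G (\<Phi> t x) (n+j))=(SUM b<n. Re (K (i-n) b) * Im (stable b (\<Phi> t x)))"
 by (intro sum.cong) (use False i in "auto simp: B_def G_def")
 moreover have "Im (SUM b<n. K (i-n) b * stable b (\<Phi> t x))=(SUM b<n. Re (K (i-n) b) * Im (stable b (\<Phi> t x)))+(SUM b<n. Im (K (i-n) b) * Re (stable b (\<Phi> t x)))"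
 by (simp add: sum.distrib)
 ultimately show ?thesis unfolding sum_double by simp
 qed
 ultimately show ?thesis using False i by (simp add: G_def)
 qed
 have "G (\<Phi> t x) i=(SUM j<n+n. mexp B t i j * G (\<Phi> 0 x) j)" if "i<n+n" for i
 by (rule linear_ode_unique[OF B, where y = "%t. G (\<Phi> t x)"]) (use ode that in auto)
 thus ?thesis by (intro E_eqI[OF G_E lin_app_E]) (simp add: lin_app_def flow_0[OF x])
qed

text \<open>In an upper triangular system the last nonzero coordinate of an eigenvector shows its eigenvalue on the diagonal.\<close>

lemma triangular_eigenvalue:
 assumes p:"!!a. a<n==>(SUM b<n. K a b * p b)=z * p a" and a:"a<n" "p a~=0"
 shows "Re z<0"
proof -
 define m where "m=Max {a. a<n&p a~=0}"
 have fin:"finite {a. a<n&p a~=0}" by simp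
 have "m:{a. a<n&p a~=0}" unfolding m_def by (rule Max_in[OF fin]) (use a in auto)
 hence m:"m<n" "p m~=0" by auto
 have above:"p b=0" if "m<b" "b<n" for b using Max_ge[OF fin, of b] that unfolding m_def[symmetric] by auto
 have "(SUM b<n. K m b * p b)=(SUM b<n. if b=m then K m m * p m else 0)"
 proof (intro sum.cong refl)
 fix b assume b:"b:{..<n}"
 consider "b<m" | "b=m" | "m<b" by linarith
 thus "K m b * p b=(if b=m then K m m * p m else 0)" using above[of b] b by cases (auto simp: K_def jform_def)
 qed
 also have "...=K m m * p m" using m(1) by simp
 finally have "z * p m=K m m * p m" unfolding p[OF m(1)] .
 hence "z=K m m" using m(2) by simp
 thus ?thesis by (simp add: K_def jform_def)
qed

text \<open>The vectors \<open>w' + i w''\<close> and \<open>w' - i w''\<close> are eigenvectors of \<open>K\<close> and of its conjugate, unless they vanish.\<close>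

lemma B_eigenvalue:
 assumes "eigenvalue (map_mat complex_of_real B) z" shows "Re z<0"
proof -
 let ?B = "map_mat complex_of_real B"
 have cB:"?B:carrier_mat (n+n) (n+n)" using B by simp
 obtain v where v:"v:carrier_vec (n+n)" "v~=0\<^sub>v (n+n)" "?B *\<^sub>v v=z \<cdot>\<^sub>v v"
 using assms cB unfolding eigenvalue_def eigenvector_def by auto
 define w where "w i=vec_index v i" for i
 have row:"(SUM j<n+n. of_real (B$$(i, j)) * w j)=z * w i" if i:"i<n+n" for i
 proof -
 have "vec_index (?B *\<^sub>v v) i=(SUM j<n+n. of_real (B$$(i, j)) * w j)"
 using i v(1) B by (simp add: scalar_prod_def w_def lessThan_atLeast0)
 thus ?thesis unfolding v(3) using i v(1) by (simp add: w_def)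
 qed
 have top:"(SUM b<n. of_real (Re (K a b)) * w b)-(SUM b<n. of_real (Im (K a b)) * w (n+b))=z * w a" if "a<n" for a
 using row[of a] that unfolding sum_double by (simp add: B_def sum_negf)
 have bot:"(SUM b<n. of_real (Im (K a b)) * w b)+(SUM b<n. of_real (Re (K a b)) * w (n+b))=z * w (n+a)" if "a<n" for a
 using row[of "n+a"] that unfolding sum_double by (simp add: B_def)
 have kc:"K a b = of_real (Re (K a b))+\<i> * of_real (Im (K a b))" "cnj (K a b) = of_real (Re (K a b))-\<i> * of_real (Im (K a b))" for a b
 by (simp_all add: complex_eq_iff)
 have 1:"(SUM b<n. K a b*(w b+\<i> * w (n+b)))=z*(w a+\<i> * w (n+a))" if a:"a<n" for a
 proof -
 have "K a b*(w b+\<i> * w (n+b))=(of_real (Re (K a b)) * w b - of_real (Im (K a b)) * w (n+b))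
 + \<i>*(of_real (Im (K a b)) * w b + of_real (Re (K a b)) * w (n+b))" for b
 by (subst kc(1)) (simp add: algebra_simps)
 hence "(SUM b<n. K a b*(w b+\<i> * w (n+b))) =
 ((SUM b<n. of_real (Re (K a b)) * w b)-(SUM b<n. of_real (Im (K a b)) * w (n+b))) +
 \<i>*((SUM b<n. of_real (Im (K a b)) * w b)+(SUM b<n. of_real (Re (K a b)) * w (n+b)))"
 by (simp only: sum.distrib sum_subtractf sum_distrib_left[symmetric])
 thus ?thesis unfolding top[OF a] bot[OF a] by (simp add: algebra_simps)
 qed
 have 2:"(SUM b<n. K a b * cnj (w b-\<i> * w (n+b)))=cnj z * cnj (w a-\<i> * w (n+a))" if a:"a<n" for a
 proof -
 have "cnj (K a b)*(w b-\<i> * w (n+b))=(of_real (Re (K a b)) * w b - of_real (Im (K a b)) * w (n+b))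
 - \<i>*(of_real (Im (K a b)) * w b + of_real (Re (K a b)) * w (n+b))" for b
 by (subst kc(2)) (simp add: algebra_simps)
 hence "(SUM b<n. cnj (K a b)*(w b-\<i> * w (n+b))) =
 ((SUM b<n. of_real (Re (K a b)) * w b)-(SUM b<n. of_real (Im (K a b)) * w (n+b))) -
 \<i>*((SUM b<n. of_real (Im (K a b)) * w b)+(SUM b<n. of_real (Re (K a b)) * w (n+b)))"
 by (simp only: sum.distrib sum_subtractf sum_distrib_left[symmetric])
 hence "(SUM b<n. cnj (K a b)*(w b-\<i> * w (n+b)))=z*(w a-\<i> * w (n+a))"
 unfolding top[OF a] bot[OF a] by (simp add: algebra_simps)
 hence "cnj (SUM b<n. cnj (K a b)*(w b-\<i> * w (n+b)))=cnj (z*(w a-\<i> * w (n+a)))" by simp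
 thus ?thesis by (simp only: cnj_sum complex_cnj_mult complex_cnj_cnj)
 qed
 obtain i where i:"i<n+n" "w i~=0"
 proof -
 have "EX i<n+n. w i~=0"
 proof (rule ccontr)
 assume "\<not> ?thesis"
 hence "v=0\<^sub>v (n+n)" using v(1) by (intro eq_vecI) (auto simp: w_def)
 thus False using v(2) by blast
 qed
 thus ?thesis using that by blast
 qed
 define a where "a=(if i<n then i else i-n)"
 have a:"a<n" using i(1) by (auto simp: a_def)
 have "w a~=0\<or>w (n+a)~=0" using i by (auto simp: a_def)
 hence "w a+\<i> * w (n+a)~=0\<or>w a-\<i> * w (n+a)~=0"
 proof -
 have "w a=((w a+\<i> * w (n+a))+(w a-\<i> * w (n+a)))/2" by simp
 moreover have "\<i> * w (n+a)=((w a+\<i> * w (n+a))-(w a-\<i> * w (n+a)))/2" by simp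
 ultimately show ?thesis using \<open>w a ~= 0 \<or> w (n + a) ~= 0\<close> by (metis add_0 diff_0_right div_0 mult_eq_0_iff complex_i_not_zero)
 qed
 thus ?thesis
 proof
 assume "w a+\<i> * w (n+a)~=0"
 thus ?thesis using triangular_eigenvalue[of "%b. w b+\<i> * w (n+b)" z a] 1 a by blast
 next
 assume "w a-\<i> * w (n+a)~=0"
 hence "cnj (w a-\<i> * w (n+a))~=0" by (simp only: complex_cnj_zero_iff) simp
 hence "Re (cnj z)<0" using triangular_eigenvalue[of "%b. cnj (w b-\<i> * w (n+b))" "cnj z" a] 2 a by blast
 thus ?thesis by simp
 qed
qed

lemma u_ck: assumes "a<n" shows "ck_on k M UNIV (%x. Re (u a x))" "ck_on k M UNIV (%x. Im (u a x))"
proof -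
 have "Re (u a x)=(SUM i<n. Re (Q a i) * F x i)" "Im (u a x)=(SUM i<n. Im (Q a i) * F x i)" for x
 by (simp_all add: u_def)
 thus "ck_on k M UNIV (%x. Re (u a x))" "ck_on k M UNIV (%x. Im (u a x))"
 by (simp_all only:) (intro ck_on_sum[OF Mc opn_UNIV] ck_on_mult[OF Mc opn_UNIV] ck_on_const[OF Mc opn_UNIV] Fi, simp)+
qed

lemma G_ck: assumes "i<n+n" shows "ck_on k M UNIV (%x. G x i)"
proof -
 have z:"ck_on k M UNIV (%_. 0)" by (rule ck_on_const[OF Mc opn_UNIV])
 show ?thesis
 proof (cases "i<n")
 case True thus ?thesis using u_ck(1)[OF True] z by (cases "Re (la i)<0") (simp_all add: G_def stable_def)
 next
 case False
 hence "i-n<n" using assms by simp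
 have "G x i=(if Re (la (i-n))<0 then Im (u (i-n) x) else 0)" for x using False assms by (simp add: G_def stable_def)
 thus ?thesis using u_ck(2)[OF \<open>i - n < n\<close>] z by (cases "Re (la (i-n))<0") simp_all
 qed
qed

lemma G_zero:"x:A==>G x i=0" using stable_zero_on_A by (simp add: G_def stable_def)

lemma G_zero_in_A:
 assumes x:"x:points M" and z:"!!i. i<n+n==>G x i=0" shows "x:A"
proof (rule in_A[OF x])
 fix a assume a:"a<n" "Re (la a)<0"
 have "G x a=Re (u a x)" "G x (n+a)=Im (u a x)" using a by (simp_all add: G_def stable_def)
 thus "u a x=0" using z[of a] z[of "n+a"] a(1) by (simp add: complex_eq_iff)
qed

lemma proper_F:"proper X (Euc n) F"
proof -
 have dec:"((%t. mexp B t i j) \<longlongrightarrow> 0) at_top" if "i<n+n" "j<n+n" for i j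
 by (rule mexp_decay[OF B B_eigenvalue that])
 have Gc:"continuous_map X (Euc (n+n)) G"
 using ck_map_cont[of k M "euclidean_mfd (n+n)" G] ck_map_euclidean[OF Mc, of k "n+n" G] G_ck G_E by auto
 define L where "L=(SUM a<n. SUM j<n. cmod (Q a j))"
 have ub:"cmod (u a x)<=L*(SUM j<n. \<bar>F x j\<bar>)" if a:"a<n" for a x
 proof -
 have "cmod (u a x)<=(SUM j<n. cmod (Q a j * of_real (F x j)))" unfolding u_def by (rule norm_sum)
 also have "...<=(SUM j<n. L*\<bar>F x j\<bar>)"
 proof (rule sum_mono)
 fix j assume j:"j:{..<n}"
 have "cmod (Q a j)<=(SUM j<n. cmod (Q a j))" by (rule member_le_sum[OF j]) auto
 also have "...<=L" unfolding L_def by (rule member_le_sum[of a "{..<n}" "%a. SUM j<n. cmod (Q a j)"]) (use a in "auto intro: sum_nonneg")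
 finally show "cmod (Q a j * of_real (F x j))<=L*\<bar>F x j\<bar>" by (simp add: norm_mult mult_right_mono)
 qed
 finally show ?thesis by (simp add: sum_distrib_left)
 qed
 have L0:"0<=L*(SUM j<n. \<bar>F x j\<bar>)" for x unfolding L_def by (intro mult_nonneg_nonneg sum_nonneg) auto
 show ?thesis
 proof (rule proper_of_sublevels[OF ck_map_cont[OF Fck, simplified] sublevel_compact[OF B dec Gc G_flow G_zero_in_A], of L])
 fix x i assume "i<n+n"
 thus "\<bar>G x i\<bar><=L*(SUM j<n. \<bar>F x j\<bar>)"
 using order_trans[OF abs_Re_le_cmod ub[of i x]] order_trans[OF abs_Im_le_cmod ub[of "i-n" x]] L0[of x]
 by (auto simp: G_def stable_def)
 qed
qed

text \<open>Modulo the phase, \<open>F\<close> is a linear function of \<open>G\<close>; so a vector killed by \<open>dG\<close> is fixed by the derivative of the phase and hence tangent to \<open>A\<close>.\<close>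

lemma kernel_G:
 assumes e:"slice_chart k M p A e" and a:"a:cdom e" "a:A" and w:"w:E (cdim e)"
 shows "(ALL i<n+n. dch e a (%y. G y i) w=0)\<longleftrightarrow>w:E p"
proof
 note ea = slice_adm[OF e] note ec = adm_chart[OF ea]
 assume wp:"w:E p"
 show "ALL i<n+n. dch e a (%y. G y i) w=0"
 proof (intro allI impI)
 fix i assume "i<n+n"
 have sc:"sub_chart e A p:atlas_of (sub_mfd k M A)" using e by (auto simp: atlas_sub)
 have "dch e a (%y. G y i) w=dch (sub_chart e A p) a (%y. G y i) w" by (rule dch_sub_chart[OF e a wp, symmetric])
 also have "...=dch (sub_chart e A p) a (%_. 0) w"
 by (rule dch_cong[OF charted_chart[OF charted_sub[OF sliced_A] sc] _ opn_UNIV]) (use a G_zero points_sub[OF AM] in auto)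
 also have "...=0" by (rule dch_zero_fun)
 finally show "dch e a (%y. G y i) w=0" .
 qed
next
 note ea = slice_adm[OF e] note ec = adm_chart[OF ea]
 assume G0:"ALL i<n+n. dch e a (%y. G y i) w=0"
 have aM:"a:points M" using a(2) AM by blast
 have Pra:"Pr a=a" by (rule Pr_id[OF a(2)])
 define w' where "w'=(%i. if i<cdim e then dch e a (%y. cmap e (Pr y) i) w else 0)"
 have PrF:"ck_on k M UNIV (%y. F (Pr y) j)" if "j<n" for j
 using ck_on_comp[OF Mc Mc Pr_ck opn_UNIV Fi[OF that]] by simp
 have dF:"dch e a (%y. F y j) w=dch e a (%y. F y j) w'" if j:"j<n" for j
 proof -
 define L where "L i=(if i<n then Re (P j i) else if i<n+n then-Im (P j (i-n)) else 1)" for i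
 define H where "H y i=(if i<n+n then G y i else F (Pr y) j)" for y i
 have Hck:"ck_on k M UNIV (%y. H y i)" if "i<Suc (n+n)" for i
 using G_ck[of i] PrF[OF j] by (cases "i<n+n") (simp_all add: H_def)
 have eq:"F y j=(SUM i<Suc (n+n). L i * H y i)" if y:"y:points M" for y
 proof -
 have us:"u c y=u c (Pr y)+stable c y" if c:"c<n" for c using Pr(2)[OF y c] unstable_and_center(2)[OF y c]
 by (cases "Re (la c)" "0::real" rule: linorder_cases) (auto simp: stable_def)
 have "complex_of_real (F y j)=(SUM c<n. P j c * u c (Pr y)+P j c * stable c y)"
 unfolding F_u[OF j] by (intro sum.cong) (auto simp: us distrib_left)
 also have "... = of_real (F (Pr y) j)+(SUM c<n. P j c * stable c y)" by (simp add: sum.distrib F_u[OF j])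
 finally have "Re (of_real (F y j))=Re (of_real (F (Pr y) j)+(SUM c<n. P j c * stable c y))" by (rule arg_cong)
 hence "F y j=F (Pr y) j+(SUM c<n. Re (P j c) * Re (stable c y)-Im (P j c) * Im (stable c y))" by simp
 moreover have "(SUM i<Suc (n+n). L i * H y i) =
 (SUM c<n. Re (P j c) * Re (stable c y))+(SUM c<n.-Im (P j c) * Im (stable c y))+F (Pr y) j"
 unfolding sum.lessThan_Suc sum_double by (simp add: L_def H_def G_def)
 ultimately show ?thesis by (simp add: sum_subtractf sum_negf)
 qed
 have "dch e a (%y. F y j) w=dch e a (%y. SUM i<Suc (n+n). L i * H y i) w"
 by (rule dch_cong[OF ec a(1) opn_UNIV]) (use eq in auto)
 also have "...=(SUM i<Suc (n+n). L i * dch e a (%y. H y i) w)" by (rule dch_sum[OF Mc ea k a(1) Hck])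
 also have "...=dch e a (%y. F (Pr y) j) w" using G0 by (simp add: L_def H_def)
 also have "...=dch e (Pr a) (%y. F y j) w'"
 unfolding w'_def by (rule dch_comp[OF Mc Mc ea ea k Pr_ck a(1) _ opn_UNIV _ Fi[OF j]]) (use Pra a in auto)
 finally show ?thesis unfolding Pra .
 qed
 have "imm_at n e a F" using Fimm[OF aM] unfolding immersion_iff[OF Ma k ea a(1) Fck] .
 moreover have "(%i. w i-w' i):E (cdim e)" using w by (auto simp: E_iff w'_def)
 moreover have "dch e a (%y. F y j) (%i. w i-w' i)=0" if "j<n" for j unfolding dch_diff using dF[OF that] by simp
 ultimately have "(%i. w i-w' i)=(%_. 0)" unfolding imm_at_def by blast
 hence ww:"w i=w' i" for i by (metis eq_iff_diff_eq_0)
 have "w' i=0" if i:"p<=i" for i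
 proof (cases "i<cdim e")
 case True
 have o:"opn M (Pr -` cdom e)" by (rule opn_vimage[OF ck_map_cont[OF Pr_ck] adm_opn[OF ea]])
 have z:"cmap e (Pr y) i=0" if "y:Pr -` cdom e" "y:points M" for y
 using slice_coord_zero[OF e, of "Pr y"] Pr(1)[OF that(2)] that(1) i by (auto simp: E_iff)
 have "dch e a (%y. cmap e (Pr y) i) w=dch e a (%_. 0) w"
 by (rule dch_cong[OF ec a(1) o]) (use z Pra a in auto)
 thus ?thesis by (simp add: w'_def dch_zero_fun)
 qed (simp add: w'_def)
 thus "w:E p" using ww by (simp add: E_iff)
qed

theorem condition_3:"transverse_linearization k M \<Phi> A" unfolding transverse_linearization_def
proof (rule exI[of _ "n+n"], rule bexI[OF _ B], rule exI[of _ "points M"], rule exI[of _ G], intro conjI ballI allI impI)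
 show "Re z<0" if "eigenvalue (map_mat complex_of_real B) z" for z using B_eigenvalue[OF that] .
 show "openin X (points M)" "A<=points M" using AM by auto
 have oM:"openin X (points M)" by simp
 note OM = charted_open_mfd[OF Mc oM]
 show "ck_map k (open_mfd M (points M)) (euclidean_mfd (n+n)) G" unfolding ck_map_euclidean[OF OM]
 proof (intro conjI ballI allI impI G_E)
 fix i assume i:"i<n+n"
 have "ck_on k M (points M) (%x. G x i)" by (rule ck_on_subset[OF Mc opn_UNIV opn_openin[OF oM] subset_UNIV G_ck[OF i]])
 hence "ck_on k (open_mfd M (points M)) (points M) (%x. G x i)"
 using ck_on_open_mfd[OF Mc oM opn_openin[OF oM] order.refl] by blast
 moreover have p:"points (open_mfd M (points M))=points M" by (simp add: open_mfd_def)
 moreover have "opn (open_mfd M (points M)) (points M)" using openin_topspace[of "space_of (open_mfd M (points M))"] unfolding p by simp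
 ultimately show "ck_on k (open_mfd M (points M)) UNIV (%x. G x i)"
 by (intro ck_on_local[OF OM opn_UNIV]) auto
 qed
 show "G (\<Phi> t x)=mat_app (mat_exp (t \<cdot>\<^sub>m B)) (G x)" if "x:points M" for x t
 unfolding mat_app_exp[OF B] by (rule G_flow[OF that])
 fix a assume a:"a:A"
 obtain p e where e:"slice_chart k M p A e" "a:cdom e" using sliced_A a unfolding sliced_def by blast
 note ea = slice_adm[OF e(1)]
 have aM:"a:points M" using a AM by blast
 have pd:"p<=cdim e" using e(1) by (simp add: slice_chart_def)
 have tm:"tangent_map M (euclidean_mfd (n+n)) G a (tvec M e a w)=zero_tangent\<longleftrightarrow>w:E p" if w:"w:E (cdim e)" for w
 proof -
 have "tangent_map M (euclidean_mfd (n+n)) G a (tvec M e a w)=zero_tangent\<longleftrightarrow>(ALL i<n+n. dch e a (%y. G y i) w=0)"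
 proof -
 have t:"tangent_map M (euclidean_mfd (n+n)) G a (tvec M e a w) =
 (%c. if c=eucl_chart (n+n) then (%i. if i<n+n then dch e a (%y. G y i) w else 0) else (%_. 0))"
 by (rule tangent_map_euclidean[OF Ma k ea e(2) opn_UNIV UNIV_I G_ck G_E])
 show ?thesis unfolding t zero_tangent_def fun_eq_iff by auto
 qed
 thus ?thesis using kernel_G[OF e a w] by simp
 qed
 show "{v:tangent_space M a. tangent_map M (euclidean_mfd (n+n)) G a v=zero_tangent} =
 tangent_map (sub_mfd k M A) M (%x. x) a`tangent_space (sub_mfd k M A) a"
 unfolding tangent_inclusion[OF Ma k sliced_A e a] tangent_space_eq[OF Ma k ea e(2)] using tm E_mono[OF pd] by blast
qed

end

text \<open>The Jordan form of the matrix of a linearizing embedding provides its spectral coordinates.\<close>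

lemma (in attracting_flow) spectral_coordinates:
 assumes F:"linearizing_embedding k M \<Phi> n F"
 obtains P Q la s where "spectral_embedding k M \<Phi> A n F P Q la s"
proof -
 have emb:"ck_map k M (euclidean_mfd n) F" "embedding_map X (Euc n) F"
 "!!x. x:points M==>inj_on (tangent_map M (euclidean_mfd n) F x) (tangent_space M x)"
 using F unfolding linearizing_embedding_def ck_embedding_def by auto
 obtain C where C:"C:carrier_mat n n" "!!x t. x:points M==>F (\<Phi> t x)=mat_app (mat_exp (t \<cdot>\<^sub>m C)) (F x)"
 using F unfolding linearizing_embedding_def linearizing_def by blast
 have fl:"F (\<Phi> t x)=lin_app n n (mexp C t) (F x)" if "x:points M" for x t
 using C(2)[OF that] by (simp add: mat_app_exp[OF C(1)])
 show ?thesis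
 proof (rule jordan_exponential[OF C(1)])
 fix P Q :: "nat=>nat=>complex" and la s :: "nat=>complex"
 assume PQ:"!!i j. i<n==>j<n==>(SUM a<n. P i a * Q a j)=(if i=j then 1 else 0)"
 and QP:"!!a b. a<n==>b<n==>(SUM i<n. Q a i * P i b)=(if a=b then 1 else 0)"
 and s:"!!a. s a~=0==>la a=la (Suc a)"
 and sums:"!!i j t. i<n==>j<n==>(%m. complex_of_real ((C ^\<^sub>m m)$$(i, j)/fact m * t^m)) sums (SUM a<n. SUM b<n. P i a * jexp la s t a b * Q b j)"
 and J:"!!a j. a<n==>j<n==>(SUM i<n. Q a i * complex_of_real (C$$(i, j)))=(SUM b<n. jform la s a b * Q b j)"
 have me:"complex_of_real (mexp C t i j)=(SUM a<n. SUM b<n. P i a * jexp la s t a b * Q b j)" if ij:"i<n" "j<n" for i j t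
 proof -
 have "(%m. (C ^\<^sub>m m)$$(i, j)/fact m * t^m) sums mexp C t i j"
 unfolding mexp_def using mexp_summable[OF C(1) ij] by (rule summable_sums)
 hence "(%m. complex_of_real ((C ^\<^sub>m m)$$(i, j)/fact m * t^m)) sums complex_of_real (mexp C t i j)"
 by (rule sums_of_real)
 thus ?thesis using sums[OF ij] by (rule sums_unique2)
 qed
 have swap:"(SUM j<n. (SUM b<n. c b * R b j) * f j)=(SUM b<n. c b*(SUM j<n. R b j * f j))" for c f :: "nat=>complex" and R
 unfolding sum_distrib_left sum_distrib_right by (subst sum.swap) (simp add: mult.assoc)
 have "spectral_embedding k M \<Phi> A n F P Q la s"
 proof (unfold_locales)
 fix x t a assume x:"x:points M" and a:"a<n"
 have "complex_of_real (F (\<Phi> t x) i)=(SUM c<n. P i c*(SUM b<n. jexp la s t c b*(SUM j<n. Q b j * of_real (F x j))))" if i:"i<n" for i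
 proof -
 have "complex_of_real (F (\<Phi> t x) i)=(SUM j<n. complex_of_real (mexp C t i j) * of_real (F x j))"
 unfolding fl[OF x] using i by (simp add: lin_app_def)
 also have "...=(SUM j<n. (SUM b<n. (SUM c<n. P i c * jexp la s t c b) * Q b j) * of_real (F x j))"
 proof (intro sum.cong refl arg_cong2[where f = "(*)"])
 fix j assume "j:{..<n}"
 thus "complex_of_real (mexp C t i j)=(SUM b<n. (SUM c<n. P i c * jexp la s t c b) * Q b j)"
 unfolding sum_distrib_right by (subst sum.swap) (simp add: me[OF i])
 qed
 also have "...=(SUM b<n. (SUM c<n. P i c * jexp la s t c b)*(SUM j<n. Q b j * of_real (F x j)))" by (rule swap)
 also have "...=(SUM c<n. P i c*(SUM b<n. jexp la s t c b*(SUM j<n. Q b j * of_real (F x j))))"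
 by (rule swap)
 finally show ?thesis .
 qed
 hence "(SUM i<n. Q a i * complex_of_real (F (\<Phi> t x) i)) =
 (SUM i<n. Q a i*(SUM c<n. P i c*(SUM b<n. jexp la s t c b*(SUM j<n. Q b j * of_real (F x j)))))"
 by (intro sum.cong) auto
 also have "...=(SUM b<n. jexp la s t a b*(SUM j<n. Q b j * of_real (F x j)))" by (rule inverse_apply[OF QP a])
 finally show "(SUM i<n. Q a i * complex_of_real (F (\<Phi> t x) i))=(SUM b<n. jexp la s t a b*(SUM j<n. Q b j * of_real (F x j)))" .
 have dF:"((%t. F (\<Phi> t x) i) has_real_derivative (SUM j<n. C$$(i, j) * F (\<Phi> t x) j)) (at t)" if "i<n" for i
 unfolding fl[OF x] by (rule lin_app_deriv[OF C(1) that])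
 have "((%t. SUM i<n. Q a i * complex_of_real (F (\<Phi> t x) i)) has_vector_derivative
 (SUM i<n. Q a i * complex_of_real (SUM j<n. C$$(i, j) * F (\<Phi> t x) j))) (at t)"
 by (intro has_vector_derivative_sum has_vector_derivative_mult_right has_vector_derivative_of_real) (rule dF, simp)
 moreover have "(SUM i<n. Q a i * complex_of_real (SUM j<n. C$$(i, j) * F (\<Phi> t x) j)) =
 (SUM j<n. (SUM i<n. Q a i * complex_of_real (C$$(i, j))) * of_real (F (\<Phi> t x) j))"
 unfolding of_real_sum sum_distrib_left sum_distrib_right by (subst sum.swap) (simp add: mult.assoc)
 moreover have "...=(SUM b<n. jform la s a b*(SUM i<n. Q b i * of_real (F (\<Phi> t x) i)))"
 unfolding swap[symmetric] by (intro sum.cong refl) (simp add: J[OF a])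
 ultimately show "((%t. SUM i<n. Q a i * complex_of_real (F (\<Phi> t x) i)) has_vector_derivative
 (SUM b<n. jform la s a b*(SUM i<n. Q b i * of_real (F (\<Phi> t x) i)))) (at t)" by simp
 qed (use emb PQ QP s in auto)
 thus ?thesis by (rule that)
 qed
qed

theorem theorem4:
  fixes k :: enat and M :: "'a mfd" and \<Phi> :: "real \<Rightarrow> 'a \<Rightarrow> 'a" and A :: "'a set"
  assumes "k \<ge> 1"
    and "ck_manifold k M"
    and "ck_flow k M \<Phi>"
    and "uniquely_integrable M (generator M \<Phi>)"
    and "compactin (space_of M) A"
    and "invariant_set \<Phi> A"
    and "globally_asymptotically_stable (space_of M) \<Phi> A"
  shows "(linearizable_by_embedding k M \<Phi> \<longleftrightarrow>
            submanifold_with_phase k M \<Phi> A \<and>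
            torus_subgroup_flow k M \<Phi> A \<and>
            transverse_linearization k M \<Phi> A) \<and>
         (\<forall>n F. linearizing_embedding k M \<Phi> n F \<longrightarrow>
            proper (space_of M) (Euclidean_space n) F)"
proof -
 interpret attracting_flow k M \<Phi> A by unfold_locales (use assms in auto)
 have "submanifold_with_phase k M \<Phi> A&torus_subgroup_flow k M \<Phi> A&transverse_linearization k M \<Phi> A &
 proper (space_of M) (Euc n) F" if F:"linearizing_embedding k M \<Phi> n F" for n F
 proof (rule spectral_coordinates[OF F])
 fix P Q la s assume "spectral_embedding k M \<Phi> A n F P Q la s"
 then interpret spectral_embedding k M \<Phi> A n F P Q la s .
 show ?thesis using condition_1 condition_2 condition_3 proper_F by blast
 qed
 thus ?thesis using embedding_if unfolding linearizable_by_embedding_def by blast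
qed

end
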